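(* Let $n\in\mathbb Z_{>0}$. The equation $\mathrm{GLE}^{(1)}_n(p(\tau),T(\tau),\tau)$ admits no nontrivial monodromy-preserving deformation as $\tau$ varies; that is, there do not exist a nonempty connected open set $U\subset\mathbb H$ and holomorphic functions $p(\tau),T(\tau)$ on $U$, with $p(\tau)\in E_\tau\setminus E_\tau[2]$ for all $\tau\in U$, such that the monodromy of $\mathrm{GLE}^{(1)}_n(p(\tau),T(\tau),\tau)$ is preserved as $\tau$ varies in $U$.
   Context: $E_\tau=\mathbb C/(\mathbb Z+\mathbb Z\tau)$; $\wp,\zeta$ are the Weierstrass functions. $\mathrm{GLE}^{(1)}_n(p,T,\tau)$ is $y''=q^{(1)}_n(z;p,T)y$ with $$q_n^{(1)}=n(n+1)\wp(z)+\tfrac34(\wp(z+p)+\wp(z-p))+T(\zeta(z+p)+\zeta(z-p)-2\zeta(z))-\tfrac{\wp''(p)}{4\wp'(p)}(\zeta(z+p)-\zeta(z-p))+B,$$ $B=T^2+\frac{\wp''(p)}{2\wp'(p)}\zeta(p)-\frac12(2n^2+2n-3)\wp(p)$. It is log-free at $0,\pm p$, with local monodromy $I$ at $0$ and $-I$ at $\pm p$. The monodromy is preserved if there are bases of solutions, depending on $\tau$, for which the monodromy matrices $M_1,M_2$ along the continuously varying period cycles $z\to z+1$ and $z\to z+\tau$ are independent of $\tau$. *)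

theory Defs
  imports "HOL-Complex_Analysis.Complex_Analysis"
begin

section \<open>The torus and the Weierstrass functions\<close>

definition period_lattice :: "complex \<Rightarrow> complex set" where
  "period_lattice \<tau> = {of_int a + of_int b * \<tau> | a b. True}"

text \<open>Both series converge absolutely for \<open>Im \<tau> > 0\<close> and \<open>z\<close> outside the lattice, so the
  unordered sums have their usual values. The values at lattice points are irrelevant.\<close>

definition weierstrass_wp :: "complex \<Rightarrow> complex \<Rightarrow> complex" where
  "weierstrass_wp \<tau> z = 1 / z\<^sup>2 +
     (\<Sum>\<^sub>\<infinity>\<omega>\<in>period_lattice \<tau> - {0}. 1 / (z - \<omega>)\<^sup>2 - 1 / \<omega>\<^sup>2)"

definition weierstrass_zeta :: "complex \<Rightarrow> complex \<Rightarrow> complex" where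
  "weierstrass_zeta \<tau> z = 1 / z +
     (\<Sum>\<^sub>\<infinity>\<omega>\<in>period_lattice \<tau> - {0}. 1 / (z - \<omega>) + 1 / \<omega> + z / \<omega>\<^sup>2)"

text \<open>A point of \<open>E\<^sub>\<tau> = \<complex> / (\<int> + \<int>\<tau>)\<close> is given by a representative in \<open>\<complex>\<close>. Accordingly, a
  holomorphic function \<open>\<tau> \<mapsto> p \<tau> \<in> E\<^sub>\<tau>\<close> is a choice of representatives that agrees modulo
  the (varying) lattice with a holomorphic complex-valued function near each point of \<open>U\<close>.
  Any globally holomorphic \<open>p\<close> is an instance.\<close>

definition holomorphic_torus_section :: "complex set \<Rightarrow> (complex \<Rightarrow> complex) \<Rightarrow> bool" where
  "holomorphic_torus_section U p \<longleftrightarrow>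
     (\<forall>\<tau>0\<in>U. \<exists>V p'. open V \<and> \<tau>0 \<in> V \<and> V \<subseteq> U \<and> p' holomorphic_on V \<and>
        (\<forall>\<tau>\<in>V. p \<tau> - p' \<tau> \<in> period_lattice \<tau>))"

definition two_torsion :: "complex \<Rightarrow> complex set" where
  "two_torsion \<tau> = {p. 2 * p \<in> period_lattice \<tau>}"


section \<open>The equation\<close>

text \<open>For fixed \<open>z\<close>, the potential is unchanged when \<open>p\<close> is shifted by a period: the
  quasi-period contributions of the \<open>\<zeta>\<close>-terms cancel against that of \<open>\<zeta>(p)\<close> in the constant.\<close>

definition gle1_const :: "nat \<Rightarrow> complex \<Rightarrow> complex \<Rightarrow> complex \<Rightarrow> complex" where
  "gle1_const n p T \<tau> =
     T\<^sup>2
     + (deriv ^^ 2) (weierstrass_wp \<tau>) p / (2 * deriv (weierstrass_wp \<tau>) p) * weierstrass_zeta \<tau> p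
     - 1 / 2 * (2 * of_nat n ^ 2 + 2 * of_nat n - 3) * weierstrass_wp \<tau> p"

definition gle1_potential :: "nat \<Rightarrow> complex \<Rightarrow> complex \<Rightarrow> complex \<Rightarrow> complex \<Rightarrow> complex" where
  "gle1_potential n p T \<tau> z =
     of_nat n * (of_nat n + 1) * weierstrass_wp \<tau> z
     + 3 / 4 * (weierstrass_wp \<tau> (z + p) + weierstrass_wp \<tau> (z - p))
     + T * (weierstrass_zeta \<tau> (z + p) + weierstrass_zeta \<tau> (z - p) - 2 * weierstrass_zeta \<tau> z)
     - (deriv ^^ 2) (weierstrass_wp \<tau>) p / (4 * deriv (weierstrass_wp \<tau>) p)
         * (weierstrass_zeta \<tau> (z + p) - weierstrass_zeta \<tau> (z - p))
     + gle1_const n p T \<tau>"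

definition gle1_singularities :: "complex \<Rightarrow> complex \<Rightarrow> complex set" where
  "gle1_singularities p \<tau> =
     {z. z \<in> period_lattice \<tau> \<or> z - p \<in> period_lattice \<tau> \<or> z + p \<in> period_lattice \<tau>}"


section \<open>Local solutions and monodromy\<close>

text \<open>Functions are regarded as germs: only their values near the stated point matter.\<close>

definition local_solution ::
  "(complex \<Rightarrow> complex) \<Rightarrow> complex \<Rightarrow> (complex \<Rightarrow> complex) \<Rightarrow> bool" where
  "local_solution q z0 y \<longleftrightarrow>
     y analytic_on {z0} \<and> (\<forall>\<^sub>F z in nhds z0. (deriv ^^ 2) y z = q z * y z)"

definition solution_basis ::
  "(complex \<Rightarrow> complex) \<Rightarrow> complex \<Rightarrow> (2 \<Rightarrow> complex \<Rightarrow> complex) \<Rightarrow> bool" where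
  "solution_basis q z0 y \<longleftrightarrow>
     (\<forall>i. local_solution q z0 (y i)) \<and>
     (\<forall>c. (\<forall>\<^sub>F z in nhds z0. (\<Sum>i\<in>UNIV. c i * y i z) = 0) \<longrightarrow> (\<forall>i. c i = 0)) \<and>
     (\<forall>w. local_solution q z0 w \<longrightarrow>
        (\<exists>c. \<forall>\<^sub>F z in nhds z0. w z = (\<Sum>i\<in>UNIV. c i * y i z)))"

text \<open>Weierstrass analytic continuation of the germ of \<open>f\<close> at \<open>\<gamma> 0\<close> to the germ of \<open>g\<close> at
  \<open>\<gamma> 1\<close>, via function elements \<open>F t\<close> at \<open>\<gamma> t\<close>.\<close>

definition analytic_continuation_along ::
  "(real \<Rightarrow> complex) \<Rightarrow> (complex \<Rightarrow> complex) \<Rightarrow> (complex \<Rightarrow> complex) \<Rightarrow> bool" where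
  "analytic_continuation_along \<gamma> f g \<longleftrightarrow>
     (\<exists>F :: real \<Rightarrow> complex \<Rightarrow> complex.
        (\<forall>t\<in>{0..1}. F t analytic_on {\<gamma> t} \<and>
           (\<forall>\<^sub>F s in at t within {0..1}. \<forall>\<^sub>F z in nhds (\<gamma> s). F s z = F t z)) \<and>
        (\<forall>\<^sub>F z in nhds (\<gamma> 0). F 0 z = f z) \<and>
        (\<forall>\<^sub>F z in nhds (\<gamma> 1). F 1 z = g z))"

text \<open>A cycle on the torus in the class of the period \<open>\<omega>\<close> is a path \<open>\<gamma>\<close> in \<open>\<complex>\<close> from \<open>z0\<close> to
  \<open>z0 + \<omega>\<close>. Continuing the basis \<open>y\<close> along it and translating back by \<open>\<omega>\<close> gives germs at \<open>z0\<close>,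
  which are expressed in \<open>y\<close> by the monodromy matrix (acting on the column of basis elements).\<close>

definition monodromy_matrix_along ::
  "(real \<Rightarrow> complex) \<Rightarrow> complex \<Rightarrow> (2 \<Rightarrow> complex \<Rightarrow> complex) \<Rightarrow> complex^2^2 \<Rightarrow> bool" where
  "monodromy_matrix_along \<gamma> \<omega> y M \<longleftrightarrow>
     (\<exists>w. (\<forall>i. analytic_continuation_along \<gamma> (y i) (w i)) \<and>
          (\<forall>\<^sub>F z in nhds (\<gamma> 0). (\<chi> i. w i (z + \<omega>)) = M *v (\<chi> i. y i z)))"

definition continuous_cycle_family ::
  "complex set \<Rightarrow> (complex \<Rightarrow> complex) \<Rightarrow> (complex \<Rightarrow> complex) \<Rightarrow> (complex \<Rightarrow> complex)
     \<Rightarrow> (complex \<Rightarrow> real \<Rightarrow> complex) \<Rightarrow> bool" where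
  "continuous_cycle_family U p z0 \<omega> \<gamma> \<longleftrightarrow>
     continuous_on (U \<times> {0..1}) (\<lambda>(\<tau>, t). \<gamma> \<tau> t) \<and>
     (\<forall>\<tau>\<in>U. \<gamma> \<tau> 0 = z0 \<tau> \<and> \<gamma> \<tau> 1 = z0 \<tau> + \<omega> \<tau> \<and>
        (\<forall>t\<in>{0..1}. \<gamma> \<tau> t \<notin> gle1_singularities (p \<tau>) \<tau>))"

text \<open>No regularity in \<open>\<tau>\<close> is imposed on the bases. The local monodromies are \<open>\<plusminus>I\<close>, hence another
  choice of cycles changes \<open>M1\<close> and \<open>M2\<close> at most by signs.\<close>

definition gle1_monodromy_preserved ::
  "nat \<Rightarrow> complex set \<Rightarrow> (complex \<Rightarrow> complex) \<Rightarrow> (complex \<Rightarrow> complex) \<Rightarrow> bool" where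
  "gle1_monodromy_preserved n U p T \<longleftrightarrow>
     (\<exists>z0 \<gamma>1 \<gamma>2 M1 M2.
        continuous_cycle_family U p z0 (\<lambda>\<tau>. 1) \<gamma>1 \<and>
        continuous_cycle_family U p z0 (\<lambda>\<tau>. \<tau>) \<gamma>2 \<and>
        (\<forall>\<tau>\<in>U. \<exists>y. solution_basis (gle1_potential n (p \<tau>) (T \<tau>) \<tau>) (z0 \<tau>) y \<and>
           monodromy_matrix_along (\<gamma>1 \<tau>) 1 y M1 \<and>
           monodromy_matrix_along (\<gamma>2 \<tau>) \<tau> y M2))"

end

theory Submission
  imports Defs
begin

text \<open>Write \<open>v = \<wp> - \<wp>(p)\<close>, \<open>R = v'/v\<close> and \<open>N = n (n + 1)\<close>. The potential of GLE is
  \<open>T\<^sup>2 + T R + N v + R\<^sup>2/4 - R'/2\<close>, so \<open>y = (f' - T f) / sqrt v\<close> turns solutions of the Lame equation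
  \<open>f'' = (N \<wp> + E) f\<close> with \<open>E = T\<^sup>2 - N \<wp>(p)\<close> into solutions of GLE. Hence, up to signs, the
  monodromy of GLE is that of a Lame equation, and one choice of signs occurs on an uncountable
  set of \<open>\<tau>\<close>, which has an accumulation point \<open>\<tau>0\<close> in itself.

  The Lame equation has single-valued solutions \<open>\<psi> = z\<^sup>-\<^sup>n (1 + \<dots>)\<close> and
  \<open>\<phi> = z\<^sup>n\<^sup>+\<^sup>1 (1 + \<dots>)\<close> of opposite parity, depending continuously on \<open>\<tau>\<close> and \<open>E\<close>. By parity their
  period matrices have the shape \<open>[A B; C A]\<close>, so conjugacy to a fixed pair forces them to be constant
  after replacing \<open>\<phi>\<close> by \<open>\<phi> / k\<close>. For \<open>\<tau>\<close> near \<open>\<tau>0\<close> the determinant of the two frames at \<open>\<tau>\<close> and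
  \<open>\<tau>0\<close> is then single-valued around a period cell, with a removable singularity at \<open>0\<close>, and invariant
  under \<open>z + 1\<close>. Cauchy's theorem equates its integrals along the bottom and top edges; shifting the top
  edge down by \<open>\<tau>0\<close>, this says that the determinant of \<open>F z - F (z - (\<tau> - \<tau>0))\<close>, with \<open>F\<close> the frame
  at \<open>\<tau>\<close>, against the frame at \<open>\<tau>0\<close> integrates to zero along the bottom edge. Divided by \<open>\<tau> - \<tau>0\<close> the
  integrand tends to minus the Wronskian of \<open>\<psi>\<close> and \<open>\<phi>\<close>, which is \<open>- (2 n + 1) \<noteq> 0\<close>.\<close>

section \<open>Lattice sums\<close>

text \<open>The bases of solutions carry no regularity in \<open>\<tau>\<close>, and the signs
  produced by continuing a square root of \<open>v\<close> may jump from one \<open>\<tau>\<close>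
  to the next. Nothing can therefore be differentiated in \<open>\<tau>\<close>; the argument lives
  at a limit point of parameters and uses only continuity of the Lame frame there. The missing
  \<open>\<tau>\<close>-derivative is replaced by a derivative in \<open>z\<close>: the second
  period itself moves by \<open>\<tau> - \<tau>0\<close>, and this displacement becomes a shift of
  the argument.

  The difference quotient survives only if the matched frames converge to each other, which an
  arbitrary conjugating matrix would spoil. The parity normalisation leaves one scalar
  \<open>k\<close>, which can be read off from the frame by a continuous formula and tends to 1.

  Anchoring the frame at the pole of \<open>\<wp>\<close> serves twice: the exponents
  \<open>-n\<close> and \<open>n + 1\<close> add up to 1, so the determinant of two frames is
  \<open>z\<close> times a holomorphic function; and their difference is the Wronskian behind the
  contradiction.\<close>

definition lat :: "complex \<Rightarrow> int \<times> int \<Rightarrow> complex" where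
  "lat \<tau> = (\<lambda>(a, b). of_int a + of_int b * \<tau>)"

lemma Im_lat: "Im (lat \<tau> (a, b)) = of_int b * Im \<tau>"
  by (simp add: lat_def)

lemma inj_lat: "Im \<tau> > 0 \<Longrightarrow> inj (lat \<tau>)"
  by (rule injI) (auto simp: lat_def complex_eq_iff)

lemma period_lattice_eq_range: "period_lattice \<tau> = range (lat \<tau>)"
  by (auto simp: period_lattice_def lat_def)

lemma lat_0 [simp]: "lat \<tau> (0, 0) = 0"
  by (simp add: lat_def)

lemma lat_eq_0_iff: "Im \<tau> > 0 \<Longrightarrow> lat \<tau> x = 0 \<longleftrightarrow> x = (0, 0)"
  using inj_lat[of \<tau>] by (metis injD lat_0)

lemma infsum_period_lattice:
  assumes "Im \<tau> > 0"
  shows "(\<Sum>\<^sub>\<infinity>\<omega>\<in>period_lattice \<tau> - {0}. f \<omega>) = (\<Sum>\<^sub>\<infinity>x\<in>-{(0,0)}. f (lat \<tau> x))"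
proof -
  have "bij_betw (lat \<tau>) (-{(0,0)}) (period_lattice \<tau> - {0})"
    using inj_lat[OF assms] lat_eq_0_iff[OF assms]
    by (auto simp: bij_betw_def period_lattice_eq_range inj_on_def image_iff)
  from infsum_reindex_bij_betw[OF this, of f] show ?thesis by simp
qed

text \<open>The imaginary part bounds \<open>b\<close>, and then \<open>a\<close> is bounded by the
  triangle inequality. The constant depends on \<open>\<tau>\<close> only through
  \<open>\<eta>\<close> and \<open>R\<close>, so one bound serves all \<open>\<tau>\<close> in a
  compact set.\<close>

lemma norm_lat_ge:
  assumes "Im \<tau> \<ge> \<eta>" "\<eta> > 0" "norm \<tau> \<le> R"
  shows "real_of_int (\<bar>a\<bar> + \<bar>b\<bar>) \<le> (1 + (R + 1) / \<eta>) * norm (lat \<tau> (a, b))"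
proof -
  let ?w = "lat \<tau> (a, b)"
  have "\<bar>of_int b\<bar> * \<eta> \<le> \<bar>Im ?w\<bar>"
    unfolding Im_lat abs_mult using assms by (intro mult_left_mono) auto
  also have "\<dots> \<le> norm ?w" by (rule abs_Im_le_cmod)
  finally have b: "\<bar>of_int b\<bar> \<le> norm ?w / \<eta>" using assms by (simp add: field_simps)
  have "\<bar>real_of_int a\<bar> = norm (?w - of_int b * \<tau>)" by (simp add: lat_def)
  also have "\<dots> \<le> norm ?w + \<bar>of_int b\<bar> * norm \<tau>"
    by (metis norm_mult norm_of_int norm_triangle_ineq4)
  also have "\<dots> \<le> norm ?w + (norm ?w / \<eta>) * R"
    using b assms by (intro add_left_mono mult_mono) auto
  finally show ?thesis using b by (simp add: field_simps add_divide_distrib)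
qed

text \<open>The cubic decay of the lattice terms is split as 3/2 + 3/2 between the two indices, so
  that summability over pairs factors into two one-dimensional series.\<close>

definition lattice_majorant :: "int \<times> int \<Rightarrow> real" where
  "lattice_majorant = (\<lambda>(a, b). (1 + \<bar>of_int a\<bar>) powr (-3/2) * (1 + \<bar>of_int b\<bar>) powr (-3/2))"

lemma lattice_majorant_pos: "lattice_majorant x > 0"
  by (auto simp: lattice_majorant_def split: prod.split)

lemma summable_on_int_powr: "(\<lambda>a::int. (1 + \<bar>of_int a\<bar>) powr (-3/2) :: real) summable_on UNIV"
proof -
  let ?f = "\<lambda>a::int. (1 + \<bar>of_int a\<bar>) powr (-3/2) :: real"
  have "summable (\<lambda>n. real n powr (-3/2))"
    by (simp add: summable_real_powr_iff)
  then have s: "summable (\<lambda>n. real (Suc n) powr (-3/2))"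
    by (subst summable_Suc_iff)
  have n: "(\<lambda>n. real (Suc n) powr (-3/2)) summable_on UNIV"
    using s by (intro norm_summable_imp_summable_on) simp
  have 1: "?f summable_on range int"
    by (subst summable_on_reindex) (use n in \<open>auto simp: o_def add_ac\<close>)
  have 2: "?f summable_on range (\<lambda>n. - int n)"
    by (subst summable_on_reindex) (use n in \<open>auto simp: o_def add_ac inj_on_def\<close>)
  have "range int \<union> range (\<lambda>n. - int n) = UNIV"
    by (auto intro: int_cases2)
  with summable_on_union[OF 1 2] show ?thesis by simp
qed

lemma summable_lattice_majorant: "lattice_majorant summable_on A"
proof -
  let ?f = "\<lambda>a::int. (1 + \<bar>of_int a\<bar>) powr (-3/2) :: real"
  have "(\<lambda>x. norm (case x of (a, b) \<Rightarrow> ?f a * ?f b)) summable_on Sigma UNIV (\<lambda>_. UNIV)"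
    unfolding Infinite_Sum.abs_summable_on_Sigma_iff
    using summable_on_int_powr by (auto simp: abs_mult infsum_cmult_right'
             intro!: summable_on_cmult_right summable_on_cmult_left)
  then have "(\<lambda>x. norm (lattice_majorant x)) summable_on UNIV"
    unfolding lattice_majorant_def UNIV_Times_UNIV .
  then have "lattice_majorant summable_on UNIV"
    by (simp add: abs_summable_summable)
  then show ?thesis by (rule summable_on_subset_banach) simp
qed

lemma lattice_majorant_ge:
  assumes "(a, b) \<noteq> (0, 0)"
  shows "1 / real_of_int (\<bar>a\<bar> + \<bar>b\<bar>) ^ 3 \<le> 8 * lattice_majorant (a, b)"
proof -
  define s where "s = real_of_int (\<bar>a\<bar> + \<bar>b\<bar>)"
  define p where "p = (1 + \<bar>real_of_int a\<bar>) * (1 + \<bar>real_of_int b\<bar>)"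
  have "\<bar>a\<bar> + \<bar>b\<bar> \<ge> 1" using assms by auto
  then have s1: "s \<ge> 1" unfolding s_def by linarith
  have p1: "p > 0" by (simp add: p_def)
  \<comment> \<open>Each factor of \<open>p\<close> is at most \<open>1 + s\<close>, and
    \<open>1 + s \<le> 2 * s\<close> because \<open>s \<ge> 1\<close>; the power 3/2 then turns the
    square into \<open>8 * s ^ 3\<close>.\<close>
  have "p \<le> (1 + s)\<^sup>2"
    unfolding p_def s_def by (simp add: power2_eq_square algebra_simps)
  also have "\<dots> \<le> (2 * s)\<^sup>2" using s1 by (intro power_mono) auto
  finally have "p powr (3/2) \<le> ((2 * s)\<^sup>2) powr (3/2)"
    using p1 by (intro powr_mono2) auto
  also have "((2 * s)\<^sup>2) powr (3/2) = ((2 * s) powr 2) powr (3/2)"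
    using s1 by (subst powr_numeral) auto
  also have "\<dots> = (2 * s) powr 3" by (simp add: powr_powr)
  also have "\<dots> = 8 * s ^ 3" using s1 by (subst powr_numeral) (auto simp: power_mult_distrib)
  finally have *: "p powr (3/2) \<le> 8 * s ^ 3" .
  have "lattice_majorant (a, b) = p powr (-3/2)"
    by (simp add: lattice_majorant_def p_def powr_mult)
  also have "\<dots> = 1 / p powr (3/2)"
    by (simp add: powr_minus_divide)
  finally have m: "lattice_majorant (a, b) = 1 / p powr (3/2)" .
  show ?thesis
    using * p1 s1 unfolding m s_def[symmetric] by (simp add: field_simps)
qed

lemma finite_int_pairs: "finite {x :: int \<times> int. real_of_int (\<bar>fst x\<bar> + \<bar>snd x\<bar>) \<le> R}"
proof (rule finite_subset)
  show "{x :: int \<times> int. real_of_int (\<bar>fst x\<bar> + \<bar>snd x\<bar>) \<le> R} \<subseteq> {-\<lfloor>R\<rfloor>..\<lfloor>R\<rfloor>} \<times> {-\<lfloor>R\<rfloor>..\<lfloor>R\<rfloor>}"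
  proof
    fix x :: "int \<times> int" assume "x \<in> {x. real_of_int (\<bar>fst x\<bar> + \<bar>snd x\<bar>) \<le> R}"
    then have "\<bar>fst x\<bar> + \<bar>snd x\<bar> \<le> \<lfloor>R\<rfloor>" by (simp add: le_floor_iff)
    then show "x \<in> {-\<lfloor>R\<rfloor>..\<lfloor>R\<rfloor>} \<times> {-\<lfloor>R\<rfloor>..\<lfloor>R\<rfloor>}" by (cases x) auto
  qed
qed auto

section \<open>Convergence uniform in the lattice and in the argument\<close>

definition lattice_domain :: "(complex \<times> complex) set" where
  "lattice_domain = {(\<tau>, z). Im \<tau> > 0 \<and> (\<forall>x. x \<noteq> (0, 0) \<longrightarrow> z \<noteq> lat \<tau> x)}"

lemma continuous_on_lat: "continuous_on A (\<lambda>y. lat (fst y) x)"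
  by (cases x) (auto simp: lat_def intro!: continuous_intros)

text \<open>Only finitely many indices can give a lattice point near \<open>z0\<close> while
  \<open>\<tau>\<close> stays near \<open>\<tau>0\<close>: by \<open>norm_lat_ge\<close> all other
  lattice vectors are too long. The finitely many remaining conditions are open. The point
  \<open>z = 0\<close> belongs to the domain, since its pole is split off below.\<close>

lemma open_lattice_domain: "open lattice_domain"
proof (subst open_subopen, rule ballI)
  fix y0 assume "y0 \<in> lattice_domain"
  then obtain \<tau>0 z0 where y0: "y0 = (\<tau>0, z0)" "Im \<tau>0 > 0" "\<And>x. x \<noteq> (0, 0) \<Longrightarrow> z0 \<noteq> lat \<tau>0 x"
    by (auto simp: lattice_domain_def)
  define \<eta> where "\<eta> = Im \<tau>0 / 2"
  define C where "C = 1 + ((norm \<tau>0 + 1) + 1) / \<eta>"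
  have \<eta>: "\<eta> > 0" using y0 by (simp add: \<eta>_def)
  define A where "A = {x :: int \<times> int. real_of_int (\<bar>fst x\<bar> + \<bar>snd x\<bar>) \<le> C * (norm z0 + 1)}"
  define V where "V = ({\<tau>. Im \<tau> > \<eta>} \<inter> ball \<tau>0 1) \<times> ball z0 1"
  define W where "W = V \<inter> (\<Inter>x\<in>A-{(0,0)}. {y. snd y \<noteq> lat (fst y) x})"
  have "finite A" unfolding A_def by (rule finite_int_pairs)
  moreover have "open V" unfolding V_def
    by (intro open_Times open_Int open_halfspace_Im_gt) auto
  moreover have "open {y. snd y \<noteq> lat (fst y) x}" for x
    by (intro open_Collect_neq continuous_on_lat continuous_on_snd continuous_on_id)
  ultimately have "open W" unfolding W_def by (intro open_Int open_INT) auto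
  moreover have "y0 \<in> W" using y0 \<eta> by (auto simp: W_def V_def \<eta>_def)
  moreover have "W \<subseteq> lattice_domain"
  proof
    fix y assume y: "y \<in> W"
    obtain \<tau> z where yz: "y = (\<tau>, z)" by (cases y)
    have t: "Im \<tau> \<ge> \<eta>" "dist \<tau>0 \<tau> < 1" "dist z0 z < 1" using y by (auto simp: yz W_def V_def)
    have nt: "norm \<tau> \<le> norm \<tau>0 + 1" "norm z < norm z0 + 1"
      using t norm_triangle_ineq2[of \<tau> \<tau>0] norm_triangle_ineq2[of z z0]
      by (auto simp: dist_norm norm_minus_commute)
    have C: "C > 0" using \<eta> unfolding C_def by (intro add_pos_nonneg divide_nonneg_pos) auto
    have "z \<noteq> lat \<tau> x" if x: "x \<noteq> (0, 0)" for x
    proof (cases "x \<in> A")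
      case True then show ?thesis using y x by (auto simp: W_def yz)
    next
      case False
      obtain a b where ab: "x = (a, b)" by (cases x)
      have "C * (norm z0 + 1) < real_of_int (\<bar>a\<bar> + \<bar>b\<bar>)" using False by (simp add: A_def ab)
      also have "\<dots> \<le> C * norm (lat \<tau> x)"
        unfolding C_def ab by (rule norm_lat_ge) (use t nt \<eta> in auto)
      finally have "norm z0 + 1 < norm (lat \<tau> x)" using C by simp
      then show ?thesis using nt by auto
    qed
    then show "y \<in> lattice_domain" using t \<eta> by (auto simp: lattice_domain_def yz)
  qed
  ultimately show "\<exists>T. open T \<and> y0 \<in> T \<and> T \<subseteq> lattice_domain" by blast
qed

text \<open>Indices of short lattice vectors form a finite set, on which compactness gives bounds;
  for all others the assumed cubic decay applies. Both are dominated by one multiple of the same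
  majorant.\<close>

lemma lattice_majorant_bound:
  fixes f :: "int \<times> int \<Rightarrow> complex \<times> complex \<Rightarrow> complex"
  assumes Y: "compact Y" "Y \<subseteq> lattice_domain"
    and cont: "\<And>x. x \<noteq> (0,0) \<Longrightarrow> continuous_on Y (f x)"
    and decay: "\<And>x \<tau> z. x \<noteq> (0,0) \<Longrightarrow> (\<tau>, z) \<in> Y \<Longrightarrow> 2 * norm z \<le> norm (lat \<tau> x) \<Longrightarrow>
                  norm (f x (\<tau>, z)) \<le> c / norm (lat \<tau> x) ^ 3"
    and c: "c \<ge> 0"
  obtains K where "\<And>x y. x \<noteq> (0,0) \<Longrightarrow> y \<in> Y \<Longrightarrow> norm (f x y) \<le> K * lattice_majorant x"
proof (cases "Y = {}")
  case True then show ?thesis using that by auto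
next
  case False
  have "continuous_on Y (\<lambda>y. Im (fst y))" by (intro continuous_intros)
  from continuous_attains_inf[OF Y(1) False this] obtain y1 where
    y1: "y1 \<in> Y" "\<And>y. y \<in> Y \<Longrightarrow> Im (fst y1) \<le> Im (fst y)" by auto
  define \<eta> where "\<eta> = Im (fst y1)"
  have \<eta>: "\<eta> > 0" using y1 Y by (auto simp: \<eta>_def lattice_domain_def)
  from compact_imp_bounded[OF Y(1)] obtain R where R: "\<And>y. y \<in> Y \<Longrightarrow> norm y \<le> R"
    by (auto simp: bounded_iff)
  have R0: "R \<ge> 0" using R[OF y1(1)] norm_ge_zero order_trans by blast
  have Rt: "norm \<tau> \<le> R" "norm z \<le> R" if "(\<tau>, z) \<in> Y" for \<tau> z
    using R[OF that] norm_fst_le[of \<tau> z] norm_snd_le[of z \<tau>] by linarith+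
  define C where "C = 1 + (R + 1) / \<eta>"
  have C: "C > 0" using \<eta> R0 unfolding C_def by (intro add_pos_nonneg divide_nonneg_pos) auto
  have lat: "real_of_int (\<bar>a\<bar> + \<bar>b\<bar>) \<le> C * norm (lat \<tau> (a, b))" if "(\<tau>, z) \<in> Y" for \<tau> z a b
    unfolding C_def using y1(2)[OF that] \<eta> Rt[OF that] by (intro norm_lat_ge) (auto simp: \<eta>_def)
  define A where "A = {x :: int \<times> int. real_of_int (\<bar>fst x\<bar> + \<bar>snd x\<bar>) \<le> C * (2 * R)} - {(0,0)}"
  have fA: "finite A" using finite_int_pairs by (simp add: A_def)
  have "\<exists>B. \<forall>y\<in>Y. norm (f x y) \<le> B" if "x \<in> A" for x
    using compact_imp_bounded[OF compact_continuous_image[OF cont Y(1), of x]] that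
    by (auto simp: A_def bounded_iff)
  then obtain B where B: "\<And>x y. x \<in> A \<Longrightarrow> y \<in> Y \<Longrightarrow> norm (f x y) \<le> B x" by metis
  \<comment> \<open>The first summand is the constant of the decay estimate; the finitely many short
    indices enter through the ratio of their bound to the majorant.\<close>
  define K where "K = 8 * c * C ^ 3 + (\<Sum>x\<in>A. \<bar>B x\<bar> / lattice_majorant x)"
  have K1: "K \<ge> 8 * c * C ^ 3"
    using lattice_majorant_pos less_imp_le by (auto simp: K_def intro!: sum_nonneg divide_nonneg_pos)
  show ?thesis
  proof (rule that)
    fix x :: "int \<times> int" and y assume x: "x \<noteq> (0, 0)" and y: "y \<in> Y"
    obtain \<tau> z where yz: "y = (\<tau>, z)" by (cases y)
    obtain a b where ab: "x = (a, b)" by (cases x)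
    show "norm (f x y) \<le> K * lattice_majorant x"
    proof (cases "x \<in> A")
      case True
      have "\<bar>B x\<bar> / lattice_majorant x \<le> (\<Sum>x\<in>A. \<bar>B x\<bar> / lattice_majorant x)"
        using True fA lattice_majorant_pos
        by (intro member_le_sum) (auto intro!: divide_nonneg_pos)
      also have "\<dots> \<le> K" using c C by (simp add: K_def)
      finally have "\<bar>B x\<bar> \<le> K * lattice_majorant x"
        using lattice_majorant_pos[of x] by (simp add: field_simps)
      then show ?thesis using B[OF True y] by linarith
    next
      case False
      have s: "real_of_int (\<bar>a\<bar> + \<bar>b\<bar>) > C * (2 * R)" using False x by (auto simp: A_def ab)
      have l: "real_of_int (\<bar>a\<bar> + \<bar>b\<bar>) \<le> C * norm (lat \<tau> x)" using lat y by (auto simp: yz ab)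
      have "\<bar>a\<bar> + \<bar>b\<bar> \<ge> 1" using x by (auto simp: ab)
      then have s1: "real_of_int (\<bar>a\<bar> + \<bar>b\<bar>) \<ge> 1" by linarith
      have "C * (2 * R) < C * norm (lat \<tau> x)" using s l by linarith
      then have "2 * R < norm (lat \<tau> x)" using C by simp
      then have "2 * norm z \<le> norm (lat \<tau> x)" using Rt y by (fastforce simp: yz)
      from decay[OF x y[unfolded yz] this]
      have "norm (f x y) \<le> c / norm (lat \<tau> x) ^ 3" by (simp add: yz)
      also have "\<dots> = c * C ^ 3 / (C * norm (lat \<tau> x)) ^ 3"
        using C by (simp add: power_mult_distrib)
      also have "\<dots> \<le> c * C ^ 3 / real_of_int (\<bar>a\<bar> + \<bar>b\<bar>) ^ 3"
        using c C l s1 by (intro divide_left_mono power_mono mult_pos_pos zero_less_power) auto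
      also have "\<dots> = c * C ^ 3 * (1 / real_of_int (\<bar>a\<bar> + \<bar>b\<bar>) ^ 3)" by simp
      also have "\<dots> \<le> c * C ^ 3 * (8 * lattice_majorant x)"
        unfolding ab by (intro mult_left_mono lattice_majorant_ge) (use x ab c C in auto)
      also have "\<dots> \<le> K * lattice_majorant x"
        using mult_right_mono[OF K1, of "lattice_majorant x"] lattice_majorant_pos[of x] by simp
      finally show ?thesis .
    qed
  qed
qed

section \<open>The Weierstrass sums with the pole at the origin removed\<close>

definition zeta_term :: "int \<times> int \<Rightarrow> complex \<times> complex \<Rightarrow> complex" where
  "zeta_term x = (\<lambda>(\<tau>, z). 1 / (z - lat \<tau> x) + 1 / lat \<tau> x + z / (lat \<tau> x)\<^sup>2)"

definition wp_term :: "int \<times> int \<Rightarrow> complex \<times> complex \<Rightarrow> complex" where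
  "wp_term x = (\<lambda>(\<tau>, z). 1 / (z - lat \<tau> x)\<^sup>2 - 1 / (lat \<tau> x)\<^sup>2)"

definition zeta_reg :: "complex \<Rightarrow> complex \<Rightarrow> complex" where
  "zeta_reg \<tau> z = (\<Sum>\<^sub>\<infinity>x\<in>-{(0,0)}. zeta_term x (\<tau>, z))"

definition wp_reg :: "complex \<Rightarrow> complex \<Rightarrow> complex" where
  "wp_reg \<tau> z = (\<Sum>\<^sub>\<infinity>x\<in>-{(0,0)}. wp_term x (\<tau>, z))"

lemma weierstrass_zeta_eq: "Im \<tau> > 0 \<Longrightarrow> weierstrass_zeta \<tau> z = 1 / z + zeta_reg \<tau> z"
  by (simp add: weierstrass_zeta_def zeta_reg_def zeta_term_def infsum_period_lattice)

lemma weierstrass_wp_eq: "Im \<tau> > 0 \<Longrightarrow> weierstrass_wp \<tau> z = 1 / z\<^sup>2 + wp_reg \<tau> z"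
  by (simp add: weierstrass_wp_def wp_reg_def wp_term_def infsum_period_lattice)

text \<open>Over a common denominator the terms are \<open>z\<^sup>2 / (w\<^sup>2 * (z - w))\<close>
  and \<open>z * (2 * w - z) / (w\<^sup>2 * (z - w)\<^sup>2)\<close>. The hypothesis gives
  \<open>norm (z - w) \<ge> norm w / 2\<close> and
  \<open>norm (2 * w - z) \<le> 5/2 * norm w\<close>, whence the factors 2 and 10.\<close>

lemma term_bounds:
  fixes z w :: complex
  assumes w: "w \<noteq> 0" and zw: "2 * norm z \<le> norm w" and R: "norm z \<le> R"
  shows "norm (1 / (z - w) + 1 / w + z / w\<^sup>2) \<le> 2 * R\<^sup>2 / norm w ^ 3"
    and "norm (1 / (z - w)\<^sup>2 - 1 / w\<^sup>2) \<le> 10 * R / norm w ^ 3"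
proof -
  have d: "norm (z - w) \<ge> norm w / 2"
    using norm_triangle_ineq2[of w z] zw by (simp add: norm_minus_commute)
  have w0: "norm w > 0" using w by simp
  have d0: "z - w \<noteq> 0" using d w0 by auto
  have R0: "R \<ge> 0" using R norm_ge_zero order_trans by blast
  have "1 / (z - w) + 1 / w + z / w\<^sup>2 = z\<^sup>2 / (w\<^sup>2 * (z - w))"
    using d0 w by (simp add: field_simps power2_eq_square)
  also have "norm \<dots> = norm z ^ 2 / (norm w ^ 2 * norm (z - w))"
    by (simp add: norm_divide norm_mult norm_power)
  also have "\<dots> \<le> R\<^sup>2 / (norm w ^ 2 * (norm w / 2))"
    using d w0 R by (intro frac_le mult_left_mono power_mono) auto
  finally show "norm (1 / (z - w) + 1 / w + z / w\<^sup>2) \<le> 2 * R\<^sup>2 / norm w ^ 3"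
    by (simp add: power2_eq_square power3_eq_cube mult_ac)
  have "1 / (z - w)\<^sup>2 - 1 / w\<^sup>2 = z * (2 * w - z) / (w\<^sup>2 * (z - w)\<^sup>2)"
  proof -
    define u where "u = z - w"
    have "z = u + w" "u \<noteq> 0" using d0 by (auto simp: u_def)
    then show ?thesis using w by (simp add: divide_simps) (simp add: algebra_simps power2_eq_square)
  qed
  also have "norm \<dots> = norm z * norm (2 * w - z) / (norm w ^ 2 * norm (z - w) ^ 2)"
    by (simp add: norm_divide norm_mult norm_power)
  also have "\<dots> \<le> R * (5/2 * norm w) / (norm w ^ 2 * (norm w / 2)\<^sup>2)"
  proof (intro frac_le mult_mono mult_left_mono power_mono)
    show "norm (2 * w - z) \<le> 5/2 * norm w"
      using norm_triangle_ineq4[of "2 * w" z] zw by (simp add: norm_mult)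
  qed (use d w0 R R0 in auto)
  also have "\<dots> = 10 * R / norm w ^ 3"
    using w0 by (simp add: power2_eq_square power3_eq_cube field_simps)
  finally show "norm (1 / (z - w)\<^sup>2 - 1 / w\<^sup>2) \<le> 10 * R / norm w ^ 3" .
qed

lemma lattice_domain_lat_nz: "(\<tau>, z) \<in> lattice_domain \<Longrightarrow> x \<noteq> (0,0) \<Longrightarrow> lat \<tau> x \<noteq> 0 \<and> z \<noteq> lat \<tau> x"
  unfolding lattice_domain_def using lat_eq_0_iff[of \<tau> x] by blast

lemma lattice_uniform_limits:
  assumes Y: "compact Y" "Y \<subseteq> lattice_domain"
  shows "uniform_limit Y (\<lambda>X y. \<Sum>x\<in>X. zeta_term x y) (\<lambda>(\<tau>, z). zeta_reg \<tau> z) (finite_subsets_at_top (-{(0,0)}))"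
    and "uniform_limit Y (\<lambda>X y. \<Sum>x\<in>X. wp_term x y) (\<lambda>(\<tau>, z). wp_reg \<tau> z) (finite_subsets_at_top (-{(0,0)}))"
    and "x \<noteq> (0,0) \<Longrightarrow> continuous_on Y (zeta_term x)"
    and "x \<noteq> (0,0) \<Longrightarrow> continuous_on Y (wp_term x)"
proof -
  from compact_imp_bounded[OF Y(1)] obtain R0 where R0: "\<And>y. y \<in> Y \<Longrightarrow> norm y \<le> R0"
    by (auto simp: bounded_iff)
  define R where "R = max R0 0"
  have R: "norm z \<le> R" if "(\<tau>, z) \<in> Y" for \<tau> z
    using R0[OF that] norm_snd_le[of z \<tau>] by (simp add: R_def)
  have R0: "R \<ge> 0" by (simp add: R_def)
  have nz: "lat (fst y) x \<noteq> 0 \<and> snd y \<noteq> lat (fst y) x" if "x \<noteq> (0,0)" "y \<in> Y" for x y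
    using lattice_domain_lat_nz[of "fst y" "snd y" x] Y that by auto
  have c1: "continuous_on Y (zeta_term x)" if "x \<noteq> (0,0)" for x
    unfolding zeta_term_def split_beta
    by (intro continuous_intros continuous_on_lat) (use nz[OF that] in auto)
  have c2: "continuous_on Y (wp_term x)" if "x \<noteq> (0,0)" for x
    unfolding wp_term_def split_beta
    by (intro continuous_intros continuous_on_lat) (use nz[OF that] in auto)
  show "x \<noteq> (0,0) \<Longrightarrow> continuous_on Y (zeta_term x)" "x \<noteq> (0,0) \<Longrightarrow> continuous_on Y (wp_term x)"
    using c1 c2 by auto
  have d1: "norm (zeta_term x (\<tau>, z)) \<le> 2 * R\<^sup>2 / norm (lat \<tau> x) ^ 3"
    if "x \<noteq> (0,0)" "(\<tau>, z) \<in> Y" "2 * norm z \<le> norm (lat \<tau> x)" for x \<tau> z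
    using term_bounds(1)[of "lat \<tau> x" z R] that R[of \<tau> z] nz[of x "(\<tau>, z)"] by (simp add: zeta_term_def)
  have d2: "norm (wp_term x (\<tau>, z)) \<le> 10 * R / norm (lat \<tau> x) ^ 3"
    if "x \<noteq> (0,0)" "(\<tau>, z) \<in> Y" "2 * norm z \<le> norm (lat \<tau> x)" for x \<tau> z
    using term_bounds(2)[of "lat \<tau> x" z R] that R[of \<tau> z] nz[of x "(\<tau>, z)"] by (simp add: wp_term_def)
  obtain K1 where K1: "\<And>x y. x \<noteq> (0,0) \<Longrightarrow> y \<in> Y \<Longrightarrow> norm (zeta_term x y) \<le> K1 * lattice_majorant x"
    by (rule lattice_majorant_bound[OF Y c1 d1]) auto
  obtain K2 where K2: "\<And>x y. x \<noteq> (0,0) \<Longrightarrow> y \<in> Y \<Longrightarrow> norm (wp_term x y) \<le> K2 * lattice_majorant x"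
    by (rule lattice_majorant_bound[OF Y c2 d2]) (use R0 in auto)
  show "uniform_limit Y (\<lambda>X y. \<Sum>x\<in>X. zeta_term x y) (\<lambda>(\<tau>, z). zeta_reg \<tau> z) (finite_subsets_at_top (-{(0,0)}))"
    unfolding zeta_reg_def split_beta prod.collapse
    by (rule Weierstrass_m_test_general[where M="\<lambda>x. K1 * lattice_majorant x"])
       (use K1 in \<open>auto intro!: summable_on_cmult_right summable_lattice_majorant\<close>)
  show "uniform_limit Y (\<lambda>X y. \<Sum>x\<in>X. wp_term x y) (\<lambda>(\<tau>, z). wp_reg \<tau> z) (finite_subsets_at_top (-{(0,0)}))"
    unfolding wp_reg_def split_beta prod.collapse
    by (rule Weierstrass_m_test_general[where M="\<lambda>x. K2 * lattice_majorant x"])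
       (use K2 in \<open>auto intro!: summable_on_cmult_right summable_lattice_majorant\<close>)
qed

text \<open>Every later limit in \<open>\<tau>\<close> rests on this joint continuity: it enters
  through the Lame potential and through \<open>wp\<close> at \<open>p\<close>.\<close>

lemma continuous_on_wp_reg: "continuous_on lattice_domain (\<lambda>(\<tau>, z). wp_reg \<tau> z)"
proof (rule continuous_on_eq_continuous_at[OF open_lattice_domain, THEN iffD2], rule ballI)
  fix y assume "y \<in> lattice_domain"
  then obtain e where e: "e > 0" "cball y e \<subseteq> lattice_domain"
    using open_lattice_domain open_contains_cball by metis
  have "continuous_on (cball y e) (\<lambda>(\<tau>, z). wp_reg \<tau> z)"
    by (rule uniform_limit_theorem[OF _ lattice_uniform_limits(2)[OF _ e(2)]])
       (use e lattice_uniform_limits(4)[OF _ e(2)] in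
         \<open>auto intro!: eventually_finite_subsets_at_top_weakI continuous_on_sum\<close>)
  then show "isCont (\<lambda>(\<tau>, z). wp_reg \<tau> z) y"
    using e(1) by (auto intro!: continuous_on_interior)
qed

text \<open>The finite partial sums form a net of holomorphic functions. The theorem on derivatives
  of uniform limits yields both the derivative of the sum and the convergence of the differentiated
  sum.\<close>

lemma has_field_derivative_infsum:
  fixes f f' :: "'i \<Rightarrow> complex \<Rightarrow> complex"
  assumes r: "r > 0"
    and d: "\<And>x w. x \<in> I \<Longrightarrow> w \<in> cball z r \<Longrightarrow> (f x has_field_derivative f' x w) (at w)"
    and lim: "uniform_limit (cball z r) (\<lambda>X w. \<Sum>x\<in>X. f x w) g (finite_subsets_at_top I)"
  shows "\<exists>g'. (g has_field_derivative g') (at z) \<and> ((\<lambda>x. f' x z) has_sum g') I"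
proof -
  have "continuous_on (cball z r) (f x)" if "x \<in> I" for x
    using d[OF that] DERIV_isCont continuous_at_imp_continuous_on by blast
  then have "\<forall>\<^sub>F X in finite_subsets_at_top I. continuous_on (cball z r) (\<lambda>w. \<Sum>x\<in>X. f x w) \<and>
        (\<forall>w\<in>ball z r. ((\<lambda>w. \<Sum>x\<in>X. f x w) has_field_derivative (\<Sum>x\<in>X. f' x w)) (at w))"
    by (intro eventually_finite_subsets_at_top_weakI conjI continuous_on_sum ballI DERIV_sum)
       (use d in \<open>auto simp: subset_iff\<close>)
  from has_complex_derivative_uniform_limit[OF this lim _ r]
  obtain g' where "(g has_field_derivative g' z) (at z)"
    "((\<lambda>X. \<Sum>x\<in>X. f' x z) \<longlongrightarrow> g' z) (finite_subsets_at_top I)"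
    using r by (metis centre_in_ball finite_subsets_at_top_neq_bot)
  then show ?thesis by (auto simp: has_sum_def)
qed

lemma lattice_domain_cball:
  assumes "(\<tau>, z) \<in> lattice_domain"
  obtains r where "r > 0" "\<And>w. w \<in> cball z r \<Longrightarrow> (\<tau>, w) \<in> lattice_domain"
proof -
  obtain e where e: "e > 0" "cball (\<tau>, z) e \<subseteq> lattice_domain"
    using assms open_lattice_domain open_contains_cball by metis
  show ?thesis
    by (rule that[of e]) (use e in \<open>auto simp: subset_iff dist_Pair_Pair\<close>)
qed

lemma uniform_limit_slice:
  assumes "uniform_limit ({\<tau>} \<times> A) (\<lambda>X y. F X y) (\<lambda>(\<tau>, z). g \<tau> z) G"
  shows "uniform_limit A (\<lambda>X z. F X (\<tau>, z)) (g \<tau>) G"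
  using assms by (simp add: uniform_limit_iff)

lemma zeta_reg_deriv:
  assumes "(\<tau>, z) \<in> lattice_domain"
  shows "(zeta_reg \<tau> has_field_derivative - wp_reg \<tau> z) (at z)"
proof -
  obtain r where r: "r > 0" "\<And>w. w \<in> cball z r \<Longrightarrow> (\<tau>, w) \<in> lattice_domain"
    using lattice_domain_cball[OF assms] by blast
  have nz: "lat \<tau> x \<noteq> 0 \<and> w \<noteq> lat \<tau> x" if "x \<noteq> (0,0)" "w \<in> cball z r" for x w
    using lattice_domain_lat_nz r that by blast
  have Y: "compact ({\<tau>} \<times> cball z r)" "{\<tau>} \<times> cball z r \<subseteq> lattice_domain"
    using r by (auto intro!: compact_Times)
  have "((\<lambda>z. zeta_term x (\<tau>, z)) has_field_derivative - wp_term x (\<tau>, w)) (at w)"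
    if "x \<in> -{(0,0)}" "w \<in> cball z r" for x w
    unfolding zeta_term_def wp_term_def split
  proof -
    have "w - lat \<tau> x \<noteq> 0" "lat \<tau> x \<noteq> 0" using nz[of x w] that by auto
    then show "((\<lambda>z. 1 / (z - lat \<tau> x) + 1 / lat \<tau> x + z / (lat \<tau> x)\<^sup>2) has_field_derivative
        - (1 / (w - lat \<tau> x)\<^sup>2 - 1 / (lat \<tau> x)\<^sup>2)) (at w)"
      by (auto intro!: derivative_eq_intros simp: power2_eq_square)
  qed
  from has_field_derivative_infsum[OF r(1) this uniform_limit_slice[OF lattice_uniform_limits(1)[OF Y]]]
  obtain g' where g': "(zeta_reg \<tau> has_field_derivative g') (at z)"
    "((\<lambda>x. - wp_term x (\<tau>, z)) has_sum g') (-{(0,0)})" by auto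
  from has_sum_uminusI[OF g'(2)] have "wp_reg \<tau> z = - g'"
    unfolding wp_reg_def by (intro infsumI) simp
  with g'(1) show ?thesis by simp
qed

text \<open>Differentiation removes the convergence-producing term
  \<open>1 / (lat \<tau> x)\<^sup>2\<close>. What remains depends on \<open>z - lat \<tau> x\<close>
  alone, and a translation by a period merely permutes such terms.\<close>

lemma wp_reg_deriv:
  assumes "(\<tau>, z) \<in> lattice_domain"
  shows "\<exists>s. (wp_reg \<tau> has_field_derivative s) (at z) \<and>
             ((\<lambda>x. -2 / (z - lat \<tau> x) ^ 3) has_sum s) (-{(0,0)})"
proof -
  obtain r where r: "r > 0" "\<And>w. w \<in> cball z r \<Longrightarrow> (\<tau>, w) \<in> lattice_domain"
    using lattice_domain_cball[OF assms] by blast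
  have nz: "lat \<tau> x \<noteq> 0 \<and> w \<noteq> lat \<tau> x" if "x \<noteq> (0,0)" "w \<in> cball z r" for x w
    using lattice_domain_lat_nz r that by blast
  have Y: "compact ({\<tau>} \<times> cball z r)" "{\<tau>} \<times> cball z r \<subseteq> lattice_domain"
    using r by (auto intro!: compact_Times)
  have "((\<lambda>z. wp_term x (\<tau>, z)) has_field_derivative -2 / (w - lat \<tau> x) ^ 3) (at w)"
    if "x \<in> -{(0,0)}" "w \<in> cball z r" for x w
    unfolding wp_term_def split
  proof -
    have "w - lat \<tau> x \<noteq> 0" using nz[of x w] that by auto
    show "((\<lambda>z. 1 / (z - lat \<tau> x)\<^sup>2 - 1 / (lat \<tau> x)\<^sup>2) has_field_derivative
        -2 / (w - lat \<tau> x) ^ 3) (at w)"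
    proof (rule DERIV_cong)
      show "((\<lambda>z. 1 / (z - lat \<tau> x)\<^sup>2 - 1 / (lat \<tau> x)\<^sup>2) has_field_derivative
          - (2 * (w - lat \<tau> x)) / ((w - lat \<tau> x)\<^sup>2)\<^sup>2) (at w)"
        using \<open>w - lat \<tau> x \<noteq> 0\<close> by (auto intro!: derivative_eq_intros simp: power2_eq_square)
      show "- (2 * u) / (u\<^sup>2)\<^sup>2 = -2 / u ^ 3" for u :: complex
        by (simp add: power2_eq_square power3_eq_cube)
    qed
  qed
  from has_field_derivative_infsum[OF r(1) this uniform_limit_slice[OF lattice_uniform_limits(2)[OF Y]]]
  show ?thesis by auto
qed

lemma analytic_factor:
  assumes f: "f analytic_on {c}" and f0: "f c = 0"
  obtains h where "h analytic_on {c}" "\<And>z. f z = (z - c) * h z" "h c = deriv f c"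
proof -
  obtain S where S: "open S" "c \<in> S" "f holomorphic_on S"
    using f by (auto simp: analytic_at)
  let ?h = "\<lambda>z. if z = c then deriv f c else (f z - f c) / (z - c)"
  have "?h holomorphic_on S" by (rule pole_lemma_open[OF S(3) S(1)])
  then have "?h analytic_on {c}" using S by (auto simp: analytic_at)
  then show ?thesis by (rule that) (auto simp: f0)
qed

section \<open>Weierstrass functions\<close>

text \<open>Division is total, so functions have meaningless values at their poles. Removability is
  therefore stated on punctured neighbourhoods and never refers to \<open>f s\<close>.\<close>

definition removable_at :: "(complex \<Rightarrow> complex) \<Rightarrow> complex \<Rightarrow> bool" where
  "removable_at f s \<longleftrightarrow> (\<exists>h. h analytic_on {s} \<and> (\<forall>\<^sub>F z in at s. f z = h z))"

lemma removable_atI: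
  "h analytic_on {s} \<Longrightarrow> (\<forall>\<^sub>F z in at s. f z = h z) \<Longrightarrow> removable_at f s"
  by (auto simp: removable_at_def)

lemma removable_at_analytic: "f analytic_on {s} \<Longrightarrow> removable_at f s"
  by (auto simp: removable_at_def)

lemma eventually_at_add: "(\<forall>\<^sub>F z in at (s + w :: complex). P z) \<longleftrightarrow> (\<forall>\<^sub>F z in at s. P (z + w))"
  by (simp add: at_to_0[of "s + w"] at_to_0[of s] eventually_filtermap add_ac)

lemma eventually_at_uminus: "(\<forall>\<^sub>F z in at (- s :: complex). P z) \<longleftrightarrow> (\<forall>\<^sub>F z in at s. P (- z))"
  using filtermap_at_minus[of s] by (simp add: eventually_filtermap flip: filtermap_at_minus)

lemma removable_at_shift:
  assumes "removable_at f (s + w)" "\<forall>\<^sub>F z in at s. f (z + w) = f z"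
  shows "removable_at f s"
proof -
  obtain h where h: "h analytic_on {s + w}" "\<forall>\<^sub>F z in at (s + w). f z = h z"
    using assms by (auto simp: removable_at_def)
  have "(\<lambda>z. h (z + w)) analytic_on {s}"
    using analytic_on_compose[of "\<lambda>z. z + w" "{s}" h] h(1)
    by (simp add: o_def analytic_intros)
  moreover have "\<forall>\<^sub>F z in at s. f z = h (z + w)"
    using assms(2) h(2)[unfolded eventually_at_add] by eventually_elim simp
  ultimately show ?thesis by (rule removable_atI)
qed

lemma removable_at_uminus:
  assumes "removable_at f s" "\<forall>\<^sub>F z in at (- s). f (- z) = k * f z" "k \<noteq> 0"
  shows "removable_at f (- s)"
proof -
  obtain h where h: "h analytic_on {s}" "\<forall>\<^sub>F z in at s. f z = h z"
    using assms by (auto simp: removable_at_def)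
  have "(\<lambda>z. h (- z)) analytic_on {- s}"
    using analytic_on_compose[of "\<lambda>z. - z" "{- s}" h] h(1)
    by (simp add: o_def analytic_intros)
  then have "(\<lambda>z. h (- z) / k) analytic_on {- s}"
    by (intro analytic_intros) (use assms in auto)
  moreover have "\<forall>\<^sub>F z in at (- s). f (- z) = h (- z)"
    using h(2) by (subst eventually_at_uminus) simp
  then have "\<forall>\<^sub>F z in at (- s). f z = h (- z) / k"
    using assms(2) by eventually_elim (use assms(3) in \<open>simp add: field_simps\<close>)
  ultimately show ?thesis by (rule removable_atI)
qed

text \<open>Typically applied to the holomorphic extension of a function known to be constant, to
  read off the constant at a former pole.\<close>

lemma analytic_at_eq_limit:
  assumes "f analytic_on {z}" "\<forall>\<^sub>F w in at z. f w = (c::complex)"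
  shows "f z = c"
proof -
  have "isCont f z" using assms(1) analytic_at_imp_isCont by blast
  then have "f \<midarrow>z\<rightarrow> f z" by (simp add: isCont_def)
  moreover have "f \<midarrow>z\<rightarrow> c" by (rule tendsto_eventually) fact
  ultimately show ?thesis by (rule tendsto_unique[rotated]) auto
qed

lemma periodic_int:
  fixes F :: "complex \<Rightarrow> 'a"
  assumes "\<And>z. F (z + w) = F z"
  shows "F (z + of_int k * w) = F z"
proof (induction k rule: int_induct[where k=0])
  case (step1 i) then show ?case using assms[of "z + of_int i * w"] by (simp add: algebra_simps)
next
  case (step2 i) then show ?case using assms[of "z + of_int (i - 1) * w"] by (simp add: algebra_simps)
qed simp

section \<open>One fixed lattice: periodicity and Liouville's theorem\<close>

locale torus =
  fixes \<tau> :: complex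
  assumes Im_pos: "Im \<tau> > 0"
begin

abbreviation "L \<equiv> period_lattice \<tau>"
abbreviation "wp \<equiv> weierstrass_wp \<tau>"
abbreviation "ze \<equiv> weierstrass_zeta \<tau>"
abbreviation "wpr \<equiv> wp_reg \<tau>"
abbreviation "zer \<equiv> zeta_reg \<tau>"

lemma lattice_simps [simp, intro]:
  "0 \<in> L" "1 \<in> L" "\<tau> \<in> L" "lat \<tau> x \<in> L"
proof -
  have "1 = lat \<tau> (1, 0)" "\<tau> = lat \<tau> (0, 1)" "0 = lat \<tau> (0, 0)" by (auto simp: lat_def)
  then show "0 \<in> L" "1 \<in> L" "\<tau> \<in> L" "lat \<tau> x \<in> L"
    unfolding period_lattice_eq_range by blast+
qed

lemma lattice_add [intro]: "\<omega> \<in> L \<Longrightarrow> \<omega>' \<in> L \<Longrightarrow> \<omega> + \<omega>' \<in> L"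
proof -
  have "lat \<tau> (a, b) + lat \<tau> (a', b') = lat \<tau> (a + a', b + b')" for a b a' b'
    by (simp add: lat_def algebra_simps)
  then show "\<omega> \<in> L \<Longrightarrow> \<omega>' \<in> L \<Longrightarrow> \<omega> + \<omega>' \<in> L"
    unfolding period_lattice_eq_range by fastforce
qed

lemma lattice_uminus_iff [simp]: "- \<omega> \<in> L \<longleftrightarrow> \<omega> \<in> L"
proof -
  have "- lat \<tau> (a, b) = lat \<tau> (- a, - b)" for a b by (simp add: lat_def algebra_simps)
  then have "\<omega> \<in> L \<Longrightarrow> - \<omega> \<in> L" for \<omega> unfolding period_lattice_eq_range by fastforce
  from this[of \<omega>] this[of "- \<omega>"] show ?thesis by auto
qed

lemma lattice_add_iff: "\<omega> \<in> L \<Longrightarrow> z + \<omega> \<in> L \<longleftrightarrow> z \<in> L"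
  using lattice_add[of "z + \<omega>" "- \<omega>"] lattice_add[of z \<omega>] by auto

lemma lattice_diff_commute: "z - w \<in> L \<longleftrightarrow> w - z \<in> L"
  by (metis lattice_uminus_iff minus_diff_eq)

lemma lattice_domain_iff: "(\<tau>, z) \<in> lattice_domain \<longleftrightarrow> z \<notin> L - {0}"
  using lat_eq_0_iff[OF Im_pos] by (auto simp: lattice_domain_def Im_pos period_lattice_eq_range)

lemma open_lattice_slice: "open {z. (\<tau>, z) \<in> lattice_domain}"
proof -
  have "open (Pair \<tau> -` lattice_domain)"
    by (intro open_vimage open_lattice_domain continuous_intros)
  then show ?thesis by (simp add: vimage_def)
qed

lemma open_compl_lattice: "open (- L)"
proof -
  have "- L = {z. (\<tau>, z) \<in> lattice_domain} - {0}" by (auto simp: lattice_domain_iff)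
  then show ?thesis using open_lattice_slice by (simp add: open_delete)
qed

lemma countable_lattice: "countable L"
  by (simp add: period_lattice_eq_range)

lemma connected_compl_lattice: "connected (- L)"
  using connected_open_diff_countable[of UNIV L] countable_lattice connected_UNIV by (simp add: Compl_eq_Diff_UNIV)

lemma eventually_not_lattice: "\<forall>\<^sub>F z in at s. z \<notin> L"
proof (cases "s \<in> L")
  case False
  then show ?thesis using eventually_at_in_open'[OF open_compl_lattice, of s] by simp
next
  case True
  have "\<forall>\<^sub>F z in at 0. (z::complex) \<in> {z. (\<tau>, z) \<in> lattice_domain} - {0}"
    by (intro eventually_at_in_open open_lattice_slice) (auto simp: lattice_domain_iff)
  then have "\<forall>\<^sub>F z in at 0. z + s \<notin> L"
    by eventually_elim (auto simp: lattice_domain_iff lattice_add_iff[OF True])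
  then show ?thesis using eventually_at_add[of "\<lambda>z. z \<notin> L" 0 s] by simp
qed

lemma wp_eq: "wp z = 1 / z\<^sup>2 + wpr z" and ze_eq: "ze z = 1 / z + zer z"
  using weierstrass_wp_eq weierstrass_zeta_eq Im_pos by auto

lemma neg_bij: "bij_betw (\<lambda>(a, b). (- a, - b)) (-{(0::int, 0::int)}) (-{(0, 0)})"
  by (rule bij_betwI[where g = "\<lambda>(a, b). (- a, - b)"]) auto

lemma wpr_even: "wpr (- z) = wpr z"
proof -
  have "wp_term (case x of (a, b) \<Rightarrow> (- a, - b)) (\<tau>, - z) = wp_term x (\<tau>, z)" for x
  proof -
    have 1: "lat \<tau> (case x of (a, b) \<Rightarrow> (- a, - b)) = - lat \<tau> x" by (cases x) (simp add: lat_def)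
    have "(- z - - w)\<^sup>2 = (z - w)\<^sup>2" for w by (simp add: power2_eq_square algebra_simps)
    then show ?thesis unfolding wp_term_def split 1 by simp
  qed
  then show ?thesis
    unfolding wp_reg_def by (subst infsum_reindex_bij_betw[OF neg_bij, symmetric]) simp
qed

lemma zer_odd: "zer (- z) = - zer z"
proof -
  have "zeta_term (case x of (a, b) \<Rightarrow> (- a, - b)) (\<tau>, - z) = - zeta_term x (\<tau>, z)" for x
  proof -
    have 1: "lat \<tau> (case x of (a, b) \<Rightarrow> (- a, - b)) = - lat \<tau> x" by (cases x) (simp add: lat_def)
    have "1 / (- z - - w) = - (1 / (z - w))" for w
      by (metis minus_diff_minus minus_divide_right)
    then show ?thesis unfolding zeta_term_def split 1 by simp
  qed
  then have "zer (- z) = (\<Sum>\<^sub>\<infinity>x\<in>-{(0,0)}. - zeta_term x (\<tau>, z))"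
    unfolding zeta_reg_def by (subst infsum_reindex_bij_betw[OF neg_bij, symmetric]) simp
  then show ?thesis by (simp add: zeta_reg_def infsum_uminus)
qed

lemma wpr_0 [simp]: "wpr 0 = 0" and zer_0 [simp]: "zer 0 = 0"
proof -
  have "zeta_term x (\<tau>, 0) = 0" "wp_term x (\<tau>, 0) = 0" for x
    by (auto simp: zeta_term_def wp_term_def)
  then show "wpr 0 = 0" "zer 0 = 0" by (simp_all add: wp_reg_def zeta_reg_def)
qed

lemma wp_even: "wp (- z) = wp z" and ze_odd: "ze (- z) = - ze z"
  by (simp_all add: wp_eq ze_eq wpr_even zer_odd)

lemma wpr_holomorphic: "wpr holomorphic_on {z. (\<tau>, z) \<in> lattice_domain}"
  using wp_reg_deriv open_lattice_slice by (fastforce simp: holomorphic_on_open)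

lemma wpr_analytic_0: "wpr analytic_on {0}" and zer_analytic_0: "zer analytic_on {0}"
proof -
  have "zer holomorphic_on {z. (\<tau>, z) \<in> lattice_domain}"
    using zeta_reg_deriv open_lattice_slice by (fastforce simp: holomorphic_on_open)
  then show "wpr analytic_on {0}" "zer analytic_on {0}"
    using wpr_holomorphic open_lattice_slice
    by (auto simp: analytic_at lattice_domain_iff)
qed

lemma zer_deriv_0: "(zer has_field_derivative 0) (at 0)"
  using zeta_reg_deriv[of \<tau> 0] by (simp add: lattice_domain_iff)

lemma wp_deriv_sum:
  assumes "z \<notin> L"
  shows "(wp has_field_derivative (\<Sum>\<^sub>\<infinity>x. -2 / (z - lat \<tau> x) ^ 3)) (at z)"
proof -
  have z0: "z \<noteq> 0" using assms by auto
  have "(\<tau>, z) \<in> lattice_domain" using assms by (simp add: lattice_domain_iff)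
  from wp_reg_deriv[OF this] obtain s where s: "(wpr has_field_derivative s) (at z)"
    "((\<lambda>x. -2 / (z - lat \<tau> x) ^ 3) has_sum s) (-{(0,0)})" by blast
  \<comment> \<open>The index \<open>(0, 0)\<close> supplies the derivative of
    \<open>1 / z\<^sup>2\<close>; the sum then runs over the whole lattice and is invariant under
    reindexing.\<close>
  have "((\<lambda>x. -2 / (z - lat \<tau> x) ^ 3) has_sum (-2 / (z - lat \<tau> (0,0)) ^ 3 + s)) (insert (0,0) (-{(0,0)}))"
    by (rule has_sum_insert[OF _ s(2)]) simp
  then have e: "(\<Sum>\<^sub>\<infinity>x. -2 / (z - lat \<tau> x) ^ 3) = -2 / z ^ 3 + s"
    by (intro infsumI) (simp add: insert_absorb2 Compl_eq_Diff_UNIV insert_Diff_single)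
  have "((\<lambda>z. 1 / z\<^sup>2 + wpr z) has_field_derivative (-2 / z ^ 3 + s)) (at z)"
    using s(1) z0 by (auto intro!: derivative_eq_intros simp: power2_eq_square power3_eq_cube)
  moreover have "wp = (\<lambda>z. 1 / z\<^sup>2 + wpr z)" by (simp add: fun_eq_iff wp_eq)
  ultimately show ?thesis unfolding e by simp
qed

lemma wp_deriv: "z \<notin> L \<Longrightarrow> (wp has_field_derivative deriv wp z) (at z)"
  using wp_deriv_sum DERIV_imp_deriv by metis

lemma deriv_wp_periodic:
  assumes "z \<notin> L" "\<omega> \<in> L"
  shows "deriv wp (z + \<omega>) = deriv wp z"
proof -
  obtain y where y: "\<omega> = lat \<tau> y" using assms by (auto simp: period_lattice_eq_range)
  let ?t = "\<lambda>x. (fst x + fst y, snd x + snd y)"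
  have b: "bij_betw ?t UNIV UNIV"
    by (rule bij_betwI[where g = "\<lambda>x. (fst x - fst y, snd x - snd y)"]) auto
  have t: "z + \<omega> - lat \<tau> (?t x) = z - lat \<tau> x" for x
    by (cases x, cases y) (simp add: y lat_def algebra_simps)
  have "z + \<omega> \<notin> L" using assms by (simp add: lattice_add_iff)
  then have "deriv wp (z + \<omega>) = (\<Sum>\<^sub>\<infinity>x. -2 / (z + \<omega> - lat \<tau> x) ^ 3)"
    using DERIV_imp_deriv wp_deriv_sum by blast
  also have "\<dots> = (\<Sum>\<^sub>\<infinity>x. -2 / (z + \<omega> - lat \<tau> (?t x)) ^ 3)"
    by (rule infsum_reindex_bij_betw[OF b, symmetric])
  also have "\<dots> = deriv wp z"
    unfolding t using DERIV_imp_deriv wp_deriv_sum assms(1) by metis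
  finally show ?thesis .
qed

lemma const_on_compl_lattice:
  assumes "\<And>z. z \<notin> L \<Longrightarrow> (f has_field_derivative 0) (at z)"
  shows "\<exists>c. \<forall>z. z \<notin> L \<longrightarrow> f z = c"
  using has_field_derivative_0_imp_constant_on[of "- L" f] assms
    connected_compl_lattice open_compl_lattice by (auto simp: constant_on_def)

lemma DERIV_add_shift:
  assumes "(f has_field_derivative d) (at (z + \<omega>))"
  shows "((\<lambda>z. f (z + \<omega>)) has_field_derivative d) (at (z :: complex))"
  using assms by (simp add: DERIV_shift)

text \<open>The difference \<open>wp (z + \<omega>) - wp z\<close> is a constant \<open>c\<close>,
  because its derivative vanishes on the connected complement of the lattice. Evaluating it at
  \<open>- (z + \<omega>)\<close> rather than at \<open>- \<omega> / 2\<close> gives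
  \<open>c = - c\<close> by evenness even when half of \<open>\<omega>\<close> is itself a
  period.\<close>

lemma wp_periodic:
  assumes "z \<notin> L" "\<omega> \<in> L"
  shows "wp (z + \<omega>) = wp z"
proof -
  have "((\<lambda>z. wp (z + \<omega>) - wp z) has_field_derivative 0) (at z)" if "z \<notin> L" for z
    using DERIV_diff[OF DERIV_add_shift[OF wp_deriv, of z \<omega>] wp_deriv[of z]] that
      deriv_wp_periodic[OF that assms(2)] by (simp add: lattice_add_iff assms(2))
  then obtain c where c: "\<And>z. z \<notin> L \<Longrightarrow> wp (z + \<omega>) - wp z = c"
    using const_on_compl_lattice[of "\<lambda>z. wp (z + \<omega>) - wp z"] by blast
  have "- (z + \<omega>) \<notin> L" using assms by (simp only: lattice_uminus_iff lattice_add_iff) simp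
  from c[OF this] c[OF assms(1)] wp_even[of z] wp_even[of "z + \<omega>"] have "c = - c"
    by (simp add: algebra_simps)
  then have "c = 0" by simp
  with c[OF assms(1)] show ?thesis by simp
qed

lemma ze_deriv:
  assumes "z \<notin> L"
  shows "(ze has_field_derivative - wp z) (at z)"
proof -
  have z0: "z \<noteq> 0" using assms by auto
  have "(\<tau>, z) \<in> lattice_domain" using assms by (simp add: lattice_domain_iff)
  from zeta_reg_deriv[OF this] have "((\<lambda>z. 1 / z + zer z) has_field_derivative - (1 / z\<^sup>2 + wpr z)) (at z)"
    using z0 by (auto intro!: derivative_eq_intros simp: power2_eq_square)
  moreover have "ze = (\<lambda>z. 1 / z + zer z)" by (simp add: fun_eq_iff ze_eq)
  ultimately show ?thesis by (simp add: wp_eq)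
qed

lemma ze_quasiperiodic:
  assumes "\<omega> \<in> L"
  obtains \<eta> where "\<And>z. z \<notin> L \<Longrightarrow> ze (z + \<omega>) = ze z + \<eta>"
proof -
  have "((\<lambda>z. ze (z + \<omega>) - ze z) has_field_derivative 0) (at z)" if "z \<notin> L" for z
    using DERIV_diff[OF DERIV_add_shift[OF ze_deriv, of z \<omega>] ze_deriv[of z]] that
      wp_periodic[OF that assms] by (simp add: lattice_add_iff assms)
  then obtain c where c: "\<And>z. z \<notin> L \<Longrightarrow> ze (z + \<omega>) - ze z = c"
    using const_on_compl_lattice[of "\<lambda>z. ze (z + \<omega>) - ze z"] by blast
  show ?thesis by (rule that[of c]) (use c in \<open>auto simp: algebra_simps\<close>)
qed

lemma wp_holomorphic: "wp holomorphic_on - L" and ze_holomorphic: "ze holomorphic_on - L"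
  using wp_deriv ze_deriv open_compl_lattice by (fastforce simp: holomorphic_on_open)+

lemma wp_analytic [analytic_intros]:
  "f analytic_on A \<Longrightarrow> (\<And>z. z \<in> A \<Longrightarrow> f z \<notin> L) \<Longrightarrow> (\<lambda>z. wp (f z)) analytic_on A"
  using analytic_on_compose_gen[of f A wp "- L"] wp_holomorphic open_compl_lattice
  by (auto simp: o_def analytic_on_open)

lemma ze_analytic [analytic_intros]:
  "f analytic_on A \<Longrightarrow> (\<And>z. z \<in> A \<Longrightarrow> f z \<notin> L) \<Longrightarrow> (\<lambda>z. ze (f z)) analytic_on A"
  using analytic_on_compose_gen[of f A ze "- L"] ze_holomorphic open_compl_lattice
  by (auto simp: o_def analytic_on_open)

lemma deriv_wp_analytic [analytic_intros]:
  "f analytic_on A \<Longrightarrow> (\<And>z. z \<in> A \<Longrightarrow> f z \<notin> L) \<Longrightarrow> (\<lambda>z. deriv wp (f z)) analytic_on A"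
  using analytic_on_compose_gen[of f A "deriv wp" "- L"] wp_holomorphic open_compl_lattice
  by (auto simp: o_def analytic_on_open holomorphic_deriv)

lemma deriv_wp_odd:
  assumes "z \<notin> L"
  shows "deriv wp (- z) = - deriv wp z"
proof -
  have "((\<lambda>z. wp (- z)) has_field_derivative deriv wp (- z) * (-1)) (at z)"
    by (rule DERIV_chain2[OF wp_deriv]) (use assms in \<open>auto intro!: derivative_eq_intros\<close>)
  then have "(wp has_field_derivative - deriv wp (- z)) (at z)"
    by (simp add: wp_even)
  with wp_deriv[OF assms] show ?thesis by (metis DERIV_unique minus_minus)
qed

text \<open>Liouville's theorem for doubly periodic functions. Removability is asked at one
  representative of each class modulo the lattice, and periodicity carries it to all points. The
  conclusion speaks of punctured neighbourhoods because \<open>f\<close> may take arbitrary values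
  on \<open>S\<close>.\<close>

lemma elliptic_const:
  assumes S: "\<And>s. \<forall>\<^sub>F z in at s. z \<notin> S"
    and per: "\<And>z \<omega>. z \<notin> S \<Longrightarrow> \<omega> \<in> L \<Longrightarrow> f (z + \<omega>) = f z"
    and loc: "\<And>s. \<exists>\<omega>\<in>L. removable_at f (s + \<omega>)"
  obtains c where "\<And>s. \<forall>\<^sub>F z in at s. f z = c"
proof -
  have ev: "\<forall>\<^sub>F z in at s. f (z + \<omega>) = f z" if "\<omega> \<in> L" for s \<omega>
    using S[of s] by eventually_elim (use per that in auto)
  have "removable_at f s" for s
    using loc[of s] removable_at_shift ev by blast
  then have "\<exists>h. \<forall>s. h s analytic_on {s} \<and> (\<forall>\<^sub>F z in at s. f z = h s z)"
    unfolding removable_at_def by metis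
  then obtain h where h: "\<And>s. h s analytic_on {s}" "\<And>s. \<forall>\<^sub>F z in at s. f z = h s z" by blast
  \<comment> \<open>The diagonal of the local extensions: \<open>F z\<close> is the value at
    \<open>z\<close> of the extension chosen at \<open>z\<close>. It is the limit of
    \<open>f\<close> at \<open>z\<close>, hence independent of the choices.\<close>
  define F where "F z = h z z" for z
  have lim: "f \<midarrow>s\<rightarrow> F s" for s
  proof -
    have "h s \<midarrow>s\<rightarrow> h s s" using h(1)[of s] analytic_at_imp_isCont isCont_def by blast
    then show ?thesis unfolding F_def
      by (rule tendsto_cong[THEN iffD2, rotated]) (rule h(2))
  qed
  have Fh: "\<forall>\<^sub>F z in nhds s. F z = h s z" for s
  proof -
    obtain U where U: "open U" "s \<in> U" "h s holomorphic_on U" using h(1)[of s] by (auto simp: analytic_at)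
    obtain V where V: "open V" "s \<in> V" "\<And>z. z \<in> V \<Longrightarrow> z \<noteq> s \<Longrightarrow> f z = h s z"
      using h(2)[of s] unfolding eventually_at_topological by blast
    have "F z = h s z" if z: "z \<in> U \<inter> V" for z
    proof (cases "z = s")
      case False
      have "isCont (h s) z"
        using U z by (meson IntD1 continuous_on_eq_continuous_at holomorphic_on_imp_continuous_on)
      then have "h s \<midarrow>z\<rightarrow> h s z" by (simp add: isCont_def)
      moreover have "\<forall>\<^sub>F w in at z. w \<in> V - {s}"
        using V z False by (intro eventually_at_in_open') auto
      then have "\<forall>\<^sub>F w in at z. f w = h s w" by eventually_elim (use V in auto)
      ultimately have "f \<midarrow>z\<rightarrow> h s z" using tendsto_cong by blast
      with lim[of z] show ?thesis using LIM_unique by blast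
    qed (simp add: F_def)
    then show ?thesis
      using U V by (intro eventually_nhds_in_open[of "U \<inter> V", THEN eventually_mono]) auto
  qed
  have "F analytic_on {s}" for s
    using analytic_at_cong[OF Fh[of s] refl] h(1)[of s] by simp
  then have hol: "F holomorphic_on UNIV"
    by (meson UNIV_I analytic_imp_holomorphic analytic_on_def analytic_on_analytic_at)
  have Fper: "F (z + \<omega>) = F z" if "\<omega> \<in> L" for z \<omega>
  proof -
    have "(\<lambda>w. f (w + \<omega>)) \<midarrow>z\<rightarrow> F (z + \<omega>)" using LIM_offset[OF lim[of "z + \<omega>"], of \<omega>] by simp
    then have "f \<midarrow>z\<rightarrow> F (z + \<omega>)" using tendsto_cong[OF ev[OF that, of z]] by blast
    then show ?thesis using lim LIM_unique by blast
  qed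
  \<comment> \<open>A closed period parallelogram. Subtracting the floors of the real coordinates
    moves any point into it, so \<open>F\<close> is bounded.\<close>
  define K where "K = (\<lambda>(a::real, b::real). of_real a + of_real b * \<tau>) ` ({0..1} \<times> {0..1})"
  have "compact K" unfolding K_def split_beta
    by (intro compact_continuous_image continuous_intros compact_Times) auto
  have "F z \<in> F ` K" for z
  proof -
    define y where "y = Im z / Im \<tau>"
    define x where "x = Re z - y * Re \<tau>"
    have z: "z = of_real x + of_real y * \<tau>"
      using Im_pos by (simp add: complex_eq_iff x_def y_def)
    have l: "lat \<tau> (- \<lfloor>x\<rfloor>, - \<lfloor>y\<rfloor>) \<in> L" by simp
    have "z + lat \<tau> (- \<lfloor>x\<rfloor>, - \<lfloor>y\<rfloor>) = of_real (frac x) + of_real (frac y) * \<tau>"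
      by (simp add: z lat_def frac_def algebra_simps)
    moreover have "of_real (frac x) + of_real (frac y) * \<tau> \<in> K"
      unfolding K_def by (rule image_eqI[of _ _ "(frac x, frac y)"]) (auto simp: frac_lt_1 less_imp_le)
    ultimately show ?thesis using Fper[OF l, of z] by (metis imageI)
  qed
  moreover have "bounded (F ` K)"
    using \<open>compact K\<close> hol by (meson compact_continuous_image compact_imp_bounded
        continuous_on_subset holomorphic_on_imp_continuous_on subset_UNIV)
  ultimately have "bounded (range F)" by (meson bounded_subset image_subsetI)
  with hol have "F constant_on UNIV" by (rule Liouville_theorem)
  then obtain c where c: "\<And>z. F z = c" by (auto simp: constant_on_def)
  have "\<forall>\<^sub>F z in at s. f z = c" for s
    using h(2)[of s] Fh[of s] unfolding eventually_at_filter
  proof eventually_elim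
    case (elim z) then show ?case using c[of z] by simp
  qed
  then show ?thesis by (rule that)
qed

end

section \<open>Elliptic functions with poles at the classes of 0, p and -p\<close>

locale torus_point = torus +
  fixes p :: complex
  assumes p2: "2 * p \<notin> L"
begin

lemma p_notin: "p \<notin> L" and mp_notin: "- p \<notin> L" and pp_notin: "p + p \<notin> L" "- p - p \<notin> L"
proof -
  show pp: "p + p \<notin> L" using p2 by simp
  then show "p \<notin> L" using lattice_add[of p p] by blast
  then show "- p \<notin> L" by simp
  have "- p - p = - (p + p)" by simp
  then show "- p - p \<notin> L" using pp by (simp only: lattice_uminus_iff) simp
qed

definition v :: "complex \<Rightarrow> complex" where "v z = wp z - wp p"
definition R :: "complex \<Rightarrow> complex" where "R z = ze (z + p) + ze (z - p) - 2 * ze z"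
text \<open>The zeta expansion of \<open>deriv wp p / v z\<close>, as \<open>vQ\<close> shows:
  simple poles at \<open>p\<close> and \<open>- p\<close> with residues 1 and -1, and a constant
  that makes it vanish at 0.\<close>

definition Q :: "complex \<Rightarrow> complex" where "Q z = ze (z - p) - ze (z + p) + 2 * ze p"

abbreviation "S \<equiv> gle1_singularities p \<tau>"

lemma notin_S_iff: "z \<notin> S \<longleftrightarrow> z \<notin> L \<and> z - p \<notin> L \<and> z + p \<notin> L"
  by (auto simp: gle1_singularities_def)

lemma eventually_notin_S: "\<forall>\<^sub>F z in at s. z \<notin> S"
  using eventually_not_lattice[of s] eventually_not_lattice[of "s - p"] eventually_not_lattice[of "s + p"]
    eventually_at_add[of "\<lambda>z. z \<notin> L" s p] eventually_at_add[of "\<lambda>z. z \<notin> L" s "- p"]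
  by (simp add: notin_S_iff eventually_conj_iff)

lemma S_reps:
  assumes "\<And>s. s \<notin> S \<Longrightarrow> removable_at f s" "removable_at f 0" "removable_at f p" "removable_at f (- p)"
  shows "\<exists>\<omega>\<in>L. removable_at f (s + \<omega>)"
proof -
  consider "s \<notin> S" | "s \<in> L" | "s - p \<in> L" | "s + p \<in> L" by (auto simp: gle1_singularities_def)
  then show ?thesis
  proof cases
    case 1 then show ?thesis using assms(1)[of "s + 0"] by (intro bexI[of _ 0]) auto
  next
    case 2 then show ?thesis using assms(2) by (intro bexI[of _ "- s"]) auto
  next
    case 3 then show ?thesis using assms(3)
      by (intro bexI[of _ "- (s - p)"]) (auto simp: lattice_diff_commute)
  next
    case 4
    then have "- (s + p) \<in> L" by (simp only: lattice_uminus_iff)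
    then show ?thesis using assms(4) by (intro bexI[of _ "- (s + p)"]) auto
  qed
qed

lemma v_even: "v (- z) = v z" and R_odd: "R (- z) = - R z" and Q_even: "Q (- z) = Q z"
proof -
  have "- z + p = - (z - p)" "- z - p = - (z + p)" by simp_all
  then have "ze (- z + p) = - ze (z - p)" "ze (- z - p) = - ze (z + p)"
    by (simp_all only: ze_odd)
  then show "v (- z) = v z" "R (- z) = - R z" "Q (- z) = Q z"
    by (simp_all add: v_def R_def Q_def wp_even ze_odd)
qed

lemma periodic:
  assumes "z \<notin> S" "\<omega> \<in> L"
  shows "v (z + \<omega>) = v z" "R (z + \<omega>) = R z" "Q (z + \<omega>) = Q z" "deriv wp (z + \<omega>) = deriv wp z"
    "wp (z + \<omega>) = wp z" "wp (z + \<omega> + p) = wp (z + p)" "wp (z + \<omega> - p) = wp (z - p)"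
proof -
  have z: "z \<notin> L" "z - p \<notin> L" "z + p \<notin> L" using assms notin_S_iff by auto
  obtain \<eta> where \<eta>: "\<And>z. z \<notin> L \<Longrightarrow> ze (z + \<omega>) = ze z + \<eta>"
    using ze_quasiperiodic assms by blast
  have "ze (z + \<omega> + p) = ze (z + p) + \<eta>" "ze (z + \<omega> - p) = ze (z - p) + \<eta>"
    using \<eta>[OF z(3)] \<eta>[OF z(2)] by (simp_all add: algebra_simps)
  then show "v (z + \<omega>) = v z" "R (z + \<omega>) = R z" "Q (z + \<omega>) = Q z" "deriv wp (z + \<omega>) = deriv wp z"
    "wp (z + \<omega>) = wp z"
    using \<eta>[OF z(1)] z assms by (simp_all add: v_def R_def Q_def wp_periodic deriv_wp_periodic)
  show "wp (z + \<omega> + p) = wp (z + p)" "wp (z + \<omega> - p) = wp (z - p)"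
    using wp_periodic[OF z(3) assms(2)] wp_periodic[OF z(2) assms(2)] by (simp_all add: algebra_simps)
qed

lemma v_analytic: "s \<notin> L \<Longrightarrow> v analytic_on {s}"
  and R_analytic: "s \<notin> S \<Longrightarrow> R analytic_on {s}"
  and Q_analytic: "s - p \<notin> L \<Longrightarrow> s + p \<notin> L \<Longrightarrow> Q analytic_on {s}"
  unfolding v_def R_def Q_def notin_S_iff by (auto intro!: analytic_intros)

lemma v_p [simp]: "v p = 0" by (simp add: v_def)

lemma deriv_v: "s \<notin> L \<Longrightarrow> (v has_field_derivative deriv wp s) (at s)"
  unfolding v_def using wp_deriv by (auto intro!: derivative_eq_intros)

lemma R_at_0:
  obtains h where "h analytic_on {0}" "\<And>z. z \<noteq> 0 \<Longrightarrow> R z = z\<^sup>2 * h z - 2 * wp p * z - 2 / z"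
proof -
  define a where "a z = ze (z + p) + ze (z - p) - 2 * zer z + 2 * wp p * z" for z
  have an: "a analytic_on {0}" unfolding a_def
    using zer_analytic_0 p_notin mp_notin by (auto intro!: analytic_intros)
  have a0: "a 0 = 0" by (simp add: a_def ze_odd)
  have "((\<lambda>z. ze (z + p)) has_field_derivative - wp p) (at 0)"
       "((\<lambda>z. ze (z - p)) has_field_derivative - wp (- p)) (at 0)"
    using DERIV_add_shift[OF ze_deriv, of 0 p] DERIV_add_shift[OF ze_deriv, of 0 "- p"] p_notin mp_notin by auto
  then have "(a has_field_derivative (- wp p - wp (- p) - 2 * 0 + 2 * wp p)) (at 0)"
    unfolding a_def using zer_deriv_0 by (auto intro!: derivative_eq_intros)
  then have d0: "deriv a 0 = 0" by (simp add: DERIV_imp_deriv wp_even)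
  obtain a1 where a1: "a1 analytic_on {0}" "\<And>z. a z = (z - 0) * a1 z" "a1 0 = deriv a 0"
    using analytic_factor[OF an a0] by blast
  obtain a2 where a2: "a2 analytic_on {0}" "\<And>z. a1 z = (z - 0) * a2 z"
    using analytic_factor[OF a1(1)] a1(3) d0 by auto
  show ?thesis
  proof (rule that[OF a2(1)])
    fix z :: complex assume "z \<noteq> 0"
    have "a z = z\<^sup>2 * a2 z" by (simp add: a1 a2 power2_eq_square)
    then show "R z = z\<^sup>2 * a2 z - 2 * wp p * z - 2 / z"
      by (simp add: a_def R_def ze_eq[of z] algebra_simps)
  qed
qed

text \<open>\<open>R\<close> and \<open>Q\<close> share their principal part at \<open>p\<close>.
  Describing both by the same \<open>\<rho>\<close> lets \<open>R_squared\<close> match residues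
  directly.\<close>

lemma R_at_p:
  obtains \<rho> where "\<rho> analytic_on {p}" "\<And>z. R z = 1 / (z - p) + \<rho> z" "\<And>z. Q z = 1 / (z - p) + (\<rho> z - 2 * ze (z + p) + 2 * ze z + 2 * ze p)"
proof -
  define \<rho> where "\<rho> z = zer (z - p) + ze (z + p) - 2 * ze z" for z
  have "(\<lambda>z. zer (z - p)) analytic_on {p}"
    using analytic_on_compose[of "\<lambda>z. z - p" "{p}" zer] zer_analytic_0 by (simp add: o_def analytic_intros)
  then have "\<rho> analytic_on {p}" unfolding \<rho>_def using p_notin pp_notin by (auto intro!: analytic_intros)
  moreover have "R z = 1 / (z - p) + \<rho> z" "Q z = 1 / (z - p) + (\<rho> z - 2 * ze (z + p) + 2 * ze z + 2 * ze p)" for z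
    by (simp_all add: R_def Q_def \<rho>_def ze_eq[of "z - p"])
  ultimately show ?thesis by (rule that)
qed

lemma v_at_p:
  obtains h where "h analytic_on {p}" "\<And>z. v z = (z - p) * h z" "h p = deriv wp p"
  using analytic_factor[OF v_analytic[OF p_notin] v_p] DERIV_imp_deriv[OF deriv_v[OF p_notin]] by metis

lemma wp_near_0: "\<forall>\<^sub>F z in at 0. z \<notin> L - {0} \<and> z \<noteq> 0"
  using eventually_not_lattice[of 0] by eventually_elim auto

lemma analytic_on_S_const:
  assumes "\<And>s. s \<notin> S \<Longrightarrow> f analytic_on {s}" "removable_at f 0" "removable_at f p"
    and "\<And>z. z \<notin> S \<Longrightarrow> f (- z) = k * f z" "k \<noteq> 0"
    and "\<And>z \<omega>. z \<notin> S \<Longrightarrow> \<omega> \<in> L \<Longrightarrow> f (z + \<omega>) = f z"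
  obtains c where "\<And>z. f analytic_on {z} \<Longrightarrow> f z = c" "\<And>s. \<forall>\<^sub>F z in at s. f z = c"
proof -
  have "\<forall>\<^sub>F z in at (- p). f (- z) = k * f z"
    using eventually_notin_S[of "- p"] by eventually_elim (rule assms(4))
  from removable_at_uminus[OF assms(3) this assms(5)] have m: "removable_at f (- p)" .
  obtain c where "\<And>s. \<forall>\<^sub>F z in at s. f z = c"
    by (rule elliptic_const[of S f]) (use eventually_notin_S assms S_reps[OF _ assms(2,3) m] removable_at_analytic in blast)+
  then show ?thesis using analytic_at_eq_limit that by metis
qed

text \<open>Both sides have the same principal parts at 0 and at \<open>p\<close>, so they differ by
  a constant, and oddness forces that constant to be zero.\<close>

lemma vR:
  assumes "z \<notin> S"
  shows "v z * R z = deriv wp z"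
proof -
  let ?f = "\<lambda>z. v z * R z - deriv wp z"
  have an: "?f analytic_on {s}" if "s \<notin> S" for s
    using that v_analytic R_analytic deriv_wp_analytic[of "\<lambda>z. z" "{s}"] notin_S_iff
    by (auto intro!: analytic_intros)
  have r0: "removable_at ?f 0"
  proof -
    obtain a where a: "a analytic_on {0}" "\<And>z. z \<noteq> 0 \<Longrightarrow> R z = z\<^sup>2 * a z - 2 * wp p * z - 2 / z"
      by (rule R_at_0) (rule that, assumption+)
    obtain w1 where w1: "w1 analytic_on {0}" "\<And>z. wpr z = (z - 0) * w1 z"
      using analytic_factor[OF wpr_analytic_0] by auto
    have dw: "(deriv wpr) analytic_on {0}" using wpr_analytic_0 by (rule analytic_deriv)
    show ?thesis
    proof (rule removable_atI)
      show "(\<lambda>z. a z + (wpr z - wp p) * (z\<^sup>2 * a z - 2 * wp p * z) - 2 * w1 z - deriv wpr z) analytic_on {0}"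
        using a w1 dw wpr_analytic_0 by (auto intro!: analytic_intros)
      show "\<forall>\<^sub>F z in at 0. ?f z = a z + (wpr z - wp p) * (z\<^sup>2 * a z - 2 * wp p * z) - 2 * w1 z - deriv wpr z"
        using wp_near_0
      proof eventually_elim
        case (elim z)
        then have z: "z \<noteq> 0" "z \<notin> L" by auto
        have "(\<tau>, z) \<in> lattice_domain" using elim lattice_domain_iff by blast
        then obtain s where s: "(wpr has_field_derivative s) (at z)" using wp_reg_deriv by blast
        then have "((\<lambda>z. 1 / z\<^sup>2 + wpr z) has_field_derivative (-2 / z ^ 3 + s)) (at z)"
          using z by (auto intro!: derivative_eq_intros simp: power2_eq_square power3_eq_cube)
        moreover have "wp = (\<lambda>z. 1 / z\<^sup>2 + wpr z)" by (simp add: fun_eq_iff wp_eq)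
        ultimately have "(wp has_field_derivative (-2 / z ^ 3 + s)) (at z)" by simp
        then have "deriv wp z = -2 / z ^ 3 + deriv wpr z"
          by (simp only: DERIV_imp_deriv[OF s] DERIV_imp_deriv)
        moreover have w: "w1 z = wpr z / z" using w1(2)[of z] z by simp
        ultimately show ?case
          unfolding w v_def wp_eq[of z] a(2)[OF z(1)]
        proof -
          define i where "i = 1 / z"
          have i: "z * i = 1" using z by (simp add: i_def)
          assume d: "deriv wp z = - 2 / z ^ 3 + deriv wpr z"
          have e: "1 / z\<^sup>2 = i ^ 2" "2 / z = 2 * i" "- 2 / z ^ 3 = - 2 * i ^ 3" "wpr z / z = wpr z * i"
            by (simp_all add: i_def power_divide)
          show "(1 / z\<^sup>2 + wpr z - wp p) * (z\<^sup>2 * a z - 2 * wp p * z - 2 / z) - deriv wp z =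
            a z + (wpr z - wp p) * (z\<^sup>2 * a z - 2 * wp p * z) - 2 * (wpr z / z) - deriv wpr z"
            (is "(_ + ?w - ?P) * ?X - _ = _")
          proof -
            have "i\<^sup>2 * (z\<^sup>2 * a z - 2 * ?P * z - 2 * i) = (z * i)\<^sup>2 * a z - 2 * ?P * (z * i) * i - 2 * i ^ 3"
              by (simp add: algebra_simps power2_eq_square power3_eq_cube)
            then have k: "i\<^sup>2 * (z\<^sup>2 * a z - 2 * ?P * z - 2 * i) = a z - 2 * ?P * i - 2 * i ^ 3"
              by (simp add: i)
            have "(i\<^sup>2 + ?w - ?P) * (z\<^sup>2 * a z - 2 * ?P * z - 2 * i) =
                i\<^sup>2 * (z\<^sup>2 * a z - 2 * ?P * z - 2 * i) + (?w - ?P) * (z\<^sup>2 * a z - 2 * ?P * z) - 2 * (?w * i) + 2 * ?P * i"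
              by (simp add: algebra_simps)
            then show ?thesis unfolding d e k by simp
          qed
        qed
      qed
    qed
  qed
  have rp: "removable_at ?f p"
  proof -
    obtain \<rho> where \<rho>: "\<rho> analytic_on {p}" "\<And>z. R z = 1 / (z - p) + \<rho> z"
      "\<And>z. Q z = 1 / (z - p) + (\<rho> z - 2 * ze (z + p) + 2 * ze z + 2 * ze p)" by (rule R_at_p) (rule that, assumption+)
    obtain h where h: "h analytic_on {p}" "\<And>z. v z = (z - p) * h z" "h p = deriv wp p" by (rule v_at_p) (rule that, assumption+)
    show ?thesis
    proof (rule removable_atI)
      show "(\<lambda>z. h z + v z * \<rho> z - deriv wp z) analytic_on {p}"
        using \<rho> h v_analytic[OF p_notin] p_notin deriv_wp_analytic[of "\<lambda>z. z" "{p}"] by (auto intro!: analytic_intros)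
      show "\<forall>\<^sub>F z in at p. ?f z = h z + v z * \<rho> z - deriv wp z"
      proof -
        have "?f z = h z + v z * \<rho> z - deriv wp z" if "z \<noteq> p" for z
        proof -
          have "v z * (1 / (z - p)) = h z" using that by (simp add: h(2))
          then show ?thesis unfolding \<rho>(2) by (simp only: distrib_left)
        qed
        then show ?thesis by (auto simp: eventually_at_filter)
      qed
    qed
  qed
  have odd: "?f (- z) = (-1) * ?f z" if "z \<notin> S" for z
    using that by (simp add: v_even R_odd deriv_wp_odd notin_S_iff)
  obtain c where c: "\<And>z. ?f analytic_on {z} \<Longrightarrow> ?f z = c" "\<And>s. \<forall>\<^sub>F z in at s. ?f z = c"
    by (rule analytic_on_S_const[of ?f "-1"]) (use an r0 rp odd periodic in auto)
  have "- z \<notin> S" using assms by (simp add: notin_S_iff) (metis lattice_uminus_iff minus_add_distrib minus_diff_eq uminus_add_conv_diff add.commute)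
  then have "c = - c" using c(1)[OF an[OF assms]] c(1)[OF an, of "- z"] odd[OF assms] by simp
  then have "c = 0" by simp
  then show ?thesis using c(1)[OF an[OF assms]] by simp
qed

text \<open>The zeros of \<open>v\<close> at \<open>p\<close> and \<open>- p\<close> cancel the
  poles of \<open>Q\<close>, and the double zero of \<open>Q\<close> at 0 cancels the pole of
  \<open>v\<close>. The constant is the value at \<open>p\<close>: the derivative of
  \<open>v\<close> times the residue 1.\<close>

lemma vQ:
  assumes "z \<notin> S"
  shows "v z * Q z = deriv wp p"
proof -
  let ?f = "\<lambda>z. v z * Q z"
  have an: "?f analytic_on {s}" if "s \<notin> S" for s
    using that v_analytic Q_analytic notin_S_iff by (auto intro!: analytic_intros)
  have r0: "removable_at ?f 0"
  proof -
    have Qan: "Q analytic_on {0}" using p_notin mp_notin by (intro Q_analytic) auto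
    have Q0: "Q 0 = 0" by (simp add: Q_def ze_odd)
    have "((\<lambda>z. ze (z + p)) has_field_derivative - wp p) (at 0)"
         "((\<lambda>z. ze (z - p)) has_field_derivative - wp (- p)) (at 0)"
      using DERIV_add_shift[OF ze_deriv, of 0 p] DERIV_add_shift[OF ze_deriv, of 0 "- p"] p_notin mp_notin by auto
    then have "(Q has_field_derivative (- wp (- p) - - wp p)) (at 0)"
      unfolding Q_def by (auto intro!: derivative_eq_intros)
    then have d0: "deriv Q 0 = 0" by (simp add: DERIV_imp_deriv wp_even)
    obtain a1 where a1: "a1 analytic_on {0}" "\<And>z. Q z = (z - 0) * a1 z" "a1 0 = deriv Q 0"
      using analytic_factor[OF Qan Q0] by blast
    obtain a2 where a2: "a2 analytic_on {0}" "\<And>z. a1 z = (z - 0) * a2 z"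
      using analytic_factor[OF a1(1)] a1(3) d0 by auto
    show ?thesis
    proof (rule removable_atI)
      show "(\<lambda>z. (1 + z\<^sup>2 * (wpr z - wp p)) * a2 z) analytic_on {0}"
        using a2 wpr_analytic_0 by (auto intro!: analytic_intros)
      show "\<forall>\<^sub>F z in at 0. ?f z = (1 + z\<^sup>2 * (wpr z - wp p)) * a2 z"
        using wp_near_0
      proof eventually_elim
        case (elim z)
        then have z: "z \<noteq> 0" by auto
        have "Q z = z\<^sup>2 * a2 z" by (simp add: a1(2) a2(2) power2_eq_square)
        then show ?case unfolding v_def wp_eq[of z] using z by (simp add: field_simps)
      qed
    qed
  qed
  obtain \<rho> where \<rho>0: "\<rho> analytic_on {p}" "\<And>z. R z = 1 / (z - p) + \<rho> z"
    "\<And>z. Q z = 1 / (z - p) + (\<rho> z - 2 * ze (z + p) + 2 * ze z + 2 * ze p)"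
    by (rule R_at_p) (rule that, assumption+)
  note \<rho> = \<rho>0(1,3)
  obtain h where h: "h analytic_on {p}" "\<And>z. v z = (z - p) * h z" "h p = deriv wp p" by (rule v_at_p) (rule that, assumption+)
  let ?g = "\<lambda>z. h z + v z * (\<rho> z - 2 * ze (z + p) + 2 * ze z + 2 * ze p)"
  have g: "?g analytic_on {p}"
    using \<rho> h v_analytic[OF p_notin] p_notin pp_notin by (auto intro!: analytic_intros)
  have "?f z = ?g z" if "z \<noteq> p" for z
  proof -
    have "v z * (1 / (z - p)) = h z" using that by (simp add: h(2))
    then show ?thesis unfolding \<rho>(2) by (simp only: distrib_left)
  qed
  then have fg: "\<forall>\<^sub>F z in at p. ?f z = ?g z" by (auto simp: eventually_at_filter)
  have rp: "removable_at ?f p" using g fg by (rule removable_atI)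
  obtain c where c: "\<And>z. ?f analytic_on {z} \<Longrightarrow> ?f z = c" "\<And>s. \<forall>\<^sub>F z in at s. ?f z = c"
    by (rule analytic_on_S_const[of ?f "1"]) (use an r0 rp periodic in \<open>auto simp: v_even Q_even\<close>)
  have "\<forall>\<^sub>F z in at p. ?g z = c" using fg c(2)[of p] by eventually_elim simp
  from analytic_at_eq_limit[OF g this] have "c = deriv wp p" by (simp add: h(3))
  then show ?thesis using c(1)[OF an[OF assms]] by simp
qed

text \<open>No count of zeros is involved. If \<open>deriv wp p\<close> vanished, \<open>vQ\<close>
  would give \<open>v z * Q z = 0\<close>; as \<open>Q\<close> has a pole at \<open>p\<close>, the
  function \<open>v\<close> would vanish near \<open>p\<close> and then on the whole complement of
  the lattice, against its double pole at 0.\<close>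

lemma deriv_wp_p_nz: "deriv wp p \<noteq> 0"
proof
  assume 0: "deriv wp p = 0"
  obtain \<rho> where \<rho>0: "\<rho> analytic_on {p}" "\<And>z. R z = 1 / (z - p) + \<rho> z"
    "\<And>z. Q z = 1 / (z - p) + (\<rho> z - 2 * ze (z + p) + 2 * ze z + 2 * ze p)"
    by (rule R_at_p) (rule that, assumption+)
  note \<rho> = \<rho>0(1,3)
  let ?g = "\<lambda>z. 1 + (z - p) * (\<rho> z - 2 * ze (z + p) + 2 * ze z + 2 * ze p)"
  have "?g analytic_on {p}"
    using \<rho> p_notin pp_notin by (auto intro!: analytic_intros)
  then have "isCont ?g p" by (rule analytic_at_imp_isCont)
  then have "\<forall>\<^sub>F z in at p. ?g z \<noteq> 0"
    unfolding isCont_def by (rule tendsto_imp_eventually_ne) simp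
  moreover have "\<forall>\<^sub>F z in at p. z \<noteq> p" by (simp add: eventually_at_filter)
  ultimately have "\<forall>\<^sub>F z in at p. v z = 0" using eventually_notin_S[of p]
  proof eventually_elim
    case (elim z)
    then have "(z - p) * Q z \<noteq> 0" by (simp add: \<rho>(2) distrib_left)
    then show ?case using vQ[OF elim(3)] 0 by auto
  qed
  then obtain e where e: "e > 0" "\<And>z. z \<noteq> p \<Longrightarrow> dist z p < e \<Longrightarrow> v z = 0"
    by (auto simp: eventually_at)
  have "v holomorphic_on - L" unfolding v_def by (intro holomorphic_intros wp_holomorphic)
  have "open (ball p e \<inter> - L)" using open_compl_lattice by auto
  then have lim: "p islimpt (ball p e \<inter> - L)" using p_notin e by (intro interior_limit_point) (simp add: interior_open open_compl_lattice)
  have v_e: "v z = 0" if "z \<in> ball p e \<inter> - L" for z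
    using e(2)[of z] that v_p by (cases "z = p") (auto simp: dist_commute)
  have v0: "v z = 0" if "z \<notin> L" for z
    by (rule analytic_continuation[OF \<open>v holomorphic_on - L\<close> open_compl_lattice connected_compl_lattice _ _ lim])
       (use that p_notin v_e in auto)
  let ?k = "\<lambda>z. 1 + z\<^sup>2 * (wpr z - wp p)"
  have "?k analytic_on {0}" using wpr_analytic_0 by (auto intro!: analytic_intros)
  moreover have "\<forall>\<^sub>F z in at 0. ?k z = 0"
    using wp_near_0
  proof eventually_elim
    case (elim z)
    then have "v z = 0" "z \<noteq> 0" using v0 by auto
    then show ?case unfolding v_def wp_eq[of z] by (simp add: field_simps)
  qed
  ultimately have "?k 0 = 0" by (rule analytic_at_eq_limit)
  then show False by simp
qed

lemma v_nz: "z \<notin> S \<Longrightarrow> v z \<noteq> 0"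
  using vQ[of z] deriv_wp_p_nz by auto

text \<open>Squaring the simple poles of \<open>R\<close> produces the double poles of the
  \<open>wp\<close> terms. At \<open>p\<close> the cross term leaves the residue
  \<open>2 * \<rho> p\<close>, which has to match the coefficient of \<open>Q\<close>; the additive
  constant is fixed at 0.\<close>

lemma R_squared:
  assumes "z \<notin> S"
  shows "(R z)\<^sup>2 = wp (z + p) + wp (z - p) + 4 * wp z + 6 * wp p
           + (deriv ^^ 2) wp p / deriv wp p * Q z"
proof -
  define k where "k = (deriv ^^ 2) wp p / deriv wp p"
  let ?f = "\<lambda>z. (R z)\<^sup>2 - (wp (z + p) + wp (z - p) + 4 * wp z + 6 * wp p + k * Q z)"
  have an: "?f analytic_on {s}" if "s \<notin> S" for s
    using that R_analytic Q_analytic notin_S_iff by (auto intro!: analytic_intros)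
  obtain a where a: "a analytic_on {0}" "\<And>z. z \<noteq> 0 \<Longrightarrow> R z = z\<^sup>2 * a z - 2 * wp p * z - 2 / z"
    by (rule R_at_0) (rule that, assumption+)
  let ?b = "\<lambda>z. z * a z - 2 * wp p"
  let ?g0 = "\<lambda>z. (z * ?b z)\<^sup>2 - 4 * ?b z - wp (z + p) - wp (z - p) - 4 * wpr z - 6 * wp p - k * Q z"
  have g0: "?g0 analytic_on {0}"
    using a wpr_analytic_0 p_notin mp_notin Q_analytic[of 0] by (auto intro!: analytic_intros)
  have fg0: "\<forall>\<^sub>F z in at 0. ?f z = ?g0 z"
    using wp_near_0
  proof eventually_elim
    case (elim z)
    then have z: "z \<noteq> 0" by auto
    have "R z = z * ?b z - 2 / z" using z by (simp add: a(2) algebra_simps power2_eq_square)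
    then have "(R z)\<^sup>2 = (z * ?b z)\<^sup>2 - 4 * ?b z + 4 / z\<^sup>2"
      using z by (simp add: power2_diff power_divide)
    then show ?case by (simp add: wp_eq[of z])
  qed
  have r0: "removable_at ?f 0" using g0 fg0 by (rule removable_atI)
  obtain \<rho> where \<rho>: "\<rho> analytic_on {p}" "\<And>z. R z = 1 / (z - p) + \<rho> z"
    "\<And>z. Q z = 1 / (z - p) + (\<rho> z - 2 * ze (z + p) + 2 * ze z + 2 * ze p)"
    by (rule R_at_p) (rule that, assumption+)
  obtain h where h: "h analytic_on {p}" "\<And>z. v z = (z - p) * h z" "h p = deriv wp p" by (rule v_at_p) (rule that, assumption+)
  obtain U where U: "open U" "p \<in> U" "h holomorphic_on U" using h(1) by (auto simp: analytic_at)
  have dwp: "deriv wp z = h z + (z - p) * deriv h z" if "z \<in> U - L" for z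
  proof -
    have "(h has_field_derivative deriv h z) (at z)" using U that holomorphic_derivI by blast
    then have "((\<lambda>z. (z - p) * h z) has_field_derivative h z + (z - p) * deriv h z) (at z)"
      by (auto intro!: derivative_eq_intros)
    moreover have "v = (\<lambda>z. (z - p) * h z)" using h(2) by (simp add: fun_eq_iff)
    ultimately show ?thesis using deriv_v that DERIV_unique by (metis DiffD2)
  qed
  have UL: "open (U - L)" "p \<in> U - L"
    using U open_compl_lattice p_notin by (auto simp: Diff_eq)
  have dh: "deriv h analytic_on {p}" using h(1) by (rule analytic_deriv)
  have "\<forall>\<^sub>F z in at p. h z * \<rho> z - deriv h z = 0"
    using eventually_notin_S[of p] eventually_at_in_open[OF UL]
  proof eventually_elim
    case (elim z)
    have "v z * (1 / (z - p)) = h z" using elim(2) by (simp add: h(2))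
    then have "h z + v z * \<rho> z = deriv wp z"
      using vR[OF elim(1)] unfolding \<rho>(2) by (simp only: distrib_left)
    then have "h z + (z - p) * (h z * \<rho> z) = deriv wp z"
      by (simp add: h(2) mult.assoc)
    also have "\<dots> = h z + (z - p) * deriv h z" using dwp elim by auto
    finally show ?case using elim by simp
  qed
  \<comment> \<open>With \<open>v z = (z - p) * h z\<close>, the regular part of
    \<open>v * R = v'\<close> near \<open>p\<close> reads \<open>h * \<rho> = h'\<close>; the value
    at \<open>p\<close> follows by continuity.\<close>
  then have hp: "h p * \<rho> p = deriv h p"
    using analytic_at_eq_limit[of "\<lambda>z. h z * \<rho> z - deriv h z" p 0] h(1) \<rho>(1) dh by (simp add: analytic_intros)
  have "((\<lambda>z. h z + (z - p) * deriv h z) has_field_derivative deriv h p + (1 * deriv h p + (p - p) * deriv (deriv h) p)) (at p)"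
    using holomorphic_derivI[OF U(3,1,2)] holomorphic_derivI[OF holomorphic_deriv[OF U(3,1)] U(1,2)]
    by (auto intro!: derivative_eq_intros)
  then have "(deriv wp has_field_derivative 2 * deriv h p) (at p)"
    using UL dwp by (subst DERIV_cong_ev[OF refl _ refl, of _ "\<lambda>z. h z + (z - p) * deriv h z"])
      (auto intro!: eventually_nhds_in_open[of "U - L", THEN eventually_mono])
  \<comment> \<open>At \<open>p\<close> the first derivative of \<open>v\<close> is
    \<open>h p\<close> and the second is twice the derivative of \<open>h\<close>, so the residue
    \<open>2 * \<rho> p\<close> equals \<open>k\<close>.\<close>
  then have kp: "2 * \<rho> p = k"
    using hp h(3) deriv_wp_p_nz by (simp add: k_def numeral_2_eq_2 DERIV_imp_deriv field_simps)
  have "(\<lambda>z. 2 * \<rho> z - k) analytic_on {p}" using \<rho> by (auto intro!: analytic_intros)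
  then obtain m where m: "m analytic_on {p}" "\<And>z. 2 * \<rho> z - k = (z - p) * m z"
    using analytic_factor[of "\<lambda>z. 2 * \<rho> z - k" p] kp by auto
  have rp: "removable_at ?f p"
  proof (rule removable_atI)
    let ?g = "\<lambda>z. m z + (\<rho> z)\<^sup>2 - wp (z + p) - wpr (z - p) - 4 * wp z - 6 * wp p
      - k * (\<rho> z - 2 * ze (z + p) + 2 * ze z + 2 * ze p)"
    have "(\<lambda>z. wpr (z - p)) analytic_on {p}"
      using analytic_on_compose[of "\<lambda>z. z - p" "{p}" wpr] wpr_analytic_0 by (simp add: o_def analytic_intros)
    then show "?g analytic_on {p}" using m \<rho> p_notin pp_notin by (auto intro!: analytic_intros)
    have "?f z = ?g z" if "z \<noteq> p" for z
    proof -
      have "m z = (2 * \<rho> z - k) / (z - p)" using m(2)[of z] that by simp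
      then show ?thesis using that
        unfolding \<rho>(2)[of z] \<rho>(3)[of z] wp_eq[of "z - p"]
        by (simp add: power2_sum power_divide diff_divide_distrib algebra_simps)
    qed
    then show "\<forall>\<^sub>F z in at p. ?f z = ?g z" by (auto simp: eventually_at_filter)
  qed
  have ev: "?f (- z) = ?f z" for z
  proof -
    have "- z + p = - (z - p)" "- z - p = - (z + p)" by simp_all
    then have "wp (- z + p) = wp (z - p)" "wp (- z - p) = wp (z + p)" by (simp_all only: wp_even)
    then show ?thesis by (simp add: R_odd Q_even wp_even)
  qed
  obtain c where c: "\<And>z. ?f analytic_on {z} \<Longrightarrow> ?f z = c" "\<And>s. \<forall>\<^sub>F z in at s. ?f z = c"
    by (rule analytic_on_S_const[of ?f "1"]) (use an r0 rp periodic ev in auto)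
  have "\<forall>\<^sub>F z in at 0. ?g0 z = c" using fg0 c(2)[of 0] by eventually_elim simp
  \<comment> \<open>At 0 the value \<open>wp p\<close> occurs with the coefficients 8, -2 and -6,
    and all other terms vanish.\<close>
  from analytic_at_eq_limit[OF g0 this] have "c = 0" by (simp add: wp_even Q_def ze_odd)
  then show ?thesis using c(1)[OF an[OF assms]] by (simp add: k_def)
qed

lemma R_deriv:
  assumes "z \<notin> S"
  shows "(R has_field_derivative (- wp (z + p) - wp (z - p) + 2 * wp z)) (at z)"
proof -
  have "((\<lambda>z. ze (z + p)) has_field_derivative - wp (z + p)) (at z)"
    "((\<lambda>z. ze (z - p)) has_field_derivative - wp (z - p)) (at z)"
    "(ze has_field_derivative - wp z) (at z)"
    using DERIV_add_shift[OF ze_deriv, of z p] DERIV_add_shift[OF ze_deriv, of z "- p"] ze_deriv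
      assms notin_S_iff by auto
  then show ?thesis unfolding R_def by (auto intro!: derivative_eq_intros)
qed

text \<open>The constant of the equation is exactly what this shape requires:
  \<open>- n * (n + 1) * wp p\<close> sits in the term with \<open>v z\<close>, while
  \<open>(R z)\<^sup>2 / 4\<close> supplies \<open>3/2 * wp p\<close> directly and the term with
  \<open>ze p\<close> through \<open>Q\<close>.\<close>

lemma potential_eq:
  assumes "z \<notin> S"
  shows "gle1_potential n p T \<tau> z = T\<^sup>2 + T * R z + of_nat n * (of_nat n + 1) * v z
     + (R z)\<^sup>2 / 4 - (- wp (z + p) - wp (z - p) + 2 * wp z) / 2"
proof -
  define k where "k = (deriv ^^ 2) wp p / deriv wp p"
  have k: "(deriv ^^ 2) wp p / (2 * deriv wp p) = k / 2" "(deriv ^^ 2) wp p / (4 * deriv wp p) = k / 4"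
    by (simp_all add: k_def)
  have "(R z)\<^sup>2 = wp (z + p) + wp (z - p) + 4 * wp z + 6 * wp p + k * Q z"
    using R_squared[OF assms] by (simp add: k_def)
  moreover have r: "ze (z + p) + ze (z - p) - 2 * ze z = R z" and q: "ze (z + p) - ze (z - p) = 2 * ze p - Q z"
    by (simp_all add: R_def Q_def)
  ultimately show ?thesis
    unfolding gle1_potential_def gle1_const_def k v_def r q
    by (simp add: field_simps power2_eq_square)
qed

end

section \<open>Singular Volterra equations\<close>

text \<open>For \<open>z \<noteq> 0\<close> and continuous \<open>g\<close> this is the integral of
  \<open>w ^ m * g w\<close> along the segment from 0 to \<open>z\<close>, divided by
  \<open>z ^ (m + 1)\<close>. The rescaled form makes sense at 0 as well and is holomorphic there
  with \<open>g\<close>.\<close>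

definition ray_moment :: "nat \<Rightarrow> (complex \<Rightarrow> complex) \<Rightarrow> complex \<Rightarrow> complex" where
  "ray_moment m g z = integral {0..1} (\<lambda>r. of_real (r ^ m) * g (of_real r * z))"

text \<open>Variation of constants: \<open>z ^ (n + 1) * volt n g z\<close> solves
  \<open>f'' = n (n + 1) / z\<^sup>2 * f + z ^ (n + 1) * g\<close>.\<close>

definition volt :: "nat \<Rightarrow> (complex \<Rightarrow> complex) \<Rightarrow> complex \<Rightarrow> complex" where
  "volt n g z = z\<^sup>2 * (ray_moment 1 g z - ray_moment (2 * n + 2) g z) / (2 * of_nat n + 1)"

lemma ray_mem:
  assumes "convex X" "0 \<in> X" "z \<in> X" "r \<in> {0..1}"
  shows "of_real r * z \<in> (X :: complex set)"
  using convexD_alt[OF assms(1,2,3), of r] assms(4) by (simp add: scaleR_conv_of_real)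

lemma ray_continuous:
  fixes z :: complex and g :: "complex \<Rightarrow> complex"
  assumes "convex X" "0 \<in> X" "z \<in> X" "continuous_on X g"
  shows "continuous_on {0..1} (\<lambda>r. of_real (r ^ m) * g (of_real r * z))"
proof -
  have "continuous_on {0..1} (\<lambda>r. g (of_real r * z))"
  proof (rule continuous_on_compose2[OF assms(4)])
    show "continuous_on {0..1} (\<lambda>r. of_real r * z)" by (intro continuous_intros)
    show "(\<lambda>r. of_real r * z) ` {0..1} \<subseteq> X" using ray_mem[OF assms(1-3)] by blast
  qed
  then show ?thesis by (rule continuous_on_mult[rotated]) (intro continuous_intros)
qed

lemma ray_integrable:
  fixes z :: complex and g :: "complex \<Rightarrow> complex"
  assumes "convex X" "0 \<in> X" "z \<in> X" "continuous_on X g"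
  shows "(\<lambda>r. of_real (r ^ m) * g (of_real r * z)) integrable_on {0..1}"
  by (rule integrable_continuous_real[OF ray_continuous[OF assms]])

lemma ray_moment_deriv:
  assumes X: "open X" "convex X" "0 \<in> X" "z \<in> X" and g: "g holomorphic_on X"
  shows "(ray_moment m g has_field_derivative ray_moment (Suc m) (deriv g) z) (at z)"
proof -
  have c: "continuous_on X (deriv g)"
    using g X(1) holomorphic_deriv holomorphic_on_imp_continuous_on by blast
  have "continuous_on (X \<times> {0..1}) (\<lambda>y. deriv g (of_real (snd y) * fst y))"
    by (rule continuous_on_compose2[OF c]) (use ray_mem[OF X(2,3)] in \<open>auto intro!: continuous_intros\<close>)
  then have c2: "continuous_on (X \<times> cbox 0 (1::real))
       (\<lambda>(x, t). of_real (t ^ m) * (deriv g (of_real t * x) * of_real t))"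
    unfolding split_beta by (auto intro!: continuous_intros)
  have "((\<lambda>x. integral (cbox 0 1) (\<lambda>t::real. of_real (t ^ m) * g (of_real t * x))) has_field_derivative
      integral (cbox 0 1) (\<lambda>t::real. of_real (t ^ m) * (deriv g (of_real t * z) * of_real t))) (at z within X)"
  proof (rule leibniz_rule_field_derivative[OF _ _ c2 X(4,2)])
    fix x and t :: real assume x: "x \<in> X" and t: "t \<in> cbox 0 1"
    have "(g has_field_derivative deriv g (of_real t * x)) (at (of_real t * x))"
      using holomorphic_derivI[OF g X(1)] ray_mem[OF X(2,3) x] t by simp
    from DERIV_chain2[where f = g and g = "\<lambda>x. of_real t * x" and x = x, OF this, of "of_real t" X]
    show "((\<lambda>x. of_real (t ^ m) * g (of_real t * x)) has_field_derivative
        of_real (t ^ m) * (deriv g (of_real t * x) * of_real t)) (at x within X)"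
      by (intro DERIV_cmult) (metis DERIV_cmult_Id)
  next
    fix x assume "x \<in> X"
    then show "(\<lambda>t::real. of_real (t ^ m) * g (of_real t * x)) integrable_on cbox 0 1"
      using ray_integrable[OF X(2,3) \<open>x \<in> X\<close> holomorphic_on_imp_continuous_on[OF g], of m] by simp
  qed
  moreover have "at z within X = at z" by (rule at_within_open[OF X(4,1)])
  moreover have "(\<lambda>t::real. of_real (t ^ m) * (deriv g (of_real t * z) * of_real t)) =
      (\<lambda>t. of_real (t ^ Suc m) * deriv g (of_real t * z))" by (simp add: fun_eq_iff)
  ultimately show ?thesis
    unfolding ray_moment_def[abs_def] by simp
qed

text \<open>The fundamental theorem of calculus for \<open>t ^ (m + 1) * g (t * z)\<close> on
  \<open>{0..1}\<close>; the exponent is positive, so only the endpoint \<open>t = 1\<close>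
  contributes.\<close>

lemma ray_moment_ode:
  assumes X: "open X" "convex X" "0 \<in> X" "z \<in> X" and g: "g holomorphic_on X"
  shows "z * ray_moment (Suc m) (deriv g) z + (of_nat m + 1) * ray_moment m g z = g z"
proof -
  have c: "continuous_on X (deriv g)" "continuous_on X g"
    using g X(1) holomorphic_deriv holomorphic_on_imp_continuous_on by blast+
  have i: "(\<lambda>t. of_real (t ^ Suc m) * deriv g (of_real t * z)) integrable_on {0..1}"
    "(\<lambda>t. of_real (t ^ m) * g (of_real t * z)) integrable_on {0..1}"
    using ray_integrable[OF X(2-4)] c by blast+
  have "((\<lambda>t. of_real (t ^ Suc m) * g (of_real t * z)) has_vector_derivative
      (z * (of_real (t ^ Suc m) * deriv g (of_real t * z)) + (of_nat m + 1) * (of_real (t ^ m) * g (of_real t * z))))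
      (at t within {0..1})" if t: "t \<in> {0..1}" for t :: real
  proof -
    have "(g has_field_derivative deriv g (of_real t * z)) (at (of_real t * z))"
      using holomorphic_derivI[OF g X(1)] ray_mem[OF X(2-4) t] by simp
    from DERIV_chain2[where f = g and g = "\<lambda>t. t * z" and x = "of_real t", OF this, of z UNIV]
    have 1: "((\<lambda>t. g (t * z)) has_field_derivative deriv g (of_real t * z) * z) (at (of_real t))"
      using DERIV_cmult_right[OF DERIV_ident, of z "of_real t" UNIV] by simp
    have "((\<lambda>t. t ^ Suc m * g (t * z)) has_field_derivative
       (of_nat (Suc m) * of_real t ^ m) * g (of_real t * z) + of_real t ^ Suc m * (deriv g (of_real t * z) * z)) (at (of_real t))"
      by (rule DERIV_cong[OF DERIV_mult[OF DERIV_power_Suc[OF DERIV_ident, where n = m] 1]]) simp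
    from has_vector_derivative_real_field[OF this]
    have "((\<lambda>t. of_real t ^ Suc m * g (of_real t * z)) has_vector_derivative
       (of_nat (Suc m) * of_real t ^ m) * g (of_real t * z) + of_real t ^ Suc m * (deriv g (of_real t * z) * z)) (at t within {0..1})" .
    then show ?thesis by (simp add: algebra_simps)
  qed
  then have "((\<lambda>t. z * (of_real (t ^ Suc m) * deriv g (of_real t * z)) + (of_nat m + 1) * (of_real (t ^ m) * g (of_real t * z)))
      has_integral (of_real (1 ^ Suc m) * g (of_real 1 * z) - of_real (0 ^ Suc m) * g (of_real 0 * z))) {0..1}"
    by (intro fundamental_theorem_of_calculus) auto
  then have "integral {0..1} (\<lambda>t. z * (of_real (t ^ Suc m) * deriv g (of_real t * z)) + (of_nat m + 1) * (of_real (t ^ m) * g (of_real t * z))) = g z"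
    by (simp add: integral_unique)
  moreover have "integral {0..1} (\<lambda>t. z * (of_real (t ^ Suc m) * deriv g (of_real t * z)) + (of_nat m + 1) * (of_real (t ^ m) * g (of_real t * z)))
     = z * ray_moment (Suc m) (deriv g) z + (of_nat m + 1) * ray_moment m g z"
    unfolding ray_moment_def
    by (subst integral_add) (use i in \<open>auto intro!: integrable_on_mult_right simp del: of_real_power power_Suc\<close>)
  ultimately show ?thesis by simp
qed

text \<open>In the derivative of \<open>volt\<close> the relations of \<open>ray_moment_ode\<close>
  cancel \<open>g\<close> and the moment of order 1, and the remaining factor
  \<open>2 * n + 1\<close> cancels the denominator. A single moment is left, whose relation gives
  the second derivative.\<close>

lemma volt_deriv:
  assumes X: "open X" "convex X" "0 \<in> X" "z \<in> X" and g: "g holomorphic_on X"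
  shows "(volt n g has_field_derivative z * ray_moment (2 * n + 2) g z) (at z)"
    and "((\<lambda>z. z * ray_moment (2 * n + 2) g z) has_field_derivative
            g z - (2 * of_nat n + 2) * ray_moment (2 * n + 2) g z) (at z)"
proof -
  let ?m = "2 * n + 2"
  note d = ray_moment_deriv[OF X g]
  note o1 = ray_moment_ode[OF X g, of 1] and o2 = ray_moment_ode[OF X g, of ?m]
  have nz: "2 * of_nat n + 1 \<noteq> (0::complex)"
    by (metis add_is_0 mult_2 of_nat_1 of_nat_add of_nat_eq_0_iff one_neq_zero)
  have "((\<lambda>z. z\<^sup>2 * (ray_moment 1 g z - ray_moment ?m g z) / (2 * of_nat n + 1)) has_field_derivative
     (2 * z * (ray_moment 1 g z - ray_moment ?m g z) + z\<^sup>2 * (ray_moment (Suc 1) (deriv g) z - ray_moment (Suc ?m) (deriv g) z)) / (2 * of_nat n + 1)) (at z)"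
    using d[of 1] d[of ?m] nz by (auto intro!: derivative_eq_intros)
  also have "2 * z * (ray_moment 1 g z - ray_moment ?m g z) + z\<^sup>2 * (ray_moment (Suc 1) (deriv g) z - ray_moment (Suc ?m) (deriv g) z)
     = 2 * z * (ray_moment 1 g z - ray_moment ?m g z) + z * (z * ray_moment (Suc 1) (deriv g) z - z * ray_moment (Suc ?m) (deriv g) z)"
    by (simp add: power2_eq_square algebra_simps)
  also have "\<dots> = z * ray_moment ?m g z * (2 * of_nat n + 1)"
  proof -
    have "z * ray_moment (Suc 1) (deriv g) z = g z - 2 * ray_moment 1 g z"
      "z * ray_moment (Suc ?m) (deriv g) z = g z - (2 * of_nat n + 3) * ray_moment ?m g z"
      using o1 o2 by (auto simp: algebra_simps)
    then show ?thesis by (simp only:) (simp add: algebra_simps)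
  qed
  finally show "(volt n g has_field_derivative z * ray_moment ?m g z) (at z)"
    using nz by (simp add: volt_def[abs_def])
  have "((\<lambda>z. z * ray_moment ?m g z) has_field_derivative
     ray_moment ?m g z + z * ray_moment (Suc ?m) (deriv g) z) (at z)"
    using d[of ?m] by (auto intro!: derivative_eq_intros)
  also have "ray_moment ?m g z + z * ray_moment (Suc ?m) (deriv g) z = g z - (2 * of_nat n + 2) * ray_moment ?m g z"
    using o2 by (simp add: algebra_simps)
  finally show "((\<lambda>z. z * ray_moment ?m g z) has_field_derivative
            g z - (2 * of_nat n + 2) * ray_moment ?m g z) (at z)" .
qed

lemma volt_holomorphic:
  assumes "open X" "convex X" "0 \<in> X" "g holomorphic_on X"
  shows "volt n g holomorphic_on X"
  using volt_deriv(1)[OF assms(1-3) _ assms(4)] assms(1) by (auto simp: holomorphic_on_open)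

lemma volt_linear:
  assumes X: "convex X" "0 \<in> X" "z \<in> X" and c: "continuous_on X f" "continuous_on X g"
  shows "volt n (\<lambda>z. f z + g z) z = volt n f z + volt n g z"
    and "volt n (\<lambda>z. f z - g z) z = volt n f z - volt n g z"
proof -
  have e: "ray_moment m (\<lambda>z. f z + g z) z = ray_moment m f z + ray_moment m g z"
    "ray_moment m (\<lambda>z. f z - g z) z = ray_moment m f z - ray_moment m g z" for m
    unfolding ray_moment_def
    using integral_add[OF ray_integrable[OF X c(1)] ray_integrable[OF X c(2)], of m m]
      integral_diff[OF ray_integrable[OF X c(1)] ray_integrable[OF X c(2)], of m m]
    by (simp_all add: algebra_simps)
  show "volt n (\<lambda>z. f z + g z) z = volt n f z + volt n g z"
    "volt n (\<lambda>z. f z - g z) z = volt n f z - volt n g z"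
    unfolding volt_def e by (simp_all add: algebra_simps add_divide_distrib diff_divide_distrib)
qed

lemma ray_moment_bound:
  assumes X: "convex X" "0 \<in> X" "z \<in> X" and c: "continuous_on X g"
    and b: "\<And>r. r \<in> {0..1} \<Longrightarrow> norm (g (of_real r * z)) \<le> c * r ^ k" and m: "m \<ge> 1" and c0: "c \<ge> 0"
  shows "norm (ray_moment m g z) \<le> c / (real k + 2)"
proof -
  have i: "((\<lambda>r. c * r ^ (k + 1)) has_integral c / (real k + 2)) {0..1}"
  proof -
    have "((\<lambda>r. c / (real k + 2) * r ^ (k + 2)) has_vector_derivative c * r ^ (k + 1)) (at r within {0..1})" for r
      unfolding has_real_derivative_iff_has_vector_derivative[symmetric]
    proof (rule DERIV_cong)
      show "((\<lambda>r. c / (real k + 2) * r ^ (k + 2)) has_real_derivative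
          c / (real k + 2) * (real (k + 2) * r ^ (k + 2 - Suc 0))) (at r within {0..1})"
        by (intro DERIV_cmult DERIV_pow)
      show "c / (real k + 2) * (real (k + 2) * r ^ (k + 2 - Suc 0)) = c * r ^ (k + 1)"
        by (simp add: field_simps)
    qed
    then have "((\<lambda>r. c * r ^ (k + 1)) has_integral c / (real k + 2) * 1 ^ (k + 2) - c / (real k + 2) * 0 ^ (k + 2)) {0..1}"
      by (intro fundamental_theorem_of_calculus) auto
    then show ?thesis by simp
  qed
  have "norm (ray_moment m g z) \<le> integral {0..1} (\<lambda>r. c * r ^ (k + 1))"
    unfolding ray_moment_def
  proof (rule integral_norm_bound_integral[OF ray_integrable[OF X c]])
    show "(\<lambda>r. c * r ^ (k + 1)) integrable_on {0..1}" using i by blast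
    fix r :: real assume r: "r \<in> {0..1}"
    have "norm (of_real (r ^ m) * g (of_real r * z)) = r ^ m * norm (g (of_real r * z))"
      using r by (simp add: norm_mult norm_power)
    also have "\<dots> \<le> r ^ 1 * (c * r ^ k)"
      using r b[OF r] m by (intro mult_mono power_decreasing) auto
    finally show "norm (of_real (r ^ m) * g (of_real r * z)) \<le> c * r ^ (k + 1)"
      by (simp add: algebra_simps)
  qed
  then show ?thesis unfolding integral_unique[OF i] .
qed

text \<open>A factor \<open>r ^ k\<close> along the ray is rewarded by \<open>1 / (k + 2)\<close>.
  Repeated application therefore makes the iterates decay factorially.\<close>

lemma volt_bound:
  assumes X: "convex X" "0 \<in> X" "z \<in> X" and c: "continuous_on X g"
    and b: "\<And>r. r \<in> {0..1} \<Longrightarrow> norm (g (of_real r * z)) \<le> c * r ^ k" and c0: "c \<ge> 0"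
  shows "norm (volt n g z) \<le> 2 * (norm z)\<^sup>2 * c / (real k + 2)"
proof -
  have "norm (2 * of_nat n + 1 :: complex) = 2 * real n + 1"
    by (metis (no_types, lifting) norm_of_nat of_nat_1 of_nat_add of_nat_mult of_nat_numeral)
  then have "norm (volt n g z) = (norm z)\<^sup>2 * norm (ray_moment 1 g z - ray_moment (2 * n + 2) g z) / (2 * real n + 1)"
    by (simp add: volt_def norm_mult norm_divide norm_power)
  also have "\<dots> \<le> (norm z)\<^sup>2 * norm (ray_moment 1 g z - ray_moment (2 * n + 2) g z) / 1"
    by (intro divide_left_mono) auto
  also have "\<dots> \<le> (norm z)\<^sup>2 * (c / (real k + 2) + c / (real k + 2)) / 1"
    by (intro divide_right_mono mult_left_mono order_trans[OF norm_triangle_ineq4 add_mono] ray_moment_bound[OF X c b _ c0]) auto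
  finally show ?thesis by (simp add: algebra_simps)
qed

lemma volt_bound_const:
  assumes X: "convex X" "0 \<in> X" "z \<in> X" and c: "continuous_on X g"
    and b: "\<And>r. r \<in> {0..1} \<Longrightarrow> norm (g (of_real r * z)) \<le> c" and c0: "c \<ge> 0"
  shows "norm (volt n g z) \<le> (norm z)\<^sup>2 * c"
  using volt_bound[OF X c, of c 0] b c0 by simp

section \<open>Neumann series of the Volterra equation
  \<open>w z = h z + volt n (\<lambda>z. q z * w z) z\<close>\<close>

primrec picard :: "nat \<Rightarrow> (complex \<Rightarrow> complex) \<Rightarrow> (complex \<Rightarrow> complex) \<Rightarrow> nat \<Rightarrow> complex \<Rightarrow> complex" where
  "picard n q h 0 = h"
| "picard n q h (Suc k) = volt n (\<lambda>z. q z * picard n q h k z)"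

definition volterra_sol :: "nat \<Rightarrow> (complex \<Rightarrow> complex) \<Rightarrow> (complex \<Rightarrow> complex) \<Rightarrow> complex \<Rightarrow> complex" where
  "volterra_sol n q h z = (\<Sum>k. picard n q h k z)"

lemma picard_holomorphic:
  assumes "open X" "convex X" "0 \<in> X" "q holomorphic_on X" "h holomorphic_on X"
  shows "picard n q h k holomorphic_on X"
  by (induction k) (use assms in \<open>auto intro!: volt_holomorphic holomorphic_intros\<close>)

lemma picard_add:
  assumes X: "open X" "convex X" "0 \<in> X" "q holomorphic_on X" "h holomorphic_on X" "h' holomorphic_on X"
    and h: "\<And>z. z \<in> X \<Longrightarrow> h'' z = h z + h' z" and z: "z \<in> X"
  shows "picard n q h'' k z = picard n q h k z + picard n q h' k z"
  using z
proof (induction k arbitrary: z)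
  case (Suc k)
  have "picard n q h'' (Suc k) z = volt n (\<lambda>z. q z * picard n q h k z + q z * picard n q h' k z) z"
    unfolding picard.simps volt_def ray_moment_def
    by (intro arg_cong2[where f="\<lambda>a b. z\<^sup>2 * (a - b) / (2 * of_nat n + 1)"] integral_cong)
       (use Suc ray_mem[OF X(2,3) Suc.prems] in \<open>auto simp: algebra_simps\<close>)
  also have "\<dots> = volt n (\<lambda>z. q z * picard n q h k z) z + volt n (\<lambda>z. q z * picard n q h' k z) z"
    by (rule volt_linear[OF X(2,3) Suc.prems])
       (intro holomorphic_on_imp_continuous_on holomorphic_intros picard_holomorphic X)+
  finally show ?case by simp
qed (use h in auto)

text \<open>The bound is carried at \<open>r * z\<close> with an explicit power of \<open>r\<close>
  because each iteration integrates along the ray; for \<open>r = 1\<close> it is a term of an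
  exponential series.\<close>

lemma picard_bound:
  assumes X: "open X" "convex X" "0 \<in> X" "q holomorphic_on X" "h holomorphic_on X"
    and Y: "convex Y" "0 \<in> Y" "Y \<subseteq> X"
    and b: "\<And>z. z \<in> Y \<Longrightarrow> norm (q z) \<le> M" "\<And>z. z \<in> Y \<Longrightarrow> norm (h z) \<le> c" "\<And>z. z \<in> Y \<Longrightarrow> norm z \<le> \<rho>"
    and z: "z \<in> Y" and r: "r \<in> {0..1}"
  shows "norm (picard n q h k (of_real r * z)) \<le> c * (2 * M * \<rho>\<^sup>2) ^ k * r ^ k / fact k"
proof -
  have M0: "M \<ge> 0" "c \<ge> 0" "\<rho> \<ge> 0" using b[OF Y(2)] norm_ge_zero order_trans by blast+
  show ?thesis using r
  proof (induction k arbitrary: r)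
    case 0
    then show ?case using b(2) ray_mem[OF Y(1,2) z] by simp
  next
    case (Suc k)
    let ?w = "of_real r * z"
    let ?B = "c * (2 * M * \<rho>\<^sup>2) ^ k * r ^ k / fact k"
    have w: "?w \<in> Y" using ray_mem[OF Y(1,2) z Suc.prems] .
    have r0: "0 \<le> r" "r \<le> 1" using Suc.prems by auto
    have B0: "M * ?B \<ge> 0" using M0 r0 by (auto intro!: mult_nonneg_nonneg divide_nonneg_nonneg)
    have "norm (picard n q h (Suc k) ?w) \<le> 2 * (norm ?w)\<^sup>2 * (M * ?B) / (real k + 2)"
      unfolding picard.simps
    proof (rule volt_bound[OF X(2,3)])
      show "?w \<in> X" using w Y by auto
      show "continuous_on X (\<lambda>z. q z * picard n q h k z)"
        by (intro holomorphic_on_imp_continuous_on holomorphic_intros picard_holomorphic X)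
      fix t :: real assume t: "t \<in> {0..1}"
      have e: "of_real t * ?w = of_real (t * r) * z" by simp
      have "t * r \<in> {0..1}" using t r0 mult_le_one by auto
      from Suc.IH[OF this] have "norm (picard n q h k (of_real t * ?w)) \<le> ?B * t ^ k"
        unfolding e by (simp add: power_mult_distrib mult_ac)
      moreover have "norm (q (of_real t * ?w)) \<le> M" using b(1) ray_mem[OF Y(1,2) w t] by blast
      ultimately have "norm (q (of_real t * ?w)) * norm (picard n q h k (of_real t * ?w)) \<le> M * (?B * t ^ k)"
        using M0 by (intro mult_mono) auto
      then show "norm (q (of_real t * ?w) * picard n q h k (of_real t * ?w)) \<le> M * ?B * t ^ k"
        by (simp add: norm_mult mult.assoc)
    qed (rule B0)
    \<comment> \<open>One factor of \<open>r\<^sup>2\<close> raises the power of \<open>r\<close>,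
      the other is dropped; \<open>k + 2\<close> is weakened to \<open>k + 1\<close> to produce the
      factorial.\<close>
    also have "\<dots> \<le> 2 * (r * \<rho>\<^sup>2) * (M * ?B) / (real k + 1)"
    proof -
      have "(norm ?w)\<^sup>2 = r\<^sup>2 * (norm z)\<^sup>2" using r0 by (simp add: norm_mult power_mult_distrib)
      also have "\<dots> \<le> r * \<rho>\<^sup>2"
        using r0 b(3)[OF z] by (intro mult_mono power_mono) (auto simp: power2_eq_square mult_left_le)
      finally have "2 * (norm ?w)\<^sup>2 \<le> 2 * (r * \<rho>\<^sup>2)" by simp
      from mult_right_mono[OF this B0] show ?thesis
        by (rule frac_le[rotated]) (use mult_nonneg_nonneg[OF _ B0, of "2 * (r * \<rho>\<^sup>2)"] r0 in auto)
    qed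
    also have "\<dots> = c * (2 * M * \<rho>\<^sup>2) ^ Suc k * r ^ Suc k / fact (Suc k)"
      by (simp add: field_simps)
    finally show ?case .
  qed
qed

context
  fixes X :: "complex set" and n :: nat and q h :: "complex \<Rightarrow> complex"
  assumes X: "open X" "convex X" "0 \<in> X" "q holomorphic_on X" "h holomorphic_on X"
begin

lemma compact_convex_bounds:
  assumes Y: "compact Y" "Y \<subseteq> X"
  obtains M c \<rho> where "\<And>z. z \<in> Y \<Longrightarrow> norm (q z) \<le> M" "\<And>z. z \<in> Y \<Longrightarrow> norm (h z) \<le> c" "\<And>z. z \<in> Y \<Longrightarrow> norm z \<le> \<rho>"
proof -
  have "compact (q ` Y)" "compact (h ` Y)"
    using X(4,5) Y by (meson compact_continuous_image continuous_on_subset holomorphic_on_imp_continuous_on)+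
  then have "bounded (q ` Y)" "bounded (h ` Y)" "bounded Y"
    using Y compact_imp_bounded by auto
  then obtain M c \<rho> where "\<forall>z\<in>Y. norm (q z) \<le> M" "\<forall>z\<in>Y. norm (h z) \<le> c" "\<forall>z\<in>Y. norm z \<le> \<rho>"
    unfolding bounded_iff by auto
  then show ?thesis by (intro that[of M c \<rho>]) auto
qed

lemma volterra_uniform_limit:
  assumes Y: "compact Y" "convex Y" "0 \<in> Y" "Y \<subseteq> X"
  shows "uniform_limit Y (\<lambda>K z. \<Sum>k<K. picard n q h k z) (volterra_sol n q h) sequentially"
proof -
  obtain M c \<rho> where b: "\<And>z. z \<in> Y \<Longrightarrow> norm (q z) \<le> M" "\<And>z. z \<in> Y \<Longrightarrow> norm (h z) \<le> c" "\<And>z. z \<in> Y \<Longrightarrow> norm z \<le> \<rho>"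
    by (rule compact_convex_bounds[OF Y(1,4)]) (rule that, assumption+)
  show ?thesis unfolding volterra_sol_def
  proof (rule Weierstrass_m_test)
    fix k z assume "z \<in> Y"
    from picard_bound[OF X Y(2-4) b this, of 1 n k]
    show "norm (picard n q h k z) \<le> c * ((2 * M * \<rho>\<^sup>2) ^ k / fact k)" by simp
  next
    show "summable (\<lambda>k. c * ((2 * M * \<rho>\<^sup>2) ^ k / fact k))"
      using summable_exp[of "2 * M * \<rho>\<^sup>2"] by (intro summable_mult) (simp add: field_simps)
  qed
qed

lemma volterra_sol_bound:
  assumes Y: "convex Y" "0 \<in> Y" "Y \<subseteq> X"
    and b: "\<And>z. z \<in> Y \<Longrightarrow> norm (q z) \<le> M" "\<And>z. z \<in> Y \<Longrightarrow> norm (h z) \<le> c" "\<And>z. z \<in> Y \<Longrightarrow> norm z \<le> \<rho>"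
    and z: "z \<in> Y"
  shows "norm (volterra_sol n q h z) \<le> c * exp (2 * M * \<rho>\<^sup>2)"
proof -
  have s: "(\<lambda>k. c * ((2 * M * \<rho>\<^sup>2) ^ k / fact k)) sums (c * exp (2 * M * \<rho>\<^sup>2))"
    using exp_converges[of "2 * M * \<rho>\<^sup>2"] by (intro sums_mult) (simp add: field_simps)
  have le: "norm (picard n q h k z) \<le> c * ((2 * M * \<rho>\<^sup>2) ^ k / fact k)" for k
    using picard_bound[OF X Y b z, of 1 n k] by simp
  have "norm (\<Sum>k. picard n q h k z) \<le> (\<Sum>k. c * ((2 * M * \<rho>\<^sup>2) ^ k / fact k))"
    by (rule norm_suminf_le[OF le sums_summable[OF s]])
  then show ?thesis using sums_unique[OF s] by (simp add: volterra_sol_def)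
qed

lemma volterra_sol_holomorphic: "volterra_sol n q h holomorphic_on X"
proof -
  have "volterra_sol n q h field_differentiable (at z)" if z: "z \<in> X" for z
  proof -
    obtain e where e: "e > 0" "cball z e \<subseteq> X" using X(1) z open_contains_cball by blast
    \<comment> \<open>The iterates at a point involve its segment to 0, so uniform convergence is
      established on the hull of the disc and 0.\<close>
    define Y where "Y = convex hull (insert 0 (cball z e))"
    have Y: "compact Y" "convex Y" "0 \<in> Y" "Y \<subseteq> X" "cball z e \<subseteq> Y"
    proof -
      show "compact Y" unfolding Y_def by (intro compact_convex_hull compact_insert compact_cball)
      show "convex Y" unfolding Y_def by (rule convex_convex_hull)
      show "0 \<in> Y" "cball z e \<subseteq> Y" unfolding Y_def by (auto intro: hull_inc)
      show "Y \<subseteq> X" unfolding Y_def using e X by (intro hull_minimal) auto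
    qed
    have u: "uniform_limit (cball z e) (\<lambda>K z. \<Sum>k<K. picard n q h k z) (volterra_sol n q h) sequentially"
      using uniform_limit_on_subset[OF volterra_uniform_limit[OF Y(1-4)] Y(5)] .
    have "picard n q h k holomorphic_on cball z e" for k
      using picard_holomorphic[OF X] e(2) holomorphic_on_subset by blast
    then have "(\<lambda>z. \<Sum>k<K. picard n q h k z) holomorphic_on cball z e" for K
      by (intro holomorphic_intros)
    then have "\<forall>\<^sub>F K in sequentially. continuous_on (cball z e) (\<lambda>z. \<Sum>k<K. picard n q h k z) \<and>
        (\<lambda>z. \<Sum>k<K. picard n q h k z) holomorphic_on ball z e"
      by (blast intro: always_eventually holomorphic_on_imp_continuous_on
           holomorphic_on_subset[OF _ ball_subset_cball])
    then have "volterra_sol n q h holomorphic_on ball z e"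
      using holomorphic_uniform_limit[OF _ u] by auto
    then show ?thesis using e(1) by (simp add: holomorphic_on_open field_differentiable_def)
  qed
  then show ?thesis using X(1) by (simp add: holomorphic_on_open field_differentiable_def)
qed

text \<open>Substituting the equation into itself \<open>K\<close> times leaves the
  \<open>K\<close>-th iterate of \<open>w\<close> as remainder, and this decays factorially by
  \<open>picard_bound\<close>.\<close>

lemma volterra_unique:
  assumes w: "w holomorphic_on X" "\<And>z. z \<in> X \<Longrightarrow> w z = h z + volt n (\<lambda>z. q z * w z) z" and z: "z \<in> X"
  shows "w z = volterra_sol n q h z"
proof -
  have v: "volt n (\<lambda>z. q z * w z) holomorphic_on X"
    by (intro volt_holomorphic holomorphic_intros X w)
  have shift: "picard n q (volt n (\<lambda>z. q z * w z)) k = picard n q w (Suc k)" for k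
    by (induction k) auto
  have eq: "w z = (\<Sum>k<K. picard n q h k z) + picard n q w K z" for K
  proof (induction K)
    case (Suc K)
    have "picard n q w K z = picard n q h K z + picard n q (volt n (\<lambda>z. q z * w z)) K z"
      by (rule picard_add[OF X v w(2) z])
    then show ?case using Suc by (simp add: shift)
  qed simp
  define Y where "Y = closed_segment 0 z"
  have Y: "compact Y" "convex Y" "0 \<in> Y" "Y \<subseteq> X" "z \<in> Y"
    using X z by (auto simp: Y_def closed_segment_subset)
  obtain M c \<rho> where b: "\<And>z. z \<in> Y \<Longrightarrow> norm (q z) \<le> M" "\<And>z. z \<in> Y \<Longrightarrow> norm (h z) \<le> c" "\<And>z. z \<in> Y \<Longrightarrow> norm z \<le> \<rho>"
    by (rule compact_convex_bounds[OF Y(1,4)]) (rule that, assumption+)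
  have "bounded (w ` Y)"
    using w(1) Y by (meson compact_continuous_image compact_imp_bounded continuous_on_subset holomorphic_on_imp_continuous_on)
  then obtain B where B: "\<And>z. z \<in> Y \<Longrightarrow> norm (w z) \<le> B" by (auto simp: bounded_iff)
  have "norm (picard n q w k z) \<le> B * ((2 * M * \<rho>\<^sup>2) ^ k / fact k)" for k
    using picard_bound[OF X(1-4) w(1) Y(2-4) b(1) B b(3) Y(5), of 1 n k] by simp
  moreover have "(\<lambda>k. B * ((2 * M * \<rho>\<^sup>2) ^ k / fact k)) \<longlonglongrightarrow> B * 0"
    using summable_LIMSEQ_zero[OF summable_exp[of "2 * M * \<rho>\<^sup>2"]]
    by (intro tendsto_mult tendsto_const) (simp add: field_simps)
  ultimately have "(\<lambda>k. picard n q w k z) \<longlonglongrightarrow> 0"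
    by (rule_tac Lim_null_comparison[OF always_eventually[OF allI], rotated]) simp_all
  moreover have "(\<lambda>K. \<Sum>k<K. picard n q h k z) \<longlonglongrightarrow> volterra_sol n q h z"
    using tendsto_uniform_limitI[OF volterra_uniform_limit[OF Y(1-4)] Y(5)] .
  ultimately have "(\<lambda>K. (\<Sum>k<K. picard n q h k z) + picard n q w K z) \<longlonglongrightarrow> volterra_sol n q h z + 0"
    by (rule tendsto_add[rotated])
  then have "(\<lambda>K. w z) \<longlonglongrightarrow> volterra_sol n q h z"
    unfolding eq[symmetric] by simp
  then show ?thesis by (simp add: LIMSEQ_const_iff)
qed

text \<open>The partial sums satisfy the equation with the index shifted by one, and uniform
  convergence on the segment from 0 to \<open>z\<close> passes through \<open>volt\<close>.\<close>

lemma volterra_sol_eq: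
  assumes z: "z \<in> X"
  shows "volterra_sol n q h z = h z + volt n (\<lambda>z. q z * volterra_sol n q h z) z"
proof -
  define Y where "Y = closed_segment 0 z"
  have Y: "compact Y" "convex Y" "0 \<in> Y" "Y \<subseteq> X" "z \<in> Y"
    using X z by (auto simp: Y_def closed_segment_subset)
  obtain M c \<rho> where b: "\<And>z. z \<in> Y \<Longrightarrow> norm (q z) \<le> M" "\<And>z. z \<in> Y \<Longrightarrow> norm (h z) \<le> c" "\<And>z. z \<in> Y \<Longrightarrow> norm z \<le> \<rho>"
    by (rule compact_convex_bounds[OF Y(1,4)]) (rule that, assumption+)
  have M0: "M \<ge> 0" using b(1)[OF Y(3)] norm_ge_zero order_trans by blast
  let ?s = "\<lambda>K z. \<Sum>k<K. picard n q h k z"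
  let ?w = "volterra_sol n q h"
  have sh: "?s K holomorphic_on X" for K by (intro holomorphic_intros picard_holomorphic X)
  note cont = holomorphic_on_imp_continuous_on
  have sv: "?s (Suc K) z = h z + volt n (\<lambda>z. q z * ?s K z) z" for K
  proof (induction K)
    case 0 then show ?case by (simp add: volt_def ray_moment_def)
  next
    case (Suc K)
    have "volt n (\<lambda>z. q z * ?s (Suc K) z) z = volt n (\<lambda>z. q z * ?s K z + q z * picard n q h K z) z"
      by (simp add: algebra_simps)
    also have "\<dots> = volt n (\<lambda>z. q z * ?s K z) z + volt n (\<lambda>z. q z * picard n q h K z) z"
      by (rule volt_linear[OF X(2,3) z]) (intro cont holomorphic_intros sh X picard_holomorphic)+
    finally show ?case using Suc by simp
  qed
  have u: "uniform_limit Y ?s ?w sequentially" by (rule volterra_uniform_limit[OF Y(1-4)])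
  have "(\<lambda>K. volt n (\<lambda>z. q z * ?s K z) z) \<longlonglongrightarrow> volt n (\<lambda>z. q z * ?w z) z"
  proof (rule tendstoI)
    fix e :: real assume e: "e > 0"
    define d where "d = e / ((norm z)\<^sup>2 * M + 1)"
    have pos: "(norm z)\<^sup>2 * M + 1 > 0" using M0 by (intro add_nonneg_pos) auto
    have d: "d > 0" using e pos by (simp add: d_def)
    show "\<forall>\<^sub>F K in sequentially. dist (volt n (\<lambda>z. q z * ?s K z) z) (volt n (\<lambda>z. q z * ?w z) z) < e"
      using uniform_limitD[OF u d]
    proof eventually_elim
      case (elim K)
      have "volt n (\<lambda>z. q z * ?s K z) z - volt n (\<lambda>z. q z * ?w z) z = volt n (\<lambda>z. q z * ?s K z - q z * ?w z) z"
        by (rule volt_linear(2)[OF X(2,3) z, symmetric]) (intro cont holomorphic_intros sh X volterra_sol_holomorphic)+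
      also have "norm \<dots> \<le> (norm z)\<^sup>2 * (M * d)"
      proof (rule volt_bound_const[OF X(2,3) z])
        show "continuous_on X (\<lambda>z. q z * ?s K z - q z * ?w z)"
          by (intro cont holomorphic_intros sh X volterra_sol_holomorphic)
        fix r :: real assume "r \<in> {0..1}"
        then have rY: "of_real r * z \<in> Y" by (rule ray_mem[OF Y(2,3,5)])
        have "norm (q (of_real r * z) * (?s K (of_real r * z) - ?w (of_real r * z))) \<le> M * d"
          unfolding norm_mult using b(1)[OF rY] elim rY M0
          by (intro mult_mono) (auto simp: dist_norm less_imp_le)
        then show "norm (q (of_real r * z) * ?s K (of_real r * z) - q (of_real r * z) * ?w (of_real r * z)) \<le> M * d"
          by (simp add: algebra_simps)
      qed (use M0 d in auto)
      also have "\<dots> = ((norm z)\<^sup>2 * M) * d" by simp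
      also have "\<dots> < ((norm z)\<^sup>2 * M + 1) * d" using d by simp
      also have "\<dots> = e" using pos by (simp add: d_def)
      finally show ?case by (simp add: dist_norm)
    qed
  qed
  then have "(\<lambda>K. ?s (Suc K) z) \<longlonglongrightarrow> h z + volt n (\<lambda>z. q z * ?w z) z"
    unfolding sv by (intro tendsto_add tendsto_const)
  moreover have "(\<lambda>K. ?s (Suc K) z) \<longlonglongrightarrow> ?w z"
    using tendsto_uniform_limitI[OF u Y(5)] by (rule LIMSEQ_Suc)
  ultimately show ?thesis using LIMSEQ_unique by blast
qed

end

lemma picard_parity:
  assumes "\<And>z. q (- z) = q z" "\<And>z. h (- z) = s * h z"
  shows "picard n q h k (- z) = s * picard n q h k z"
proof (induction k arbitrary: z)
  case (Suc k)
  have "ray_moment m (\<lambda>z. q z * picard n q h k z) (- z) = s * ray_moment m (\<lambda>z. q z * picard n q h k z) z" for m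
    unfolding ray_moment_def by (simp add: Suc assms mult.left_commute flip: integral_mult_right)
  then show ?case by (simp add: volt_def algebra_simps)
qed (use assms in simp)

lemma volterra_sol_parity:
  assumes X: "open X" "convex X" "0 \<in> X" "q holomorphic_on X" "h holomorphic_on X" and z: "z \<in> X"
    and par: "\<And>z. q (- z) = q z" "\<And>z. h (- z) = s * h z"
  shows "volterra_sol n q h (- z) = s * volterra_sol n q h z"
proof -
  have Y: "compact (closed_segment 0 z)" "convex (closed_segment 0 z)" "0 \<in> closed_segment 0 z"
    "closed_segment 0 z \<subseteq> X" "z \<in> closed_segment 0 z"
    using X z by (auto simp: closed_segment_subset)
  have "(\<lambda>k. picard n q h k z) sums volterra_sol n q h z"
    using tendsto_uniform_limitI[OF volterra_uniform_limit[OF X Y(1-4)] Y(5)] by (simp add: sums_def)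
  then have "(\<lambda>k. picard n q h k (- z)) sums (s * volterra_sol n q h z)"
    unfolding picard_parity[of q h s, OF par] by (rule sums_mult)
  then show ?thesis by (simp add: volterra_sol_def sums_iff)
qed

lemma volterra_sol_0:
  "volterra_sol n q h 0 = h 0"
proof -
  have "picard n q h (Suc k) 0 = 0" for k by (simp add: volt_def)
  then have "picard n q h k 0 = 0" if "k \<noteq> 0" for k using that by (cases k) auto
  then show ?thesis using suminf_finite[of "{0}" "\<lambda>k. picard n q h k 0"]
    by (auto simp: volterra_sol_def)
qed

lemma volt_uniform_limit:
  assumes Y: "compact Y" "convex Y" "0 \<in> Y"
    and f: "\<And>x. x \<in> T \<Longrightarrow> open (X x) \<and> convex (X x) \<and> Y \<subseteq> X x \<and> f x holomorphic_on X x"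
    and T: "\<forall>\<^sub>F x in F. x \<in> T" "x0 \<in> T"
    and lim: "uniform_limit Y f (f x0) F"
  shows "uniform_limit Y (\<lambda>x. volt n (f x)) (volt n (f x0)) F"
proof (rule uniform_limitI)
  fix e :: real assume e: "e > 0"
  obtain \<rho> where \<rho>: "\<And>z. z \<in> Y \<Longrightarrow> norm z \<le> \<rho>"
    using compact_imp_bounded[OF Y(1)] by (auto simp: bounded_iff)
  define d where "d = e / (\<rho>\<^sup>2 + 1)"
  have pos: "\<rho>\<^sup>2 + 1 > 0" by (intro add_nonneg_pos) auto
  have d: "d > 0" using e pos by (simp add: d_def)
  show "\<forall>\<^sub>F x in F. \<forall>z\<in>Y. dist (volt n (f x) z) (volt n (f x0) z) < e"
    using uniform_limitD[OF lim d] T(1)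
  proof eventually_elim
    case (elim x)
    show ?case
    proof
      fix z assume z: "z \<in> Y"
      have c: "continuous_on Y (f x)" "continuous_on Y (f x0)"
        using f[OF elim(2)] f[OF T(2)] by (meson continuous_on_subset holomorphic_on_imp_continuous_on)+
      have "norm (volt n (f x) z - volt n (f x0) z) = norm (volt n (\<lambda>z. f x z - f x0 z) z)"
        by (simp only: volt_linear(2)[OF Y(2,3) z c])
      also have "\<dots> \<le> (norm z)\<^sup>2 * d"
        by (rule volt_bound_const[OF Y(2,3) z])
           (use c d elim ray_mem[OF Y(2,3) z] in \<open>auto intro!: continuous_on_diff less_imp_le simp: dist_norm\<close>)
      also have "\<dots> \<le> \<rho>\<^sup>2 * d" using \<rho>[OF z] d by (intro mult_right_mono power_mono) auto
      also have "\<dots> < (\<rho>\<^sup>2 + 1) * d" using d by (simp add: algebra_simps)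
      also have "\<dots> = e" using pos by (simp add: d_def)
      finally show "dist (volt n (f x) z) (volt n (f x0) z) < e" by (simp add: dist_norm)
    qed
  qed
qed

text \<open>The difference of two solutions solves a Volterra equation with potential
  \<open>q x\<close> and a small source \<open>r\<close>; uniqueness identifies it with a Volterra
  solution, to which the a priori bound applies. The domains move with the parameter, so two
  solutions are compared on the intersection of theirs.\<close>

lemma volterra_continuous:
  assumes Y: "compact Y" "convex Y" "0 \<in> Y"
    and f: "\<And>x. x \<in> T \<Longrightarrow> open (X x) \<and> convex (X x) \<and> Y \<subseteq> X x \<and> q x holomorphic_on X x \<and> h x holomorphic_on X x"
    and T: "\<forall>\<^sub>F x in F. x \<in> T" "x0 \<in> T"
    and limq: "uniform_limit Y q (q x0) F" and limh: "uniform_limit Y h (h x0) F"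
  shows "uniform_limit Y (\<lambda>x. volterra_sol n (q x) (h x)) (volterra_sol n (q x0) (h x0)) F"
proof (rule uniform_limitI)
  fix e :: real assume e: "e > 0"
  let ?w = "\<lambda>x. volterra_sol n (q x) (h x)"
  note f0 = f[OF T(2)]
  have w0: "?w x0 holomorphic_on X x0"
    using f0 Y by (intro volterra_sol_holomorphic) auto
  obtain M c \<rho> where b: "\<And>z. z \<in> Y \<Longrightarrow> norm (q x0 z) \<le> M" "\<And>z. z \<in> Y \<Longrightarrow> norm (?w x0 z) \<le> c" "\<And>z. z \<in> Y \<Longrightarrow> norm z \<le> \<rho>"
    by (rule compact_convex_bounds[of "X x0" "q x0" "?w x0" Y]) (use f0 Y w0 in auto)
  have M0: "M \<ge> 0" "c \<ge> 0" "\<rho> \<ge> 0" using b[OF Y(3)] norm_ge_zero order_trans by blast+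
  define E where "E = exp (2 * (M + 1) * \<rho>\<^sup>2)"
  \<comment> \<open>The 1 keeps \<open>norm (q x z)\<close> below \<open>M + 1\<close>. The source
    is at most \<open>(1 + \<rho>\<^sup>2 * c) * d\<close>, and \<open>E\<close> is the
    amplification factor of \<open>volterra_sol_bound\<close>.\<close>
  define d where "d = min 1 (e / ((1 + \<rho>\<^sup>2 * c + 1) * E))"
  have E: "E > 0" by (simp add: E_def)
  have pos: "1 + \<rho>\<^sup>2 * c + 1 > 0" using M0 by (intro add_nonneg_pos add_nonneg_nonneg mult_nonneg_nonneg) auto
  have d: "d > 0" "d \<le> 1" using e E pos by (auto simp: d_def)
  have de: "(1 + \<rho>\<^sup>2 * c) * d * E < e"
  proof -
    have "(1 + \<rho>\<^sup>2 * c) * d * E < (1 + \<rho>\<^sup>2 * c + 1) * d * E" using d E by simp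
    also have "\<dots> = d * ((1 + \<rho>\<^sup>2 * c + 1) * E)" by simp
    also have "\<dots> \<le> e / ((1 + \<rho>\<^sup>2 * c + 1) * E) * ((1 + \<rho>\<^sup>2 * c + 1) * E)"
      using pos E by (intro mult_right_mono mult_nonneg_nonneg) (auto simp: d_def)
    also have "\<dots> = e" using pos E by simp
    finally show ?thesis .
  qed
  show "\<forall>\<^sub>F x in F. \<forall>z\<in>Y. dist (?w x z) (?w x0 z) < e"
    using uniform_limitD[OF limq d(1)] uniform_limitD[OF limh d(1)] T(1)
  proof eventually_elim
    case (elim x)
    note fx = f[OF elim(3)]
    define X' where "X' = X x \<inter> X x0"
    have X': "open X'" "convex X'" "0 \<in> X'" "Y \<subseteq> X'" using fx f0 Y by (auto simp: X'_def convex_Int)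
    have hol: "q x holomorphic_on X'" "h x holomorphic_on X'" "q x0 holomorphic_on X'" "h x0 holomorphic_on X'"
      using fx f0 unfolding X'_def by (meson Int_lower1 Int_lower2 holomorphic_on_subset)+
    have wh: "?w x holomorphic_on X'" "?w x0 holomorphic_on X'"
      using volterra_sol_holomorphic[OF X'(1-3)] hol by blast+
    define r where "r = (\<lambda>z. (h x z - h x0 z) + volt n (\<lambda>z. (q x z - q x0 z) * ?w x0 z) z)"
    have rh: "r holomorphic_on X'" unfolding r_def
      by (intro holomorphic_intros hol volt_holomorphic X' wh)
    have "?w x z - ?w x0 z = volterra_sol n (q x) r z" if z: "z \<in> X'" for z
    proof (rule volterra_unique[OF X'(1-3) hol(1) rh _ _ z])
      show "(\<lambda>z. ?w x z - ?w x0 z) holomorphic_on X'" by (intro holomorphic_intros wh)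
      fix z assume z: "z \<in> X'"
      note c = holomorphic_on_imp_continuous_on
      have "?w x z - ?w x0 z = h x z - h x0 z + (volt n (\<lambda>z. q x z * ?w x z) z - volt n (\<lambda>z. q x0 z * ?w x0 z) z)"
        using volterra_sol_eq[OF X'(1-3) hol(1,2) z] volterra_sol_eq[OF X'(1-3) hol(3,4) z] by simp
      also have "volt n (\<lambda>z. q x z * ?w x z) z - volt n (\<lambda>z. q x0 z * ?w x0 z) z =
          volt n (\<lambda>z. q x z * ?w x z - q x0 z * ?w x0 z) z"
        by (rule volt_linear(2)[OF X'(2,3) z, symmetric]) (intro c holomorphic_intros hol wh)+
      also have "(\<lambda>z. q x z * ?w x z - q x0 z * ?w x0 z) =
          (\<lambda>z. (q x z - q x0 z) * ?w x0 z + q x z * (?w x z - ?w x0 z))"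
        by (simp add: fun_eq_iff algebra_simps)
      also have "volt n \<dots> z = volt n (\<lambda>z. (q x z - q x0 z) * ?w x0 z) z + volt n (\<lambda>z. q x z * (?w x z - ?w x0 z)) z"
        by (rule volt_linear(1)[OF X'(2,3) z]) (intro c holomorphic_intros hol wh)+
      finally show "?w x z - ?w x0 z = r z + volt n (\<lambda>z. q x z * (?w x z - ?w x0 z)) z"
        by (simp add: r_def)
    qed
    moreover have "norm (volterra_sol n (q x) r z) \<le> ((1 + \<rho>\<^sup>2 * c) * d) * exp (2 * (M + 1) * \<rho>\<^sup>2)" if z: "z \<in> Y" for z
    proof (rule volterra_sol_bound[OF X'(1-3) hol(1) rh Y(2,3) X'(4) _ _ b(3) z])
      fix z assume z: "z \<in> Y"
      have qd: "norm (q x z - q x0 z) \<le> d" if "z \<in> Y" for z using elim(1) that by (auto simp: dist_norm less_imp_le)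
      show "norm (q x z) \<le> M + 1"
        using norm_triangle_sub[of "q x z" "q x0 z"] qd[OF z] b(1)[OF z] d by linarith
      have "norm (volt n (\<lambda>z. (q x z - q x0 z) * ?w x0 z) z) \<le> (norm z)\<^sup>2 * (d * c)"
      proof (rule volt_bound_const[OF X'(2,3)])
        show "z \<in> X'" using z X' by auto
        show "continuous_on X' (\<lambda>z. (q x z - q x0 z) * ?w x0 z)"
          by (intro holomorphic_on_imp_continuous_on holomorphic_intros hol wh)
        fix t :: real assume "t \<in> {0..1}"
        then have "of_real t * z \<in> Y" by (rule ray_mem[OF Y(2,3) z])
        then show "norm ((q x (of_real t * z) - q x0 (of_real t * z)) * ?w x0 (of_real t * z)) \<le> d * c"
          unfolding norm_mult using qd b(2) d by (intro mult_mono) auto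
      qed (use d M0 in auto)
      also have "\<dots> \<le> \<rho>\<^sup>2 * (d * c)" using b(3)[OF z] d M0 by (intro mult_right_mono power_mono) auto
      finally have "norm (r z) \<le> norm (h x z - h x0 z) + \<rho>\<^sup>2 * (d * c)"
        unfolding r_def using norm_triangle_ineq order_trans add_left_mono by meson
      also have "norm (h x z - h x0 z) \<le> d" using elim(2) z by (auto simp: dist_norm less_imp_le)
      finally show "norm (r z) \<le> (1 + \<rho>\<^sup>2 * c) * d" by (simp add: algebra_simps)
    qed
    ultimately show ?case using de X'(4) unfolding E_def[symmetric] dist_norm
      by (metis order.strict_trans1 subsetD)
  qed
qed

section \<open>Local solutions at the singular point\<close>

definition dq :: "(complex \<Rightarrow> complex) \<Rightarrow> complex \<Rightarrow> complex" where
  "dq f z = (if z = 0 then deriv f 0 else (f z - f 0) / z)"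

lemma dq_eq: "f z = f 0 + z * dq f z"
  by (simp add: dq_def)

lemma dq_holomorphic: "f holomorphic_on X \<Longrightarrow> open X \<Longrightarrow> dq f holomorphic_on X"
  using pole_lemma_open[of f X 0] unfolding dq_def[abs_def] diff_zero .

lemma deriv_0_even:
  assumes "\<And>z. f (- z) = f z" "f field_differentiable at 0"
  shows "deriv f (0::complex) = 0"
proof -
  have d: "(f has_field_derivative deriv f 0) (at 0)" using assms(2) field_differentiable_derivI by blast
  have "((\<lambda>z. f (- z)) has_field_derivative deriv f 0 * (-1)) (at 0)"
    by (rule DERIV_chain2[where g = uminus]) (use d in \<open>auto intro!: derivative_eq_intros\<close>)
  then have "(f has_field_derivative - deriv f 0) (at 0)" by (simp add: assms(1))
  from DERIV_unique[OF d this] show ?thesis by simp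
qed

text \<open>The derivative of an even function vanishes at 0, so two applications of
  \<open>dq\<close> strip exactly one even Taylor coefficient and preserve evenness.\<close>

lemma dq_dq_even:
  assumes e: "\<And>z. f (- z) = f z" and d: "f field_differentiable at 0"
  shows "dq (dq f) (- z) = dq (dq f) z" and "f z = f 0 + z\<^sup>2 * dq (dq f) z"
proof -
  have 0: "dq f 0 = 0" using deriv_0_even[OF assms] by (simp add: dq_def)
  have m: "dq f (- z) = - dq f z" for z using 0 by (simp add: dq_def e field_simps)
  show "dq (dq f) (- z) = dq (dq f) z" unfolding dq_def[of "dq f"] using 0 m by simp
  show "f z = f 0 + z\<^sup>2 * dq (dq f) z"
    using dq_eq[of f z] dq_eq[of "dq f" z] 0 by (simp add: power2_eq_square)
qed

text \<open>Away from the disc of radius \<open>r\<close> the division costs at most a factor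
  \<open>1 / r\<close>; inside, the maximum modulus principle transfers the bound from the circle.
  Two values of \<open>f\<close> are involved, whence the bound \<open>2 * d / r\<close>, which is
  \<open>2/3 * e\<close>.\<close>

lemma dq_uniform_limit:
  assumes Y: "compact Y" "cball 0 r \<subseteq> Y" "r > 0"
    and f: "\<And>x. x \<in> T \<Longrightarrow> open (X x) \<and> Y \<subseteq> X x \<and> f x holomorphic_on X x"
    and T: "\<forall>\<^sub>F x in F. x \<in> T" "x0 \<in> T"
    and lim: "uniform_limit Y f (f x0) F"
  shows "uniform_limit Y (\<lambda>x. dq (f x)) (dq (f x0)) F"
proof (rule uniform_limitI)
  fix e :: real assume e: "e > 0"
  define d where "d = r * e / 3"
  have d: "d > 0" using e Y by (simp add: d_def)
  have 0: "0 \<in> Y" using Y by auto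
  show "\<forall>\<^sub>F x in F. \<forall>z\<in>Y. dist (dq (f x) z) (dq (f x0) z) < e"
    using uniform_limitD[OF lim d] T(1)
  proof eventually_elim
    case (elim x)
    note fx = f[OF elim(2)] and f0 = f[OF T(2)]
    define X' where "X' = X x \<inter> X x0"
    have X': "open X'" "Y \<subseteq> X'" using fx f0 by (auto simp: X'_def)
    have hol: "f x holomorphic_on X'" "f x0 holomorphic_on X'"
      using fx f0 unfolding X'_def by (meson Int_lower1 Int_lower2 holomorphic_on_subset)+
    let ?g = "\<lambda>z. f x z - f x0 z"
    let ?h = "\<lambda>z. dq (f x) z - dq (f x0) z"
    have hh: "?h holomorphic_on X'" by (intro holomorphic_intros dq_holomorphic hol X')
    have zh: "z * ?h z = ?g z - ?g 0" for z
      using dq_eq[of "f x" z] dq_eq[of "f x0" z] by (simp add: algebra_simps)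
    have b: "norm (?h z) \<le> 2 * d / r" if z: "z \<in> Y" "norm z \<ge> r" for z
    proof -
      have "norm z * norm (?h z) \<le> norm (?g z) + norm (?g 0)"
        using zh[of z] norm_triangle_ineq4[of "?g z" "?g 0"] by (simp flip: norm_mult)
      also have "\<dots> \<le> d + d" using elim(1) z 0 by (intro add_mono) (auto simp: dist_norm less_imp_le)
      finally have "norm z * norm (?h z) \<le> 2 * d" by simp
      moreover have "r * norm (?h z) \<le> norm z * norm (?h z)" using z by (intro mult_right_mono) auto
      ultimately show ?thesis using Y(3) by (simp add: field_simps)
    qed
    have b': "norm (?h z) \<le> 2 * d / r" if z: "z \<in> Y" for z
    proof (cases "norm z \<ge> r")
      case False
      show ?thesis
      proof (rule maximum_modulus_frontier[of ?h "cball 0 r"])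
        show "?h holomorphic_on interior (cball 0 r)" "continuous_on (closure (cball 0 r)) ?h"
        proof -
          have "cball 0 r \<subseteq> X'" using X'(2) Y(2) by blast
          then have "?h holomorphic_on cball 0 r" by (rule holomorphic_on_subset[OF hh])
          then show "?h holomorphic_on interior (cball 0 r)" "continuous_on (closure (cball 0 r)) ?h"
            using holomorphic_on_subset[OF _ interior_subset] holomorphic_on_imp_continuous_on by auto
        qed
        show "bounded (cball (0::complex) r)" "z \<in> cball 0 r" using False by auto
        fix w assume "w \<in> frontier (cball (0::complex) r)"
        then have "norm w = r" using Y(3) by (simp add: frontier_cball)
        then show "norm (?h w) \<le> 2 * d / r" using Y(2) by (intro b) auto
      qed
    qed (use b z in auto)
    show ?case
    proof
      fix z assume "z \<in> Y"
      from b'[OF this] have "dist (dq (f x) z) (dq (f x0) z) \<le> 2 * d / r" by (simp add: dist_norm)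
      also have "\<dots> < e" using e Y(3) by (simp add: d_def)
      finally show "dist (dq (f x) z) (dq (f x0) z) < e" .
    qed
  qed
qed

text \<open>The truncated Frobenius solution at the smaller exponent \<open>-n\<close>: \<open>frob_poly n q N\<close> is even of
  degree at most \<open>2 * N\<close>, and \<open>z powi (- n)\<close> times it solves the equation up to \<open>z powi (2 * N - n)\<close>
  times \<open>frob_rem n q N\<close>. The recursion never breaks down because \<open>2 * N + 1 - 2 * n\<close> is odd; this
  is the absence of logarithms.\<close>

primrec frob_rem :: "nat \<Rightarrow> (complex \<Rightarrow> complex) \<Rightarrow> nat \<Rightarrow> complex \<Rightarrow> complex" where
  "frob_rem n q 0 = q"
| "frob_rem n q (Suc N) = (\<lambda>z. dq (dq (frob_rem n q N)) z +
     frob_rem n q N 0 / ((2 * of_nat N + 2) * (2 * of_nat N + 1 - 2 * of_nat n)) * q z)"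

text \<open>The denominator is the indicial polynomial \<open>s * (s - 1) - n * (n + 1)\<close> at
  the exponent \<open>s = 2 * N + 2 - n\<close>.\<close>

definition frob_coeff :: "nat \<Rightarrow> (complex \<Rightarrow> complex) \<Rightarrow> nat \<Rightarrow> complex" where
  "frob_coeff n q N = frob_rem n q N 0 / ((2 * of_nat N + 2) * (2 * of_nat N + 1 - 2 * of_nat n))"

definition frob_poly :: "nat \<Rightarrow> (complex \<Rightarrow> complex) \<Rightarrow> nat \<Rightarrow> complex \<Rightarrow> complex" where
  "frob_poly n q N z = 1 + (\<Sum>k<N. frob_coeff n q k * z ^ (2 * k + 2))"

definition frob_poly' :: "nat \<Rightarrow> (complex \<Rightarrow> complex) \<Rightarrow> nat \<Rightarrow> complex \<Rightarrow> complex" where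
  "frob_poly' n q N z = (\<Sum>k<N. frob_coeff n q k * ((2 * of_nat k + 2) * z ^ (2 * k + 1)))"

definition frob_poly'' :: "nat \<Rightarrow> (complex \<Rightarrow> complex) \<Rightarrow> nat \<Rightarrow> complex \<Rightarrow> complex" where
  "frob_poly'' n q N z = (\<Sum>k<N. frob_coeff n q k * ((2 * of_nat k + 2) * ((2 * of_nat k + 1) * z ^ (2 * k))))"

lemma frob_poly_deriv:
  "(frob_poly n q N has_field_derivative frob_poly' n q N z) (at z)"
  "(frob_poly' n q N has_field_derivative frob_poly'' n q N z) (at z)"
proof -
  have "((\<lambda>z. z ^ (2 * k + 2)) has_field_derivative (2 * of_nat k + 2) * z ^ (2 * k + 1)) (at z)"
    "((\<lambda>z. z ^ (2 * k + 1)) has_field_derivative (2 * of_nat k + 1) * z ^ (2 * k)) (at z)" for k and z :: complex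
    using DERIV_power_Suc[OF DERIV_ident, where n = "2 * k + 1" and x = z and s = UNIV]
      DERIV_power_Suc[OF DERIV_ident, where n = "2 * k" and x = z and s = UNIV]
    by (simp_all add: algebra_simps)
  note d = this
  have "((\<lambda>z. 1 + (\<Sum>k<N. frob_coeff n q k * z ^ (2 * k + 2))) has_field_derivative
      0 + (\<Sum>k<N. frob_coeff n q k * ((2 * of_nat k + 2) * z ^ (2 * k + 1)))) (at z)"
    by (intro DERIV_add DERIV_const DERIV_sum DERIV_cmult d)
  then show "(frob_poly n q N has_field_derivative frob_poly' n q N z) (at z)"
    by (simp add: frob_poly_def[abs_def] frob_poly'_def)
  have "((\<lambda>z. \<Sum>k<N. frob_coeff n q k * ((2 * of_nat k + 2) * z ^ (2 * k + 1))) has_field_derivative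
      (\<Sum>k<N. frob_coeff n q k * ((2 * of_nat k + 2) * ((2 * of_nat k + 1) * z ^ (2 * k))))) (at z)"
    by (intro DERIV_sum DERIV_cmult d)
  then show "(frob_poly' n q N has_field_derivative frob_poly'' n q N z) (at z)"
    by (simp add: frob_poly'_def[abs_def] frob_poly''_def)
qed

lemma odd_nonzero: "2 * of_nat N + 1 - 2 * of_nat n \<noteq> (0::complex)"
proof
  assume "2 * of_nat N + 1 - 2 * of_nat n = (0::complex)"
  then have "of_nat (2 * N + 1) = (of_nat (2 * n) :: complex)" by (simp add: add.commute)
  then have "2 * N + 1 = 2 * n" by (simp only: of_nat_eq_iff)
  then show False by presburger
qed

context
  fixes X :: "complex set" and n :: nat and q :: "complex \<Rightarrow> complex"
  assumes X: "open X" "convex X" "0 \<in> X" "q holomorphic_on X" and even: "\<And>z. q (- z) = q z"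
begin

lemma frob_rem_holomorphic: "frob_rem n q N holomorphic_on X"
  by (induction N) (use X in \<open>auto intro!: holomorphic_intros dq_holomorphic\<close>)

lemma frob_rem_diff: "frob_rem n q N field_differentiable at 0"
  using frob_rem_holomorphic X holomorphic_on_imp_differentiable_at by blast

lemma frob_rem_even: "frob_rem n q N (- z) = frob_rem n q N z"
proof (induction N arbitrary: z)
  case (Suc N)
  show ?case using dq_dq_even(1)[OF Suc frob_rem_diff] even by simp
qed (use even in simp)

text \<open>Away from 0 the left side is \<open>- (z ^ (n + 1))\<close> times the defect of
  \<open>frob_poly / z ^ n\<close> in the equation
  \<open>f'' = (n * (n + 1) / z\<^sup>2 + q) * f\<close>. In this form negative powers and the
  inverse-square term have disappeared, and the induction is polynomial algebra.\<close>

lemma frob_identity: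
  "z * (q z * frob_poly n q N z - frob_poly'' n q N z) + 2 * of_nat n * frob_poly' n q N z
     = z ^ (2 * N + 1) * frob_rem n q N z"
proof (induction N)
  case 0
  then show ?case by (simp add: frob_poly_def frob_poly'_def frob_poly''_def)
next
  case (Suc N)
  let ?c = "frob_coeff n q N" and ?R = "frob_rem n q N"
  let ?k = "2 * of_nat N :: complex"
  have nz: "?k + 2 \<noteq> 0"
  proof
    assume "?k + 2 = 0"
    then have "(of_nat (2 * N + 2) :: complex) = 0" by (simp add: add.commute)
    then show False by (simp only: of_nat_eq_0_iff)
  qed
  have c: "?c * (?k + 2) * (?k + 1 - 2 * of_nat n) = ?R 0"
    using nz odd_nonzero[of N n] by (simp add: frob_coeff_def)
  have R: "?R z = ?R 0 + z\<^sup>2 * dq (dq ?R) z"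
    by (rule dq_dq_even(2)[OF frob_rem_even frob_rem_diff])
  have p: "frob_poly n q (Suc N) z = frob_poly n q N z + ?c * z ^ (2 * N + 2)"
    "frob_poly' n q (Suc N) z = frob_poly' n q N z + ?c * ((?k + 2) * z ^ (2 * N + 1))"
    "frob_poly'' n q (Suc N) z = frob_poly'' n q N z + ?c * ((?k + 2) * ((?k + 1) * z ^ (2 * N)))"
    by (simp_all add: frob_poly_def frob_poly'_def frob_poly''_def)
  define A where "A = z * (q z * frob_poly n q N z - frob_poly'' n q N z) + 2 * of_nat n * frob_poly' n q N z"
  have A: "A = z ^ (2 * N + 1) * ?R z" unfolding A_def by (rule Suc)
  have "z * (q z * frob_poly n q (Suc N) z - frob_poly'' n q (Suc N) z) + 2 * of_nat n * frob_poly' n q (Suc N) z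
      = A + ?c * q z * z ^ (2 * N + 3) - (?c * (?k + 2) * (?k + 1 - 2 * of_nat n)) * z ^ (2 * N + 1)"
    unfolding p A_def by (simp add: algebra_simps power_add eval_nat_numeral)
  also have "\<dots> = z ^ (2 * N + 1) * (?R 0 + z\<^sup>2 * dq (dq ?R) z) + ?c * q z * z ^ (2 * N + 3) - ?R 0 * z ^ (2 * N + 1)"
    unfolding c A R[symmetric] ..
  also have "\<dots> = z ^ (2 * N + 3) * (dq (dq ?R) z + ?c * q z)"
    by (simp add: algebra_simps power_add eval_nat_numeral)
  also have "\<dots> = z ^ (2 * Suc N + 1) * frob_rem n q (Suc N) z"
    by (simp add: frob_coeff_def numeral_3_eq_3)
  finally show ?case .
qed

end

section \<open>The two Lame solutions at the origin\<close>

definition lame_u :: "nat \<Rightarrow> (complex \<Rightarrow> complex) \<Rightarrow> complex \<Rightarrow> complex" where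
  "lame_u n q = volterra_sol n q (\<lambda>_. 1)"

text \<open>Truncation at order \<open>Suc n\<close> leaves, up to sign, the defect
  \<open>z ^ (n + 1) * (z * frob_rem)\<close>, which is the kind of source that \<open>volt\<close>
  integrates; order \<open>n\<close> would in general provide only a factor \<open>z ^ n\<close>.
  The source \<open>z * frob_rem\<close> is odd, which keeps \<open>lame_v\<close> even.\<close>

definition frob_corr :: "nat \<Rightarrow> (complex \<Rightarrow> complex) \<Rightarrow> complex \<Rightarrow> complex" where
  "frob_corr n q = volterra_sol n q (volt n (\<lambda>z. z * frob_rem n q (Suc n) z))"

definition lame_v :: "nat \<Rightarrow> (complex \<Rightarrow> complex) \<Rightarrow> complex \<Rightarrow> complex" where
  "lame_v n q z = frob_poly n q (Suc n) z + z ^ (2 * n + 1) * frob_corr n q z"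

definition lame_phi :: "nat \<Rightarrow> (complex \<Rightarrow> complex) \<Rightarrow> complex \<Rightarrow> complex" where
  "lame_phi n q z = z ^ (n + 1) * lame_u n q z"

definition lame_psi :: "nat \<Rightarrow> (complex \<Rightarrow> complex) \<Rightarrow> complex \<Rightarrow> complex" where
  "lame_psi n q z = lame_v n q z / z ^ n"

definition solves_on :: "(complex \<Rightarrow> complex) \<Rightarrow> complex set \<Rightarrow> (complex \<Rightarrow> complex) \<Rightarrow> bool" where
  "solves_on V D f \<longleftrightarrow> f holomorphic_on D \<and> (\<forall>z\<in>D. deriv (deriv f) z = V z * f z)"

lemma deriv2_eqI:
  assumes D: "open D" "z \<in> D" and f: "\<And>z. z \<in> D \<Longrightarrow> (f has_field_derivative f' z) (at z)"
    and f': "(f' has_field_derivative c) (at z)"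
  shows "deriv (deriv f) z = (c::complex)"
proof -
  have "\<forall>\<^sub>F w in nhds z. deriv f w = f' w"
    using D by (auto intro!: eventually_nhds_in_open[THEN eventually_mono] DERIV_imp_deriv f)
  then have "deriv (deriv f) z = deriv f' z" by (rule deriv_cong_ev) simp
  then show ?thesis using DERIV_imp_deriv[OF f'] by simp
qed

lemma solves_onI:
  assumes D: "open D" and f: "\<And>z. z \<in> D \<Longrightarrow> (f has_field_derivative f' z) (at z)"
    and f': "\<And>z. z \<in> D \<Longrightarrow> (f' has_field_derivative V z * f z) (at z)"
  shows "solves_on V D f"
  unfolding solves_on_def using deriv2_eqI[OF D _ f f'] f D by (auto simp: holomorphic_on_open)

lemma solves_onD:
  assumes "open D" "solves_on V D f" "z \<in> D"
  shows "(f has_field_derivative deriv f z) (at z)"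
    and "(deriv f has_field_derivative V z * f z) (at z)"
  using assms holomorphic_derivI[of f D z] holomorphic_derivI[of "deriv f" D z] holomorphic_deriv[of f D]
  by (auto simp: solves_on_def)

lemma uniform_limit_of_tendsto:
  assumes "(c \<longlongrightarrow> c0) F"
  shows "uniform_limit Y (\<lambda>x z. c x) (\<lambda>z. c0) F"
  using assms unfolding uniform_limit_iff tendsto_iff by (auto elim!: eventually_mono)

lemma power_deriv_quot:
  assumes "z \<noteq> (0::complex)"
  shows "((\<lambda>z. z ^ n) has_field_derivative of_nat n * z ^ n / z) (at z)"
proof -
  have "of_nat n * (1 * z ^ (n - Suc 0)) = of_nat n * z ^ n / z" using assms by (cases n) auto
  then show ?thesis using DERIV_power[OF DERIV_ident, where n = n and x = z and s = UNIV] by simp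
qed

lemma uniform_limit_lessThan_sum:
  fixes f :: "nat \<Rightarrow> 'a \<Rightarrow> 'b \<Rightarrow> complex"
  assumes "\<And>k. uniform_limit Y (f k) (g k) F"
  shows "uniform_limit Y (\<lambda>x z. \<Sum>k<N::nat. f k x z) (\<lambda>z. \<Sum>k<N. g k z) F"
  by (induction N) (auto intro!: uniform_limit_const uniform_limit_add assms)

context
  fixes X :: "complex set" and n :: nat and q :: "complex \<Rightarrow> complex"
  assumes X: "open X" "convex X" "0 \<in> X" "q holomorphic_on X" and even: "\<And>z. q (- z) = q z"
begin

lemma rem_holomorphic: "(\<lambda>z. z * frob_rem n q (Suc n) z) holomorphic_on X"
  by (intro holomorphic_intros frob_rem_holomorphic[OF X even])

lemma frob_corr_props:
  shows "frob_corr n q holomorphic_on X"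
    and "z \<in> X \<Longrightarrow> frob_corr n q z = 0 + volt n (\<lambda>z. z * frob_rem n q (Suc n) z + q z * frob_corr n q z) z"
    and "z \<in> X \<Longrightarrow> frob_corr n q (- z) = - frob_corr n q z"
proof -
  note h = volt_holomorphic[OF X(1-3) rem_holomorphic]
  show hol: "frob_corr n q holomorphic_on X"
    unfolding frob_corr_def by (rule volterra_sol_holomorphic[OF X h])
  show "frob_corr n q z = 0 + volt n (\<lambda>z. z * frob_rem n q (Suc n) z + q z * frob_corr n q z) z" if z: "z \<in> X"
  proof -
    have "frob_corr n q z = volt n (\<lambda>z. z * frob_rem n q (Suc n) z) z + volt n (\<lambda>z. q z * frob_corr n q z) z"
      using volterra_sol_eq[OF X h z] by (simp add: frob_corr_def)
    also have "\<dots> = volt n (\<lambda>z. z * frob_rem n q (Suc n) z + q z * frob_corr n q z) z"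
      by (rule volt_linear(1)[OF X(2,3) z, symmetric])
         (intro holomorphic_on_imp_continuous_on rem_holomorphic holomorphic_intros X hol)+
    finally show ?thesis by simp
  qed
  show "frob_corr n q (- z) = - frob_corr n q z" if z: "z \<in> X"
  proof -
    have "volt n (\<lambda>z. z * frob_rem n q (Suc n) z) (- z) = -1 * volt n (\<lambda>z. z * frob_rem n q (Suc n) z) z" for z
      unfolding volt_def ray_moment_def
      by (simp add: frob_rem_even[OF X even] algebra_simps del: frob_rem.simps)
    from volterra_sol_parity[OF X h z even this] show ?thesis by (simp add: frob_corr_def)
  qed
qed

lemma lame_u_props:
  shows "lame_u n q holomorphic_on X" "lame_u n q 0 = 1"
    and "z \<in> X \<Longrightarrow> lame_u n q z = 1 + volt n (\<lambda>z. q z * lame_u n q z) z"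
    and "z \<in> X \<Longrightarrow> lame_u n q (- z) = lame_u n q z"
proof -
  have h: "(\<lambda>_. 1 :: complex) holomorphic_on X" by (rule holomorphic_on_const)
  show "lame_u n q holomorphic_on X" "lame_u n q 0 = 1"
    unfolding lame_u_def by (auto intro: volterra_sol_holomorphic[OF X h] simp: volterra_sol_0)
  show "z \<in> X \<Longrightarrow> lame_u n q z = 1 + volt n (\<lambda>z. q z * lame_u n q z) z"
    unfolding lame_u_def by (rule volterra_sol_eq[OF X h])
  show "z \<in> X \<Longrightarrow> lame_u n q (- z) = lame_u n q z"
    using volterra_sol_parity[OF X h _ even, of z 1] by (simp add: lame_u_def)
qed

lemma lame_v_props:
  shows "lame_v n q holomorphic_on X" "lame_v n q 0 = 1"
    and "z \<in> X \<Longrightarrow> lame_v n q (- z) = lame_v n q z"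
proof -
  have "frob_poly n q (Suc n) holomorphic_on X"
    unfolding holomorphic_on_open[OF X(1)] using frob_poly_deriv(1) by blast
  then show "lame_v n q holomorphic_on X"
    unfolding lame_v_def[abs_def] by (intro holomorphic_intros frob_corr_props)
  show "lame_v n q 0 = 1" by (simp add: lame_v_def frob_poly_def)
  have "(- z) ^ (2 * k + 2) = z ^ (2 * k + 2)" for k and z :: complex by simp
  then have "frob_poly n q N (- z) = frob_poly n q N z" for N z by (simp add: frob_poly_def)
  then show "z \<in> X \<Longrightarrow> lame_v n q (- z) = lame_v n q z"
    by (simp add: lame_v_def frob_corr_props)
qed

text \<open>Serves both solutions: \<open>c = 1\<close> for \<open>lame_u\<close> and
  \<open>c = 0\<close> for the correction in \<open>lame_v\<close>. As \<open>z ^ (n + 1)\<close>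
  solves the unperturbed equation, \<open>c\<close> leaves no trace in the source term.\<close>

lemma power_times_volterra:
  assumes G: "G holomorphic_on X" and w: "\<And>z. z \<in> X \<Longrightarrow> w z = c + volt n G z" and z: "z \<in> X" "z \<noteq> 0"
  shows "((\<lambda>z. z ^ (n + 1) * w z) has_field_derivative
            (of_nat n + 1) * z ^ n * w z + z ^ (n + 1) * (z * ray_moment (2 * n + 2) G z)) (at z)"
    and "((\<lambda>z. (of_nat n + 1) * z ^ n * w z + z ^ (n + 1) * (z * ray_moment (2 * n + 2) G z)) has_field_derivative
            of_nat n * (of_nat n + 1) / z\<^sup>2 * (z ^ (n + 1) * w z) + z ^ (n + 1) * G z) (at z)"
proof -
  let ?H = "ray_moment (2 * n + 2) G"
  have "((\<lambda>z. c + volt n G z) has_field_derivative z * ?H z) (at z)"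
    using volt_deriv(1)[OF X(1-3) z(1) G] by (auto intro!: derivative_eq_intros)
  then have w': "(w has_field_derivative z * ?H z) (at z)"
    by (rule has_field_derivative_transform_within_open[OF _ X(1) z(1)]) (simp add: w)
  note H' = volt_deriv(2)[OF X(1-3) z(1) G, of n]
  have p1: "((\<lambda>z. z ^ (n + 1)) has_field_derivative (of_nat n + 1) * z ^ n) (at z)"
    using DERIV_power_Suc[OF DERIV_ident, where n = n and x = z and s = UNIV] by (simp add: add.commute)
  have p0: "((\<lambda>z. z ^ n) has_field_derivative of_nat n * z ^ n / z) (at z)"
    using power_deriv_quot[OF z(2)] .
  show "((\<lambda>z. z ^ (n + 1) * w z) has_field_derivative
            (of_nat n + 1) * z ^ n * w z + z ^ (n + 1) * (z * ?H z)) (at z)"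
    using DERIV_mult[OF p1 w'] by (simp add: algebra_simps)
  have "((\<lambda>z. (of_nat n + 1) * z ^ n * w z + z ^ (n + 1) * (z * ?H z)) has_field_derivative
     ((of_nat n + 1) * (of_nat n * z ^ n / z) * w z + z * ?H z * ((of_nat n + 1) * z ^ n)) +
     ((of_nat n + 1) * z ^ n * (z * ?H z) + (G z - (2 * of_nat n + 2) * ?H z) * z ^ (n + 1))) (at z)"
    by (intro DERIV_add DERIV_mult DERIV_cmult p0 p1 w' H')
  moreover have "((of_nat n + 1) * (of_nat n * z ^ n / z) * w z + z * ?H z * ((of_nat n + 1) * z ^ n)) +
     ((of_nat n + 1) * z ^ n * (z * ?H z) + (G z - (2 * of_nat n + 2) * ?H z) * z ^ (n + 1)) =
     of_nat n * (of_nat n + 1) / z\<^sup>2 * (z ^ (n + 1) * w z) + z ^ (n + 1) * G z"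
  proof -
    have "of_nat n * z ^ n / z = of_nat n / z\<^sup>2 * z ^ (n + 1)" using z(2) by (simp add: power2_eq_square)
    then show ?thesis by (simp add: algebra_simps)
  qed
  ultimately show "((\<lambda>z. (of_nat n + 1) * z ^ n * w z + z ^ (n + 1) * (z * ?H z)) has_field_derivative
            of_nat n * (of_nat n + 1) / z\<^sup>2 * (z ^ (n + 1) * w z) + z ^ (n + 1) * G z) (at z)" by simp
qed

abbreviation "lame_V \<equiv> \<lambda>z. of_nat n * (of_nat n + 1) / z\<^sup>2 + q z"

lemma lame_phi_solves: "solves_on lame_V (X - {0}) (lame_phi n q)"
proof -
  have G: "(\<lambda>z. q z * lame_u n q z) holomorphic_on X" by (intro holomorphic_intros X lame_u_props)
  note p = power_times_volterra[OF G lame_u_props(3)]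
  show ?thesis
    unfolding lame_phi_def[abs_def]
  proof (rule solves_onI)
    show "open (X - {0})" using X by (simp add: open_delete)
    fix z assume "z \<in> X - {0}"
    then have z: "z \<in> X" "z \<noteq> 0" by auto
    show "((\<lambda>z. z ^ (n + 1) * lame_u n q z) has_field_derivative
      (of_nat n + 1) * z ^ n * lame_u n q z + z ^ (n + 1) * (z * ray_moment (2 * n + 2) (\<lambda>z. q z * lame_u n q z) z)) (at z)"
      by (rule p(1)[OF _ z])
    show "((\<lambda>z. (of_nat n + 1) * z ^ n * lame_u n q z + z ^ (n + 1) * (z * ray_moment (2 * n + 2) (\<lambda>z. q z * lame_u n q z) z))
      has_field_derivative lame_V z * (z ^ (n + 1) * lame_u n q z)) (at z)"
      by (rule DERIV_cong[OF p(2)[OF _ z]]) (simp_all add: algebra_simps)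
  qed
qed

lemma lame_psi_solves: "solves_on lame_V (X - {0}) (lame_psi n q)"
proof -
  let ?g = "frob_corr n q" and ?P = "frob_poly n q (Suc n)" and ?P' = "frob_poly' n q (Suc n)"
    and ?P'' = "frob_poly'' n q (Suc n)" and ?R = "frob_rem n q (Suc n)"
  let ?G = "\<lambda>z. z * ?R z + q z * ?g z"
  let ?e = "\<lambda>z::complex. 1 / z ^ n"
  let ?g' = "\<lambda>z. (of_nat n + 1) * z ^ n * ?g z + z ^ (n + 1) * (z * ray_moment (2 * n + 2) ?G z)"
  let ?f' = "\<lambda>z. (?P' z * ?e z - of_nat n * (?P z * (?e z / z))) + ?g' z"
  have G: "?G holomorphic_on X" by (intro holomorphic_intros X frob_corr_props rem_holomorphic)
  note p = power_times_volterra[OF G frob_corr_props(2)]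
  have e': "(?e has_field_derivative - of_nat n * (?e z / z)) (at z)" if "z \<noteq> 0" for z
  proof -
    have "((\<lambda>z. z ^ n) has_field_derivative of_nat n * z ^ n / z) (at z)"
      using power_deriv_quot[OF that] .
    from DERIV_inverse_fun[OF this] that show ?thesis by (simp add: field_simps)
  qed
  have e'': "((\<lambda>z. ?e z / z) has_field_derivative - (of_nat n + 1) * (?e z / z\<^sup>2)) (at z)" if "z \<noteq> 0" for z
    by (rule DERIV_cong[OF DERIV_divide[OF e'[OF that] DERIV_ident that]])
       (use that in \<open>simp add: field_simps power2_eq_square\<close>)
  have psi: "lame_psi n q z = ?P z * ?e z + z ^ (n + 1) * ?g z" if "z \<noteq> 0" for z
  proof -
    have "z ^ (2 * n + 1) / z ^ n = z ^ (n + 1)" using that by (simp add: mult_2 power_add)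
    then show ?thesis by (simp add: lame_psi_def lame_v_def add_divide_distrib flip: times_divide_eq_left)
  qed
  show ?thesis
  proof (rule solves_onI)
    show "open (X - {0})" using X by (simp add: open_delete)
    fix z assume "z \<in> X - {0}"
    then have z: "z \<in> X" "z \<noteq> 0" by auto
    have "((\<lambda>z. ?P z * ?e z + z ^ (n + 1) * ?g z) has_field_derivative
        (?P' z * ?e z + - of_nat n * (?e z / z) * ?P z) + ?g' z) (at z)"
      by (intro DERIV_add DERIV_mult frob_poly_deriv e' z p(1))
    then have "((\<lambda>z. ?P z * ?e z + z ^ (n + 1) * ?g z) has_field_derivative ?f' z) (at z)"
      by (simp add: mult_ac)
    then show "(lame_psi n q has_field_derivative ?f' z) (at z)"
      by (rule has_field_derivative_transform_within_open[of _ _ _ "- {0}"]) (use z psi in auto)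
    have "(?f' has_field_derivative
       ((?P'' z * ?e z + - of_nat n * (?e z / z) * ?P' z) - of_nat n * (?P' z * (?e z / z) + - (of_nat n + 1) * (?e z / z\<^sup>2) * ?P z))
        + (of_nat n * (of_nat n + 1) / z\<^sup>2 * (z ^ (n + 1) * ?g z) + z ^ (n + 1) * ?G z)) (at z)"
      by (intro DERIV_add DERIV_diff DERIV_mult DERIV_cmult frob_poly_deriv e' e'' z p(2))
    moreover have "(((?P'' z * ?e z + - of_nat n * (?e z / z) * ?P' z) - of_nat n * (?P' z * (?e z / z) + - (of_nat n + 1) * (?e z / z\<^sup>2) * ?P z))
        + (of_nat n * (of_nat n + 1) / z\<^sup>2 * (z ^ (n + 1) * ?g z) + z ^ (n + 1) * ?G z)) = lame_V z * lame_psi n q z"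
    proof -
      \<comment> \<open>The identity is solved for the second derivative of the polynomial; its
        remainder is cancelled by the source of the correction.\<close>
      have "z * (q z * ?P z - ?P'' z) + 2 * of_nat n * ?P' z = z ^ (2 * Suc n + 1) * ?R z"
        by (rule frob_identity[OF X even])
      then have "?P'' z * z = q z * ?P z * z + 2 * of_nat n * ?P' z - z ^ (2 * Suc n + 1) * ?R z"
        by (simp add: algebra_simps)
      also have "z ^ (2 * Suc n + 1) * ?R z = z * (z ^ (2 * n + 2) * ?R z)" by simp
      finally have P'': "?P'' z = q z * ?P z + 2 * of_nat n * ?P' z / z - z ^ (2 * n + 2) * ?R z"
        using z(2) by (simp add: field_simps)
      have e: "z ^ (2 * n + 2) * ?e z = z ^ (n + 1) * z"
        using z(2) by (simp add: mult_2 power_add)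
      have "?P'' z * ?e z = q z * ?P z * ?e z + 2 * of_nat n * ?P' z * (?e z / z) - (z ^ (n + 1) * z) * ?R z"
        unfolding P'' e[symmetric] by (simp add: algebra_simps)
      moreover have "?e z / z\<^sup>2 = ?e z * (1 / z\<^sup>2)"
        "of_nat n * (of_nat n + 1) / z\<^sup>2 = of_nat n * (of_nat n + 1) * (1 / z\<^sup>2)" by simp_all
      ultimately show ?thesis unfolding psi[OF z(2)]
        by (simp add: algebra_simps del: frob_rem.simps times_divide_eq_right times_divide_eq_left)
    qed
    ultimately show "(?f' has_field_derivative lame_V z * lame_psi n q z) (at z)" by simp
  qed
qed

text \<open>In terms of \<open>lame_u\<close> and \<open>lame_v\<close> the Wronskian extends
  holomorphically to 0, where it equals the difference of the exponents \<open>n + 1\<close> and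
  \<open>- n\<close>. \<open>local_wr\<close> evaluates the constant there.\<close>

lemma lame_wronskian_local:
  assumes z: "z \<in> X" "z \<noteq> 0"
  shows "lame_psi n q z * deriv (lame_phi n q) z - deriv (lame_psi n q) z * lame_phi n q z =
    (2 * of_nat n + 1) * (lame_v n q z * lame_u n q z) +
      z * (lame_v n q z * deriv (lame_u n q) z - deriv (lame_v n q) z * lame_u n q z)"
proof -
  let ?u = "lame_u n q" and ?v = "lame_v n q"
  have u: "(?u has_field_derivative deriv ?u z) (at z)" and v: "(?v has_field_derivative deriv ?v z) (at z)"
    using holomorphic_derivI X z lame_u_props lame_v_props by blast+
  have p1: "((\<lambda>z. z ^ (n + 1)) has_field_derivative (of_nat n + 1) * z ^ n) (at z)"
    using DERIV_power_Suc[OF DERIV_ident, where n = n and x = z and s = UNIV] by (simp add: add.commute)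
  have p0: "((\<lambda>z. z ^ n) has_field_derivative of_nat n * z ^ n / z) (at z)"
    using power_deriv_quot[OF z(2)] .
  have phi: "deriv (lame_phi n q) z = (of_nat n + 1) * z ^ n * ?u z + deriv ?u z * z ^ (n + 1)"
    unfolding lame_phi_def[abs_def] by (rule DERIV_imp_deriv[OF DERIV_mult[OF p1 u]])
  have psi: "deriv (lame_psi n q) z = (deriv ?v z * z ^ n - ?v z * (of_nat n * z ^ n / z)) / (z ^ n * z ^ n)"
    unfolding lame_psi_def[abs_def] by (rule DERIV_imp_deriv[OF DERIV_divide[OF v p0]]) (use z in auto)
  show ?thesis
    unfolding phi psi unfolding lame_phi_def lame_psi_def using z(2)
    by (simp add: field_simps)
qed

end

text \<open>Convergence is propagated along the construction: through \<open>dq\<close> to the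
  Frobenius remainders and coefficients, then through \<open>volt\<close> and the Volterra solution.
  A general filter is used because the parameter will later approach its limit within a mere set of
  parameters.\<close>

lemma lame_continuous:
  assumes Y: "compact Y" "convex Y" "cball 0 r \<subseteq> Y" "r > 0"
    and q: "\<And>x. x \<in> T \<Longrightarrow> open (X x) \<and> convex (X x) \<and> Y \<subseteq> X x \<and> q x holomorphic_on X x"
    and even: "\<And>x z. x \<in> T \<Longrightarrow> q x (- z) = q x z"
    and T: "\<forall>\<^sub>F x in F. x \<in> T" "x0 \<in> T"
    and lim: "uniform_limit Y q (q x0) F"
  shows "uniform_limit Y (\<lambda>x. lame_u n (q x)) (lame_u n (q x0)) F"
    and "uniform_limit Y (\<lambda>x. lame_v n (q x)) (lame_v n (q x0)) F"
proof -
  have 0: "0 \<in> Y" using Y by auto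
  have X: "open (X x)" "convex (X x)" "0 \<in> X x" "q x holomorphic_on X x" "Y \<subseteq> X x" if "x \<in> T" for x
    using q[OF that] 0 by auto
  show "uniform_limit Y (\<lambda>x. lame_u n (q x)) (lame_u n (q x0)) F"
    unfolding lame_u_def
    by (rule volterra_continuous[OF Y(1,2) 0 _ T lim, where X = X]) (use X in \<open>auto intro!: uniform_limit_const\<close>)
  have bdd: "bounded (f ` Y)" if "f holomorphic_on X x" "x \<in> T" for f :: "complex \<Rightarrow> complex" and x
    using that X(5) Y(1) by (meson compact_continuous_image compact_imp_bounded continuous_on_subset holomorphic_on_imp_continuous_on)
  have remh: "frob_rem n (q x) N holomorphic_on X x" if "x \<in> T" for x N
    by (rule frob_rem_holomorphic[OF X(1-4)[OF that] even[OF that]])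
  have rem: "uniform_limit Y (\<lambda>x. frob_rem n (q x) N) (frob_rem n (q x0) N) F" for N
  proof (induction N)
    case (Suc N)
    let ?d = "(2 * of_nat N + 2) * (2 * of_nat N + 1 - 2 * of_nat n) :: complex"
    have 1: "uniform_limit Y (\<lambda>x. dq (frob_rem n (q x) N)) (dq (frob_rem n (q x0) N)) F"
      by (rule dq_uniform_limit[OF Y(1,3,4) _ T Suc, where X = X]) (use X remh in auto)
    have 2: "uniform_limit Y (\<lambda>x. dq (dq (frob_rem n (q x) N))) (dq (dq (frob_rem n (q x0) N))) F"
      by (rule dq_uniform_limit[OF Y(1,3,4) _ T 1, where X = X]) (use X remh in \<open>auto intro!: dq_holomorphic\<close>)
    have "((\<lambda>x. frob_rem n (q x) N 0 * inverse ?d) \<longlongrightarrow> frob_rem n (q x0) N 0 * inverse ?d) F"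
      by (intro tendsto_mult tendsto_const tendsto_uniform_limitI[OF Suc 0])
    from uniform_limit_of_tendsto[OF this]
    have 3: "uniform_limit Y (\<lambda>x z. frob_rem n (q x) N 0 * inverse ?d) (\<lambda>z. frob_rem n (q x0) N 0 * inverse ?d) F" .
    have "uniform_limit Y (\<lambda>x z. frob_rem n (q x) N 0 * inverse ?d * q x z) (\<lambda>z. frob_rem n (q x0) N 0 * inverse ?d * q x0 z) F"
      by (rule uniform_lim_mult[OF 3 lim]) (use bdd[OF X(4)] T in \<open>auto simp: image_constant_conv\<close>)
    from uniform_limit_add[OF 2 this] show ?case by (simp add: divide_inverse)
  qed (use lim in simp)
  have id: "uniform_limit Y (\<lambda>x z. z) (\<lambda>z::complex. z) F" by (rule uniform_limit_const)
  have pw: "uniform_limit Y (\<lambda>x z. z ^ k) (\<lambda>z::complex. z ^ k) F" for k by (rule uniform_limit_const)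
  have bp: "bounded ((\<lambda>z::complex. z ^ k) ` Y)" for k
    using Y(1) by (intro compact_imp_bounded compact_continuous_image continuous_intros)
  have coeff: "((\<lambda>x. frob_coeff n (q x) N) \<longlongrightarrow> frob_coeff n (q x0) N) F" for N
    unfolding frob_coeff_def divide_inverse
    by (intro tendsto_mult tendsto_const tendsto_uniform_limitI[OF rem 0])
  have poly: "uniform_limit Y (\<lambda>x. frob_poly n (q x) (Suc n)) (frob_poly n (q x0) (Suc n)) F"
    unfolding frob_poly_def[abs_def]
    by (intro uniform_limit_add uniform_limit_const uniform_limit_lessThan_sum uniform_lim_mult
         uniform_limit_of_tendsto coeff pw bp) (auto simp: image_constant_conv)
  have t: "uniform_limit Y (\<lambda>x z. z * frob_rem n (q x) (Suc n) z) (\<lambda>z. z * frob_rem n (q x0) (Suc n) z) F"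
    using bp[of 1] by (intro uniform_lim_mult id rem bdd[OF remh T(2)] T) auto
  have h: "uniform_limit Y (\<lambda>x. volt n (\<lambda>z. z * frob_rem n (q x) (Suc n) z)) (volt n (\<lambda>z. z * frob_rem n (q x0) (Suc n) z)) F"
    by (rule volt_uniform_limit[OF Y(1,2) 0 _ T t, where X = X])
       (use X remh in \<open>auto intro!: holomorphic_intros simp del: frob_rem.simps\<close>)
  have "uniform_limit Y (\<lambda>x. frob_corr n (q x)) (frob_corr n (q x0)) F"
    unfolding frob_corr_def
    by (rule volterra_continuous[OF Y(1,2) 0 _ T lim h, where X = X])
       (use X remh in \<open>auto intro!: volt_holomorphic holomorphic_intros simp del: frob_rem.simps\<close>)
  then show "uniform_limit Y (\<lambda>x. lame_v n (q x)) (lame_v n (q x0)) F"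
    unfolding lame_v_def[abs_def]
    using bdd[OF frob_corr_props(1)[OF X(1-4)[OF T(2)] even[OF T(2)]] T(2)]
    by (intro uniform_limit_add poly uniform_lim_mult pw bp)
qed

section \<open>Monodromy of the Lame equation\<close>

definition wr :: "(complex \<Rightarrow> complex) \<Rightarrow> (complex \<Rightarrow> complex) \<Rightarrow> complex \<Rightarrow> complex" where
  "wr f g z = f z * deriv g z - deriv f z * g z"

lemma wr_const:
  assumes D: "open D" "connected D" and f: "solves_on V D f" "solves_on V D g"
  shows "\<exists>c. \<forall>z\<in>D. wr f g z = c"
proof -
  have "((\<lambda>z. f z * deriv g z - deriv f z * g z) has_field_derivative 0) (at z)" if z: "z \<in> D" for z
  proof (rule DERIV_cong)
    note sf = solves_onD[OF D(1) f(1) z] and sg = solves_onD[OF D(1) f(2) z]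
    show "((\<lambda>z. f z * deriv g z - deriv f z * g z) has_field_derivative
       (deriv f z * deriv g z + V z * g z * f z) - (V z * f z * g z + deriv g z * deriv f z)) (at z)"
      by (intro DERIV_diff DERIV_mult sf sg)
  qed (simp add: algebra_simps)
  then show ?thesis
    using has_field_derivative_0_imp_constant_on[of D "wr f g"] D
    by (auto simp: constant_on_def wr_def[abs_def])
qed

lemma solves_on_lincomb:
  assumes "open D" "solves_on V D f" "solves_on V D g"
  shows "solves_on V D (\<lambda>z. a * f z + b * g z)"
  by (rule solves_onI[where f' = "\<lambda>z. a * deriv f z + b * deriv g z"])
     (use solves_onD[OF assms(1,2)] solves_onD[OF assms(1,3)] assms(1)
      in \<open>auto intro!: derivative_eq_intros simp: algebra_simps\<close>)

lemma deriv_lincomb_cong: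
  assumes D: "open D" "z \<in> D" "f holomorphic_on D" "g holomorphic_on D"
    and h: "\<And>z. z \<in> D \<Longrightarrow> h z = a * f z + b * g z"
  shows "deriv h z = a * deriv f z + b * deriv g z"
proof -
  have "((\<lambda>z. a * f z + b * g z) has_field_derivative a * deriv f z + b * deriv g z) (at z)"
    by (intro DERIV_add DERIV_cmult holomorphic_derivI[OF _ D(1,2)] D)
  then have "(h has_field_derivative a * deriv f z + b * deriv g z) (at z)"
    by (rule has_field_derivative_transform_within_open[OF _ D(1,2)]) (simp add: h)
  then show ?thesis by (rule DERIV_imp_deriv)
qed

lemma wr_lincomb:
  assumes "open D" "z \<in> D" "\<psi> holomorphic_on D" "\<phi> holomorphic_on D"
    and "\<And>z. z \<in> D \<Longrightarrow> f z = a * \<psi> z + b * \<phi> z" "\<And>z. z \<in> D \<Longrightarrow> g z = c * \<psi> z + d * \<phi> z"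
  shows "wr f g z = (a * d - b * c) * wr \<psi> \<phi> z"
proof -
  have "deriv f z = a * deriv \<psi> z + b * deriv \<phi> z" by (rule deriv_lincomb_cong[OF assms(1-5)])
  moreover have "deriv g z = c * deriv \<psi> z + d * deriv \<phi> z" by (rule deriv_lincomb_cong[OF assms(1-4,6)])
  ultimately show ?thesis
    unfolding wr_def by (simp add: assms(5,6)[OF assms(2)] algebra_simps)
qed

text \<open>Cramer's rule in the form \<open>f z * wr \<psi> \<phi> z = \<psi> z * wr f \<phi> z +
  \<phi> z * wr \<psi> f z\<close>, where all three Wronskians are constant.\<close>

lemma solution_lincomb:
  assumes D: "open D" "connected D" and s: "solves_on V D \<psi>" "solves_on V D \<phi>" "solves_on V D f"
    and W: "W \<noteq> 0" "\<And>z. z \<in> D \<Longrightarrow> wr \<psi> \<phi> z = W"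
  obtains a b where "\<And>z. z \<in> D \<Longrightarrow> f z = a * \<psi> z + b * \<phi> z"
proof -
  obtain c where c: "\<forall>z\<in>D. wr f \<phi> z = c" using wr_const[OF D s(3,2)] by blast
  obtain d where d: "\<forall>z\<in>D. wr \<psi> f z = d" using wr_const[OF D s(1,3)] by blast
  show ?thesis
  proof (rule that[of "c / W" "d / W"])
    fix z assume z: "z \<in> D"
    have "f z * wr \<psi> \<phi> z = \<psi> z * wr f \<phi> z + \<phi> z * wr \<psi> f z"
      by (simp add: wr_def algebra_simps)
    then have "f z * W = \<psi> z * c + \<phi> z * d" using c d W z by simp
    then show "f z = c / W * \<psi> z + d / W * \<phi> z" using W(1) by (simp add: field_simps)
  qed
qed

lemma lincomb_unique:
  assumes D: "open D" "z0 \<in> D" "\<psi> holomorphic_on D" "\<phi> holomorphic_on D" and W: "wr \<psi> \<phi> z0 \<noteq> 0"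
    and eq: "\<And>z. z \<in> D \<Longrightarrow> a * \<psi> z + b * \<phi> z = c * \<psi> z + d * \<phi> z"
  shows "a = c \<and> b = d"
proof -
  have 1: "a * \<psi> z0 + b * \<phi> z0 - (c * \<psi> z0 + d * \<phi> z0) = 0" using eq[OF D(2)] by simp
  have "deriv (\<lambda>z. a * \<psi> z + b * \<phi> z) z0 = c * deriv \<psi> z0 + d * deriv \<phi> z0"
    by (rule deriv_lincomb_cong[OF D eq])
  moreover have "deriv (\<lambda>z. a * \<psi> z + b * \<phi> z) z0 = a * deriv \<psi> z0 + b * deriv \<phi> z0"
    by (rule deriv_lincomb_cong[OF D refl])
  ultimately have 2: "a * deriv \<psi> z0 + b * deriv \<phi> z0 - (c * deriv \<psi> z0 + d * deriv \<phi> z0) = 0" by simp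
  have "(a - c) * wr \<psi> \<phi> z0 = (a * \<psi> z0 + b * \<phi> z0 - (c * \<psi> z0 + d * \<phi> z0)) * deriv \<phi> z0
     - (a * deriv \<psi> z0 + b * deriv \<phi> z0 - (c * deriv \<psi> z0 + d * deriv \<phi> z0)) * \<phi> z0"
    by (simp add: wr_def algebra_simps)
  moreover have "(b - d) * wr \<psi> \<phi> z0 = (a * deriv \<psi> z0 + b * deriv \<phi> z0 - (c * deriv \<psi> z0 + d * deriv \<phi> z0)) * \<psi> z0
     - (a * \<psi> z0 + b * \<phi> z0 - (c * \<psi> z0 + d * \<phi> z0)) * deriv \<psi> z0"
    by (simp add: wr_def algebra_simps)
  ultimately show ?thesis unfolding 1 2 using W by simp
qed

lemma deriv_shift: "deriv (\<lambda>z. f (z + \<omega>)) (z::complex) = deriv f (z + \<omega>)"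
  by (simp add: deriv_def DERIV_shift)

lemma solves_on_shift:
  assumes "open D" "solves_on V D f" "\<And>z. z \<in> D' \<Longrightarrow> z + \<omega> \<in> D \<and> V (z + \<omega>) = V z" "open D'"
  shows "solves_on V D' (\<lambda>z. f (z + \<omega>))"
  by (rule solves_onI[where f' = "\<lambda>z. deriv f (z + \<omega>)"])
     (use assms solves_onD[OF assms(1,2)] in \<open>auto simp flip: DERIV_shift simp: assms(3)[THEN conjunct2, symmetric]\<close>)

lemma solves_on_local:
  assumes "\<And>z. z \<in> D \<Longrightarrow> \<exists>N g. open N \<and> z \<in> N \<and> solves_on V N g \<and> (\<forall>w\<in>N. f w = g w)" "open D"
  shows "solves_on V D f"
proof -
  have "f field_differentiable (at z) \<and> deriv (deriv f) z = V z * f z" if z: "z \<in> D" for z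
  proof -
    obtain N g where N: "open N" "z \<in> N" "solves_on V N g" "\<And>w. w \<in> N \<Longrightarrow> f w = g w"
      using assms(1)[OF z] by blast
    have d: "(f has_field_derivative deriv g w) (at w)" if "w \<in> N" for w
      using has_field_derivative_transform_within_open[OF solves_onD(1)[OF N(1,3) that] N(1) that] N(4) by simp
    have "deriv (deriv f) z = V z * f z"
      using deriv2_eqI[OF N(1,2) d solves_onD(2)[OF N(1,3,2)]] N(2,4) by simp
    then show ?thesis using d[OF N(2)] by (auto simp: field_differentiable_def)
  qed
  then show ?thesis using assms(2) by (auto simp: solves_on_def holomorphic_on_open field_differentiable_def)
qed

section \<open>Integer powers, and period matrices with equal diagonal entries\<close>

definition ipow :: "('a \<Rightarrow> 'a) \<Rightarrow> ('a \<Rightarrow> 'a) \<Rightarrow> int \<Rightarrow> 'a \<Rightarrow> 'a" where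
  "ipow L L' k = (if k \<ge> 0 then L ^^ nat k else L' ^^ nat (- k))"

lemma ipow_0 [simp]: "ipow L L' 0 = id"
  by (simp add: ipow_def)

lemma ipow_succ:
  assumes "\<And>x. L (L' x) = x"
  shows "ipow L L' (k + 1) x = L (ipow L L' k x)"
proof (cases "k \<ge> 0")
  case True
  then have "nat (k + 1) = Suc (nat k)" by simp
  then show ?thesis using True by (simp add: ipow_def)
next
  case False
  then have "nat (- k) = Suc (nat (- (k + 1)))" by simp
  then show ?thesis using False assms by (cases "k = -1") (auto simp: ipow_def)
qed

lemma ipow_commute:
  assumes "\<And>x. h (L x) = L (h x)" "\<And>x. h (L' x) = L' (h x)"
  shows "h (ipow L L' k x) = ipow L L' k (h x)"
proof -
  have "h ((L ^^ m) x) = (L ^^ m) (h x)" "h ((L' ^^ m) x) = (L' ^^ m) (h x)" for m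
    by (induction m) (simp_all add: assms)
  then show ?thesis by (simp add: ipow_def)
qed

lemma ipow_induct:
  assumes "P id" "\<And>f. P f \<Longrightarrow> P (L \<circ> f)" "\<And>f. P f \<Longrightarrow> P (L' \<circ> f)"
  shows "P (ipow L L' k)"
proof -
  have "P (L ^^ m)" "P (L' ^^ m)" for m
    by (induction m) (use assms in \<open>simp_all add: id_def\<close>)
  then show ?thesis by (simp add: ipow_def)
qed

text \<open>The action of \<open>[A B; C A]\<close>; the common diagonal entry is due to parity, see
  \<open>local_shift\<close>. For determinant 1 the inverse arises by changing the signs of
  \<open>B\<close> and \<open>C\<close>.\<close>

definition mat_act :: "complex \<Rightarrow> complex \<Rightarrow> complex \<Rightarrow> complex \<times> complex \<Rightarrow> complex \<times> complex" where
  "mat_act A B C = (\<lambda>(s, t). (A * s + B * t, C * s + A * t))"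

lemma mat_act_inverse:
  assumes "A\<^sup>2 - B * C = 1"
  shows "mat_act A B C (mat_act A (- B) (- C) x) = x" "mat_act A (- B) (- C) (mat_act A B C x) = x"
proof -
  obtain s t where x: "x = (s, t)" by (cases x)
  have "mat_act A B C (mat_act A (- B) (- C) x) = ((A\<^sup>2 - B * C) * s, (A\<^sup>2 - B * C) * t)"
    "mat_act A (- B) (- C) (mat_act A B C x) = ((A\<^sup>2 - B * C) * s, (A\<^sup>2 - B * C) * t)"
    by (simp_all add: x mat_act_def algebra_simps power2_eq_square)
  then show "mat_act A B C (mat_act A (- B) (- C) x) = x" "mat_act A (- B) (- C) (mat_act A B C x) = x"
    by (simp_all add: x assms)
qed

text \<open>The commutator of two such matrices is diagonal with entries
  \<open>B * C' - B' * C\<close> and its negative.\<close>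

lemma mat_act_commute:
  assumes "B * C' = B' * C"
  shows "mat_act A B C (mat_act A' B' C' x) = mat_act A' B' C' (mat_act A B C x)"
proof -
  obtain s t where x: "x = (s, t)" by (cases x)
  have "mat_act A B C (mat_act A' B' C' x) - mat_act A' B' C' (mat_act A B C x) =
      ((B * C' - B' * C) * s, - (B * C' - B' * C) * t)"
    by (simp add: x mat_act_def algebra_simps)
  then show ?thesis by (simp add: assms zero_prod_def[symmetric])
qed

section \<open>The Lame frame around the whole lattice\<close>

context torus
begin

definition cy :: "complex \<Rightarrow> real" where "cy z = Im z / Im \<tau>"
definition cx :: "complex \<Rightarrow> real" where "cx z = Re z - Im z / Im \<tau> * Re \<tau>"

lemma coord_simps [simp]:
  "cx (z + w) = cx z + cx w" "cy (z + w) = cy z + cy w" "cx (z - w) = cx z - cx w" "cy (z - w) = cy z - cy w"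
  "cx (- z) = - cx z" "cy (- z) = - cy z" "cx 0 = 0" "cy 0 = 0"
  "cx 1 = 1" "cy 1 = 0" "cx \<tau> = 0" "cy \<tau> = 1" "cx (of_int a) = of_int a" "cy (of_int a) = 0"
  "cx (of_int a * \<tau>) = 0" "cy (of_int a * \<tau>) = of_int a"
  "cx (of_real r * z) = r * cx z" "cy (of_real r * z) = r * cy z"
  using Im_pos by (simp_all add: cx_def cy_def field_simps)

lemma linear_coords: "linear cx" "linear cy"
  by (rule linearI; simp add: cx_def cy_def algebra_simps add_divide_distrib scaleR_conv_of_real)+

definition cell_box :: "real \<Rightarrow> real \<Rightarrow> real \<Rightarrow> real \<Rightarrow> complex set" where
  "cell_box a b c d = cx -` {a<..<b} \<inter> cy -` {c<..<d}"

lemma mem_cell_box: "z \<in> cell_box a b c d \<longleftrightarrow> a < cx z \<and> cx z < b \<and> c < cy z \<and> cy z < d"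
  by (auto simp: cell_box_def)

lemma continuous_coords: "continuous_on A cx" "continuous_on A cy"
  unfolding cx_def cy_def using Im_pos by (auto intro!: continuous_intros)

lemma cell_box_open: "open (cell_box a b c d)" and cell_box_convex: "convex (cell_box a b c d)"
proof -
  show "open (cell_box a b c d)"
    unfolding cell_box_def by (intro open_Int open_vimage continuous_coords) auto
  show "convex (cell_box a b c d)"
    unfolding cell_box_def by (intro convex_Int convex_linear_vimage linear_coords) auto
qed

text \<open>Twice the period cell in each direction, centred at 0. It still contains no other
  lattice point, and neighbouring translates overlap, which is what the gluing in
  \<open>lame_global\<close> uses.\<close>

abbreviation "D0 \<equiv> cell_box (-1) 1 (-1) 1"

lemma lattice_coords:
  assumes "z \<in> L"
  obtains a b where "cx z = of_int a" "cy z = of_int b" "z = of_int a + of_int b * \<tau>"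
  using assms that by (auto simp: period_lattice_def)

lemma D0_lattice: "z \<in> D0 \<Longrightarrow> z \<in> L \<longleftrightarrow> z = 0"
proof
  assume z: "z \<in> D0" "z \<in> L"
  obtain a b where ab: "cx z = of_int a" "cy z = of_int b" "z = of_int a + of_int b * \<tau>"
    using lattice_coords[OF z(2)] .
  then have "a = 0" "b = 0" using z(1) by (auto simp: mem_cell_box)
  then show "z = 0" using ab by simp
qed auto

definition lame_q :: "nat \<Rightarrow> complex \<Rightarrow> complex \<Rightarrow> complex" where
  "lame_q n E z = of_nat n * (of_nat n + 1) * wpr z + E"

lemma lame_q_props:
  "open D0" "convex D0" "0 \<in> D0" "lame_q n E holomorphic_on D0" "lame_q n E (- z) = lame_q n E z"
proof -
  have "D0 \<subseteq> {z. (\<tau>, z) \<in> lattice_domain}" using D0_lattice by (auto simp: lattice_domain_iff)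
  then have "wpr holomorphic_on D0" using wpr_holomorphic holomorphic_on_subset by blast
  then show "lame_q n E holomorphic_on D0" unfolding lame_q_def[abs_def] by (intro holomorphic_intros)
qed (auto simp: cell_box_open cell_box_convex mem_cell_box lame_q_def wpr_even)

context
  fixes n :: nat and E :: complex
begin

abbreviation "lame_VE \<equiv> \<lambda>z. of_nat n * (of_nat n + 1) * wp z + E"
abbreviation "psi0 \<equiv> lame_psi n (lame_q n E)"
abbreviation "phi0 \<equiv> lame_phi n (lame_q n E)"

lemma lame_VE_eq: "of_nat n * (of_nat n + 1) / z\<^sup>2 + lame_q n E z = lame_VE z"
  by (simp add: lame_q_def wp_eq distrib_left)

lemma lame_VE_periodic: "z \<notin> L \<Longrightarrow> \<omega> \<in> L \<Longrightarrow> lame_VE (z + \<omega>) = lame_VE z"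
  by (simp add: wp_periodic)

lemma D0_open': "open (D0 - {0})" by (intro open_delete cell_box_open)

lemma local_solves: "solves_on lame_VE (D0 - {0}) psi0" "solves_on lame_VE (D0 - {0}) phi0"
  using lame_psi_solves[where n = n, OF lame_q_props(1-3) lame_q_props(4,5)[of n E]]
    lame_phi_solves[where n = n, OF lame_q_props(1-3) lame_q_props(4,5)[of n E]]
  unfolding lame_VE_eq by auto

lemma nz_wr: "2 * of_nat n + 1 \<noteq> (0::complex)"
  by (metis add_is_0 mult_2 of_nat_1 of_nat_add of_nat_eq_0_iff one_neq_zero)

lemma local_wr:
  assumes "z \<in> D0 - {0}"
  shows "wr psi0 phi0 z = 2 * of_nat n + 1"
proof -
  have con: "connected (D0 - {0})"
    by (intro connected_open_delete cell_box_open convex_connected cell_box_convex) simp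
  obtain c where c: "\<forall>z\<in>D0 - {0}. wr psi0 phi0 z = c"
    using wr_const[OF D0_open' con local_solves] by blast
  let ?u = "lame_u n (lame_q n E)" and ?v = "lame_v n (lame_q n E)"
  let ?h = "\<lambda>z. (2 * of_nat n + 1) * (?v z * ?u z) + z * (?v z * deriv ?u z - deriv ?v z * ?u z)"
  note q = lame_q_props(1-3) lame_q_props(4,5)[of n E]
  have u: "?u holomorphic_on D0" "?v holomorphic_on D0" "?u 0 = 1" "?v 0 = 1"
    using lame_u_props(1,2)[OF q(1-5)] lame_v_props(1,2)[OF q(1-5)] by auto
  have "?h holomorphic_on D0"
    by (intro holomorphic_intros u holomorphic_deriv cell_box_open)
  then have "?h analytic_on {0}" using q(1,3) by (auto simp: analytic_at)
  moreover have "\<forall>\<^sub>F z in at 0. z \<in> D0 - {0}" using q by (intro eventually_at_in_open) auto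
  then have "\<forall>\<^sub>F z in at 0. ?h z = c"
    by eventually_elim (use c lame_wronskian_local[OF q(1-5)] in \<open>auto simp: wr_def\<close>)
  ultimately have "?h 0 = c" by (rule analytic_at_eq_limit)
  then show ?thesis using u c assms by simp
qed

lemma local_parity:
  assumes "z \<in> D0"
  shows "psi0 (- z) = (-1) ^ n * psi0 z" "phi0 (- z) = - ((-1) ^ n) * phi0 z"
proof -
  note q = lame_q_props(1-3) lame_q_props(4,5)[of n E]
  have "(- z) ^ k = (-1) ^ k * z ^ k" for k by (rule power_minus)
  moreover have "x / ((-1) ^ n * y) = (-1) ^ n * (x / y)" for x y :: complex
    by (cases "even n") auto
  ultimately show "psi0 (- z) = (-1) ^ n * psi0 z" "phi0 (- z) = - ((-1) ^ n) * phi0 z"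
    using lame_u_props(4)[OF q(1-5) assms] lame_v_props(3)[OF q(1-5) assms]
    by (simp_all add: lame_psi_def lame_phi_def)
qed

text \<open>The reflection that sends \<open>z\<close> to \<open>- z - \<omega>\<close> preserves
  \<open>B\<close> and turns the shift by \<open>\<omega>\<close> into its inverse. With
  \<open>P = diag(1, -1)\<close> and \<open>M\<close> the shift matrix, parity then says
  \<open>P M P M = 1\<close>, and together with \<open>det M = 1\<close> this forces equal diagonal
  entries.\<close>

lemma local_shift:
  assumes \<omega>: "\<omega> \<in> L" and B: "open B" "connected B" "B \<noteq> {}"
    and sub: "\<And>z. z \<in> B \<Longrightarrow> z \<in> D0 - {0} \<and> z + \<omega> \<in> D0 - {0} \<and> - z - \<omega> \<in> B"
  obtains A Bc C where "A\<^sup>2 - Bc * C = 1"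
    "\<And>z. z \<in> B \<Longrightarrow> (psi0 (z + \<omega>), phi0 (z + \<omega>)) = mat_act A Bc C (psi0 z, phi0 z)"
proof -
  have BL: "z \<notin> L" if "z \<in> B" for z using sub[OF that] D0_lattice by auto
  have sh: "solves_on lame_VE B (\<lambda>z. psi0 (z + \<omega>))" "solves_on lame_VE B (\<lambda>z. phi0 (z + \<omega>))"
    by (rule solves_on_shift[OF D0_open' _ _ B(1)]; use local_solves sub lame_VE_periodic[OF BL \<omega>] in blast)+
  have s: "solves_on lame_VE B psi0" "solves_on lame_VE B phi0"
    using solves_on_shift[OF D0_open' local_solves(1) _ B(1), of 0] solves_on_shift[OF D0_open' local_solves(2) _ B(1), of 0] sub by auto
  have W: "wr psi0 phi0 z = 2 * of_nat n + 1" if "z \<in> B" for z using local_wr sub that by blast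
  obtain A Bc where 1: "\<And>z. z \<in> B \<Longrightarrow> psi0 (z + \<omega>) = A * psi0 z + Bc * phi0 z"
    using solution_lincomb[OF B(1,2) s sh(1) nz_wr W] by metis
  obtain C D where 2: "\<And>z. z \<in> B \<Longrightarrow> phi0 (z + \<omega>) = C * psi0 z + D * phi0 z"
    using solution_lincomb[OF B(1,2) s sh(2) nz_wr W] by metis
  obtain z0 where z0: "z0 \<in> B" using B by blast
  have hol: "psi0 holomorphic_on B" "phi0 holomorphic_on B" using s by (auto simp: solves_on_def)
  have W0: "wr psi0 phi0 z0 \<noteq> 0" using W[OF z0] nz_wr by simp
  have "wr psi0 phi0 (z0 + \<omega>) = (A * D - Bc * C) * wr psi0 phi0 z0"
    using wr_lincomb[OF B(1) z0 hol 1 2] by (simp add: wr_def deriv_shift)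
  then have det: "A * D - Bc * C = 1" using local_wr sub[OF z0] W[OF z0] nz_wr by simp
  \<comment> \<open>The shift relation at the reflected point, combined with parity, expresses the
    frame through itself; the coefficients are the entries of \<open>P M P M\<close>.\<close>
  have par: "1 * psi0 z + 0 * phi0 z = (A * A - Bc * C) * psi0 z + (A * Bc - Bc * D) * phi0 z"
    "0 * psi0 z + 1 * phi0 z = (D * C - C * A) * psi0 z + (D * D - C * Bc) * phi0 z" if z: "z \<in> B" for z
  proof -
    let ?w = "- z - \<omega>"
    have w: "?w \<in> B" "?w + \<omega> = - z" "?w = - (z + \<omega>)" using sub[OF z] by auto
    have p: "psi0 (- z) = (-1) ^ n * psi0 z" "phi0 (- z) = - ((-1) ^ n) * phi0 z"
      "psi0 ?w = (-1) ^ n * psi0 (z + \<omega>)" "phi0 ?w = - ((-1) ^ n) * phi0 (z + \<omega>)"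
      unfolding w(3) using local_parity sub[OF z] by blast+
    have n: "(-1 :: complex) ^ n \<noteq> 0" by simp
    have "(-1) ^ n * psi0 z = (-1) ^ n * (A * psi0 (z + \<omega>) - Bc * phi0 (z + \<omega>))"
      using 1[OF w(1)] unfolding w(2) p by (simp add: algebra_simps)
    then have a: "psi0 z = A * psi0 (z + \<omega>) - Bc * phi0 (z + \<omega>)" using n by (simp only: mult_cancel_left) simp
    have "(-1) ^ n * phi0 z = (-1) ^ n * (D * phi0 (z + \<omega>) - C * psi0 (z + \<omega>))"
      using 2[OF w(1)] unfolding w(2) p by (simp add: algebra_simps)
    then have b: "phi0 z = D * phi0 (z + \<omega>) - C * psi0 (z + \<omega>)" using n by (simp only: mult_cancel_left) simp
    show "1 * psi0 z + 0 * phi0 z = (A * A - Bc * C) * psi0 z + (A * Bc - Bc * D) * phi0 z"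
      using a unfolding 1[OF z] 2[OF z] by (simp add: algebra_simps)
    show "0 * psi0 z + 1 * phi0 z = (D * C - C * A) * psi0 z + (D * D - C * Bc) * phi0 z"
      using b unfolding 1[OF z] 2[OF z] by (simp add: algebra_simps)
  qed
  have e: "1 = A * A - Bc * C" "0 = A * Bc - Bc * D" "0 = D * C - C * A"
    using lincomb_unique[OF B(1) z0 hol W0 par(1)] lincomb_unique[OF B(1) z0 hol W0 par(2)] by blast+
  have "A = D"
  proof (rule ccontr)
    assume n: "A \<noteq> D"
    have "Bc * (A - D) = 0" "C * (A - D) = 0" "A * (A - D) = 0"
      using e det by (auto simp: algebra_simps)
    then have "A = 0" "Bc = 0" using n by auto
    then show False using e(1) by simp
  qed
  then show ?thesis
    using that[of A Bc C] e(1) 1 2 by (simp add: mat_act_def power2_eq_square)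
qed

text \<open>On the quarter box both shifts can be composed in either order without leaving the
  domain of the local frame. The results agree, and comparing coefficients gives the commutation
  relation.\<close>

lemma local_monodromy:
  obtains A1 B1 C1 A2 B2 C2 where
    "A1\<^sup>2 - B1 * C1 = 1" "A2\<^sup>2 - B2 * C2 = 1" "B1 * C2 = B2 * C1"
    "\<And>z. z \<in> cell_box (-1) 0 (-1) 1 \<Longrightarrow> (psi0 (z + 1), phi0 (z + 1)) = mat_act A1 B1 C1 (psi0 z, phi0 z)"
    "\<And>z. z \<in> cell_box (-1) 1 (-1) 0 \<Longrightarrow> (psi0 (z + \<tau>), phi0 (z + \<tau>)) = mat_act A2 B2 C2 (psi0 z, phi0 z)"
proof -
  let ?b1 = "cell_box (-1) 0 (-1) 1" and ?b2 = "cell_box (-1) 1 (-1) 0" and ?b3 = "cell_box (-1) 0 (-1) 0"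
  have "of_real (-1/2) * (1 + \<tau>) \<in> ?b3"
    unfolding mem_cell_box coord_simps by simp
  then obtain p0 where p: "p0 \<in> ?b3" by blast
  moreover have "?b3 \<subseteq> ?b1" "?b3 \<subseteq> ?b2" by (auto simp: mem_cell_box)
  ultimately have ne: "?b1 \<noteq> {}" "?b2 \<noteq> {}" "?b3 \<noteq> {}" by blast+
  have n0: "z \<noteq> 0" if "cx z \<noteq> 0 \<or> cy z \<noteq> 0" for z using that by auto
  have s1: "z \<in> D0 - {0} \<and> z + 1 \<in> D0 - {0} \<and> - z - 1 \<in> ?b1" if "z \<in> ?b1" for z
    using that n0[of z] n0[of "z + 1"] by (auto simp: mem_cell_box)
  have s2: "z \<in> D0 - {0} \<and> z + \<tau> \<in> D0 - {0} \<and> - z - \<tau> \<in> ?b2" if "z \<in> ?b2" for z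
    using that n0[of z] n0[of "z + \<tau>"] by (auto simp: mem_cell_box)
  have con: "connected (cell_box a b c d)" for a b c d by (simp add: cell_box_convex convex_connected)
  obtain A1 B1 C1 where 1: "A1\<^sup>2 - B1 * C1 = 1"
    "\<And>z. z \<in> ?b1 \<Longrightarrow> (psi0 (z + 1), phi0 (z + 1)) = mat_act A1 B1 C1 (psi0 z, phi0 z)"
    by (rule local_shift[of 1 ?b1, OF _ cell_box_open con ne(1) s1]) auto
  obtain A2 B2 C2 where 2: "A2\<^sup>2 - B2 * C2 = 1"
    "\<And>z. z \<in> ?b2 \<Longrightarrow> (psi0 (z + \<tau>), phi0 (z + \<tau>)) = mat_act A2 B2 C2 (psi0 z, phi0 z)"
    by (rule local_shift[of \<tau> ?b2, OF _ cell_box_open con ne(2) s2]) auto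
  have b3: "?b3 \<subseteq> D0 - {0}" by (auto simp: mem_cell_box)
  have hol: "psi0 holomorphic_on ?b3" "phi0 holomorphic_on ?b3"
    using local_solves holomorphic_on_subset[OF _ b3] by (auto simp: solves_on_def)
  have "(A2 * A1 + B2 * C1) * psi0 z + (A2 * B1 + B2 * A1) * phi0 z =
     (A1 * A2 + B1 * C2) * psi0 z + (A1 * B2 + B1 * A2) * phi0 z" if z: "z \<in> ?b3" for z
  proof -
    have m: "z \<in> ?b1" "z \<in> ?b2" "z + 1 \<in> ?b2" "z + \<tau> \<in> ?b1" using z by (auto simp: mem_cell_box)
    have "(psi0 (z + 1 + \<tau>), phi0 (z + 1 + \<tau>)) = (psi0 (z + \<tau> + 1), phi0 (z + \<tau> + 1))"
      by (simp add: add_ac)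
    then have "mat_act A2 B2 C2 (mat_act A1 B1 C1 (psi0 z, phi0 z)) = mat_act A1 B1 C1 (mat_act A2 B2 C2 (psi0 z, phi0 z))"
      unfolding 1(2)[OF m(4)] 2(2)[OF m(3)] 1(2)[OF m(1)] 2(2)[OF m(2)] .
    then show ?thesis by (simp add: mat_act_def algebra_simps)
  qed
  from lincomb_unique[OF cell_box_open p hol _ this]
  have "A2 * A1 + B2 * C1 = A1 * A2 + B1 * C2"
    using local_wr[OF subsetD[OF b3 p]] nz_wr by auto
  then have "B1 * C2 = B2 * C1" by (simp add: algebra_simps)
  then show ?thesis by (rule that[OF 1(1) 2(1) _ 1(2) 2(2)])
qed

text \<open>The frame is known only on \<open>D0\<close>. It is extended by decreeing
  quasi-periodicity, and \<open>local_monodromy\<close> is what makes the pieces agree on overlaps.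
  That some lower-left entry is nonzero will later allow the scaling factor to be recovered.\<close>

lemma lame_global:
  obtains \<psi> \<phi> A1 B1 C1 A2 B2 C2 where
    "solves_on lame_VE (- L) \<psi>" "solves_on lame_VE (- L) \<phi>"
    "\<And>z. z \<notin> L \<Longrightarrow> wr \<psi> \<phi> z = 2 * of_nat n + 1"
    "\<And>z. z \<in> D0 - {0} \<Longrightarrow> \<psi> z = psi0 z \<and> \<phi> z = phi0 z"
    "\<And>z. (\<psi> (z + 1), \<phi> (z + 1)) = mat_act A1 B1 C1 (\<psi> z, \<phi> z)"
    "\<And>z. (\<psi> (z + \<tau>), \<phi> (z + \<tau>)) = mat_act A2 B2 C2 (\<psi> z, \<phi> z)"
    "A1\<^sup>2 - B1 * C1 = 1" "A2\<^sup>2 - B2 * C2 = 1" "B1 * C2 = B2 * C1" "C1 \<noteq> 0 \<or> C2 \<noteq> 0"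
proof -
  obtain A1 B1 C1 A2 B2 C2 where det: "A1\<^sup>2 - B1 * C1 = 1" "A2\<^sup>2 - B2 * C2 = 1" and com: "B1 * C2 = B2 * C1"
    and s1: "\<And>z. z \<in> cell_box (-1) 0 (-1) 1 \<Longrightarrow> (psi0 (z + 1), phi0 (z + 1)) = mat_act A1 B1 C1 (psi0 z, phi0 z)"
    and s2: "\<And>z. z \<in> cell_box (-1) 1 (-1) 0 \<Longrightarrow> (psi0 (z + \<tau>), phi0 (z + \<tau>)) = mat_act A2 B2 C2 (psi0 z, phi0 z)"
    by (rule local_monodromy) (rule that, assumption+)
  define L1 where "L1 = mat_act A1 B1 C1"
  define L2 where "L2 = mat_act A2 B2 C2"
  define I1 where "I1 = ipow L1 (mat_act A1 (- B1) (- C1))"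
  define I2 where "I2 = ipow L2 (mat_act A2 (- B2) (- C2))"
  have c12: "L1 (L2 x) = L2 (L1 x)" for x unfolding L1_def L2_def by (rule mat_act_commute[OF com])
  have c12': "L1 (mat_act A2 (- B2) (- C2) x) = mat_act A2 (- B2) (- C2) (L1 x)"
       "L2 (mat_act A1 (- B1) (- C1) x) = mat_act A1 (- B1) (- C1) (L2 x)" for x
    unfolding L1_def L2_def by (rule mat_act_commute; use com in simp)+
  have I1s: "I1 (k + 1) x = L1 (I1 k x)" for k x
    unfolding I1_def by (rule ipow_succ) (simp add: L1_def mat_act_inverse[OF det(1)])
  have I2s: "I2 (k + 1) x = L2 (I2 k x)" for k x
    unfolding I2_def by (rule ipow_succ) (simp add: L2_def mat_act_inverse[OF det(2)])
  have "L1 (I1 k x) = I1 k (L1 x)" for k x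
    unfolding I1_def by (rule ipow_commute) (simp_all add: L1_def mat_act_inverse[OF det(1)])
  moreover have "L2 (I1 k x) = I1 k (L2 x)" for k x
    unfolding I1_def by (rule ipow_commute) (simp_all add: c12 c12')
  ultimately have I1c: "L1 (I1 k x) = I1 k (L1 x)" "L2 (I1 k x) = I1 k (L2 x)" for k x by auto
  have "L2 (I2 k x) = I2 k (L2 x)" for k x
    unfolding I2_def by (rule ipow_commute) (simp_all add: L2_def mat_act_inverse[OF det(2)])
  moreover have "L1 (I2 k x) = I2 k (L1 x)" for k x
    unfolding I2_def by (rule ipow_commute) (simp_all add: c12 c12')
  ultimately have I2c: "L2 (I2 k x) = I2 k (L2 x)" "L1 (I2 k x) = I2 k (L1 x)" for k x by auto
  \<comment> \<open>Linearity with constant coefficients ensures that a power of the period matrices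
    maps a pair of solutions to a pair of solutions.\<close>
  define lin :: "(complex \<times> complex \<Rightarrow> complex \<times> complex) \<Rightarrow> bool" where
    "lin f \<longleftrightarrow> (\<exists>x y w v. \<forall>s t. f (s, t) = (x * s + y * t, w * s + v * t))" for f
  have lin_id: "lin id" unfolding lin_def
    by (rule exI[of _ 1], rule exI[of _ 0], rule exI[of _ 0], rule exI[of _ 1]) simp
  have lin_comp: "lin (f \<circ> g)" if fg: "lin f" "lin g" for f g
  proof -
    obtain x y w v where f: "\<And>s t. f (s, t) = (x * s + y * t, w * s + v * t)" using fg(1) unfolding lin_def by blast
    obtain x' y' w' v' where g: "\<And>s t. g (s, t) = (x' * s + y' * t, w' * s + v' * t)" using fg(2) unfolding lin_def by blast
    show ?thesis unfolding lin_def
      by (rule exI[of _ "x * x' + y * w'"], rule exI[of _ "x * y' + y * v'"],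
          rule exI[of _ "w * x' + v * w'"], rule exI[of _ "w * y' + v * v'"])
         (simp add: f g algebra_simps)
  qed
  have lin_mat: "lin (mat_act A B C)" for A B C unfolding lin_def mat_act_def
    by (rule exI[of _ A], rule exI[of _ B], rule exI[of _ C], rule exI[of _ A]) simp
  have lin_I: "lin (I1 k)" "lin (I2 k)" for k
    unfolding I1_def I2_def L1_def L2_def by (rule ipow_induct[of lin, OF lin_id]; erule lin_comp[OF lin_mat])+
  define P0 where "P0 z = (psi0 z, phi0 z)" for z
  \<comment> \<open>The point is moved to the cell at the origin, the local frame is evaluated
    there, and integer powers of the period matrices compensate. \<open>glue\<close> shows that
    every admissible translate gives the same value.\<close>
  define G where "G z = I1 \<lfloor>cx z\<rfloor> (I2 \<lfloor>cy z\<rfloor> (P0 (z - of_int \<lfloor>cx z\<rfloor> - of_int \<lfloor>cy z\<rfloor> * \<tau>)))" for z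
  have glue: "G z = I1 a (I2 b (P0 (z - of_int a - of_int b * \<tau>)))"
    if z: "z - of_int a - of_int b * \<tau> \<in> D0" for z a b
  proof -
    let ?a = "\<lfloor>cx z\<rfloor>" and ?b = "\<lfloor>cy z\<rfloor>"
    have c: "\<bar>cx z - of_int a\<bar> < 1" "\<bar>cy z - of_int b\<bar> < 1" using z by (auto simp: mem_cell_box)
    \<comment> \<open>\<open>D0\<close> has twice the width of a cell, so an admissible translate
      differs from the one chosen by the floors by at most one step in each direction.\<close>
    have a: "?a = a \<or> ?a = a - 1" and b: "?b = b \<or> ?b = b - 1" using c by linarith+
    have "G z = I1 a (I2 ?b (P0 (z - of_int a - of_int ?b * \<tau>)))"
      using a
    proof
      assume a: "?a = a - 1"
      let ?w = "z - of_int a - of_int ?b * \<tau>"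
      have "?w \<in> cell_box (-1) 0 (-1) 1" using a c by (simp add: mem_cell_box) linarith
      from s1[OF this] have w: "P0 (?w + 1) = L1 (P0 ?w)" by (simp add: P0_def L1_def)
      have "G z = I1 (a - 1) (I2 ?b (P0 (z - of_int (a - 1) - of_int ?b * \<tau>)))"
        by (simp only: G_def a)
      also have "z - of_int (a - 1) - of_int ?b * \<tau> = ?w + 1" by simp
      also note w
      also have "I1 (a - 1) (I2 ?b (L1 (P0 ?w))) = I1 a (I2 ?b (P0 ?w))"
        using I1s[of "a - 1"] by (simp add: I1c I2c flip: I2c(2))
      finally show ?thesis .
    qed (simp add: G_def)
    also have "I2 ?b (P0 (z - of_int a - of_int ?b * \<tau>)) = I2 b (P0 (z - of_int a - of_int b * \<tau>))"
      using b
    proof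
      assume b: "?b = b - 1"
      let ?w = "z - of_int a - of_int b * \<tau>"
      have "?w \<in> cell_box (-1) 1 (-1) 0" using b c by (simp add: mem_cell_box) linarith
      from s2[OF this] have w: "P0 (?w + \<tau>) = L2 (P0 ?w)" by (simp add: P0_def L2_def)
      have "I2 ?b (P0 (z - of_int a - of_int ?b * \<tau>)) = I2 (b - 1) (P0 (z - of_int a - of_int (b - 1) * \<tau>))"
        by (simp only: b)
      also have "z - of_int a - of_int (b - 1) * \<tau> = ?w + \<tau>" by (simp add: algebra_simps)
      also note w
      also have "I2 (b - 1) (L2 (P0 ?w)) = I2 b (P0 ?w)"
        using I2s[of "b - 1"] by (simp add: I2c)
      finally show ?thesis .
    qed simp
    finally show ?thesis .
  qed
  define \<psi> where "\<psi> = (\<lambda>z. fst (G z))"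
  define \<phi> where "\<phi> = (\<lambda>z. snd (G z))"
  have G1: "G (z + 1) = L1 (G z)" for z
  proof -
    have fl: "\<lfloor>cx (z + 1)\<rfloor> = \<lfloor>cx z\<rfloor> + 1" "\<lfloor>cy (z + 1)\<rfloor> = \<lfloor>cy z\<rfloor>" by simp_all
    have e: "z + 1 - of_int (\<lfloor>cx z\<rfloor> + 1) - of_int \<lfloor>cy z\<rfloor> * \<tau> = z - of_int \<lfloor>cx z\<rfloor> - of_int \<lfloor>cy z\<rfloor> * \<tau>"
      by simp
    show ?thesis unfolding G_def fl e by (simp only: I1s)
  qed
  have G2: "G (z + \<tau>) = L2 (G z)" for z
  proof -
    have fl: "\<lfloor>cx (z + \<tau>)\<rfloor> = \<lfloor>cx z\<rfloor>" "\<lfloor>cy (z + \<tau>)\<rfloor> = \<lfloor>cy z\<rfloor> + 1" by simp_all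
    have e: "z + \<tau> - of_int \<lfloor>cx z\<rfloor> - of_int (\<lfloor>cy z\<rfloor> + 1) * \<tau> = z - of_int \<lfloor>cx z\<rfloor> - of_int \<lfloor>cy z\<rfloor> * \<tau>"
      by (simp add: algebra_simps)
    show ?thesis unfolding G_def fl e by (simp only: I2s I1c)
  qed
  have D0G: "\<psi> z = psi0 z \<and> \<phi> z = phi0 z" if "z \<in> D0" for z
    using glue[of z 0 0] that by (simp add: P0_def \<psi>_def \<phi>_def I1_def I2_def)
  note D0_open = D0_open'
  have loc: "\<exists>N g h. open N \<and> z \<in> N \<and> solves_on lame_VE N g \<and> solves_on lame_VE N h \<and> (\<forall>w\<in>N. \<psi> w = g w \<and> \<phi> w = h w)"
    if z: "z \<in> - L" for z
  proof -
    define a where "a = \<lfloor>cx z\<rfloor>"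
    define b where "b = \<lfloor>cy z\<rfloor>"
    define \<omega> where "\<omega> = - (of_int a + of_int b * \<tau>)"
    define N where "N = (\<lambda>w. w + \<omega>) -` (D0 - {0})"
    have \<omega>: "\<omega> \<in> L" unfolding \<omega>_def lattice_uminus_iff by (auto simp: period_lattice_def)
    have sub: "w + \<omega> = w - of_int a - of_int b * \<tau>" for w by (simp add: \<omega>_def)
    have N: "open N" unfolding N_def by (intro open_vimage D0_open continuous_intros)
    have "z + \<omega> \<in> D0" unfolding sub mem_cell_box coord_simps a_def b_def by simp linarith
    moreover have "z + \<omega> \<noteq> 0" using z lattice_add_iff[OF \<omega>, of z] by auto
    ultimately have zN: "z \<in> N" by (simp add: N_def)
    have NL: "w \<notin> L" if "w \<in> N" for w using that D0_lattice[of "w + \<omega>"] lattice_add_iff[OF \<omega>] by (auto simp: N_def)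
    have sh: "solves_on lame_VE N (\<lambda>w. psi0 (w + \<omega>))" "solves_on lame_VE N (\<lambda>w. phi0 (w + \<omega>))"
      by (rule solves_on_shift[OF D0_open _ _ N]; use local_solves lame_VE_periodic[OF NL \<omega>] in \<open>auto simp: N_def\<close>)+
    have "lin (I1 a \<circ> I2 b)" by (intro lin_comp lin_I)
    then obtain x y w v where l: "\<And>s t. (I1 a \<circ> I2 b) (s, t) = (x * s + y * t, w * s + v * t)"
      unfolding lin_def by blast
    have "G u = (x * psi0 (u + \<omega>) + y * phi0 (u + \<omega>), w * psi0 (u + \<omega>) + v * phi0 (u + \<omega>))" if "u \<in> N" for u
      using glue[of u a b] l that by (simp add: N_def sub P0_def)
    then show ?thesis
      using N zN solves_on_lincomb[OF N sh, of x y] solves_on_lincomb[OF N sh, of w v]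
      unfolding \<psi>_def \<phi>_def
      by (intro exI[of _ N] exI[of _ "\<lambda>u. x * psi0 (u + \<omega>) + y * phi0 (u + \<omega>)"]
            exI[of _ "\<lambda>u. w * psi0 (u + \<omega>) + v * phi0 (u + \<omega>)"]) simp
  qed
  have sol: "solves_on lame_VE (- L) \<psi>" "solves_on lame_VE (- L) \<phi>"
  proof -
    have l: "\<exists>N g. open N \<and> z \<in> N \<and> solves_on lame_VE N g \<and> (\<forall>w\<in>N. \<psi> w = g w)"
      "\<exists>N g. open N \<and> z \<in> N \<and> solves_on lame_VE N g \<and> (\<forall>w\<in>N. \<phi> w = g w)" if z: "z \<in> - L" for z
    proof -
      obtain N g h where N: "open N" "z \<in> N" "solves_on lame_VE N g" "solves_on lame_VE N h"
        "\<forall>w\<in>N. \<psi> w = g w \<and> \<phi> w = h w"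
        using loc[OF z] by (elim exE conjE)
      show "\<exists>N g. open N \<and> z \<in> N \<and> solves_on lame_VE N g \<and> (\<forall>w\<in>N. \<psi> w = g w)"
        using N by (intro exI[of _ N] exI[of _ g]) simp
      show "\<exists>N g. open N \<and> z \<in> N \<and> solves_on lame_VE N g \<and> (\<forall>w\<in>N. \<phi> w = g w)"
        using N by (intro exI[of _ N] exI[of _ h]) simp
    qed
    show "solves_on lame_VE (- L) \<psi>" by (rule solves_on_local[OF l(1) open_compl_lattice])
    show "solves_on lame_VE (- L) \<phi>" by (rule solves_on_local[OF l(2) open_compl_lattice])
  qed
  obtain c where c: "\<forall>z\<in>- L. wr \<psi> \<phi> z = c"
    using wr_const[OF open_compl_lattice connected_compl_lattice sol] by blast
  have wr0: "wr \<psi> \<phi> z = 2 * of_nat n + 1" if z: "z \<in> D0 - {0}" for z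
  proof -
    have hol: "psi0 holomorphic_on D0 - {0}" "phi0 holomorphic_on D0 - {0}"
      using local_solves by (auto simp: solves_on_def)
    have "wr \<psi> \<phi> z = (1 * 1 - 0 * 0) * wr psi0 phi0 z"
      by (rule wr_lincomb[OF D0_open z hol]) (use D0G in auto)
    then show ?thesis using local_wr[OF z] by simp
  qed
  have z1: "of_real (1/2) * 1 \<in> D0 - {0}" unfolding Diff_iff mem_cell_box coord_simps by simp
  then have "of_real (1/2) * 1 \<in> - L" using D0_lattice by blast
  with c wr0[OF z1] have W: "\<And>z. z \<notin> L \<Longrightarrow> wr \<psi> \<phi> z = 2 * of_nat n + 1" by (metis ComplI)
  \<comment> \<open>If both entries vanished, \<open>A1\<close> and \<open>A2\<close> would be signs
    and the square of \<open>\<phi>\<close> would be elliptic with only removable singularities,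
    hence constant; but it has a zero of order \<open>2 * n + 2\<close> at 0 and is nonzero
    nearby.\<close>
  have "C1 \<noteq> 0 \<or> C2 \<noteq> 0"
  proof (rule ccontr)
    assume "\<not> (C1 \<noteq> 0 \<or> C2 \<noteq> 0)"
    then have C: "C1 = 0" "C2 = 0" by auto
    then have A: "A1\<^sup>2 = 1" "A2\<^sup>2 = 1" using det by auto
    let ?f = "\<lambda>z. (\<phi> z)\<^sup>2"
    have "\<phi> (z + 1) = A1 * \<phi> z" "\<phi> (z + \<tau>) = A2 * \<phi> z" for z
      using G1[of z] G2[of z] C unfolding \<phi>_def L1_def L2_def mat_act_def by (simp_all add: split_beta)
    then have p: "?f (z + 1) = ?f z" "?f (z + \<tau>) = ?f z" for z
      by (simp_all add: power_mult_distrib A)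
    have per: "?f (z + \<omega>) = ?f z" if w: "\<omega> \<in> L" for z \<omega>
    proof -
      obtain a b where "\<omega> = of_int a * 1 + of_int b * \<tau>" using w by (auto simp: period_lattice_def)
      then show ?thesis using periodic_int[of ?f 1 "z + of_int b * \<tau>" a, OF p(1)] periodic_int[of ?f \<tau> z b, OF p(2)]
        by (simp add: add_ac)
    qed
    note q = lame_q_props(1-3) lame_q_props(4,5)[of n E]
    have u: "lame_u n (lame_q n E) analytic_on {0}" "lame_u n (lame_q n E) 0 = 1"
      using lame_u_props(1,2)[OF q] q by (auto simp: analytic_at)
    have ev0: "\<forall>\<^sub>F z in at 0. ?f z = (z ^ (n + 1) * lame_u n (lame_q n E) z)\<^sup>2 \<and> z \<noteq> 0"
      using eventually_at_in_open[OF q(1,3)]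
      by eventually_elim (use D0G in \<open>auto simp: lame_phi_def\<close>)
    have r0: "removable_at ?f 0"
      by (rule removable_atI[of "\<lambda>z. (z ^ (n + 1) * lame_u n (lame_q n E) z)\<^sup>2"])
         (use u ev0 in \<open>auto intro!: analytic_intros elim: eventually_mono\<close>)
    have "\<phi> analytic_on - L" using sol(2) open_compl_lattice by (simp add: solves_on_def analytic_on_open)
    then have an: "?f analytic_on {z}" if "z \<notin> L" for z
      using that by (intro analytic_intros) (auto intro: analytic_on_subset)
    have reps: "\<exists>\<omega>\<in>L. removable_at ?f (s + \<omega>)" for s
    proof (cases "s \<in> L")
      case True
      then show ?thesis using r0 by (intro bexI[of _ "- s"]) auto
    next
      case False
      then show ?thesis using removable_at_analytic[OF an, of "s + 0"] by (intro bexI[of _ 0]) auto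
    qed
    obtain c where c: "\<And>s. \<forall>\<^sub>F z in at s. ?f z = c"
      by (rule elliptic_const[of L ?f, OF eventually_not_lattice per reps]) auto
    have "\<forall>\<^sub>F z in at 0. (z ^ (n + 1) * lame_u n (lame_q n E) z)\<^sup>2 = c"
      using c[of 0] ev0 by eventually_elim simp
    from analytic_at_eq_limit[OF _ this] u have "c = 0" by (simp add: analytic_intros)
    have "isCont (lame_u n (lame_q n E)) 0" using u(1) by (rule analytic_at_imp_isCont)
    then have "\<forall>\<^sub>F z in at 0. lame_u n (lame_q n E) z \<noteq> 0"
      unfolding isCont_def u(2) by (rule tendsto_imp_eventually_ne) simp
    then have "\<forall>\<^sub>F z in at (0::complex). False"
      using c[of 0] ev0 by eventually_elim (use \<open>c = 0\<close> in auto)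
    then show False by simp
  qed
  note C12 = this
  show ?thesis
    by (rule that[OF sol W _ _ _ det com C12]) (use D0G G1 G2 in \<open>auto simp: \<psi>_def \<phi>_def L1_def L2_def\<close>)
qed

end

end

section \<open>Reduction to the Lame equation\<close>

text \<open>Continuing \<open>y i\<close> and \<open>y j\<close> along a path preserves the relation \<open>y i * y j * H = K\<close> with
  single-valued \<open>H\<close> and \<open>K\<close>; products avoid continuing the square root of \<open>H\<close> itself.\<close>

lemma analytic_continuation_product:
  assumes \<gamma>: "continuous_on {0..1} \<gamma>"
    and F1: "analytic_continuation_along \<gamma> f1 g1" and F2: "analytic_continuation_along \<gamma> f2 g2"
    and HK: "\<And>t. t \<in> {0..1} \<Longrightarrow> H analytic_on {\<gamma> t} \<and> K analytic_on {\<gamma> t}"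
    and start: "\<forall>\<^sub>F z in nhds (\<gamma> 0). f1 z * f2 z * H z = K z"
  shows "\<forall>\<^sub>F z in nhds (\<gamma> 1). g1 z * g2 z * H z = K z"
proof -
  obtain F where F: "\<And>t. t \<in> {0..1} \<Longrightarrow> F t analytic_on {\<gamma> t}"
    "\<And>t. t \<in> {0..1} \<Longrightarrow> \<forall>\<^sub>F s in at t within {0..1}. \<forall>\<^sub>F z in nhds (\<gamma> s). F s z = F t z"
    "\<forall>\<^sub>F z in nhds (\<gamma> 0). F 0 z = f1 z" "\<forall>\<^sub>F z in nhds (\<gamma> 1). F 1 z = g1 z"
    using F1 unfolding analytic_continuation_along_def by blast
  obtain G where G: "\<And>t. t \<in> {0..1} \<Longrightarrow> G t analytic_on {\<gamma> t}"
    "\<And>t. t \<in> {0..1} \<Longrightarrow> \<forall>\<^sub>F s in at t within {0..1}. \<forall>\<^sub>F z in nhds (\<gamma> s). G s z = G t z"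
    "\<forall>\<^sub>F z in nhds (\<gamma> 0). G 0 z = f2 z" "\<forall>\<^sub>F z in nhds (\<gamma> 1). G 1 z = g2 z"
    using F2 unfolding analytic_continuation_along_def by blast
  let ?D = "\<lambda>t z. F t z * G t z * H z - K z"
  let ?P = "\<lambda>t. \<forall>\<^sub>F z in nhds (\<gamma> t). ?D t z = 0"
  have "?P 1"
  \<comment> \<open>Near a fixed \<open>t\<close> the relation at every parameter can be tested on
    the single function element \<open>?D t\<close>, and the identity theorem on a ball spreads it
    from \<open>\<gamma> x\<close> to \<open>\<gamma> y\<close>.\<close>
  proof (rule connected_induction_simple[of "{0..1::real}" 0 1 ?P])
    show "?P 0" using start F(3) G(3) by eventually_elim simp
    fix t :: real assume t: "t \<in> {0..1}"
    have "?D t analytic_on {\<gamma> t}" using F(1) G(1) HK t by (intro analytic_intros) auto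
    then obtain e where e: "e > 0" "?D t holomorphic_on ball (\<gamma> t) e"
      by (auto simp: analytic_on_def)
    have "\<forall>\<^sub>F s in at t within {0..1}. \<gamma> s \<in> ball (\<gamma> t) e"
      using tendstoD[OF bspec[OF \<gamma>[unfolded continuous_on_def] t] e(1)] by (simp add: dist_commute)
    then have ev: "\<forall>\<^sub>F s in at t within {0..1}. \<gamma> s \<in> ball (\<gamma> t) e \<and>
        (\<forall>\<^sub>F z in nhds (\<gamma> s). ?D s z = ?D t z)"
      using F(2)[OF t] G(2)[OF t]
    proof eventually_elim
      case (elim s)
      then show ?case by (auto elim: eventually_elim2)
    qed
    then obtain d where d: "d > 0" "\<And>s. s \<in> {0..1} \<Longrightarrow> s \<noteq> t \<Longrightarrow> dist s t < d \<Longrightarrow>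
        \<gamma> s \<in> ball (\<gamma> t) e \<and> (\<forall>\<^sub>F z in nhds (\<gamma> s). ?D s z = ?D t z)"
      unfolding eventually_at by blast
    have d': "\<gamma> s \<in> ball (\<gamma> t) e \<and> (\<forall>\<^sub>F z in nhds (\<gamma> s). ?D s z = ?D t z)"
      if "s \<in> {0..1} \<inter> ball t d" for s
      using d(2)[of s] that e(1) by (cases "s = t") (auto simp: dist_commute)
    show "\<exists>T. openin (top_of_set {0..1}) T \<and> t \<in> T \<and> (\<forall>x\<in>T. \<forall>y\<in>T. ?P x \<longrightarrow> ?P y)"
    proof (intro exI[of _ "{0..1} \<inter> ball t d"] conjI ballI impI)
      show "openin (top_of_set {0..1}) ({0..1} \<inter> ball t d)" by (rule openin_open_Int) simp
      show "t \<in> {0..1} \<inter> ball t d" using t d by simp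
      fix x y assume x: "x \<in> {0..1} \<inter> ball t d" and y: "y \<in> {0..1} \<inter> ball t d" and P: "?P x"
      have "\<forall>\<^sub>F z in nhds (\<gamma> x). ?D t z = 0" using P conjunct2[OF d'[OF x]] by eventually_elim simp
      then obtain U where U: "open U" "\<gamma> x \<in> U" "\<And>z. z \<in> U \<Longrightarrow> ?D t z = 0"
        unfolding eventually_nhds by blast
      have 0: "?D t z = 0" if "z \<in> ball (\<gamma> t) e" for z
        by (rule analytic_continuation_open[of "U \<inter> ball (\<gamma> t) e" "ball (\<gamma> t) e" "?D t" "\<lambda>_. 0"])
           (use U d'[OF x] e that in auto)
      have "\<forall>\<^sub>F z in nhds (\<gamma> y). z \<in> ball (\<gamma> t) e" using d'[OF y] by (intro eventually_nhds_in_open) auto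
      then show "?P y" using conjunct2[OF d'[OF y]] by eventually_elim (simp add: 0)
    qed
  qed auto
  then show ?thesis using F(4) G(4) by eventually_elim simp
qed

abbreviation mat_entry :: "complex^2^2 \<Rightarrow> 2 \<Rightarrow> 2 \<Rightarrow> complex" where
  "mat_entry M i j \<equiv> vec_nth (vec_nth M i) j"

text \<open>The quotient of \<open>W k\<close> by \<open>H k\<close> has square 1, so it is a
  constant sign on a small ball free of zeros of \<open>H k\<close>. The mixed products with index
  \<open>k\<close> transfer this one sign to every \<open>i\<close>, which is why products are kept
  besides squares; analytic continuation covers the whole ball.\<close>

lemma germ_sign:
  assumes e: "e > 0" and hol: "\<And>i. W i holomorphic_on ball z0 e" "\<And>i. H i holomorphic_on ball z0 e"
    and eq: "\<And>i j z. z \<in> ball z0 e \<Longrightarrow> W i z * W j z = H i z * H j z"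
    and nz: "\<exists>z\<in>ball z0 e. H k z \<noteq> 0"
  shows "\<exists>\<epsilon>\<in>{1,-1::complex}. \<forall>i. \<forall>z\<in>ball z0 e. W i z = \<epsilon> * H i z"
proof -
  obtain z1 where z1: "z1 \<in> ball z0 e" "H k z1 \<noteq> 0" using nz by blast
  have "open {z \<in> ball z0 e. H k z \<in> - {0}}"
    using continuous_open_preimage[OF holomorphic_on_imp_continuous_on[OF hol(2)[of k]] open_ball, of "- {0}"]
    by (simp add: vimage_def Int_def conj_commute open_Compl)
  then obtain d where d: "d > 0" "ball z1 d \<subseteq> {z \<in> ball z0 e. H k z \<in> - {0}}"
    using z1 by (metis (mono_tags, lifting) ComplI mem_Collect_eq open_contains_ball singletonD)
  have sub: "ball z1 d \<subseteq> ball z0 e" and kz: "\<And>z. z \<in> ball z1 d \<Longrightarrow> H k z \<noteq> 0" using d by auto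
  let ?r = "\<lambda>z. W k z / H k z"
  have r2: "(?r z)\<^sup>2 = 1" if "z \<in> ball z1 d" for z
    using eq[of z k k] that sub kz by (auto simp: power2_eq_square field_simps)
  have "?r holomorphic_on ball z1 d"
    using kz by (intro holomorphic_intros holomorphic_on_subset[OF hol(1) sub] holomorphic_on_subset[OF hol(2) sub]) auto
  then have "continuous_on (ball z1 d) ?r" by (rule holomorphic_on_imp_continuous_on)
  then have "?r constant_on ball z1 d"
  proof (rule continuous_finite_range_constant[rotated])
    have "?r z \<in> {1, -1}" if "z \<in> ball z1 d" for z
      using r2[OF that] unfolding power2_eq_1_iff by blast
    then have "?r ` ball z1 d \<subseteq> {1, -1}" by blast
    then show "finite (?r ` ball z1 d)" using finite_subset by blast
  qed simp
  then obtain \<epsilon> where \<epsilon>: "\<And>z. z \<in> ball z1 d \<Longrightarrow> ?r z = \<epsilon>" by (auto simp: constant_on_def)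
  have "\<epsilon>\<^sup>2 = 1" using r2[of z1] \<epsilon>[of z1] d by simp
  then have e1: "\<epsilon> \<in> {1, -1}" by (simp add: power2_eq_1_iff)
  have "W i z = \<epsilon> * H i z" if z: "z \<in> ball z0 e" for i z
  proof (rule analytic_continuation_open[of "ball z1 d" "ball z0 e" "W i" "\<lambda>z. \<epsilon> * H i z"])
    fix z assume z: "z \<in> ball z1 d"
    have "W k z = \<epsilon> * H k z" using \<epsilon>[OF z] kz[OF z] by (simp add: field_simps)
    then have "\<epsilon> * H k z * W i z = H k z * H i z" using eq[of z k i] z sub by auto
    then have "\<epsilon> * W i z = H i z" using kz[OF z] by simp
    moreover have "W i z = \<epsilon> * (\<epsilon> * W i z)" using e1 by auto
    ultimately show "W i z = \<epsilon> * H i z" by simp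
  qed (use d sub hol z in \<open>auto intro!: holomorphic_intros\<close>)
  with e1 show ?thesis by blast
qed

section \<open>Germs of solutions of GLE and their Lame counterparts\<close>

context torus_point
begin

lemma S_closed: "open (- S)"
proof -
  have "- S = - L \<inter> (\<lambda>z. z - p) -` (- L) \<inter> (\<lambda>z. z + p) -` (- L)"
    by (auto simp: gle1_singularities_def)
  then show ?thesis
    by (auto intro!: open_Int open_vimage open_compl_lattice continuous_intros)
qed

context
  fixes n :: nat and T :: complex
  assumes n: "n > 0"
begin

definition lame_E :: complex where "lame_E = T\<^sup>2 - of_nat n * (of_nat n + 1) * wp p"

abbreviation "N \<equiv> of_nat n * (of_nat n + 1) :: complex"
abbreviation "gle_lame_V \<equiv> \<lambda>z. of_nat n * (of_nat n + 1) * wp z + lame_E"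

lemma N_nz: "N \<noteq> 0"
proof -
  have "N = of_nat (n * (n + 1))" by (simp add: algebra_simps)
  then show ?thesis using n by (simp only: of_nat_eq_0_iff) simp
qed

lemma gle_lame_V_eq: "gle_lame_V z = N * v z + T\<^sup>2"
  by (simp add: lame_E_def v_def algebra_simps)

text \<open>If \<open>f'' = gle_lame_V f\<close> and \<open>g = f' - T f\<close>, then \<open>g / sqrt v\<close> solves \<open>GLE\<close>; the lemma inverts this
  transformation, with \<open>f = (g' + T g) / (N v)\<close>.\<close>

lemma gle_to_lame:
  assumes B: "open B" "B \<subseteq> - S" and s: "s holomorphic_on B" "\<And>z. z \<in> B \<Longrightarrow> v z = (s z)\<^sup>2"
    and y: "solves_on (gle1_potential n p T \<tau>) B y"
  obtains f where "solves_on gle_lame_V B f" "\<And>z. z \<in> B \<Longrightarrow> deriv f z - T * f z = y z * s z"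
proof -
  let ?R' = "\<lambda>z. - wp (z + p) - wp (z - p) + 2 * wp z"
  define g where "g z = y z * s z" for z
  define g' where "g' z = deriv y z * s z + y z * (R z * s z / 2)" for z
  define f where "f z = (g' z + T * g z) / (N * v z)" for z
  have zS: "z \<notin> S" "v z \<noteq> 0" "s z \<noteq> 0" if "z \<in> B" for z
    using B(2) that v_nz[of z] s(2)[OF that] by auto
  have dv: "(v has_field_derivative v z * R z) (at z)" if "z \<in> B" for z
    using deriv_v[of z] vR[of z] zS(1)[OF that] notin_S_iff by simp
  \<comment> \<open>The logarithmic derivative of a square root of \<open>v\<close> is
    \<open>R / 2\<close>.\<close>
  have ds: "(s has_field_derivative R z * s z / 2) (at z)" if z: "z \<in> B" for z
  proof -
    have d: "(s has_field_derivative deriv s z) (at z)" using holomorphic_derivI[OF s(1) B(1) z] .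
    then have "((\<lambda>z. (s z)\<^sup>2) has_field_derivative 2 * s z * deriv s z) (at z)"
      by (auto intro!: derivative_eq_intros)
    then have "(v has_field_derivative 2 * s z * deriv s z) (at z)"
      by (rule has_field_derivative_transform_within_open[OF _ B(1) z]) (simp add: s(2))
    from DERIV_unique[OF this dv[OF z]] have "2 * s z * deriv s z = s z * s z * R z"
      by (simp add: s(2)[OF z] power2_eq_square)
    then have "deriv s z = R z * s z / 2" using zS(3)[OF z] by (simp add: field_simps)
    from d[unfolded this] show ?thesis .
  qed
  note dy = solves_onD[OF B(1) y]
  have dg: "(g has_field_derivative g' z) (at z)" if z: "z \<in> B" for z
    unfolding g_def[abs_def]
    by (rule DERIV_cong[OF DERIV_mult[OF dy(1)[OF z] ds[OF z]]]) (simp add: g'_def)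
  \<comment> \<open>Once \<open>R z * g' z\<close> is subtracted, the square root contributes half
    the derivative of \<open>R\<close> minus \<open>(R z)\<^sup>2 / 4\<close>, which cancels the
    corresponding terms of \<open>potential_eq\<close>.\<close>
  have dg': "(g' has_field_derivative R z * g' z + (T\<^sup>2 + T * R z + N * v z) * g z) (at z)" if z: "z \<in> B" for z
  proof -
    have "((\<lambda>z. deriv y z * s z + y z * (R z * s z / 2)) has_field_derivative
       (gle1_potential n p T \<tau> z * y z) * s z + (R z * s z / 2) * deriv y z +
       (deriv y z * (R z * s z / 2) + (?R' z * s z + (R z * s z / 2) * R z) / 2 * y z)) (at z)"
      by (intro DERIV_add DERIV_mult DERIV_cdivide dy ds R_deriv zS z)
    moreover have "(gle1_potential n p T \<tau> z * y z) * s z + (R z * s z / 2) * deriv y z +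
       (deriv y z * (R z * s z / 2) + (?R' z * s z + (R z * s z / 2) * R z) / 2 * y z) =
       R z * g' z + (T\<^sup>2 + T * R z + N * v z) * g z"
      unfolding potential_eq[OF zS(1)[OF z]] g'_def g_def
      by (simp add: field_simps power2_eq_square)
    ultimately show ?thesis by (simp add: g'_def[abs_def])
  qed
  have df: "(f has_field_derivative g z + T * f z) (at z)" if z: "z \<in> B" for z
  proof -
    have nz: "N * v z \<noteq> 0" using N_nz zS(2)[OF z] by simp
    have "(f has_field_derivative
      ((R z * g' z + (T\<^sup>2 + T * R z + N * v z) * g z + T * g' z) * (N * v z) - (g' z + T * g z) * (N * (v z * R z))) /
        ((N * v z) * (N * v z))) (at z)"
      unfolding f_def[abs_def]
      by (intro DERIV_divide DERIV_add DERIV_cmult dg dg' dv z nz)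
    moreover have "((R z * g' z + (T\<^sup>2 + T * R z + N * v z) * g z + T * g' z) * (N * v z) - (g' z + T * g z) * (N * (v z * R z))) /
        ((N * v z) * (N * v z)) = g z + T * f z"
    proof -
      define M where "M = N * v z"
      have "((R z * g' z + (T\<^sup>2 + T * R z + M) * g z + T * g' z) * M - (g' z + T * g z) * (M * R z)) =
         M * (M * g z + T * (g' z + T * g z))" by (simp add: algebra_simps power2_eq_square)
      moreover have M: "M \<noteq> 0" and "g' z + T * g z = M * f z" and e: "N * (v z * R z) = M * R z"
        using nz by (simp_all add: M_def f_def)
      ultimately have "((R z * g' z + (T\<^sup>2 + T * R z + M) * g z + T * g' z) * M - (g' z + T * g z) * (M * R z)) =
         (g z + T * f z) * (M * M)" by (simp add: algebra_simps)
      then show ?thesis unfolding M_def[symmetric] e using M by simp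
    qed
    ultimately show ?thesis by simp
  qed
  have "solves_on gle_lame_V B f"
  proof (rule solves_onI[OF B(1) df])
    fix z assume z: "z \<in> B"
    have "((\<lambda>z. g z + T * f z) has_field_derivative g' z + T * (g z + T * f z)) (at z)"
      by (intro DERIV_add DERIV_cmult dg df z)
    moreover have "g' z = N * v z * f z - T * g z"
      using N_nz zS(2)[OF z] by (simp add: f_def)
    ultimately show "((\<lambda>z. g z + T * f z) has_field_derivative gle_lame_V z * f z) (at z)"
      unfolding gle_lame_V_eq by (simp add: algebra_simps power2_eq_square)
  qed
  then show ?thesis
    by (rule that) (simp add: DERIV_imp_deriv[OF df] g_def)
qed

text \<open>A relation \<open>w (z + \<omega>) = \<epsilon> (M y)(z)\<close> between germs of the first-order transforms
  \<open>g = f' - T f\<close> passes to the functions \<open>f\<close> themselves.\<close>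

lemma transform_relation:
  assumes f: "solves_on gle_lame_V (- L) f" "solves_on gle_lame_V (- L) h" and \<omega>: "\<omega> \<in> L"
    and U: "open U" "U \<subseteq> - S"
    and eq: "\<And>z. z \<in> U \<Longrightarrow> deriv f (z + \<omega>) - T * f (z + \<omega>) = deriv h z - T * h z" and z: "z \<in> U"
  shows "f (z + \<omega>) = h z"
proof -
  have zL: "z \<notin> L" "z + \<omega> \<notin> L" if "z \<in> U" for z
    using U(2) that lattice_add_iff[OF \<omega>] notin_S_iff by auto
  note df = solves_onD[OF open_compl_lattice f(1)] and dh = solves_onD[OF open_compl_lattice f(2)]
  have d: "((\<lambda>z. deriv f z - T * f z) has_field_derivative N * v z * f z - T * (deriv f z - T * f z)) (at z)" if "z \<notin> L" for z
  proof -
    have "((\<lambda>z. deriv f z - T * f z) has_field_derivative gle_lame_V z * f z - T * deriv f z) (at z)"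
      using that by (intro DERIV_diff DERIV_cmult df) auto
    then show ?thesis unfolding gle_lame_V_eq by (simp add: algebra_simps power2_eq_square)
  qed
  have d': "((\<lambda>z. deriv h z - T * h z) has_field_derivative N * v z * h z - T * (deriv h z - T * h z)) (at z)" if "z \<notin> L" for z
  proof -
    have "((\<lambda>z. deriv h z - T * h z) has_field_derivative gle_lame_V z * h z - T * deriv h z) (at z)"
      using that by (intro DERIV_diff DERIV_cmult dh) auto
    then show ?thesis unfolding gle_lame_V_eq by (simp add: algebra_simps power2_eq_square)
  qed
  have "((\<lambda>z. deriv f (z + \<omega>) - T * f (z + \<omega>)) has_field_derivative
      N * v (z + \<omega>) * f (z + \<omega>) - T * (deriv f (z + \<omega>) - T * f (z + \<omega>))) (at z)"
    using DERIV_add_shift[OF d[OF zL(2)[OF z]]] .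
  then have "((\<lambda>z. deriv h z - T * h z) has_field_derivative
      N * v (z + \<omega>) * f (z + \<omega>) - T * (deriv f (z + \<omega>) - T * f (z + \<omega>))) (at z)"
    by (rule has_field_derivative_transform_within_open[OF _ U(1) z]) (simp add: eq)
  \<comment> \<open>Differentiating the given relation brings in
    \<open>N * v z * f (z + \<omega>)\<close>, from which \<open>f\<close> is recovered because
    \<open>v\<close> has no zero off \<open>S\<close>.\<close>
  from DERIV_unique[OF this d'[OF zL(1)[OF z]]]
  have "N * v (z + \<omega>) * f (z + \<omega>) = N * v z * h z" using eq[OF z] by simp
  moreover have "z \<notin> S" using z U by auto
  then have "v (z + \<omega>) = v z" "v z \<noteq> 0" using periodic(1)[OF _ \<omega>] v_nz by auto
  ultimately show ?thesis using N_nz by simp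
qed

text \<open>On a small disc a branch \<open>s\<close> of the square root of \<open>v\<close> exists,
  and \<open>gle_to_lame\<close> turns each \<open>y i\<close> into a Lame solution with
  coefficients \<open>a i\<close> and \<open>b i\<close>. Linear independence of the germs becomes
  invertibility of the coefficient matrix.\<close>

lemma basis_to_lame:
  assumes z0: "z0 \<notin> S" and y: "solution_basis (gle1_potential n p T \<tau>) z0 y"
    and sol: "solves_on gle_lame_V (- L) \<psi>" "solves_on gle_lame_V (- L) \<phi>" and W: "W \<noteq> 0" "\<And>z. z \<notin> L \<Longrightarrow> wr \<psi> \<phi> z = W"
  obtains a b :: "2 \<Rightarrow> complex" and e s where "e > 0" "ball z0 e \<subseteq> - S" "\<And>z. z \<in> ball z0 e \<Longrightarrow> v z = (s z)\<^sup>2"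
    "\<And>i z. z \<in> ball z0 e \<Longrightarrow> a i * deriv \<psi> z + b i * deriv \<phi> z - T * (a i * \<psi> z + b i * \<phi> z) = y i z * s z"
    "a 1 * b 2 - a 2 * b 1 \<noteq> 0"
proof -
  let ?q = "gle1_potential n p T \<tau>"
  have loc: "\<exists>e>0. solves_on ?q (ball z0 e) (y i)" for i
  proof -
    have "local_solution ?q z0 (y i)" using y by (simp add: solution_basis_def)
    then obtain A U where A: "open A" "z0 \<in> A" "y i holomorphic_on A"
      and U: "open U" "z0 \<in> U" "\<And>z. z \<in> U \<Longrightarrow> (deriv ^^ 2) (y i) z = ?q z * y i z"
      unfolding local_solution_def analytic_at eventually_nhds by blast
    have "open (A \<inter> U)" "z0 \<in> A \<inter> U" using A U by auto
    then obtain e where e: "e > 0" "ball z0 e \<subseteq> A \<inter> U" using open_contains_ball by blast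
    then have "solves_on ?q (ball z0 e) (y i)"
      using A U by (auto simp: solves_on_def numeral_2_eq_2 intro: holomorphic_on_subset)
    then show ?thesis using e by blast
  qed
  then obtain ee where ee: "\<And>i. ee i > 0" "\<And>i. solves_on ?q (ball z0 (ee i)) (y i)" by metis
  obtain e0 where e0: "e0 > 0" "ball z0 e0 \<subseteq> - S"
    using S_closed z0 open_contains_ball by (metis ComplI)
  define e where "e = min e0 (min (ee 1) (ee 2))"
  define B where "B = ball z0 e"
  have e: "e > 0" "B \<subseteq> - S" "\<And>i. B \<subseteq> ball z0 (ee i)"
  proof -
    show "e > 0" "B \<subseteq> - S" using e0 ee(1) by (auto simp: e_def B_def)
    show "B \<subseteq> ball z0 (ee i)" for i
      using exhaust_2[of i] by (auto simp: e_def B_def)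
  qed
  have B: "open B" "connected B" "z0 \<in> B" "B \<subseteq> - L" using e notin_S_iff by (auto simp: B_def)
  have ys: "solves_on ?q B (y i)" for i
    using ee(2)[of i] e(3)[of i] unfolding solves_on_def by (meson holomorphic_on_subset subsetD)
  have "v holomorphic_on B" using B deriv_v unfolding holomorphic_on_open[OF B(1)] by blast
  then obtain s where s: "s holomorphic_on B" "\<And>z. z \<in> B \<Longrightarrow> v z = (s z)\<^sup>2"
    by (rule contractible_imp_holomorphic_sqrt) (use e v_nz in \<open>auto simp: B_def convex_imp_contractible\<close>)
  have solB: "solves_on gle_lame_V B \<psi>" "solves_on gle_lame_V B \<phi>"
    using sol B(4) unfolding solves_on_def by (meson holomorphic_on_subset subsetD)+
  have hol: "\<psi> holomorphic_on B" "\<phi> holomorphic_on B" using solB by (auto simp: solves_on_def)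
  have "\<exists>a b. \<forall>z\<in>B. a * deriv \<psi> z + b * deriv \<phi> z - T * (a * \<psi> z + b * \<phi> z) = y i z * s z" for i
  proof -
    obtain f where f: "solves_on gle_lame_V B f" "\<And>z. z \<in> B \<Longrightarrow> deriv f z - T * f z = y i z * s z"
      using gle_to_lame[OF B(1) e(2) s ys] by blast
    obtain a b where ab: "\<And>z. z \<in> B \<Longrightarrow> f z = a * \<psi> z + b * \<phi> z"
      by (rule solution_lincomb[OF B(1,2) solB f(1) W(1)]) (use W B in auto)
    have "deriv f z = a * deriv \<psi> z + b * deriv \<phi> z" if "z \<in> B" for z
      by (rule deriv_lincomb_cong[OF B(1) that hol ab])
    then show ?thesis using f(2) ab by (intro exI[of _ a] exI[of _ b]) auto
  qed
  then obtain a b where ab: "\<And>i z. z \<in> B \<Longrightarrow> a i * deriv \<psi> z + b i * deriv \<phi> z - T * (a i * \<psi> z + b i * \<phi> z) = y i z * s z"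
    by metis
  have ind: "c1 = 0 \<and> c2 = 0" if c: "c1 * a 1 + c2 * a 2 = 0" "c1 * b 1 + c2 * b 2 = 0" for c1 c2
  proof -
    have "c1 * y 1 z + c2 * y 2 z = 0" if z: "z \<in> B" for z
    proof -
      have "(c1 * y 1 z + c2 * y 2 z) * s z = c1 * (y 1 z * s z) + c2 * (y 2 z * s z)" by (simp add: algebra_simps)
      also have "\<dots> = (c1 * a 1 + c2 * a 2) * (deriv \<psi> z - T * \<psi> z) + (c1 * b 1 + c2 * b 2) * (deriv \<phi> z - T * \<phi> z)"
        unfolding ab[OF z, symmetric] by (simp add: algebra_simps)
      finally have "(c1 * y 1 z + c2 * y 2 z) * s z = 0" using c by simp
      moreover have "s z \<noteq> 0" using s(2)[OF z] v_nz e(2) z by auto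
      ultimately show ?thesis by simp
    qed
    then have c0: "\<forall>\<^sub>F z in nhds z0. (\<Sum>i\<in>UNIV. (if i = 1 then c1 else c2) * y i z) = 0"
      using B by (intro eventually_nhds_in_open[THEN eventually_mono, OF B(1,3)]) (simp add: UNIV_2)
    have "\<forall>c. (\<forall>\<^sub>F z in nhds z0. (\<Sum>i\<in>UNIV. c i * y i z) = 0) \<longrightarrow> (\<forall>i. c i = 0)"
      using y unfolding solution_basis_def by blast
    from this[rule_format, OF c0] have "(if i = 1 then c1 else c2) = 0" for i :: 2 .
    then have "\<forall>i::2. (if i = 1 then c1 else c2) = 0" ..
    from spec[OF this, of 1] spec[OF this, of 2] show ?thesis by simp
  qed
  have "a 1 * b 2 - a 2 * b 1 \<noteq> 0"
  proof
    assume 0: "a 1 * b 2 - a 2 * b 1 = 0"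
    \<comment> \<open>If the determinant vanished, \<open>(a 2, - a 1)\<close> and
      \<open>(b 2, - b 1)\<close> would be relations between the coefficient rows, so every
      coefficient would be zero.\<close>
    have "a 2 = 0 \<and> - a 1 = 0" by (rule ind) (use 0 in \<open>auto simp: algebra_simps\<close>)
    moreover have "b 2 = 0 \<and> - b 1 = 0" by (rule ind) (use 0 in \<open>auto simp: algebra_simps\<close>)
    ultimately have "1 = 0 \<and> 1 = (0::complex)" using ind[of 1 1] by simp
    then show False by simp
  qed
  note ab_det = this
  show ?thesis
    by (rule that[OF e(1) e(2)[unfolded B_def] s(2)[unfolded B_def] ab[unfolded B_def] ab_det])
qed

text \<open>The sign \<open>\<epsilon>\<close> is the one with which a square root of
  \<open>v\<close> may return along \<open>\<gamma>\<close>. Only the products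
  \<open>y i * y j * v = G i * G j\<close> are continued; \<open>germ_sign\<close> extracts one sign
  for both basis elements, and \<open>transform_relation\<close> moves the relation from
  \<open>G\<close> to \<open>F\<close>.\<close>

lemma monodromy_to_lame:
  assumes sol: "solves_on gle_lame_V (- L) \<psi>" "solves_on gle_lame_V (- L) \<phi>" and W: "W \<noteq> 0" "\<And>z. z \<notin> L \<Longrightarrow> wr \<psi> \<phi> z = W"
    and e: "e > 0" "ball z0 e \<subseteq> - S" and s: "\<And>z. z \<in> ball z0 e \<Longrightarrow> v z = (s z)\<^sup>2"
    and ab: "\<And>i z. z \<in> ball z0 e \<Longrightarrow> a i * deriv \<psi> z + b i * deriv \<phi> z - T * (a i * \<psi> z + b i * \<phi> z) = y i z * s z"
    and det: "a 1 * b 2 - a 2 * b 1 \<noteq> (0::complex)"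
    and \<gamma>: "continuous_on {0..1} \<gamma>" "\<gamma> 0 = z0" "\<gamma> 1 = z0 + \<omega>" "\<And>t. t \<in> {0..1} \<Longrightarrow> \<gamma> t \<notin> S" and \<omega>: "\<omega> \<in> L"
    and M: "monodromy_matrix_along \<gamma> \<omega> y M"
    and act: "\<And>z. (\<psi> (z + \<omega>), \<phi> (z + \<omega>)) = mat_act A Bc C (\<psi> z, \<phi> z)"
  shows "\<exists>\<epsilon>\<in>{1,-1}. \<forall>i. a i * A + b i * C = \<epsilon> * (mat_entry M i 1 * a 1 + mat_entry M i 2 * a 2) \<and>
           a i * Bc + b i * A = \<epsilon> * (mat_entry M i 1 * b 1 + mat_entry M i 2 * b 2)"
proof -
  define F where "F i z = a i * \<psi> z + b i * \<phi> z" for i z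
  define G where "G i z = a i * deriv \<psi> z + b i * deriv \<phi> z - T * F i z" for i z
  have Fsol: "solves_on gle_lame_V (- L) (F i)" for i
    unfolding F_def[abs_def] by (rule solves_on_lincomb[OF open_compl_lattice sol])
  have hol: "\<psi> holomorphic_on - L" "\<phi> holomorphic_on - L" using sol by (auto simp: solves_on_def)
  have dF: "deriv (F i) z = a i * deriv \<psi> z + b i * deriv \<phi> z" if "z \<notin> L" for i z
    by (rule deriv_lincomb_cong[OF open_compl_lattice _ hol]) (use that in \<open>auto simp: F_def\<close>)
  have Ghol: "G i holomorphic_on - L" for i
    unfolding G_def[abs_def] F_def by (intro holomorphic_intros hol holomorphic_deriv open_compl_lattice)
  have SL: "z \<notin> L" if "z \<notin> S" for z using that notin_S_iff by auto
  have Gan: "G i analytic_on {z}" if "z \<notin> L" for i z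
    using Ghol[of i] open_compl_lattice that by (auto simp: analytic_at)
  have Gy: "G i z = y i z * s z" if "z \<in> ball z0 e" for i z
    using ab[OF that, of i] by (simp add: G_def F_def)
  obtain w where w: "\<And>i. analytic_continuation_along \<gamma> (y i) (w i)"
    "\<forall>\<^sub>F z in nhds z0. (\<chi> i. w i (z + \<omega>)) = M *v (\<chi> i. y i z)"
    using M \<gamma>(2) unfolding monodromy_matrix_along_def by auto
  have ball: "\<forall>\<^sub>F z in nhds z0. z \<in> ball z0 e" using e by (intro eventually_nhds_in_open) auto
  have prod: "\<forall>\<^sub>F z in nhds z0. w i (z + \<omega>) * w j (z + \<omega>) * v (z + \<omega>) = G i (z + \<omega>) * G j (z + \<omega>)" for i j
  proof -
    have "\<forall>\<^sub>F z in nhds (\<gamma> 1). w i z * w j z * v z = G i z * G j z"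
    proof (rule analytic_continuation_product[OF \<gamma>(1) w(1) w(1)])
      show "\<forall>\<^sub>F z in nhds (\<gamma> 0). y i z * y j z * v z = G i z * G j z"
        unfolding \<gamma>(2) using ball by eventually_elim (auto simp: Gy s power2_eq_square)
      fix t :: real assume "t \<in> {0..1}"
      then have "\<gamma> t \<notin> L" using \<gamma>(4) SL by blast
      then show "v analytic_on {\<gamma> t} \<and> (\<lambda>z. G i z * G j z) analytic_on {\<gamma> t}"
        by (auto intro!: v_analytic analytic_intros Gan)
    qed
    then have "\<forall>\<^sub>F z in filtermap (\<lambda>z. z + \<omega>) (nhds z0). w i z * w j z * v z = G i z * G j z"
      unfolding \<gamma>(3) by (simp add: filtermap_nhds_shift[of "- \<omega>" z0, simplified])
    then show ?thesis by (simp add: eventually_filtermap)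
  qed
  define X where "X i z = mat_entry M i 1 * G 1 z + mat_entry M i 2 * G 2 z" for i z
  define H where "H i z = G i (z + \<omega>)" for i z
  have "\<forall>\<^sub>F z in nhds z0. X i z * X j z = H i z * H j z" for i j
    using w(2) prod[of i j] ball
  proof eventually_elim
    case (elim z)
    have wi: "w i (z + \<omega>) = mat_entry M i 1 * y 1 z + mat_entry M i 2 * y 2 z" for i
      using arg_cong[OF elim(1), of "\<lambda>x. vec_nth x i"] by (simp add: matrix_vector_mult_def UNIV_2)
    have "X i z = w i (z + \<omega>) * s z" for i
      unfolding X_def Gy[OF elim(3)] wi by (simp add: algebra_simps)
    moreover have "v (z + \<omega>) = (s z)\<^sup>2"
      using periodic(1)[OF _ \<omega>, of z] e(2) elim(3) s[OF elim(3)] by auto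
    ultimately show ?case using elim(2) by (simp add: H_def power2_eq_square mult_ac)
  qed
  then have "\<forall>\<^sub>F z in nhds z0. \<forall>i j. X i z * X j z = H i z * H j z"
    by (intro eventually_all_finite)
  with ball have "\<forall>\<^sub>F z in nhds z0. z \<in> ball z0 e \<and> (\<forall>i j. X i z * X j z = H i z * H j z)"
    by eventually_elim simp
  then obtain U where U: "open U" "z0 \<in> U" "\<And>z. z \<in> U \<Longrightarrow> z \<in> ball z0 e" "\<And>i j z. z \<in> U \<Longrightarrow> X i z * X j z = H i z * H j z"
    unfolding eventually_nhds by blast
  obtain d where d: "d > 0" "ball z0 d \<subseteq> U" using U open_contains_ball by blast
  have dS: "ball z0 d \<subseteq> - S" using d U(3) e(2) by blast
  have zL: "z \<notin> L" "z + \<omega> \<notin> L" if "z \<in> ball z0 d" for z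
    using that dS SL lattice_add_iff[OF \<omega>] by auto
  have Xhol: "X i holomorphic_on ball z0 d" for i
    unfolding X_def[abs_def]
    by (intro holomorphic_intros holomorphic_on_subset[OF Ghol]) (use zL in auto)
  have Hhol: "H i holomorphic_on ball z0 d" for i
  proof -
    have "(G i \<circ> (\<lambda>z. z + \<omega>)) holomorphic_on ball z0 d"
      by (rule holomorphic_on_compose_gen[OF _ Ghol]) (use zL in \<open>auto intro!: holomorphic_intros\<close>)
    then show ?thesis by (simp add: H_def[abs_def] o_def)
  qed
  have nz: "\<exists>z\<in>ball z0 d. H 1 z \<noteq> 0"
  proof (rule ccontr)
    assume "\<not> ?thesis"
    then have 0: "G 1 z = 0" if "z \<in> ball (z0 + \<omega>) d" for z
      using that by (auto simp: H_def dist_norm dest!: bspec[of _ _ "z - \<omega>"] simp: algebra_simps)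
    have "ball (z0 + \<omega>) d \<subseteq> - L"
    proof
      fix z assume "z \<in> ball (z0 + \<omega>) d"
      then have "z - \<omega> \<in> ball z0 d" by (simp add: dist_norm algebra_simps)
      from zL(2)[OF this] show "z \<in> - L" by simp
    qed
    then have G0: "G 1 z = 0" if "z \<notin> L" for z
      using analytic_continuation_open[of "ball (z0 + \<omega>) d" "- L" "G 1" "\<lambda>_. 0" z]
        open_compl_lattice connected_compl_lattice Ghol 0 d(1) that by auto
    let ?B = "ball z0 d"
    have z0: "z0 \<in> ?B" using d by simp
    have F0: "a 1 * deriv \<psi> z + b 1 * deriv \<phi> z = T * F 1 z" if "z \<notin> L" for z
      using G0[OF that] by (simp add: G_def)
    text \<open>Were \<open>F' = T F\<close>, then \<open>F'' = T\<^sup>2 F\<close>, and \<open>F = 0\<close> because \<open>V - T\<^sup>2 = N v\<close> has no zero off \<open>S\<close>.\<close>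
    have "F 1 z = 0" if z: "z \<in> ?B" for z
    proof -
      have dF1: "(F 1 has_field_derivative T * F 1 w) (at w)" if "w \<in> - L" for w
        using solves_onD(1)[OF open_compl_lattice Fsol that, of 1] dF[of w 1] F0[of w] that by simp
      have "(T * (T * F 1 z)) = deriv (deriv (F 1)) z"
        by (rule deriv2_eqI[OF open_compl_lattice _ dF1, symmetric])
           (use zL[OF z] dF1 in \<open>auto intro!: DERIV_cmult\<close>)
      also have "\<dots> = gle_lame_V z * F 1 z" using Fsol[of 1] zL[OF z] unfolding solves_on_def by blast
      finally have "N * v z * F 1 z = 0" unfolding gle_lame_V_eq by (simp add: algebra_simps power2_eq_square)
      then show ?thesis using N_nz v_nz dS z by auto
    qed
    then have "a 1 * \<psi> z + b 1 * \<phi> z = 0 * \<psi> z + 0 * \<phi> z" if "z \<in> ?B" for z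
      using that by (simp add: F_def)
    then have "a 1 = 0 \<and> b 1 = 0"
      by (rule lincomb_unique[of ?B z0 \<psi> \<phi>, rotated -1])
         (use z0 zL W in \<open>auto intro: holomorphic_on_subset[OF hol(1)] holomorphic_on_subset[OF hol(2)]\<close>)
    then show False using det by simp
  qed
  obtain \<epsilon> where \<epsilon>: "\<epsilon> \<in> {1,-1}" "\<And>i z. z \<in> ball z0 d \<Longrightarrow> X i z = \<epsilon> * H i z"
    using germ_sign[of d X z0 H 1, OF d(1) Xhol Hhol _ nz] U(4) d(2) by blast
  have rel: "F i (z + \<omega>) = \<epsilon> * mat_entry M i 1 * F 1 z + \<epsilon> * mat_entry M i 2 * F 2 z" if z: "z \<in> ball z0 d" for i z
  proof (rule transform_relation[OF Fsol _ \<omega> open_ball dS _ z])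
    show "solves_on gle_lame_V (- L) (\<lambda>z. \<epsilon> * mat_entry M i 1 * F 1 z + \<epsilon> * mat_entry M i 2 * F 2 z)"
      by (rule solves_on_lincomb[OF open_compl_lattice Fsol Fsol])
    fix z assume z: "z \<in> ball z0 d"
    have Fh: "F i holomorphic_on - L" for i using Fsol[of i] by (simp add: solves_on_def)
    have "deriv (\<lambda>z. \<epsilon> * mat_entry M i 1 * F 1 z + \<epsilon> * mat_entry M i 2 * F 2 z) z =
        \<epsilon> * mat_entry M i 1 * deriv (F 1) z + \<epsilon> * mat_entry M i 2 * deriv (F 2) z"
      by (rule deriv_lincomb_cong[OF open_compl_lattice _ Fh Fh refl]) (use zL[OF z] in auto)
    moreover have "deriv (F i) z - T * F i z = G i z" if "z \<notin> L" for i z using dF[OF that] by (simp add: G_def)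
    moreover have "H i z = \<epsilon> * X i z" using \<epsilon>(1) \<epsilon>(2)[OF z, of i] by auto
    ultimately show "deriv (F i) (z + \<omega>) - T * F i (z + \<omega>) =
       deriv (\<lambda>z. \<epsilon> * mat_entry M i 1 * F 1 z + \<epsilon> * mat_entry M i 2 * F 2 z) z - T * (\<epsilon> * mat_entry M i 1 * F 1 z + \<epsilon> * mat_entry M i 2 * F 2 z)"
      using zL[OF z] dF[of z] unfolding H_def X_def G_def by (simp add: algebra_simps)
  qed
  have "a i * A + b i * C = \<epsilon> * (mat_entry M i 1 * a 1 + mat_entry M i 2 * a 2) \<and>
           a i * Bc + b i * A = \<epsilon> * (mat_entry M i 1 * b 1 + mat_entry M i 2 * b 2)" for i
  proof (rule lincomb_unique[of "ball z0 d" z0 \<psi> \<phi>])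
    show "\<psi> holomorphic_on ball z0 d" "\<phi> holomorphic_on ball z0 d"
      using hol zL holomorphic_on_subset by (metis ComplI subsetI)+
    show "z0 \<in> ball z0 d" using d by simp
    then show "wr \<psi> \<phi> z0 \<noteq> 0" using zL W by simp
    fix z assume z: "z \<in> ball z0 d"
    have "\<psi> (z + \<omega>) = A * \<psi> z + Bc * \<phi> z" "\<phi> (z + \<omega>) = C * \<psi> z + A * \<phi> z"
      using act[of z] by (simp_all add: mat_act_def)
    then show "(a i * A + b i * C) * \<psi> z + (a i * Bc + b i * A) * \<phi> z =
       (\<epsilon> * (mat_entry M i 1 * a 1 + mat_entry M i 2 * a 2)) * \<psi> z + (\<epsilon> * (mat_entry M i 1 * b 1 + mat_entry M i 2 * b 2)) * \<phi> z"
      using rel[OF z, of i] unfolding F_def by (simp add: algebra_simps)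
  qed simp
  with \<epsilon>(1) show ?thesis by blast
qed

end

end

section \<open>Isomonodromic Lame equations\<close>

text \<open>A set that contains none of its limit points is discrete, and by the Lindelof property a
  discrete subset of the plane is countable.\<close>

lemma uncountable_limit_point:
  fixes S :: "complex set"
  assumes "uncountable S"
  obtains x where "x \<in> S" "x islimpt S"
proof -
  have "\<exists>x\<in>S. x islimpt S"
  proof (rule ccontr)
    assume n: "\<not> (\<exists>x\<in>S. x islimpt S)"
    have "\<exists>U. open U \<and> x \<in> U \<and> U \<inter> S \<subseteq> {x}" if x: "x \<in> S" for x
    proof -
      have "\<not> x islimpt S" using n x by blast
      then obtain U where "x \<in> U" "open U" "\<And>y. y \<in> S \<Longrightarrow> y \<in> U \<Longrightarrow> y = x"
        unfolding islimpt_def by metis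
      then show ?thesis by (intro exI[of _ U]) auto
    qed
    then have "\<forall>x\<in>S. \<exists>U. open U \<and> x \<in> U \<and> U \<inter> S \<subseteq> {x}" by blast
    from bchoice[OF this] obtain U where U: "\<And>x. x \<in> S \<Longrightarrow> open (U x) \<and> x \<in> U x \<and> U x \<inter> S \<subseteq> {x}"
      by blast
    obtain F where F: "F \<subseteq> U ` S" "countable F" "\<Union>F = \<Union>(U ` S)"
    proof (rule Lindelof[of "U ` S"])
      show "\<And>V. V \<in> U ` S \<Longrightarrow> open V" using U by blast
    qed (rule that, assumption+)
    have sub: "S \<subseteq> (\<Union>V\<in>F. V \<inter> S)"
    proof
      fix x assume x: "x \<in> S"
      then have "x \<in> \<Union>F" unfolding F(3) using U by blast
      then show "x \<in> (\<Union>V\<in>F. V \<inter> S)" using x by blast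
    qed
    have "countable (V \<inter> S)" if V: "V \<in> F" for V
    proof -
      obtain x where "x \<in> S" "V = U x" using V F(1) by blast
      then have "V \<inter> S \<subseteq> {x}" using U by simp
      then show ?thesis by (rule countable_subset) simp
    qed
    then have "countable (\<Union>V\<in>F. V \<inter> S)" using F(2) by (rule countable_UN[rotated])
    from countable_subset[OF sub this] assms show False by simp
  qed
  then show ?thesis using that by blast
qed

section \<open>Conjugacy of commuting pairs of matrices\<close>

lemma kernel_trivial_2x2:
  fixes a :: "2 \<Rightarrow> complex"
  assumes "\<And>i. a i * d + b i * e = 0" "a 1 * b 2 - a 2 * b 1 \<noteq> 0"
  shows "d = 0 \<and> e = 0"
proof -
  have "(a 1 * b 2 - a 2 * b 1) * d = b 2 * (a 1 * d + b 1 * e) - b 1 * (a 2 * d + b 2 * e)"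
    "(a 1 * b 2 - a 2 * b 1) * e = a 1 * (a 2 * d + b 2 * e) - a 2 * (a 1 * d + b 1 * e)"
    by (simp_all add: algebra_simps)
  then show ?thesis using assms by simp
qed

text \<open>Two commuting pairs of matrices of the shape \<open>[A B; C A]\<close> that are both conjugate to the same
  pair are conjugate by a diagonal matrix.\<close>

lemma conjugate_scaling:
  fixes A B C A' B' C' :: "2 \<Rightarrow> complex" and a b a' b' :: "2 \<Rightarrow> complex"
  assumes N: "a 1 * b 2 - a 2 * b 1 \<noteq> 0" "a' 1 * b' 2 - a' 2 * b' 1 \<noteq> 0"
    and R: "\<And>i j. a j * A i + b j * C i = m i j 1 * a 1 + m i j 2 * a 2"
      "\<And>i j. a j * B i + b j * A i = m i j 1 * b 1 + m i j 2 * b 2"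
    and R': "\<And>i j. a' j * A' i + b' j * C' i = m i j 1 * a' 1 + m i j 2 * a' 2"
      "\<And>i j. a' j * B' i + b' j * A' i = m i j 1 * b' 1 + m i j 2 * b' 2"
    and com: "B 1 * C 2 = B 2 * C 1" and nz: "C 1 \<noteq> 0 \<or> C 2 \<noteq> 0" "C' 1 \<noteq> 0 \<or> C' 2 \<noteq> 0"
  obtains k where "k \<noteq> 0" "\<And>i. A' i = A i \<and> C' i = k * C i \<and> B i = k * B' i"
proof -
  define D where "D = a' 1 * b' 2 - a' 2 * b' 1"
  have D: "D \<noteq> 0" using N(2) by (simp add: D_def)
  \<comment> \<open>\<open>P = [x y; w v]\<close> is the change of basis between the two coefficient
    systems, solved by Cramer's rule; \<open>ka\<close> and \<open>kb\<close> are the defining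
    relations.\<close>
  define x where "x = (a 1 * b' 2 - a 2 * b' 1) / D"
  define w where "w = (a' 1 * a 2 - a' 2 * a 1) / D"
  define y where "y = (b 1 * b' 2 - b 2 * b' 1) / D"
  define v where "v = (a' 1 * b 2 - a' 2 * b 1) / D"
  have cr: "a' j * ((c1 * b' 2 - c2 * b' 1) / D) + b' j * ((a' 1 * c2 - a' 2 * c1) / D) = (if j = 1 then c1 else c2)"
    for j :: 2 and c1 c2
  proof -
    have "(a' j * (c1 * b' 2 - c2 * b' 1) + b' j * (a' 1 * c2 - a' 2 * c1)) = (if j = 1 then c1 else c2) * D"
      using exhaust_2[of j] by (auto simp: D_def algebra_simps)
    then have "(a' j * (c1 * b' 2 - c2 * b' 1) + b' j * (a' 1 * c2 - a' 2 * c1)) / D = (if j = 1 then c1 else c2)"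
      using D by simp
    then show ?thesis by (simp add: add_divide_distrib)
  qed
  have ka: "a j = a' j * x + b' j * w" and kb: "b j = a' j * y + b' j * v" for j
    using cr[of j "a 1" "a 2"] cr[of j "b 1" "b 2"] exhaust_2[of j] unfolding x_def w_def y_def v_def by auto
  \<comment> \<open>First column of the intertwining relation \<open>P * M i = M' i * P\<close>,
    where \<open>M i = [A i B i; C i A i]\<close>; \<open>col2\<close> is the second column.\<close>
  have col1: "x * A i + y * C i - (A' i * x + B' i * w) = 0 \<and> w * A i + v * C i - (C' i * x + A' i * w) = 0" for i
  proof (rule kernel_trivial_2x2[OF _ N(2)])
    fix j
    have "a' j * (x * A i + y * C i - (A' i * x + B' i * w)) + b' j * (w * A i + v * C i - (C' i * x + A' i * w))
      = ((a' j * x + b' j * w) * A i + (a' j * y + b' j * v) * C i)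
        - ((a' j * A' i + b' j * C' i) * x + (a' j * B' i + b' j * A' i) * w)" by (simp add: algebra_simps)
    also have "\<dots> = (m i j 1 * a 1 + m i j 2 * a 2) - ((m i j 1 * a' 1 + m i j 2 * a' 2) * x + (m i j 1 * b' 1 + m i j 2 * b' 2) * w)"
      unfolding ka[symmetric] kb[symmetric] R(1) R' ..
    also have "\<dots> = 0" unfolding ka[of 1] ka[of 2] by (simp add: algebra_simps)
    finally show "a' j * (x * A i + y * C i - (A' i * x + B' i * w)) + b' j * (w * A i + v * C i - (C' i * x + A' i * w)) = 0" .
  qed
  have col2: "x * B i + y * A i - (A' i * y + B' i * v) = 0 \<and> w * B i + v * A i - (C' i * y + A' i * v) = 0" for i
  proof (rule kernel_trivial_2x2[OF _ N(2)])
    fix j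
    have "a' j * (x * B i + y * A i - (A' i * y + B' i * v)) + b' j * (w * B i + v * A i - (C' i * y + A' i * v))
      = ((a' j * x + b' j * w) * B i + (a' j * y + b' j * v) * A i)
        - ((a' j * A' i + b' j * C' i) * y + (a' j * B' i + b' j * A' i) * v)" by (simp add: algebra_simps)
    also have "\<dots> = (m i j 1 * b 1 + m i j 2 * b 2) - ((m i j 1 * a' 1 + m i j 2 * a' 2) * y + (m i j 1 * b' 1 + m i j 2 * b' 2) * v)"
      unfolding ka[symmetric] kb[symmetric] R(2) R' ..
    also have "\<dots> = 0" unfolding kb[of 1] kb[of 2] by (simp add: algebra_simps)
    finally show "a' j * (x * B i + y * A i - (A' i * y + B' i * v)) + b' j * (w * B i + v * A i - (C' i * y + A' i * v)) = 0" .
  qed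
  have det: "x * v - y * w \<noteq> 0"
  proof
    assume 0: "x * v - y * w = 0"
    have "a 1 * b 2 - a 2 * b 1 = D * (x * v - y * w)"
      unfolding ka[of 1] ka[of 2] kb[of 1] kb[of 2] D_def by (simp add: algebra_simps)
    then show False using N(1) 0 by simp
  qed
  \<comment> \<open>Conjugate matrices have equal traces; the combination below is that identity
    multiplied by \<open>det P\<close>.\<close>
  have AA: "A' i = A i" for i
  proof -
    have "2 * (x * v - y * w) * (A i - A' i) =
      v * (x * A i + y * C i - (A' i * x + B' i * w)) - w * (x * B i + y * A i - (A' i * y + B' i * v))
      + x * (w * B i + v * A i - (C' i * y + A' i * v)) - y * (w * A i + v * C i - (C' i * x + A' i * w))"
      by (simp add: algebra_simps)
    then have "2 * (x * v - y * w) * (A i - A' i) = 0" using col1[of i] col2[of i] by simp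
    then show ?thesis using det by simp
  qed
  have e: "y * C i = B' i * w" "v * C i = C' i * x" "x * B i = B' i * v" "w * B i = C' i * y" for i
    using col1[of i] col2[of i] unfolding AA by (simp_all add: algebra_simps)
  show ?thesis
  proof (cases "x = 0")
    case False
    have C: "C' i = v / x * C i" "B i = v / x * B' i" for i using e[of i] False by (simp_all add: field_simps)
    have "v / x \<noteq> 0" using nz(2) C(1) by (metis mult_zero_left)
    then show ?thesis using that[of "v / x"] C AA by blast
  next
    \<comment> \<open>Here \<open>P\<close> is antidiagonal and exchanges the roles of
      \<open>B\<close> and \<open>C\<close>. Commutation makes the vector of the \<open>B i\<close>
      proportional to that of the \<open>C i\<close>, so the exchange is again a scaling.\<close>
    case True
    obtain j where j: "C j \<noteq> 0" using nz(1) by blast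
    have "v = 0" using e(2)[of j] True j by simp
    have yw: "y \<noteq> 0" "w \<noteq> 0" using det True by auto
    have B: "B i * C j = B j * C i" for i
      using com exhaust_2[of i] exhaust_2[of j] by auto
    have C': "C' i = w / y * B i" and B': "B' i = y / w * C i" for i
      using e[of i] yw by (simp_all add: field_simps)
    have "B j \<noteq> 0"
    proof
      assume "B j = 0"
      then have "B i = 0" for i using B[of i] j by simp
      then show False using nz(2) C' by simp
    qed
    let ?k = "w * B j / (y * C j)"
    have "C' i = ?k * C i \<and> B i = ?k * B' i" for i
    proof -
      have "B i = B j * C i / C j" using B[of i] j by (simp add: field_simps)
      then show ?thesis unfolding C' B' using yw j by (simp add: field_simps)
    qed
    moreover have "?k \<noteq> 0" using yw j \<open>B j \<noteq> 0\<close> by simp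
    ultimately show ?thesis using that[of ?k] AA by blast
  qed
qed

section \<open>Two Lame frames over a common cell\<close>

definition lame_pot :: "nat \<Rightarrow> complex \<Rightarrow> complex \<Rightarrow> complex \<Rightarrow> complex" where
  "lame_pot n \<tau> E z = of_nat n * (of_nat n + 1) * wp_reg \<tau> z + E"

text \<open>The output of \<open>lame_global\<close> as a predicate in \<open>\<tau>\<close> and
  \<open>E\<close>, so that frames over different lattices can be compared. The index of
  \<open>A\<close>, \<open>B\<close> and \<open>C\<close> is 1 for the period 1 and 2 for the period
  \<open>\<tau>\<close>.\<close>

definition lame_data ::
  "nat \<Rightarrow> complex \<Rightarrow> complex \<Rightarrow> (complex \<Rightarrow> complex) \<Rightarrow> (complex \<Rightarrow> complex) \<Rightarrow>
    (2 \<Rightarrow> complex) \<Rightarrow> (2 \<Rightarrow> complex) \<Rightarrow> (2 \<Rightarrow> complex) \<Rightarrow> bool" where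
  "lame_data n \<tau> E \<psi> \<phi> A B C \<longleftrightarrow>
    solves_on (\<lambda>z. of_nat n * (of_nat n + 1) * weierstrass_wp \<tau> z + E) (- period_lattice \<tau>) \<psi> \<and>
    solves_on (\<lambda>z. of_nat n * (of_nat n + 1) * weierstrass_wp \<tau> z + E) (- period_lattice \<tau>) \<phi> \<and>
    (\<forall>z. z \<notin> period_lattice \<tau> \<longrightarrow> wr \<psi> \<phi> z = 2 * of_nat n + 1) \<and>
    (\<forall>z\<in>torus.cell_box \<tau> (-1) 1 (-1) 1 - {0}.
       \<psi> z = lame_psi n (lame_pot n \<tau> E) z \<and> \<phi> z = lame_phi n (lame_pot n \<tau> E) z) \<and>
    (\<forall>z. (\<psi> (z + 1), \<phi> (z + 1)) = mat_act (A 1) (B 1) (C 1) (\<psi> z, \<phi> z)) \<and>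
    (\<forall>z. (\<psi> (z + \<tau>), \<phi> (z + \<tau>)) = mat_act (A 2) (B 2) (C 2) (\<psi> z, \<phi> z)) \<and>
    (\<forall>i. (A i)\<^sup>2 - B i * C i = 1) \<and> B 1 * C 2 = B 2 * C 1 \<and> (C 1 \<noteq> 0 \<or> C 2 \<noteq> 0)"

context torus
begin

lemma lame_q_eq: "lame_q n E = lame_pot n \<tau> E"
  by (simp add: fun_eq_iff lame_q_def lame_pot_def)

lemma lame_data_exists: "\<exists>\<psi> \<phi> A B C. lame_data n \<tau> E \<psi> \<phi> A B C"
proof -
  obtain \<psi> \<phi> A1 B1 C1 A2 B2 C2 where d:
    "solves_on (\<lambda>z. of_nat n * (of_nat n + 1) * wp z + E) (- L) \<psi>"
    "solves_on (\<lambda>z. of_nat n * (of_nat n + 1) * wp z + E) (- L) \<phi>"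
    "\<And>z. z \<notin> L \<Longrightarrow> wr \<psi> \<phi> z = 2 * of_nat n + 1"
    "\<And>z. z \<in> D0 - {0} \<Longrightarrow> \<psi> z = lame_psi n (lame_q n E) z \<and> \<phi> z = lame_phi n (lame_q n E) z"
    "\<And>z. (\<psi> (z + 1), \<phi> (z + 1)) = mat_act A1 B1 C1 (\<psi> z, \<phi> z)"
    "\<And>z. (\<psi> (z + \<tau>), \<phi> (z + \<tau>)) = mat_act A2 B2 C2 (\<psi> z, \<phi> z)"
    "A1\<^sup>2 - B1 * C1 = 1" "A2\<^sup>2 - B2 * C2 = 1" "B1 * C2 = B2 * C1" "C1 \<noteq> 0 \<or> C2 \<noteq> 0"
    by (rule lame_global) (rule that, assumption+)
  let ?f = "\<lambda>s t (i::2). if i = 1 then s else t"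
  have "lame_data n \<tau> E \<psi> \<phi> (?f A1 A2) (?f B1 B2) (?f C1 C2)"
    unfolding lame_data_def using d unfolding lame_q_eq by auto
  then show ?thesis by blast
qed

lemma coords_eq: "z = of_real (cx z) + of_real (cy z) * \<tau>"
  using Im_pos by (simp add: complex_eq_iff cx_def cy_def)

lemma coords_of: "cx (of_real a + of_real b * \<tau>) = a" "cy (of_real a + of_real b * \<tau>) = b"
proof -
  have "cx (of_real a * 1 + of_real b * \<tau>) = a" "cy (of_real a * 1 + of_real b * \<tau>) = b"
    unfolding coord_simps by simp_all
  then show "cx (of_real a + of_real b * \<tau>) = a" "cy (of_real a + of_real b * \<tau>) = b" by simp_all
qed

definition closed_box :: "real \<Rightarrow> real \<Rightarrow> real \<Rightarrow> real \<Rightarrow> complex set" where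
  "closed_box a b c d = cx -` {a..b} \<inter> cy -` {c..d}"

lemma mem_closed_box: "z \<in> closed_box a b c d \<longleftrightarrow> a \<le> cx z \<and> cx z \<le> b \<and> c \<le> cy z \<and> cy z \<le> d"
  by (auto simp: closed_box_def)

lemma convex_closed_box: "convex (closed_box a b c d)"
  unfolding closed_box_def by (intro convex_Int convex_linear_vimage linear_coords) auto

lemma compact_closed_box: "compact (closed_box a b c d)"
proof -
  have "closed_box a b c d = (\<lambda>x. of_real (fst x) + of_real (snd x) * \<tau>) ` ({a..b} \<times> {c..d})"
  proof (intro equalityI subsetI)
    fix z assume "z \<in> closed_box a b c d"
    then show "z \<in> (\<lambda>x. of_real (fst x) + of_real (snd x) * \<tau>) ` ({a..b} \<times> {c..d})"
      using coords_eq[of z] by (intro image_eqI[of _ _ "(cx z, cy z)"]) (auto simp: mem_closed_box)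
  qed (auto simp: mem_closed_box coords_of simp del: coord_simps)
  also have "compact \<dots>"
    by (intro compact_continuous_image continuous_intros compact_Times) auto
  finally show ?thesis .
qed

end

lemma mat_act_det:
  assumes "A\<^sup>2 - B * C = 1" "(s', t') = mat_act A B C (s, t)" "(u', w') = mat_act A B C (u, w)"
  shows "s' * w' - t' * u' = s * w - t * (u::complex)"
proof -
  have "s' * w' - t' * u' = (A\<^sup>2 - B * C) * (s * w - t * u)"
    using assms(2,3) by (simp add: mat_act_def algebra_simps power2_eq_square)
  then show ?thesis using assms(1) by simp
qed

lemma mat_act_rescale:
  assumes "k \<noteq> 0" "(s', t') = mat_act A B (k * C) (s, t)" "B0 = k * B"
  shows "(s', t' / k) = mat_act A B0 C (s, t / k)"
  using assms by (simp add: mat_act_def field_simps)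

text \<open>The primitive of the cross Wronskian of two isomonodromic systems over a common cell takes
  equal increments along the two vertical sides; hence the difference of its increments along the
  two horizontal sides, written here as an increment of \<open>h\<close>, vanishes.\<close>

lemma cell_increment:
  assumes \<tau>0: "Im \<tau>0 > 0" and \<tau>: "Im \<tau> > 0"
    and d0: "lame_data n \<tau>0 E0 \<psi>0 \<phi>0 A0 B0 C0" and d: "lame_data n \<tau> E \<psi> \<phi> A B C"
    and k: "k \<noteq> 0" "\<And>i. A i = A0 i \<and> C i = k * C0 i \<and> B0 i = k * B i"
    and sub: "torus.closed_box \<tau>0 (-3/4) (3/4) (-3/4) (3/4) \<subseteq> torus.cell_box \<tau> (-1) 1 (-1) 1"
  obtains h where
    "\<And>z. z \<in> torus.cell_box \<tau>0 (-3/4) (3/4) (-3/4) (-1/4) \<Longrightarrow> (h has_field_derivative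
       (\<psi> z - \<psi> (z - (\<tau> - \<tau>0))) * \<phi>0 z - (\<phi> z / k - \<phi> (z - (\<tau> - \<tau>0)) / k) * \<psi>0 z) (at z)"
    "h (- (1 + \<tau>0) / 2 + 1) = h (- (1 + \<tau>0) / 2)"
proof -
  interpret t0: torus \<tau>0 by unfold_locales fact
  interpret t: torus \<tau> by unfold_locales fact
  let ?qo = "lame_pot n \<tau>0 E0" and ?qn = "lame_pot n \<tau> E"
  define X where "X = t0.cell_box (-3/4) (3/4) (-3/4) (3/4)"
  have X: "open X" "convex X" "X \<subseteq> t0.D0" "X \<subseteq> t.D0"
    using sub by (auto simp: X_def t0.cell_box_open t0.cell_box_convex t0.mem_cell_box t0.mem_closed_box)
  define D where "D z = \<psi> z * \<phi>0 z - \<phi> z / k * \<psi>0 z" for z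
  \<comment> \<open>The determinant in terms of the regular factors: the powers \<open>z ^ n\<close>
    below and \<open>z ^ (n + 1)\<close> above leave one factor \<open>z\<close>. So
    \<open>Dh\<close> is holomorphic at 0 and has a primitive on the convex cell.\<close>
  define Dh where "Dh z = z * (lame_v n ?qn z * lame_u n ?qo z - lame_u n ?qn z / k * lame_v n ?qo z)" for z
  have q0: "lame_pot n \<tau>0 E0 holomorphic_on t0.D0" "\<And>z. ?qo (- z) = ?qo z"
    using t0.lame_q_props(4,5)[of n E0] unfolding t0.lame_q_eq by auto
  have q: "lame_pot n \<tau> E holomorphic_on t.D0" "\<And>z. ?qn (- z) = ?qn z"
    using t.lame_q_props(4,5)[of n E] unfolding t.lame_q_eq by auto
  have "lame_v n ?qn holomorphic_on X" "lame_u n ?qn holomorphic_on X"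
    using lame_v_props(1)[OF t.lame_q_props(1-3) q] lame_u_props(1)[OF t.lame_q_props(1-3) q]
      X(4) holomorphic_on_subset by blast+
  moreover have "lame_v n ?qo holomorphic_on X" "lame_u n ?qo holomorphic_on X"
    using lame_v_props(1)[OF t0.lame_q_props(1-3) q0] lame_u_props(1)[OF t0.lame_q_props(1-3) q0]
      X(3) holomorphic_on_subset by blast+
  ultimately have "Dh holomorphic_on X"
    unfolding Dh_def[abs_def] by (intro holomorphic_intros) (use k in auto)
  then obtain G where "\<And>z. z \<in> X \<Longrightarrow> (G has_field_derivative Dh z) (at z within X)"
    using holomorphic_convex_primitive'[OF X(2,1)] by blast
  then have G: "(G has_field_derivative Dh z) (at z)" if "z \<in> X" for z
    using that at_within_open[OF that X(1)] by metis
  have DDh: "Dh z = D z" if "z \<in> X" "z \<noteq> 0" for z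
  proof -
    have "\<psi> z = lame_psi n ?qn z" "\<phi> z = lame_phi n ?qn z" "\<psi>0 z = lame_psi n ?qo z" "\<phi>0 z = lame_phi n ?qo z"
      using d d0 that X(3,4) unfolding lame_data_def by blast+
    moreover have "x / z ^ n * (z ^ (n + 1) * y) = z * (x * y)"
      "z ^ (n + 1) * y / k * (x / z ^ n) = z * (y / k * x)" for x y
      using that(2) by simp_all
    ultimately show ?thesis
      unfolding D_def Dh_def lame_psi_def lame_phi_def by (simp only: right_diff_distrib)
  qed
  have a0: "(\<psi>0 (z + 1), \<phi>0 (z + 1)) = mat_act (A0 1) (B0 1) (C0 1) (\<psi>0 z, \<phi>0 z)"
    "(\<psi>0 (z + \<tau>0), \<phi>0 (z + \<tau>0)) = mat_act (A0 2) (B0 2) (C0 2) (\<psi>0 z, \<phi>0 z)" for z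
    using d0 unfolding lame_data_def by blast+
  have a: "(\<psi> (z + 1), \<phi> (z + 1) / k) = mat_act (A0 1) (B0 1) (C0 1) (\<psi> z, \<phi> z / k)"
    "(\<psi> (z + \<tau>), \<phi> (z + \<tau>) / k) = mat_act (A0 2) (B0 2) (C0 2) (\<psi> z, \<phi> z / k)" for z
  proof -
    have kB: "A i = A0 i" "C i = k * C0 i" "B0 i = k * B i" for i using k(2)[of i] by auto
    have "(\<psi> (z + 1), \<phi> (z + 1)) = mat_act (A 1) (B 1) (C 1) (\<psi> z, \<phi> z)"
      "(\<psi> (z + \<tau>), \<phi> (z + \<tau>)) = mat_act (A 2) (B 2) (C 2) (\<psi> z, \<phi> z)"
      using d unfolding lame_data_def by blast+
    note * = this[unfolded kB(1,2)]
    show "(\<psi> (z + 1), \<phi> (z + 1) / k) = mat_act (A0 1) (B0 1) (C0 1) (\<psi> z, \<phi> z / k)"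
      by (rule mat_act_rescale[OF k(1) *(1) kB(3)])
    show "(\<psi> (z + \<tau>), \<phi> (z + \<tau>) / k) = mat_act (A0 2) (B0 2) (C0 2) (\<psi> z, \<phi> z / k)"
      by (rule mat_act_rescale[OF k(1) *(2) kB(3)])
  qed
  have det: "(A0 i)\<^sup>2 - B0 i * C0 i = 1" for i using d0 unfolding lame_data_def by blast
  have D1: "D (z + 1) = D z" for z
    unfolding D_def by (rule mat_act_det[OF det a(1) a0(1)])
  \<comment> \<open>Since \<open>z + \<tau>0 = (z - (\<tau> - \<tau>0)) + \<tau>\<close>, each frame
    is moved by its own period with the same matrix, at the price of a displaced argument in the
    frame at \<open>\<tau>\<close>.\<close>
  have D2: "D (z + \<tau>0) = \<psi> (z - (\<tau> - \<tau>0)) * \<phi>0 z - \<phi> (z - (\<tau> - \<tau>0)) / k * \<psi>0 z" for z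
    using mat_act_det[OF det a(2)[of "z - (\<tau> - \<tau>0)"] a0(2)[of z]] by (simp add: D_def)
  define h where "h z = G z - G (z + \<tau>0)" for z
  show ?thesis
  proof (rule that[of h])
    fix z assume z: "z \<in> t0.cell_box (-3/4) (3/4) (-3/4) (-1/4)"
    have zX: "z \<in> X" "z + \<tau>0 \<in> X" using z by (auto simp: X_def t0.mem_cell_box)
    have "t0.cy z < 0" "t0.cy (z + \<tau>0) > 0" using z by (auto simp: t0.mem_cell_box)
    then have z0: "z \<noteq> 0" "z + \<tau>0 \<noteq> 0" by (metis t0.coord_simps(8) less_irrefl)+
    have "(h has_field_derivative Dh z - Dh (z + \<tau>0)) (at z)"
      unfolding h_def[abs_def] by (intro DERIV_diff G zX t0.DERIV_add_shift)
    moreover have "Dh z - Dh (z + \<tau>0) =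
       (\<psi> z - \<psi> (z - (\<tau> - \<tau>0))) * \<phi>0 z - (\<phi> z / k - \<phi> (z - (\<tau> - \<tau>0)) / k) * \<psi>0 z"
      unfolding DDh[OF zX(1) z0(1)] DDh[OF zX(2) z0(2)] D2 unfolding D_def by (simp add: algebra_simps)
    ultimately show "(h has_field_derivative
       (\<psi> z - \<psi> (z - (\<tau> - \<tau>0))) * \<phi>0 z - (\<phi> z / k - \<phi> (z - (\<tau> - \<tau>0)) / k) * \<psi>0 z) (at z)" by simp
  next
    let ?s = "- (1 + \<tau>0) / 2"
    let ?b = "t0.cell_box (-3/4) (-1/4) (-3/4) (3/4)"
    \<comment> \<open>By periodicity of \<open>D\<close> the increment of \<open>G\<close> across
      the cell is constant on a strip around the left side, which contains both lower and upper
      corner.\<close>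
    have g0: "((\<lambda>z. G (z + 1) - G z) has_field_derivative 0) (at z)" if z: "z \<in> ?b" for z
    proof -
      have zX: "z \<in> X" "z + 1 \<in> X" using z by (auto simp: X_def t0.mem_cell_box)
      have "t0.cx z < 0" "t0.cx (z + 1) > 0" using z by (auto simp: t0.mem_cell_box)
      then have z0: "z \<noteq> 0" "z + 1 \<noteq> 0" by (metis t0.coord_simps(7) less_irrefl)+
      have "((\<lambda>z. G (z + 1) - G z) has_field_derivative Dh (z + 1) - Dh z) (at z)"
        by (intro DERIV_diff G zX t0.DERIV_add_shift)
      then show ?thesis unfolding DDh[OF zX(1) z0(1)] DDh[OF zX(2) z0(2)] D1 by simp
    qed
    have "(\<lambda>z. G (z + 1) - G z) constant_on ?b"
      by (rule has_field_derivative_0_imp_constant_on[OF g0])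
         (auto simp: t0.cell_box_open t0.cell_box_convex convex_connected)
    moreover have "?s \<in> ?b" "?s + \<tau>0 \<in> ?b"
    proof -
      have e: "?s = of_real (-1/2) * (1 + \<tau>0)" by (simp add: field_simps)
      show "?s \<in> ?b" unfolding e t0.mem_cell_box t0.coord_simps by simp
      show "?s + \<tau>0 \<in> ?b" unfolding e t0.mem_cell_box t0.coord_simps by simp
    qed
    ultimately have "G (?s + 1) - G ?s = G (?s + \<tau>0 + 1) - G (?s + \<tau>0)"
      unfolding constant_on_def by metis
    then show "h (?s + 1) = h ?s" by (simp add: h_def algebra_simps)
  qed
qed

section \<open>Passing to the limit along the parameters\<close>

lemma tendsto_uniform_limit_moving:
  fixes f :: "'a \<Rightarrow> complex \<Rightarrow> complex"
  assumes u: "uniform_limit Y f l F" and g: "(g \<longlongrightarrow> c) F" "\<forall>\<^sub>F x in F. g x \<in> Y" and l: "isCont l c"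
  shows "((\<lambda>x. f x (g x)) \<longlongrightarrow> l c) F"
proof -
  have "((\<lambda>x. f x (g x) - l (g x)) \<longlongrightarrow> 0) F"
  proof (rule tendstoI)
    fix e :: real assume "e > 0"
    from uniform_limitD[OF u this] g(2)
    show "\<forall>\<^sub>F x in F. dist (f x (g x) - l (g x)) 0 < e"
      by eventually_elim (auto simp: dist_norm)
  qed
  moreover have "((\<lambda>x. l (g x)) \<longlongrightarrow> l c) F" by (rule isCont_tendsto_compose[OF l g(1)])
  ultimately have "((\<lambda>x. (f x (g x) - l (g x)) + l (g x)) \<longlongrightarrow> 0 + l c) F" by (rule tendsto_add)
  then show ?thesis by simp
qed

text \<open>The functions \<open>f x\<close> converge uniformly, but without any rate in terms of
  \<open>\<delta> x\<close>. Cauchy's estimate makes their derivatives converge, and the mean value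
  inequality then controls the increment of \<open>f x\<close> itself.\<close>

lemma uniform_difference_quotient:
  fixes f :: "complex \<Rightarrow> complex \<Rightarrow> complex"
  assumes u: "uniform_limit Y f f0 F" and F: "(\<delta> \<longlongrightarrow> 0) F"
    and hol: "\<forall>\<^sub>F x in F. \<exists>X. open X \<and> Y \<subseteq> X \<and> f x holomorphic_on X" "open X0" "Y \<subseteq> X0" "f0 holomorphic_on X0"
    and Y: "compact Y" and r: "r > 0" "\<And>z. z \<in> K \<Longrightarrow> cball z r \<subseteq> Y" and \<eta>: "\<eta> > 0"
  shows "\<forall>\<^sub>F x in F. \<forall>z\<in>K. norm (f x z - f x (z - \<delta> x) - \<delta> x * deriv f0 z) \<le> \<eta> * norm (\<delta> x)"
proof -
  have "continuous_on Y (deriv f0)"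
    using hol(2-4) by (meson continuous_on_subset holomorphic_deriv holomorphic_on_imp_continuous_on)
  then have "uniformly_continuous_on Y (deriv f0)" using Y compact_uniformly_continuous by blast
  then obtain d where d: "d > 0" "\<And>z w. z \<in> Y \<Longrightarrow> w \<in> Y \<Longrightarrow> dist w z < d \<Longrightarrow> dist (deriv f0 w) (deriv f0 z) < \<eta> / 2"
    unfolding uniformly_continuous_on_def using \<eta> by (metis half_gt_zero)
  \<comment> \<open>A displacement below \<open>r / 2\<close> leaves room for Cauchy discs of radius
    \<open>r / 2\<close>. One half of the error is \<open>e / (r / 2) = \<eta> / 2\<close>; the
    other half is the variation of \<open>deriv f0\<close> within distance \<open>d\<close>.\<close>
  define m where "m = min d (r / 2)"
  define e where "e = \<eta> * r / 4"
  have pos: "m > 0" "e > 0" using d r \<eta> by (auto simp: m_def e_def)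
  show ?thesis
    using uniform_limitD[OF u pos(2)] hol(1) tendstoD[OF F pos(1)]
  proof eventually_elim
    case (elim x)
    obtain X where X: "open X" "Y \<subseteq> X" "f x holomorphic_on X" using elim(2) by blast
    show ?case
    proof
      fix z assume z: "z \<in> K"
      let ?S = "cball z (norm (\<delta> x))"
      have nd: "norm (\<delta> x) < m" using elim(3) by simp
      have SY: "?S \<subseteq> Y" "cball w (r / 2) \<subseteq> Y" "dist w z < d" if "w \<in> ?S" for w
      proof -
        have dw: "dist z w < m" using that nd by simp
        show "?S \<subseteq> Y" using r(2)[OF z] nd r(1) by (force simp: m_def)
        show "dist w z < d" using dw by (simp add: m_def dist_commute)
        have "cball w (r / 2) \<subseteq> cball z r"
        proof
          fix u assume "u \<in> cball w (r / 2)"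
          then have "dist w u \<le> r / 2" by simp
          then show "u \<in> cball z r" using dw dist_triangle[of z u w] by (simp add: m_def)
        qed
        then show "cball w (r / 2) \<subseteq> Y" using r(2)[OF z] by blast
      qed
      have dist_deriv: "norm (deriv (f x) w - deriv f0 z) \<le> \<eta>" if w: "w \<in> ?S" for w
      proof -
        note wY = SY[OF w]
        have wY': "w \<in> Y" "z \<in> Y" using wY(1) w by auto
        have X': "open (X \<inter> X0)" "Y \<subseteq> X \<inter> X0" using X hol(2,3) by auto
        let ?g = "\<lambda>z. f x z - f0 z"
        have gh: "?g holomorphic_on X \<inter> X0"
          by (intro holomorphic_intros holomorphic_on_subset[OF X(3)] holomorphic_on_subset[OF hol(4)]) auto
        then have gc: "?g holomorphic_on cball w (r / 2)"
          by (rule holomorphic_on_subset) (use wY(2) X'(2) in blast)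
        have "norm ((deriv ^^ 1) ?g w) \<le> fact 1 * e / (r / 2) ^ 1"
        proof (rule Cauchy_higher_deriv_bound[where y = 0])
          show "?g holomorphic_on ball w (r / 2)" using gc by (rule holomorphic_on_subset) auto
          show "continuous_on (cball w (r / 2)) ?g" using gc by (rule holomorphic_on_imp_continuous_on)
          fix u assume "u \<in> ball w (r / 2)"
          then have "u \<in> Y" using wY(2) by auto
          then show "?g u \<in> ball 0 e" using elim(1) by (simp add: dist_norm norm_minus_commute)
        qed (use r in auto)
        also have "\<dots> = \<eta> / 2" using r by (simp add: e_def)
        also have "(deriv ^^ 1) ?g w = deriv (f x) w - deriv f0 w"
          using X(1,2,3) hol(2-4) wY'(1)
          by (simp, intro deriv_diff) (meson holomorphic_on_imp_differentiable_at subsetD)+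
        finally have "norm (deriv (f x) w - deriv f0 w) \<le> \<eta> / 2" .
        moreover have "norm (deriv f0 w - deriv f0 z) \<le> \<eta> / 2"
          using d(2)[OF wY'(2,1) wY(3)] by (simp add: dist_norm)
        ultimately show ?thesis
          using norm_triangle_ineq[of "deriv (f x) w - deriv f0 w" "deriv f0 w - deriv f0 z"] by simp
      qed
      have "norm ((f x z - deriv f0 z * z) - (f x (z - \<delta> x) - deriv f0 z * (z - \<delta> x))) \<le> \<eta> * norm (z - (z - \<delta> x))"
      proof (rule field_differentiable_bound[of ?S _ "\<lambda>w. deriv (f x) w - deriv f0 z"])
        fix w assume w: "w \<in> ?S"
        have "w \<in> X" using SY(1)[OF w] w X(2) by auto
        then have "(f x has_field_derivative deriv (f x) w) (at w)" using X holomorphic_derivI by blast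
        then have "((\<lambda>w. f x w - deriv f0 z * w) has_field_derivative deriv (f x) w - deriv f0 z) (at w)"
          by (auto intro!: derivative_eq_intros)
        then show "((\<lambda>w. f x w - deriv f0 z * w) has_field_derivative deriv (f x) w - deriv f0 z) (at w within ?S)"
          by (rule has_field_derivative_at_within)
      qed (use dist_deriv in \<open>auto simp: dist_norm\<close>)
      then show "norm (f x z - f x (z - \<delta> x) - \<delta> x * deriv f0 z) \<le> \<eta> * norm (\<delta> x)"
        by (simp add: algebra_simps)
    qed
  qed
qed

text \<open>The scalars \<open>k\<close> come without any control in \<open>\<tau>\<close>, and
  \<open>E\<close> is known only to converge along \<open>S\<close>. The frame at
  \<open>\<tau>\<close> divided by \<open>k\<close> is comparable with the one at
  \<open>\<tau>0\<close> once \<open>k\<close> has been identified with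
  \<open>\<kappa> \<tau>\<close>, an expression in the frame that tends to 1.\<close>

lemma no_isomonodromic_lame:
  fixes S :: "complex set" and E :: "complex \<Rightarrow> complex"
  assumes S: "\<tau>0 \<in> S" "\<tau>0 islimpt S" "\<And>\<tau>. \<tau> \<in> S \<Longrightarrow> Im \<tau> > 0"
    and E: "(E \<longlongrightarrow> E \<tau>0) (at \<tau>0 within S)"
    and d0: "lame_data n \<tau>0 (E \<tau>0) \<psi>0 \<phi>0 A0 B0 C0"
    and d: "\<And>\<tau>. \<tau> \<in> S \<Longrightarrow> \<exists>\<psi> \<phi> A B C k. lame_data n \<tau> (E \<tau>) \<psi> \<phi> A B C \<and> k \<noteq> 0 \<and>
              (\<forall>i. A i = A0 i \<and> C i = k * C0 i \<and> B0 i = k * B i)"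
  shows False
proof -
  interpret t0: torus \<tau>0 by unfold_locales (use S in auto)
  define F where "F = at \<tau>0 within S"
  have Fb: "F \<noteq> bot" using S(2) by (simp add: F_def trivial_limit_within)
  have id: "((\<lambda>\<tau>. \<tau>) \<longlongrightarrow> \<tau>0) F" unfolding F_def by (rule tendsto_ident_at)
  define Y where "Y = t0.closed_box (-3/4) (3/4) (-3/4) (3/4)"
  define Yb where "Yb = t0.closed_box (-3/4) (3/4) (-3/4) (-1/4)"
  have Y: "compact Y" "convex Y" and Yb: "compact Yb" "Yb \<subseteq> Y" "0 \<notin> Yb"
    unfolding Y_def Yb_def
    by (auto simp: t0.compact_closed_box t0.convex_closed_box t0.mem_closed_box)
  obtain r0 where r0: "r0 > 0" "cball 0 r0 \<subseteq> Y"
  proof -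
    have "0 \<in> t0.cell_box (-3/4) (3/4) (-3/4) (3/4)" by (simp add: t0.mem_cell_box)
    then obtain r where "r > 0" "cball 0 r \<subseteq> t0.cell_box (-3/4) (3/4) (-3/4) (3/4)"
      using t0.cell_box_open open_contains_cball by metis
    moreover have "t0.cell_box (-3/4) (3/4) (-3/4) (3/4) \<subseteq> Y"
      by (auto simp: Y_def t0.mem_closed_box t0.mem_cell_box)
    ultimately show ?thesis using that[of r] by (meson subset_trans)
  qed
  \<comment> \<open>Membership of \<open>z\<close> in the doubled cell of \<open>\<tau>\<close>,
    cleared of the denominator \<open>Im \<tau>\<close>. In this form the condition is open in both
    variables, and the tube lemma yields one neighbourhood of \<open>\<tau>0\<close> that serves all
    of \<open>Y\<close>.\<close>
  define W where "W = {(\<tau>, z). Im \<tau> > 0 \<and> \<bar>Re z * Im \<tau> - Im z * Re \<tau>\<bar> < Im \<tau> \<and> \<bar>Im z\<bar> < Im \<tau>}"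
  have Wbox: "(\<tau>, z) \<in> W \<longleftrightarrow> z \<in> torus.cell_box \<tau> (-1) 1 (-1) 1" if "Im \<tau> > 0" for \<tau> z
  proof -
    interpret t: torus \<tau> by unfold_locales fact
    have ab: "\<bar>a / Im \<tau>\<bar> < 1 \<longleftrightarrow> \<bar>a\<bar> < Im \<tau>" for a using that by simp
    have c: "t.cx z = (Re z * Im \<tau> - Im z * Re \<tau>) / Im \<tau>" "t.cy z = Im z / Im \<tau>"
      using that by (simp_all add: t.cx_def t.cy_def field_simps)
    have "\<bar>t.cx z\<bar> < 1 \<longleftrightarrow> \<bar>Re z * Im \<tau> - Im z * Re \<tau>\<bar> < Im \<tau>" "\<bar>t.cy z\<bar> < 1 \<longleftrightarrow> \<bar>Im z\<bar> < Im \<tau>"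
      unfolding c using ab by simp_all
    then show ?thesis using that by (auto simp: W_def t.mem_cell_box)
  qed
  have "W = {y. Im (fst y) > 0} \<inter> {y. \<bar>Re (snd y) * Im (fst y) - Im (snd y) * Re (fst y)\<bar> < Im (fst y)} \<inter> {y. \<bar>Im (snd y)\<bar> < Im (fst y)}"
    by (auto simp: W_def)
  also have "open \<dots>"
    by (intro open_Int open_Collect_less continuous_on_rabs continuous_on_diff continuous_on_mult
        continuous_on_Re continuous_on_Im continuous_on_fst continuous_on_snd continuous_on_id continuous_on_const)
  finally have Wo: "open W" .
  have "Y \<subseteq> t0.D0" by (auto simp: Y_def t0.mem_closed_box t0.mem_cell_box)
  then have "{\<tau>0} \<times> Y \<subseteq> W" using Wbox[OF t0.Im_pos] by blast
  from Elementary_Topology.tube_lemma[OF Y(1) Wo this] obtain X0 where X0: "\<tau>0 \<in> X0" "open X0" "X0 \<times> Y \<subseteq> W" by blast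
  define T where "T = S \<inter> X0"
  have T: "\<forall>\<^sub>F \<tau> in F. \<tau> \<in> T" "\<tau>0 \<in> T"
    using X0 S(1) by (auto simp: T_def F_def eventually_at_topological)
  define q where "q \<tau> = lame_pot n \<tau> (E \<tau>)" for \<tau>
  define X where "X \<tau> = torus.cell_box \<tau> (-1) 1 (-1) 1" for \<tau>
  have XT: "open (X \<tau>)" "convex (X \<tau>)" "0 \<in> X \<tau>" "q \<tau> holomorphic_on X \<tau>" "\<And>z. q \<tau> (- z) = q \<tau> z" "Y \<subseteq> X \<tau>"
    if \<tau>: "\<tau> \<in> T" for \<tau>
  proof -
    interpret t: torus \<tau> by unfold_locales (use \<tau> S in \<open>auto simp: T_def\<close>)
    show "open (X \<tau>)" "convex (X \<tau>)" "0 \<in> X \<tau>" "q \<tau> holomorphic_on X \<tau>" "\<And>z. q \<tau> (- z) = q \<tau> z"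
      using t.lame_q_props(1-3) t.lame_q_props(4,5)[of n "E \<tau>"] unfolding X_def q_def t.lame_q_eq by auto
    show "Y \<subseteq> X \<tau>" using X0(3) \<tau> Wbox[OF t.Im_pos] by (auto simp: X_def T_def)
  qed
  have Wd: "W \<subseteq> lattice_domain"
  proof
    fix y assume y: "y \<in> W"
    obtain \<tau> z where yz: "y = (\<tau>, z)" by (cases y)
    interpret t: torus \<tau> by unfold_locales (use y yz in \<open>auto simp: W_def\<close>)
    show "y \<in> lattice_domain"
      using y Wbox[OF t.Im_pos, of z] t.D0_lattice[of z] unfolding yz t.lattice_domain_iff by blast
  qed
  \<comment> \<open>Joint continuity is uniform on a compact product, which gives convergence in
    \<open>\<tau>\<close> uniformly in \<open>z\<close>.\<close>
  have uwp: "uniform_limit Y wp_reg (wp_reg \<tau>0) F"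
  proof (rule uniform_limitI)
    fix \<epsilon> :: real assume \<epsilon>: "\<epsilon> > 0"
    obtain e where e: "e > 0" "cball \<tau>0 e \<subseteq> X0" using X0 open_contains_cball by blast
    have sub: "cball \<tau>0 e \<times> Y \<subseteq> lattice_domain" using e X0(3) Wd by blast
    have "uniformly_continuous_on (cball \<tau>0 e \<times> Y) (\<lambda>(\<tau>, z). wp_reg \<tau> z)"
      by (intro compact_uniformly_continuous continuous_on_subset[OF continuous_on_wp_reg sub] compact_Times Y) simp
    then obtain dd where dd: "dd > 0" "\<And>x y. x \<in> cball \<tau>0 e \<times> Y \<Longrightarrow> y \<in> cball \<tau>0 e \<times> Y \<Longrightarrow> dist y x < dd \<Longrightarrow>
        dist (case y of (\<tau>, z) \<Rightarrow> wp_reg \<tau> z) (case x of (\<tau>, z) \<Rightarrow> wp_reg \<tau> z) < \<epsilon>"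
      unfolding uniformly_continuous_on_def using \<epsilon> by blast
    have "\<forall>\<^sub>F \<tau> in F. dist \<tau> \<tau>0 < min dd e" using tendstoD[OF id] dd(1) e(1) by (simp add: eventually_conj_iff)
    then show "\<forall>\<^sub>F \<tau> in F. \<forall>z\<in>Y. dist (wp_reg \<tau> z) (wp_reg \<tau>0 z) < \<epsilon>"
    proof eventually_elim
      case (elim \<tau>)
      show ?case
      proof
        fix z assume z: "z \<in> Y"
        show "dist (wp_reg \<tau> z) (wp_reg \<tau>0 z) < \<epsilon>"
          using dd(2)[of "(\<tau>0, z)" "(\<tau>, z)"] elim z e by (simp add: dist_Pair_Pair dist_commute)
      qed
    qed
  qed
  have "uniform_limit Y (\<lambda>\<tau> z. of_nat n * (of_nat n + 1) * wp_reg \<tau> z + E \<tau>)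
      (\<lambda>z. of_nat n * (of_nat n + 1) * wp_reg \<tau>0 z + E \<tau>0) F"
    using E unfolding F_def[symmetric]
    by (intro uniform_limit_add uniform_limit_of_tendsto bounded_linear.uniform_limit[OF bounded_linear_mult_right uwp])
  then have uq: "uniform_limit Y q (q \<tau>0) F" by (simp add: q_def[abs_def] lame_pot_def[abs_def])
  have XTc: "open (X \<tau>) \<and> convex (X \<tau>) \<and> Y \<subseteq> X \<tau> \<and> q \<tau> holomorphic_on X \<tau>" if "\<tau> \<in> T" for \<tau>
    using XT[OF that] by blast
  note lim = lame_continuous[OF Y r0(2,1) XTc XT(5) T uq, of n]
  define \<psi>f where "\<psi>f \<tau> = lame_psi n (q \<tau>)" for \<tau>
  define \<phi>f where "\<phi>f \<tau> = lame_phi n (q \<tau>)" for \<tau>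
  have sol: "solves_on (\<lambda>z. of_nat n * (of_nat n + 1) / z\<^sup>2 + q \<tau> z) (X \<tau> - {0}) (\<psi>f \<tau>)"
    "solves_on (\<lambda>z. of_nat n * (of_nat n + 1) / z\<^sup>2 + q \<tau> z) (X \<tau> - {0}) (\<phi>f \<tau>)" if "\<tau> \<in> T" for \<tau>
    unfolding \<psi>f_def \<phi>f_def
    using lame_psi_solves[OF XT(1-5)[OF that]] lame_phi_solves[OF XT(1-5)[OF that]] by auto
  have hol: "\<psi>f \<tau> holomorphic_on X \<tau> - {0}" "\<phi>f \<tau> holomorphic_on X \<tau> - {0}" if "\<tau> \<in> T" for \<tau>
    using sol[OF that] by (auto simp: solves_on_def)
  have XT0: "open (X \<tau> - {0})" "Yb \<subseteq> X \<tau> - {0}" if "\<tau> \<in> T" for \<tau>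
    using XT(1,6)[OF that] Yb by (auto simp: open_delete)
  have bdd: "bounded (f ` Y)" if "f holomorphic_on X \<tau>0" for f :: "complex \<Rightarrow> complex"
    using that XT(6)[OF T(2)] Y(1)
    by (meson compact_continuous_image compact_imp_bounded continuous_on_subset holomorphic_on_imp_continuous_on)
  have bpow: "bounded ((\<lambda>z::complex. z ^ (n + 1)) ` Y)"
    by (intro compact_imp_bounded compact_continuous_image continuous_intros Y)
  have binv: "bounded ((\<lambda>z::complex. 1 / z ^ n) ` Yb)"
    by (intro compact_imp_bounded compact_continuous_image continuous_intros Yb) (use Yb(3) in auto)
  note u0 = lame_u_props(1)[OF XT(1-5)[OF T(2)], of n] and v0 = lame_v_props(1)[OF XT(1-5)[OF T(2)], of n]
  have uphi: "uniform_limit Y \<phi>f (\<phi>f \<tau>0) F"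
    unfolding \<phi>f_def[abs_def] lame_phi_def[abs_def]
    by (intro uniform_lim_mult uniform_limit_const lim(1) bpow bdd u0)
  have "uniform_limit Yb (\<lambda>\<tau> z. lame_v n (q \<tau>) z * (1 / z ^ n)) (\<lambda>z. lame_v n (q \<tau>0) z * (1 / z ^ n)) F"
    using bounded_subset[OF bdd[OF v0] image_mono[OF Yb(2)]]
    by (intro uniform_lim_mult uniform_limit_const uniform_limit_on_subset[OF lim(2) Yb(2)] binv)
  then have upsi: "uniform_limit Yb \<psi>f (\<psi>f \<tau>0) F"
    unfolding \<psi>f_def[abs_def] lame_psi_def[abs_def] by simp
  have wr0: "wr (\<psi>f \<tau>0) (\<phi>f \<tau>0) z = 2 * of_nat n + 1" if "z \<in> X \<tau>0 - {0}" for z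
    using t0.local_wr[of z n "E \<tau>0"] that unfolding t0.lame_q_eq X_def \<psi>f_def \<phi>f_def q_def by blast
  have nz0: "C0 1 \<noteq> 0 \<or> C0 2 \<noteq> 0" using d0 unfolding lame_data_def by blast
  then obtain j :: 2 where j: "C0 j \<noteq> 0" by blast
  define per where "per \<tau> = (if j = 1 then 1 else \<tau>)" for \<tau> :: complex
  define b3 where "b3 = t0.cell_box (-3/4) (-1/4) (-3/4) (-1/4)"
  have b3: "open b3" "b3 \<subseteq> Yb" by (auto simp: b3_def Yb_def t0.cell_box_open t0.mem_cell_box t0.mem_closed_box)
  \<comment> \<open>At a point where the solution with exponent \<open>- n\<close> does not vanish,
    the period relation for \<open>j\<close> can be solved for the scaling factor. Vanishing
    throughout \<open>b3\<close> would make the Wronskian zero.\<close>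
  obtain z1 where z1: "z1 \<in> b3" "\<psi>f \<tau>0 z1 \<noteq> 0"
  proof (rule ccontr)
    assume "\<not> thesis"
    then have 0: "\<psi>f \<tau>0 z = 0" if "z \<in> b3" for z using that \<open>\<And>z1. z1 \<in> b3 \<Longrightarrow> \<psi>f \<tau>0 z1 \<noteq> 0 \<Longrightarrow> thesis\<close> by blast
    have p: "of_real (-1/2) * (1 + \<tau>0) \<in> b3" (is "?p \<in> _")
      unfolding b3_def t0.mem_cell_box t0.coord_simps by simp
    have "((\<lambda>_. 0) has_field_derivative 0) (at ?p)" by simp
    then have d0p: "(\<psi>f \<tau>0 has_field_derivative 0) (at ?p)"
      by (rule has_field_derivative_transform_within_open[OF _ b3(1) p]) (simp add: 0)
    have "wr (\<psi>f \<tau>0) (\<phi>f \<tau>0) ?p = 0" using 0[OF p] DERIV_imp_deriv[OF d0p] unfolding wr_def by simp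
    moreover have "?p \<in> X \<tau>0 - {0}" using p b3(2) XT0(2)[OF T(2)] by blast
    ultimately show False using wr0 t0.nz_wr[of n] by metis
  qed
  have z1Y: "z1 \<in> Yb" "z1 \<in> Y" using z1 b3 Yb by auto
  have perT: "(per \<longlongrightarrow> per \<tau>0) F" using id by (simp add: per_def[abs_def])
  have "z1 + per \<tau>0 \<in> t0.cell_box (-3/4) (3/4) (-3/4) (3/4)"
    using z1(1) by (auto simp: b3_def per_def t0.mem_cell_box)
  then have zp: "z1 + per \<tau>0 \<in> Y" "z1 + per \<tau>0 \<noteq> 0"
    and evp: "\<forall>\<^sub>F \<tau> in F. z1 + per \<tau> \<in> t0.cell_box (-3/4) (3/4) (-3/4) (3/4) - {0}"
  proof -
    assume a: "z1 + per \<tau>0 \<in> t0.cell_box (-3/4) (3/4) (-3/4) (3/4)"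
    then show "z1 + per \<tau>0 \<in> Y" by (auto simp: Y_def t0.mem_cell_box t0.mem_closed_box)
    have "t0.cx (z1 + per \<tau>0) \<noteq> 0 \<or> t0.cy (z1 + per \<tau>0) \<noteq> 0"
      using z1(1) by (auto simp: b3_def per_def t0.mem_cell_box)
    then show nz: "z1 + per \<tau>0 \<noteq> 0" by (metis t0.coord_simps(7,8))
    have "((\<lambda>\<tau>. z1 + per \<tau>) \<longlongrightarrow> z1 + per \<tau>0) F" by (intro tendsto_intros perT)
    then show "\<forall>\<^sub>F \<tau> in F. z1 + per \<tau> \<in> t0.cell_box (-3/4) (3/4) (-3/4) (3/4) - {0}"
      by (rule topological_tendstoD) (use a nz in \<open>auto intro!: open_delete t0.cell_box_open\<close>)
  qed
  \<comment> \<open>The relation \<open>\<phi> (z + per \<tau>) = k * C0 j * \<psi> z + A0 j *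
    \<phi> z\<close>, solved for \<open>k\<close> at \<open>z1\<close>.\<close>
  define \<kappa> where "\<kappa> \<tau> = (\<phi>f \<tau> (z1 + per \<tau>) - A0 j * \<phi>f \<tau> z1) / (C0 j * \<psi>f \<tau> z1)" for \<tau>
  have actf: "\<phi> (z + per \<tau>) = C j * \<psi> z + A j * \<phi> z" if "lame_data n \<tau> e \<psi> \<phi> A B C" for \<tau> e \<psi> \<phi> A B C z
  proof -
    have "(\<psi> (z + 1), \<phi> (z + 1)) = mat_act (A 1) (B 1) (C 1) (\<psi> z, \<phi> z)"
      "(\<psi> (z + \<tau>), \<phi> (z + \<tau>)) = mat_act (A 2) (B 2) (C 2) (\<psi> z, \<phi> z)"
      using that unfolding lame_data_def by blast+
    then show ?thesis using exhaust_2[of j] by (auto simp: per_def mat_act_def)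
  qed
  have loc: "\<psi> z = \<psi>f \<tau> z \<and> \<phi> z = \<phi>f \<tau> z" if "lame_data n \<tau> (E \<tau>) \<psi> \<phi> A B C" "z \<in> X \<tau> - {0}" for \<tau> \<psi> \<phi> A B C z
    using that unfolding lame_data_def X_def \<psi>f_def \<phi>f_def q_def by blast
  have \<kappa>0: "\<kappa> \<tau>0 = 1"
  proof -
    have "z1 \<in> X \<tau>0 - {0}" "z1 + per \<tau>0 \<in> X \<tau>0 - {0}" using z1Y zp XT0(2)[OF T(2)] XT(6)[OF T(2)] by auto
    then have "\<phi>f \<tau>0 (z1 + per \<tau>0) = C0 j * \<psi>f \<tau>0 z1 + A0 j * \<phi>f \<tau>0 z1"
      using actf[OF d0, of z1] loc[OF d0] by simp
    then show ?thesis using j z1(2) by (simp add: \<kappa>_def)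
  qed
  have "((\<lambda>\<tau>. \<phi>f \<tau> (z1 + per \<tau>)) \<longlongrightarrow> \<phi>f \<tau>0 (z1 + per \<tau>0)) F"
  proof (rule tendsto_uniform_limit_moving[OF uphi])
    show "((\<lambda>\<tau>. z1 + per \<tau>) \<longlongrightarrow> z1 + per \<tau>0) F" by (intro tendsto_intros perT)
    show "\<forall>\<^sub>F \<tau> in F. z1 + per \<tau> \<in> Y"
      using evp by eventually_elim (auto simp: Y_def t0.mem_cell_box t0.mem_closed_box)
    have "\<phi>f \<tau>0 field_differentiable (at (z1 + per \<tau>0))"
      by (rule holomorphic_on_imp_differentiable_at[OF hol(2)[OF T(2)] XT0(1)[OF T(2)]]) (use zp XT(6)[OF T(2)] in auto)
    then show "isCont (\<phi>f \<tau>0) (z1 + per \<tau>0)" by (rule field_differentiable_imp_continuous_at)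
  qed
  moreover have "((\<lambda>\<tau>. \<phi>f \<tau> z1) \<longlongrightarrow> \<phi>f \<tau>0 z1) F" by (rule tendsto_uniform_limitI[OF uphi z1Y(2)])
  moreover have psi1: "((\<lambda>\<tau>. \<psi>f \<tau> z1) \<longlongrightarrow> \<psi>f \<tau>0 z1) F" by (rule tendsto_uniform_limitI[OF upsi z1Y(1)])
  ultimately have "(\<kappa> \<longlongrightarrow> \<kappa> \<tau>0) F"
    unfolding \<kappa>_def[abs_def] by (intro tendsto_intros) (use j z1 in auto)
  then have \<kappa>1: "(\<kappa> \<longlongrightarrow> 1) F" by (simp add: \<kappa>0)
  then have \<kappa>i: "((\<lambda>\<tau>. 1 / \<kappa> \<tau>) \<longlongrightarrow> 1) F" using tendsto_divide[OF tendsto_const[of 1] \<kappa>1] by simp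
  have bpsi: "bounded (\<psi>f \<tau>0 ` Yb)" "bounded (\<phi>f \<tau>0 ` Yb)"
    using hol[OF T(2)] XT0(2)[OF T(2)] Yb(1)
    by (meson compact_continuous_image compact_imp_bounded continuous_on_subset holomorphic_on_imp_continuous_on)+
  have "uniform_limit Yb (\<lambda>\<tau> z. \<phi>f \<tau> z * (1 / \<kappa> \<tau>)) (\<lambda>z. \<phi>f \<tau>0 z * 1) F"
    by (intro uniform_lim_mult uniform_limit_on_subset[OF uphi Yb(2)] uniform_limit_of_tendsto \<kappa>i bpsi)
       (auto simp: image_constant_conv)
  then have uphik: "uniform_limit Yb (\<lambda>\<tau> z. \<phi>f \<tau> z / \<kappa> \<tau>) (\<phi>f \<tau>0) F" by simp
  obtain Bd where Bd: "Bd > 0" "\<And>z. z \<in> Yb \<Longrightarrow> norm (\<psi>f \<tau>0 z) \<le> Bd" "\<And>z. z \<in> Yb \<Longrightarrow> norm (\<phi>f \<tau>0 z) \<le> Bd"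
  proof -
    obtain b1 b2 where "\<forall>z\<in>Yb. norm (\<psi>f \<tau>0 z) \<le> b1" "\<forall>z\<in>Yb. norm (\<phi>f \<tau>0 z) \<le> b2"
      using bpsi unfolding bounded_iff by auto
    then show ?thesis by (intro that[of "max 1 (max b1 b2)"]) (auto simp: le_max_iff_disj)
  qed
  \<comment> \<open>The bottom edge of the period cell centred at 0: the segment from
    \<open>- (1 + \<tau>0) / 2\<close> to its translate by 1.\<close>
  define K where "K = t0.closed_box (-1/2) (1/2) (-1/2) (-1/2)"
  have K: "compact K" "convex K" "K \<subseteq> t0.cell_box (-3/4) (3/4) (-3/4) (-1/4)"
    by (auto simp: K_def t0.compact_closed_box t0.convex_closed_box t0.mem_closed_box t0.mem_cell_box)
  obtain r where r: "r > 0" "(\<Union>x\<in>K. cball x r) \<subseteq> t0.cell_box (-3/4) (3/4) (-3/4) (-1/4)"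
    using compact_subset_open_imp_cball_epsilon_subset[OF K(1) t0.cell_box_open K(3)] by blast
  have rY: "cball z r \<subseteq> Yb" if "z \<in> K" for z
    using r(2) that by (fastforce simp: Yb_def t0.mem_closed_box t0.mem_cell_box)
  have KYb: "K \<subseteq> Yb" using rY r(1) by force
  define m :: real where "m = 2 * real n + 1"
  have m: "m > 0" by (simp add: m_def)
  \<comment> \<open>Two errors, each at most \<open>\<eta> * Bd * norm (\<delta> \<tau>)\<close>,
    add up to one half of the main term \<open>m * norm (\<delta> \<tau>)\<close>.\<close>
  define \<eta> where "\<eta> = m / (4 * Bd)"
  have \<eta>: "\<eta> > 0" using m Bd by (simp add: \<eta>_def)
  define \<delta> where "\<delta> \<tau> = \<tau> - \<tau>0" for \<tau>
  have \<delta>: "(\<delta> \<longlongrightarrow> 0) F" unfolding \<delta>_def[abs_def] using LIM_zero[OF id] .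
  have h1: "\<forall>\<^sub>F \<tau> in F. \<exists>X. open X \<and> Yb \<subseteq> X \<and> \<psi>f \<tau> holomorphic_on X"
    using T(1) by eventually_elim (use hol(1) XT0 in blast)
  have h2: "\<forall>\<^sub>F \<tau> in F. \<exists>X. open X \<and> Yb \<subseteq> X \<and> (\<lambda>z. \<phi>f \<tau> z / \<kappa> \<tau>) holomorphic_on X"
    using T(1) tendsto_imp_eventually_ne[OF \<kappa>1 one_neq_zero]
  proof eventually_elim
    case (elim \<tau>)
    then have "(\<lambda>z. \<phi>f \<tau> z / \<kappa> \<tau>) holomorphic_on X \<tau> - {0}"
      by (intro holomorphic_intros hol(2)) auto
    then show ?case using XT0[OF elim(1)] by blast
  qed
  have q1: "\<forall>\<^sub>F \<tau> in F. \<forall>z\<in>K. norm (\<psi>f \<tau> z - \<psi>f \<tau> (z - \<delta> \<tau>) - \<delta> \<tau> * deriv (\<psi>f \<tau>0) z) \<le> \<eta> * norm (\<delta> \<tau>)"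
    by (rule uniform_difference_quotient[OF upsi \<delta> h1 XT0[OF T(2)] hol(1)[OF T(2)] Yb(1) r(1) _ \<eta>]) (rule rY)
  have q2: "\<forall>\<^sub>F \<tau> in F. \<forall>z\<in>K. norm (\<phi>f \<tau> z / \<kappa> \<tau> - \<phi>f \<tau> (z - \<delta> \<tau>) / \<kappa> \<tau> - \<delta> \<tau> * deriv (\<phi>f \<tau>0) z) \<le> \<eta> * norm (\<delta> \<tau>)"
    by (rule uniform_difference_quotient[OF uphik \<delta> h2 XT0[OF T(2)] hol(2)[OF T(2)] Yb(1) r(1) _ \<eta>]) (rule rY)
  have ne: "\<forall>\<^sub>F \<tau> in F. \<tau> \<noteq> \<tau>0" unfolding F_def by (auto simp: eventually_at_topological)
  have sm: "\<forall>\<^sub>F \<tau> in F. norm (\<delta> \<tau>) < r" using tendstoD[OF \<delta> r(1)] by simp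
  have "\<forall>\<^sub>F \<tau> in F. \<tau> \<in> T \<and> \<tau> \<noteq> \<tau>0 \<and> norm (\<delta> \<tau>) < r \<and> \<psi>f \<tau> z1 \<noteq> 0 \<and> z1 + per \<tau> \<in> Y - {0} \<and>
     (\<forall>z\<in>K. norm (\<psi>f \<tau> z - \<psi>f \<tau> (z - \<delta> \<tau>) - \<delta> \<tau> * deriv (\<psi>f \<tau>0) z) \<le> \<eta> * norm (\<delta> \<tau>)) \<and>
     (\<forall>z\<in>K. norm (\<phi>f \<tau> z / \<kappa> \<tau> - \<phi>f \<tau> (z - \<delta> \<tau>) / \<kappa> \<tau> - \<delta> \<tau> * deriv (\<phi>f \<tau>0) z) \<le> \<eta> * norm (\<delta> \<tau>))"
    using T(1) ne sm tendsto_imp_eventually_ne[OF psi1 z1(2)] evp q1 q2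
    by eventually_elim (auto simp: Y_def t0.mem_cell_box t0.mem_closed_box)
  then obtain \<tau> where \<tau>: "\<tau> \<in> T" "\<tau> \<noteq> \<tau>0" "norm (\<delta> \<tau>) < r" "\<psi>f \<tau> z1 \<noteq> 0" "z1 + per \<tau> \<in> Y - {0}"
    and e1: "\<And>z. z \<in> K \<Longrightarrow> norm (\<psi>f \<tau> z - \<psi>f \<tau> (z - \<delta> \<tau>) - \<delta> \<tau> * deriv (\<psi>f \<tau>0) z) \<le> \<eta> * norm (\<delta> \<tau>)"
    and e2: "\<And>z. z \<in> K \<Longrightarrow> norm (\<phi>f \<tau> z / \<kappa> \<tau> - \<phi>f \<tau> (z - \<delta> \<tau>) / \<kappa> \<tau> - \<delta> \<tau> * deriv (\<phi>f \<tau>0) z) \<le> \<eta> * norm (\<delta> \<tau>)"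
    using eventually_happens'[OF Fb] by (smt (verit, del_insts))
  have \<tau>S: "\<tau> \<in> S" using \<tau>(1) by (simp add: T_def)
  obtain \<psi> \<phi> A B C k where dd: "lame_data n \<tau> (E \<tau>) \<psi> \<phi> A B C" and k: "k \<noteq> 0" "\<And>i. A i = A0 i \<and> C i = k * C0 i \<and> B0 i = k * B i"
    using d[OF \<tau>S] by blast
  have k\<kappa>: "k = \<kappa> \<tau>"
  proof -
    have "z1 \<in> X \<tau> - {0}" "z1 + per \<tau> \<in> X \<tau> - {0}" using z1Y \<tau>(5) XT0(2)[OF \<tau>(1)] XT(6)[OF \<tau>(1)] by auto
    then have "\<phi>f \<tau> (z1 + per \<tau>) = k * C0 j * \<psi>f \<tau> z1 + A0 j * \<phi>f \<tau> z1"
      using actf[OF dd, of z1] loc[OF dd] k(2)[of j] by simp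
    then show ?thesis using j \<tau>(4) by (simp add: \<kappa>_def)
  qed
  have sub: "t0.closed_box (-3/4) (3/4) (-3/4) (3/4) \<subseteq> torus.cell_box \<tau> (-1) 1 (-1) 1"
    using XT(6)[OF \<tau>(1)] by (simp add: Y_def X_def)
  obtain h where h: "\<And>z. z \<in> t0.cell_box (-3/4) (3/4) (-3/4) (-1/4) \<Longrightarrow> (h has_field_derivative
       (\<psi> z - \<psi> (z - (\<tau> - \<tau>0))) * \<phi>0 z - (\<phi> z / k - \<phi> (z - (\<tau> - \<tau>0)) / k) * \<psi>0 z) (at z)"
    "h (- (1 + \<tau>0) / 2 + 1) = h (- (1 + \<tau>0) / 2)"
    by (rule cell_increment[OF t0.Im_pos S(3)[OF \<tau>S] d0 dd k sub]) (rule that, assumption+)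
  let ?w = "- (2 * of_nat n + 1) :: complex"
  let ?s = "- (1 + \<tau>0) / 2"
  let ?D = "\<lambda>z. (\<psi> z - \<psi> (z - \<delta> \<tau>)) * \<phi>0 z - (\<phi> z / k - \<phi> (z - \<delta> \<tau>) / k) * \<psi>0 z"
  have est: "norm (?D z - \<delta> \<tau> * ?w) \<le> m / 2 * norm (\<delta> \<tau>)" if z: "z \<in> K" for z
  proof -
    have zY: "z \<in> Yb" "z - \<delta> \<tau> \<in> Yb"
      using rY[OF z] \<tau>(3) r(1) by (auto simp: dist_norm subset_iff)
    have zX: "z \<in> X \<tau> - {0}" "z - \<delta> \<tau> \<in> X \<tau> - {0}" "z \<in> X \<tau>0 - {0}"
      using zY XT0(2)[OF \<tau>(1)] XT0(2)[OF T(2)] by auto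
    let ?a = "\<psi>f \<tau> z - \<psi>f \<tau> (z - \<delta> \<tau>) - \<delta> \<tau> * deriv (\<psi>f \<tau>0) z"
    let ?b = "\<phi>f \<tau> z / \<kappa> \<tau> - \<phi>f \<tau> (z - \<delta> \<tau>) / \<kappa> \<tau> - \<delta> \<tau> * deriv (\<phi>f \<tau>0) z"
    have "?D z = (\<psi>f \<tau> z - \<psi>f \<tau> (z - \<delta> \<tau>)) * \<phi>f \<tau>0 z - (\<phi>f \<tau> z / \<kappa> \<tau> - \<phi>f \<tau> (z - \<delta> \<tau>) / \<kappa> \<tau>) * \<psi>f \<tau>0 z"
      using loc[OF dd zX(1)] loc[OF dd zX(2)] loc[OF d0 zX(3)] by (simp add: k\<kappa>)
    also have "\<dots> = ?a * \<phi>f \<tau>0 z - ?b * \<psi>f \<tau>0 z - \<delta> \<tau> * wr (\<psi>f \<tau>0) (\<phi>f \<tau>0) z"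
      by (simp add: wr_def algebra_simps)
    finally have "?D z - \<delta> \<tau> * ?w = ?a * \<phi>f \<tau>0 z - ?b * \<psi>f \<tau>0 z"
      using wr0[OF zX(3)] by (simp add: algebra_simps)
    also have "norm \<dots> \<le> norm ?a * norm (\<phi>f \<tau>0 z) + norm ?b * norm (\<psi>f \<tau>0 z)"
      by (rule order_trans[OF norm_triangle_ineq4]) (simp add: norm_mult)
    also have "\<dots> \<le> \<eta> * norm (\<delta> \<tau>) * Bd + \<eta> * norm (\<delta> \<tau>) * Bd"
      using e1[OF z] e2[OF z] Bd zY(1) \<eta> by (intro add_mono mult_mono) auto
    also have "\<dots> = m / 2 * norm (\<delta> \<tau>)" using Bd(1) by (simp add: \<eta>_def)
    finally show ?thesis .
  qed
  have sK: "?s \<in> K" "?s + 1 \<in> K"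
  proof -
    have e: "?s = of_real (-1/2) * (1 + \<tau>0)" by (simp add: field_simps)
    show "?s \<in> K" "?s + 1 \<in> K" unfolding e K_def t0.mem_closed_box t0.coord_simps by simp_all
  qed
  \<comment> \<open>The mean value inequality for \<open>h z - \<delta> \<tau> * ?w * z\<close>
    along the edge. As \<open>h\<close> returns to its initial value, the linear part alone has to
    obey the error bound, which amounts to \<open>m \<le> m / 2\<close>.\<close>
  have "norm ((h (?s + 1) - \<delta> \<tau> * ?w * (?s + 1)) - (h ?s - \<delta> \<tau> * ?w * ?s)) \<le> m / 2 * norm (\<delta> \<tau>) * norm (?s + 1 - ?s)"
  proof (rule field_differentiable_bound[OF K(2) _ est sK(2,1)])
    fix z assume z: "z \<in> K"
    have "(h has_field_derivative ?D z) (at z)"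
      using h(1)[OF subsetD[OF K(3) z]] by (simp add: \<delta>_def)
    then have "((\<lambda>z. h z - \<delta> \<tau> * ?w * z) has_field_derivative ?D z - \<delta> \<tau> * ?w) (at z)"
      by (auto intro!: derivative_eq_intros)
    then show "((\<lambda>z. h z - \<delta> \<tau> * ?w * z) has_field_derivative ?D z - \<delta> \<tau> * ?w) (at z within K)"
      by (rule has_field_derivative_at_within)
  qed
  also have "(h (?s + 1) - \<delta> \<tau> * ?w * (?s + 1)) - (h ?s - \<delta> \<tau> * ?w * ?s) = - (\<delta> \<tau> * ?w)"
    unfolding h(2) by (simp add: algebra_simps)
  also have "norm (- (\<delta> \<tau> * ?w)) = norm (\<delta> \<tau>) * m"
  proof -
    have "norm (2 * of_nat n + 1 :: complex) = m"
      unfolding m_def by (metis (no_types, lifting) norm_of_nat of_nat_1 of_nat_add of_nat_mult of_nat_numeral)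
    then show ?thesis by (simp only: norm_minus_cancel norm_mult)
  qed
  finally have "norm (\<delta> \<tau>) * m \<le> norm (\<delta> \<tau>) * m / 2" by (simp add: mult.commute)
  moreover have "norm (\<delta> \<tau>) * m > 0" using \<tau>(2) m by (simp add: \<delta>_def)
  ultimately show False by linarith
qed

text \<open>The rows \<open>(a j, b j)\<close> intertwine the Lame period matrices with
  \<open>\<epsilon> i * M i\<close>, where \<open>i\<close> numbers the periods and \<open>j\<close>
  the basis elements. The frame and the rows are bound inside because they vary with
  \<open>\<tau>\<close>; \<open>M\<close> and \<open>\<epsilon>\<close> are what several
  \<open>\<tau>\<close> can share.\<close>

definition gle_lame_relation ::
  "nat \<Rightarrow> complex \<Rightarrow> complex \<Rightarrow> (2 \<Rightarrow> complex^2^2) \<Rightarrow> (2 \<Rightarrow> complex) \<Rightarrow> bool" where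
  "gle_lame_relation n \<tau> E M \<epsilon> \<longleftrightarrow>
    (\<exists>\<psi> \<phi> A B C a b. lame_data n \<tau> E \<psi> \<phi> A B C \<and> a 1 * b 2 - a 2 * b 1 \<noteq> (0::complex) \<and>
      (\<forall>i j. a j * A i + b j * C i = \<epsilon> i * mat_entry (M i) j 1 * a 1 + \<epsilon> i * mat_entry (M i) j 2 * a (2::2)) \<and>
      (\<forall>i j. a j * B i + b j * A i = \<epsilon> i * mat_entry (M i) j 1 * b 1 + \<epsilon> i * mat_entry (M i) j 2 * b 2))"

section \<open>Conclusion for GLE\<close>

context torus_point
begin

lemma gle_lame_relationI:
  assumes n: "n > 0" and y: "solution_basis (gle1_potential n p T \<tau>) z0 y"
    and \<gamma>1: "continuous_on {0..1} \<gamma>1" "\<gamma>1 0 = z0" "\<gamma>1 1 = z0 + 1" "\<And>t. t \<in> {0..1} \<Longrightarrow> \<gamma>1 t \<notin> S"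
    and \<gamma>2: "continuous_on {0..1} \<gamma>2" "\<gamma>2 0 = z0" "\<gamma>2 1 = z0 + \<tau>" "\<And>t. t \<in> {0..1} \<Longrightarrow> \<gamma>2 t \<notin> S"
    and M: "monodromy_matrix_along \<gamma>1 1 y M1" "monodromy_matrix_along \<gamma>2 \<tau> y M2"
  shows "\<exists>e1\<in>{1,-1}. \<exists>e2\<in>{1,-1}. gle_lame_relation n \<tau> (T\<^sup>2 - of_nat n * (of_nat n + 1) * wp p)
           (\<lambda>i. if i = 1 then M1 else M2) (\<lambda>i. if i = 1 then e1 else e2)"
proof -
  let ?E = "T\<^sup>2 - of_nat n * (of_nat n + 1) * wp p"
  have E: "lame_E n T = ?E" by (simp add: lame_E_def[OF n])
  obtain \<psi> \<phi> A B C where d: "lame_data n \<tau> ?E \<psi> \<phi> A B C" using lame_data_exists by blast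
  have sol: "solves_on (\<lambda>z. of_nat n * (of_nat n + 1) * wp z + lame_E n T) (- L) \<psi>"
    "solves_on (\<lambda>z. of_nat n * (of_nat n + 1) * wp z + lame_E n T) (- L) \<phi>"
    and W: "\<And>z. z \<notin> L \<Longrightarrow> wr \<psi> \<phi> z = 2 * of_nat n + 1"
    and act: "\<And>z. (\<psi> (z + 1), \<phi> (z + 1)) = mat_act (A 1) (B 1) (C 1) (\<psi> z, \<phi> z)"
      "\<And>z. (\<psi> (z + \<tau>), \<phi> (z + \<tau>)) = mat_act (A 2) (B 2) (C 2) (\<psi> z, \<phi> z)"
    using d unfolding lame_data_def E by blast+
  have z0: "z0 \<notin> S" using \<gamma>1(2) \<gamma>1(4)[of 0] by auto
  obtain a b e s where ab: "e > 0" "ball z0 e \<subseteq> - S" "\<And>z. z \<in> ball z0 e \<Longrightarrow> v z = (s z)\<^sup>2"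
    "\<And>i z. z \<in> ball z0 e \<Longrightarrow> a i * deriv \<psi> z + b i * deriv \<phi> z - T * (a i * \<psi> z + b i * \<phi> z) = y i z * s z"
    "a 1 * b 2 - a 2 * b 1 \<noteq> 0"
    by (rule basis_to_lame[OF n z0 y sol nz_wr W]) (assumption, rule that, assumption+)
  have "\<exists>\<epsilon>\<in>{1,-1}. \<forall>i. a i * A 1 + b i * C 1 = \<epsilon> * (mat_entry M1 i 1 * a 1 + mat_entry M1 i 2 * a 2) \<and>
      a i * B 1 + b i * A 1 = \<epsilon> * (mat_entry M1 i 1 * b 1 + mat_entry M1 i 2 * b 2)"
    by (rule monodromy_to_lame[OF n sol nz_wr W ab \<gamma>1 _ M(1) act(1)]) (assumption | simp)+
  then obtain e1 where e1: "e1 \<in> {1,-1}" "\<forall>i. a i * A 1 + b i * C 1 = e1 * (mat_entry M1 i 1 * a 1 + mat_entry M1 i 2 * a 2) \<and>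
      a i * B 1 + b i * A 1 = e1 * (mat_entry M1 i 1 * b 1 + mat_entry M1 i 2 * b 2)" by blast
  have "\<exists>\<epsilon>\<in>{1,-1}. \<forall>i. a i * A 2 + b i * C 2 = \<epsilon> * (mat_entry M2 i 1 * a 1 + mat_entry M2 i 2 * a 2) \<and>
      a i * B 2 + b i * A 2 = \<epsilon> * (mat_entry M2 i 1 * b 1 + mat_entry M2 i 2 * b 2)"
    by (rule monodromy_to_lame[OF n sol nz_wr W ab \<gamma>2 _ M(2) act(2)]) (assumption | simp)+
  then obtain e2 where e2: "e2 \<in> {1,-1}" "\<forall>i. a i * A 2 + b i * C 2 = e2 * (mat_entry M2 i 1 * a 1 + mat_entry M2 i 2 * a 2) \<and>
      a i * B 2 + b i * A 2 = e2 * (mat_entry M2 i 1 * b 1 + mat_entry M2 i 2 * b 2)" by blast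
  let ?M = "\<lambda>i::2. if i = 1 then M1 else M2" and ?e = "\<lambda>i::2. if i = 1 then e1 else e2"
  have "a j * A i + b j * C i = ?e i * mat_entry (?M i) j 1 * a 1 + ?e i * mat_entry (?M i) j 2 * a 2 \<and>
    a j * B i + b j * A i = ?e i * mat_entry (?M i) j 1 * b 1 + ?e i * mat_entry (?M i) j 2 * b 2" for i j
    using e1(2) e2(2) exhaust_2[of i] by (auto simp: distrib_left mult.assoc)
  then have "gle_lame_relation n \<tau> ?E ?M ?e"
    unfolding gle_lame_relation_def using d ab(5) by blast
  then show ?thesis using e1(1) e2(1) by blast
qed

end

text \<open>The representatives \<open>p \<tau>\<close> may jump by periods. Since \<open>wp\<close>
  is periodic, they can be replaced near \<open>\<tau>0\<close> by the holomorphic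
  \<open>p'\<close>; avoiding two-torsion keeps \<open>p'\<close> off the lattice and hence away
  from the pole.\<close>

lemma lame_energy_tendsto:
  assumes U: "open U" "U \<subseteq> {\<tau>. Im \<tau> > 0}" "\<tau>0 \<in> U" and p: "holomorphic_torus_section U p"
    and T: "T holomorphic_on U" and nt: "\<And>\<tau>. \<tau> \<in> U \<Longrightarrow> p \<tau> \<notin> two_torsion \<tau>"
  shows "((\<lambda>\<tau>. (T \<tau>)\<^sup>2 - of_nat n * (of_nat n + 1) * weierstrass_wp \<tau> (p \<tau>))
           \<longlongrightarrow> (T \<tau>0)\<^sup>2 - of_nat n * (of_nat n + 1) * weierstrass_wp \<tau>0 (p \<tau>0)) (at \<tau>0 within S)"
proof -
  from bspec[OF p[unfolded holomorphic_torus_section_def] U(3)]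
  obtain V p' where V: "open V" "\<tau>0 \<in> V" "V \<subseteq> U" "p' holomorphic_on V"
    and V5: "\<forall>\<tau>\<in>V. p \<tau> - p' \<tau> \<in> period_lattice \<tau>" by (elim exE conjE) (rule that)
  have eq: "p' \<tau> \<notin> period_lattice \<tau> \<and> weierstrass_wp \<tau> (p \<tau>) = 1 / (p' \<tau>)\<^sup>2 + wp_reg \<tau> (p' \<tau>)"
    if \<tau>: "\<tau> \<in> V" for \<tau>
  proof -
    interpret t: torus_point \<tau> "p \<tau>"
      by unfold_locales (use \<tau> V U nt in \<open>auto simp: two_torsion_def\<close>)
    have l: "p \<tau> - p' \<tau> \<in> t.L" using V5 \<tau> by blast
    have n: "p' \<tau> \<notin> t.L" using t.p_notin t.lattice_add_iff[OF l, of "p' \<tau>"] by simp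
    have "t.wp (p \<tau>) = t.wp (p' \<tau>)" using t.wp_periodic[OF n l] by simp
    then show ?thesis using n t.wp_eq by simp
  qed
  interpret t0: torus \<tau>0 by unfold_locales (use U in auto)
  have d: "(\<tau>0, p' \<tau>0) \<in> lattice_domain" using eq[OF V(2)] unfolding t0.lattice_domain_iff by blast
  have p': "(p' \<longlongrightarrow> p' \<tau>0) (at \<tau>0 within S)"
    using V holomorphic_on_imp_continuous_on[OF V(4)]
    by (meson continuous_on_eq_continuous_at isCont_def tendsto_within_subset subset_UNIV)
  have T': "(T \<longlongrightarrow> T \<tau>0) (at \<tau>0 within S)"
    using U holomorphic_on_imp_continuous_on[OF T]
    by (meson continuous_on_eq_continuous_at isCont_def tendsto_within_subset subset_UNIV)
  have "isCont (\<lambda>(\<tau>, z). wp_reg \<tau> z) (\<tau>0, p' \<tau>0)"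
    using continuous_on_wp_reg d open_lattice_domain by (simp add: continuous_on_eq_continuous_at)
  from isCont_tendsto_compose[OF this tendsto_Pair[OF tendsto_ident_at p']]
  have w: "((\<lambda>\<tau>. wp_reg \<tau> (p' \<tau>)) \<longlongrightarrow> wp_reg \<tau>0 (p' \<tau>0)) (at \<tau>0 within S)" by simp
  have nz: "p' \<tau>0 \<noteq> 0" using eq[OF V(2)] t0.lattice_simps(1) by metis
  have "((\<lambda>\<tau>. 1 / (p' \<tau>)\<^sup>2 + wp_reg \<tau> (p' \<tau>)) \<longlongrightarrow> 1 / (p' \<tau>0)\<^sup>2 + wp_reg \<tau>0 (p' \<tau>0)) (at \<tau>0 within S)"
    using nz by (intro tendsto_intros p' w) auto
  moreover have "\<forall>\<^sub>F \<tau> in at \<tau>0 within S. \<tau> \<in> V"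
    using V by (auto simp: eventually_at_topological)
  then have "\<forall>\<^sub>F \<tau> in at \<tau>0 within S. 1 / (p' \<tau>)\<^sup>2 + wp_reg \<tau> (p' \<tau>) = weierstrass_wp \<tau> (p \<tau>)"
    by eventually_elim (simp add: eq)
  ultimately have "((\<lambda>\<tau>. weierstrass_wp \<tau> (p \<tau>)) \<longlongrightarrow> weierstrass_wp \<tau>0 (p \<tau>0)) (at \<tau>0 within S)"
    using eq[OF V(2)] Lim_transform_eventually by fastforce
  then show ?thesis by (intro tendsto_intros T')
qed

theorem theorem5p6:
  fixes n :: nat
  assumes "n > 0"
  shows "\<not> (\<exists>U p T. open U \<and> connected U \<and> U \<noteq> {} \<and> U \<subseteq> {\<tau>. Im \<tau> > 0} \<and>
              holomorphic_torus_section U p \<and> T holomorphic_on U \<and>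
              (\<forall>\<tau>\<in>U. p \<tau> \<notin> two_torsion \<tau>) \<and>
              gle1_monodromy_preserved n U p T)"
proof
  assume "\<exists>U p T. open U \<and> connected U \<and> U \<noteq> {} \<and> U \<subseteq> {\<tau>. Im \<tau> > 0} \<and>
              holomorphic_torus_section U p \<and> T holomorphic_on U \<and>
              (\<forall>\<tau>\<in>U. p \<tau> \<notin> two_torsion \<tau>) \<and> gle1_monodromy_preserved n U p T"
  then obtain U p T where U: "open U" "U \<noteq> {}" "U \<subseteq> {\<tau>. Im \<tau> > 0}" and p: "holomorphic_torus_section U p"
    and T: "T holomorphic_on U" and nt: "\<And>\<tau>. \<tau> \<in> U \<Longrightarrow> p \<tau> \<notin> two_torsion \<tau>"
    and mp: "gle1_monodromy_preserved n U p T" by blast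
  obtain z0 \<gamma>1 \<gamma>2 M1 M2 where \<gamma>: "continuous_cycle_family U p z0 (\<lambda>\<tau>. 1) \<gamma>1"
      "continuous_cycle_family U p z0 (\<lambda>\<tau>. \<tau>) \<gamma>2"
    and M: "\<forall>\<tau>\<in>U. \<exists>y. solution_basis (gle1_potential n (p \<tau>) (T \<tau>) \<tau>) (z0 \<tau>) y \<and>
           monodromy_matrix_along (\<gamma>1 \<tau>) 1 y M1 \<and> monodromy_matrix_along (\<gamma>2 \<tau>) \<tau> y M2"
    using mp unfolding gle1_monodromy_preserved_def by blast
  define E where "E \<tau> = (T \<tau>)\<^sup>2 - of_nat n * (of_nat n + 1) * weierstrass_wp \<tau> (p \<tau>)" for \<tau>
  let ?M = "\<lambda>i::2. if i = 1 then M1 else M2" and ?e = "\<lambda>e i::2. if i = 1 then fst e else snd e"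
  \<comment> \<open>Parameters are sorted by their pair of signs. Nothing relates the signs at
    different \<open>\<tau>\<close>, but four classes cover the uncountable set \<open>U\<close>, so
    one of them is uncountable.\<close>
  define Cl where "Cl e = {\<tau> \<in> U. gle_lame_relation n \<tau> (E \<tau>) ?M (?e e)}" for e :: "complex \<times> complex"
  have cf: "continuous_on {0..1} (\<gamma> \<tau>) \<and> \<gamma> \<tau> 0 = z0 \<tau> \<and> \<gamma> \<tau> 1 = z0 \<tau> + \<omega> \<tau> \<and>
      (\<forall>t\<in>{0..1}. \<gamma> \<tau> t \<notin> gle1_singularities (p \<tau>) \<tau>)"
    if "continuous_cycle_family U p z0 \<omega> \<gamma>" "\<tau> \<in> U" for \<omega> \<gamma> \<tau>
  proof -
    have "continuous_on {0..1} ((\<lambda>(\<tau>, t). \<gamma> \<tau> t) \<circ> (\<lambda>t. (\<tau>, t)))"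
      using that unfolding continuous_cycle_family_def
      by (intro continuous_on_compose continuous_intros) (auto elim: continuous_on_subset)
    then show ?thesis using that unfolding continuous_cycle_family_def by (simp add: o_def)
  qed
  have "U \<subseteq> (\<Union>e\<in>{1,-1} \<times> {1,-1}. Cl e)"
  proof
    fix \<tau> assume \<tau>: "\<tau> \<in> U"
    interpret t: torus_point \<tau> "p \<tau>"
      by unfold_locales (use \<tau> U nt in \<open>auto simp: two_torsion_def\<close>)
    obtain y where y: "solution_basis (gle1_potential n (p \<tau>) (T \<tau>) \<tau>) (z0 \<tau>) y"
      "monodromy_matrix_along (\<gamma>1 \<tau>) 1 y M1" "monodromy_matrix_along (\<gamma>2 \<tau>) \<tau> y M2" using M \<tau> by blast
    obtain e1 e2 where "e1 \<in> {1,-1}" "e2 \<in> {1,-1}"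
      "gle_lame_relation n \<tau> (E \<tau>) ?M (\<lambda>i. if i = 1 then e1 else e2)"
      using t.gle_lame_relationI[OF assms y(1) _ _ _ _ _ _ _ _ y(2,3)] cf[OF \<gamma>(1) \<tau>] cf[OF \<gamma>(2) \<tau>]
      unfolding E_def by blast
    then have "e1 \<in> {1,-1}" "e2 \<in> {1,-1}" "\<tau> \<in> Cl (e1, e2)"
      using \<tau> by (simp_all only: Cl_def mem_Collect_eq fst_conv snd_conv simp_thms)
    then show "\<tau> \<in> (\<Union>e\<in>{1,-1} \<times> {1,-1}. Cl e)" by blast
  qed
  moreover have "uncountable U"
  proof -
    obtain x r where "r > 0" "ball x r \<subseteq> U" using U(1,2) open_contains_ball by blast
    then show ?thesis using uncountable_ball countable_subset by blast
  qed
  ultimately have "\<exists>e. uncountable (Cl e)"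
    by (metis (no_types, lifting) countable_UN countable_finite countable_subset finite.emptyI finite.insertI finite_SigmaI)
  then obtain e where e: "uncountable (Cl e)" by blast
  then obtain \<tau>0 where \<tau>0: "\<tau>0 \<in> Cl e" "\<tau>0 islimpt Cl e" by (rule uncountable_limit_point)
  have ClU: "Cl e \<subseteq> U" by (auto simp: Cl_def)
  let ?m = "\<lambda>i j l. ?e e i * mat_entry (?M i) j l"
  obtain \<psi>0 \<phi>0 A0 B0 C0 a0 b0 where d0: "lame_data n \<tau>0 (E \<tau>0) \<psi>0 \<phi>0 A0 B0 C0" "a0 1 * b0 2 - a0 2 * b0 1 \<noteq> 0"
    "\<And>i j. a0 j * A0 i + b0 j * C0 i = ?m i j 1 * a0 1 + ?m i j 2 * a0 2"
    "\<And>i j. a0 j * B0 i + b0 j * A0 i = ?m i j 1 * b0 1 + ?m i j 2 * b0 2"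
    using \<tau>0(1) unfolding Cl_def gle_lame_relation_def by blast
  show False
  proof (rule no_isomonodromic_lame[where E = E, OF \<tau>0 _ _ d0(1)])
    show "\<And>\<tau>. \<tau> \<in> Cl e \<Longrightarrow> 0 < Im \<tau>" using ClU U by blast
    show "(E \<longlongrightarrow> E \<tau>0) (at \<tau>0 within Cl e)"
      unfolding E_def[abs_def] by (rule lame_energy_tendsto[OF U(1,3) _ p T nt]) (use \<tau>0 ClU in auto)
    fix \<tau> assume "\<tau> \<in> Cl e"
    then obtain \<psi> \<phi> A B C a b where d: "lame_data n \<tau> (E \<tau>) \<psi> \<phi> A B C" "a 1 * b 2 - a 2 * b 1 \<noteq> 0"
      "\<And>i j. a j * A i + b j * C i = ?m i j 1 * a 1 + ?m i j 2 * a 2"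
      "\<And>i j. a j * B i + b j * A i = ?m i j 1 * b 1 + ?m i j 2 * b 2"
      unfolding Cl_def gle_lame_relation_def by blast
    have "B0 1 * C0 2 = B0 2 * C0 1" "C0 1 \<noteq> 0 \<or> C0 2 \<noteq> 0" "C 1 \<noteq> 0 \<or> C 2 \<noteq> 0"
      using d0(1) d(1) unfolding lame_data_def by blast+
    \<comment> \<open>The signs are absorbed into the matrices \<open>?m\<close>, which are common
      to all of \<open>Cl e\<close>; both Lame pairs are conjugate to these and hence to each
      other.\<close>
    from conjugate_scaling[OF d0(2) d(2) d0(3,4) d(3,4) this] obtain k where
      "k \<noteq> 0" "\<And>i. A i = A0 i \<and> C i = k * C0 i \<and> B0 i = k * B i" by blast
    with d(1) show "\<exists>\<psi> \<phi> A B C k. lame_data n \<tau> (E \<tau>) \<psi> \<phi> A B C \<and> k \<noteq> 0 \<and>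
              (\<forall>i. A i = A0 i \<and> C i = k * C0 i \<and> B0 i = k * B i)" by blast
  qed
qed

end
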